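(* Let $q\in L^1_{loc}([0,+\infty),\mathbb{R})$ and consider the singular Sturm-Liouville problem $-y''+qy=\lambda y$ on $[0,+\infty)$ with $y(0)=0$ (and, in the limit-circle case at $+\infty$, a fixed self-adjoint separated boundary condition at $+\infty$). Assume that either (H1) $q$ is non-negative (equivalently, up to a shift of the spectral parameter, bounded below), or (H2) $\tau_q y:=-y''+qy$ is in the limit-circle case and non-oscillatory at $+\infty$. Let $\lambda(t,r)=\lambda(t,r;q)$ be the first eigenvalue function of this problem, i.e. the first eigenvalue of the problem obtained by replacing $q$ by $q-r\delta(x-t)$. Then the potential $q$ is uniquely determined by the function $\lambda(t,r)$, and it is given by $$q(x)=\frac{\varphi_0''(x)}{\varphi_0(x)}+\lambda_1,\qquad \varphi_0(x):=\sqrt{-\frac{\partial\lambda(x,0)}{\partial r}},\qquad x\in(0,+\infty),$$ where $\lambda_1=\lambda(t,0)$ is the first eigenvalue of the unperturbed problem and $\frac{\partial\lambda(x,0)}{\partial r}$ is the right partial derivative of $\lambda(x,r)$ with respect to $r$ at $r=0$.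
   Context: Potentials in $L^1_{loc}$ are identified up to equality almost everywhere. Let $\tau_q y=-y''+qy$ and $\mathcal{D}_{max}=\{y\in L^2[0,+\infty): y,y'\in AC_{loc}[0,+\infty),\ \tau_q y\in L^2[0,+\infty)\}$. For $y,z\in\mathcal{D}_{max}$ put $[y,z]=y\overline{z}'-\overline{z}y'$ and $[y,z](+\infty)=\lim_{x\to+\infty}[y,z](x)$ (this limit exists). Limit-point / limit-circle at $+\infty$ are in the sense of Weyl (limit-circle: all solutions of $\tau_q y=\lambda y$ are in $L^2[0,+\infty)$). Under (H1) $\tau_q$ is in the limit-point case. Non-oscillatory at $+\infty$ in the limit-circle case: for some (equivalently every) real $\lambda$, every nontrivial real solution of $\tau_q y=\lambda y$ has no zeros on some interval $(a,+\infty)$. Unperturbed problem and operator $S_q$: under (H1), $S_q y=\tau_q y$ with domain $\{y\in\mathcal{D}_{max}: y(0)=0\}$. Under (H2), fix $\beta\in(0,\pi]$ and real-valued $f,g\in\mathcal{D}_{max}$ with $[f,g](+\infty)=1$; the domain is $\{y\in\mathcal{D}_{max}: y(0)=0=[y,f](+\infty)\sin\beta-[y,g](+\infty)\cos\beta\}$. Perturbed problem: for $t,r\ge 0$, the operator $S^{t,r}$ corresponds to $-y''+[q-r\delta(x-t)]y=\lambda y$. It acts as $-y''+qy$ on $[0,t)\cup(t,+\infty)$ on those $y\in L^2[0,+\infty)$ which are continuous, with $y,y'$ locally absolutely continuous on $[0,t)\cup(t,+\infty)$, with one-sided limits $y'(t\pm0)$ existing, $y'(t-0)-y'(t+0)=r\,y(t)$,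 $y(0)=0$, $-y''+qy\in L^2[0,+\infty)$ (computed away from $t$), and, under (H2), $[y,f](+\infty)\sin\beta-[y,g](+\infty)\cos\beta=0$. For $t=0$ or $r=0$ the perturbation has no effect and $S^{t,r}=S_q$. The first eigenvalue function $\lambda(t,r)=\lambda(t,r;q)$ is the first (smallest) eigenvalue of $S^{t,r}$.
   Formalization: In case (H1) it is additionally assumed, for every potential considered, that λ₁ is the bottom of the spectrum of the unperturbed operator; otherwise the smallest eigenvalue may be embedded in the continuous spectrum, λ(t,r) may jump at r=0, and the formula fails. *)

theory Defs
  imports "HOL-Analysis.Analysis"
begin

text \<open>Functions on \<open>[0,\<infinity>)\<close> are total functions on the reals whose values on the negative half-line are
  irrelevant; derivatives are therefore taken within \<open>[0,\<infinity>)\<close> (one-sided at 0).\<close>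

text \<open>The usual \<open>\<epsilon>\<close>-\<open>\<delta>\<close> definition; a finite family of non-overlapping intervals is a \<open>D\<close> with
  \<open>D division_of \<Union>D\<close>.\<close>

definition abs_cont_on :: "real \<Rightarrow> real \<Rightarrow> (real \<Rightarrow> 'a::real_normed_vector) \<Rightarrow> bool" where
  "abs_cont_on a b f \<longleftrightarrow>
    (\<forall>e>0. \<exists>d>0. \<forall>D. D division_of \<Union>D \<and> \<Union>D \<subseteq> {a..b} \<and> (\<Sum>K\<in>D. Sup K - Inf K) < d \<longrightarrow>
       (\<Sum>K\<in>D. norm (f (Sup K) - f (Inf K))) < e)"

definition AC_loc :: "real set \<Rightarrow> (real \<Rightarrow> 'a::real_normed_vector) \<Rightarrow> bool" where
  "AC_loc I f \<longleftrightarrow> (\<forall>a b. {a..b} \<subseteq> I \<longrightarrow> abs_cont_on a b f)"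

definition D\<^sub>x :: "(real \<Rightarrow> 'a::real_normed_vector) \<Rightarrow> real \<Rightarrow> 'a" where
  "D\<^sub>x y x = vector_derivative y (at x within {0..})"

text \<open>\<open>y, y' \<in> AC_loc(I)\<close>; then \<open>y''\<close> exists almost everywhere on \<open>I\<close>.\<close>

definition AC1_loc :: "real set \<Rightarrow> (real \<Rightarrow> 'a::real_normed_vector) \<Rightarrow> bool" where
  "AC1_loc I y \<longleftrightarrow>
     AC_loc I y \<and> (\<forall>x\<in>I. y differentiable (at x within {0..})) \<and> AC_loc I (D\<^sub>x y)"

definition L2 :: "(real \<Rightarrow> complex) set" where
  "L2 = {y. y \<in> borel_measurable (lebesgue_on {0..}) \<and>
            integrable (lebesgue_on {0..}) (\<lambda>x. (norm (y x))\<^sup>2)}"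

definition L2_norm :: "(real \<Rightarrow> complex) \<Rightarrow> real" where
  "L2_norm y = sqrt (integral\<^sup>L (lebesgue_on {0..}) (\<lambda>x. (norm (y x))\<^sup>2))"

definition L1_loc :: "(real \<Rightarrow> real) \<Rightarrow> bool" where
  "L1_loc q \<longleftrightarrow> (\<forall>b\<ge>0. set_integrable lebesgue {0..b} q)"

definition tau :: "(real \<Rightarrow> real) \<Rightarrow> (real \<Rightarrow> complex) \<Rightarrow> real \<Rightarrow> complex" where
  "tau q y x = - D\<^sub>x (D\<^sub>x y) x + of_real (q x) * y x"

definition max_dom :: "(real \<Rightarrow> real) \<Rightarrow> (real \<Rightarrow> complex) set" where
  "max_dom q = {y. y \<in> L2 \<and> AC1_loc {0..} y \<and> tau q y \<in> L2}"

definition bracket :: "(real \<Rightarrow> complex) \<Rightarrow> (real \<Rightarrow> complex) \<Rightarrow> real \<Rightarrow> complex" where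
  "bracket y z x = y x * cnj (D\<^sub>x z x) - cnj (z x) * D\<^sub>x y x"

definition solution :: "(real \<Rightarrow> real) \<Rightarrow> complex \<Rightarrow> (real \<Rightarrow> complex) \<Rightarrow> bool" where
  "solution q z y \<longleftrightarrow> AC1_loc {0..} y \<and> (AE x in lebesgue_on {0..}. tau q y x = z * y x)"

text \<open>By Weyl's theorem, the choice of \<open>z\<close> does not matter. Likewise, in the limit-circle case,
  the choice of \<open>l\<close> in the definition of non-oscillation does not matter.\<close>

definition limit_circle :: "(real \<Rightarrow> real) \<Rightarrow> bool" where
  "limit_circle q \<longleftrightarrow> (\<exists>z. \<forall>y. solution q z y \<longrightarrow> y \<in> L2)"

definition non_oscillatory :: "(real \<Rightarrow> real) \<Rightarrow> bool" where
  "non_oscillatory q \<longleftrightarrow>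
    (\<exists>l::real. \<forall>y::real \<Rightarrow> real.
       solution q (of_real l) (\<lambda>x. of_real (y x)) \<and> (\<exists>x\<ge>0. y x \<noteq> 0) \<longrightarrow>
       (\<exists>a\<ge>0. \<forall>x>a. y x \<noteq> 0))"

text \<open>The endpoint \<open>+\<infinity>\<close>: either no boundary condition, or the boundary condition
  \<open>[y,f](+\<infinity>) sin \<beta> - [y,g](+\<infinity>) cos \<beta> = 0\<close> given by \<open>f\<close>, \<open>g\<close>, \<open>\<beta>\<close>.\<close>

datatype endpoint = No_BC | BC "real \<Rightarrow> real" "real \<Rightarrow> real" real

fun satisfies_bc :: "endpoint \<Rightarrow> (real \<Rightarrow> complex) \<Rightarrow> bool" where
  "satisfies_bc No_BC y \<longleftrightarrow> True"
| "satisfies_bc (BC f g \<beta>) y \<longleftrightarrow>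
    (\<exists>A B. (bracket y (\<lambda>x. of_real (f x)) \<longlongrightarrow> A) at_top \<and>
           (bracket y (\<lambda>x. of_real (g x)) \<longlongrightarrow> B) at_top \<and>
           A * of_real (sin \<beta>) - B * of_real (cos \<beta>) = 0)"

text \<open>A non-negative potential is limit-point at \<open>+\<infinity>\<close>, so that no boundary condition is imposed there.\<close>

fun admissible :: "(real \<Rightarrow> real) \<Rightarrow> endpoint \<Rightarrow> bool" where
  "admissible q No_BC \<longleftrightarrow> (AE x in lebesgue_on {0..}. 0 \<le> q x)"
| "admissible q (BC f g \<beta>) \<longleftrightarrow>
    limit_circle q \<and> non_oscillatory q \<and> 0 < \<beta> \<and> \<beta> \<le> pi \<and>
    (\<lambda>x. of_real (f x)) \<in> max_dom q \<and> (\<lambda>x. of_real (g x)) \<in> max_dom q \<and>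
    (bracket (\<lambda>x. of_real (f x)) (\<lambda>x. of_real (g x)) \<longlongrightarrow> 1) at_top"

definition dom_S :: "(real \<Rightarrow> real) \<Rightarrow> endpoint \<Rightarrow> (real \<Rightarrow> complex) set" where
  "dom_S q E = {y \<in> max_dom q. y 0 = 0 \<and> satisfies_bc E y}"

text \<open>The operator \<open>S\<^sup>t\<^sup>,\<^sup>r\<close> acts as \<open>tau q\<close> almost everywhere on the following domain.\<close>

definition dom_S_delta ::
  "(real \<Rightarrow> real) \<Rightarrow> endpoint \<Rightarrow> real \<Rightarrow> real \<Rightarrow> (real \<Rightarrow> complex) set" where
  "dom_S_delta q E t r =
    (if t = 0 \<or> r = 0 then dom_S q E
     else {y \<in> L2. continuous_on {0..} y \<and> AC1_loc ({0..} - {t}) y \<and>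
             (\<exists>dl dr. (D\<^sub>x y \<longlongrightarrow> dl) (at_left t) \<and> (D\<^sub>x y \<longlongrightarrow> dr) (at_right t) \<and>
                      dl - dr = of_real r * y t) \<and>
             y 0 = 0 \<and> tau q y \<in> L2 \<and> satisfies_bc E y})"

definition eigenvalue ::
  "(real \<Rightarrow> real) \<Rightarrow> endpoint \<Rightarrow> real \<Rightarrow> real \<Rightarrow> real \<Rightarrow> bool" where
  "eigenvalue q E t r l \<longleftrightarrow>
    (\<exists>y \<in> dom_S_delta q E t r. (\<exists>x\<ge>0. y x \<noteq> 0) \<and>
       (AE x in lebesgue_on {0..}. tau q y x = of_real l * y x))"

definition first_eigenvalue ::
  "(real \<Rightarrow> real) \<Rightarrow> endpoint \<Rightarrow> real \<Rightarrow> real \<Rightarrow> real \<Rightarrow> bool" where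
  "first_eigenvalue q E t r l \<longleftrightarrow>
    eigenvalue q E t r l \<and> (\<forall>m. eigenvalue q E t r m \<longrightarrow> l \<le> m)"

definition resolvent_set :: "(real \<Rightarrow> real) \<Rightarrow> endpoint \<Rightarrow> complex set" where
  "resolvent_set q E =
    {z. (\<forall>h\<in>L2. \<exists>y\<in>dom_S q E. AE x in lebesgue_on {0..}. tau q y x - z * y x = h x) \<and>
        (\<exists>C. \<forall>y\<in>dom_S q E. L2_norm y \<le> C * L2_norm (\<lambda>x. tau q y x - z * y x))}"

definition spectrum_S :: "(real \<Rightarrow> real) \<Rightarrow> endpoint \<Rightarrow> complex set" where
  "spectrum_S q E = - resolvent_set q E"

text \<open>For \<open>q \<ge> 0\<close> the spectrum need not be discrete: \<open>S\<^sub>q\<close> may have no eigenvalue at all, or its smallest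
  eigenvalue may be embedded in the continuous spectrum, and then \<open>lam\<close> may jump at \<open>r = 0\<close>.
  So in this case "first eigenvalue" of \<open>S\<^sub>q\<close> is required to mean that the bottom of the spectrum is
  an eigenvalue. In the limit-circle, non-oscillatory case this is automatic, since the spectrum is discrete.\<close>

definition first_eigenvalue_function ::
  "(real \<Rightarrow> real) \<Rightarrow> endpoint \<Rightarrow> (real \<Rightarrow> real \<Rightarrow> real) \<Rightarrow> bool" where
  "first_eigenvalue_function q E lam \<longleftrightarrow>
    (\<forall>t\<ge>0. \<forall>r\<ge>0. first_eigenvalue q E t r (lam t r)) \<and>
    (E = No_BC \<longrightarrow> (\<forall>z\<in>spectrum_S q E. lam 0 0 \<le> Re z))"

definition right_pderiv_r :: "(real \<Rightarrow> real \<Rightarrow> real) \<Rightarrow> real \<Rightarrow> real" where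
  "right_pderiv_r lam x = vector_derivative (lam x) (at_right 0)"

definition phi0 :: "(real \<Rightarrow> real \<Rightarrow> real) \<Rightarrow> real \<Rightarrow> real" where
  "phi0 lam x = sqrt (- right_pderiv_r lam x)"

end

theory Submission
  imports Defs
begin

text \<open>Let \<open>u\<close> be the eigenfunction for \<open>\<lambda>\<^sub>1\<close>. If \<open>u > 0\<close> on \<open>(0, \<infinity>)\<close>, then for \<open>e > 0\<close> the solution
  on \<open>[0, t]\<close> vanishing at 0 and the solution on \<open>[t, \<infinity>)\<close> satisfying the condition at \<open>\<infinity>\<close>, both at level
  \<open>\<lambda>\<^sub>1 - e\<close> and equal to \<open>u(t)\<close> at \<open>t\<close>, lie between 0 and \<open>u\<close>. Glued together they are an eigenfunction of
  \<open>S\<close> with a perturbation of some strength \<open>r(e)\<close> at \<open>t\<close>, and Green's formula against \<open>u\<close> gives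
  \<open>r(e) u(t)\<^sup>2 = e \<parallel>u\<parallel>\<^sup>2 + o(e)\<close>. So \<open>- \<partial>\<lambda>(t, 0) / \<partial>r = u(t)\<^sup>2 / \<parallel>u\<parallel>\<^sup>2\<close>, whence \<open>\<phi>\<^sub>0 = u / \<parallel>u\<parallel>\<close> and \<open>\<phi>\<^sub>0'' = (q - \<lambda>\<^sub>1) \<phi>\<^sub>0\<close>.

  The ground state is positive because a zero of \<open>u\<close> would produce spectrum below \<open>\<lambda>\<^sub>1\<close>: for \<open>q \<ge> 0\<close>, a Dirichlet
  solution slightly below \<open>\<lambda>\<^sub>1\<close> would still have a zero, and cutting it off there would violate the lower bound of the
  form; in the limit-circle case, the zeros of the solutions satisfying the condition at \<open>\<infinity>\<close> are followed to 0.\<close>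

section \<open>Absolutely continuous functions\<close>

text \<open>The perturbed eigenvalue is prescribed and the strength producing it is computed; no
  perturbation series and no variational principle for the perturbed operator enters. Two facts
  allow the resulting curve to be read as \<lambda>(t, r). An eigenfunction below lambda_1 has no
  zero, so Green's formula between it and the glued function leaves no eigenvalue below l - e at the
  same strength. And r(e) is continuous and tends to 0, so every small strength occurs. The o(e) is
  dominated convergence with majorant u^2.

  The potential is only locally integrable, so y'' exists only almost everywhere and every identity
  is used in integrated form; the differentiability of absolutely continuous functions links this
  form with the definition of the domains. The boundary terms at infinity vanish for different
  reasons: for q >= 0 because y' is square integrable, in the limit-circle case because the boundary
  values of two admissible functions are proportional. The right-hand side of the formula involves
  only \<lambda>, so a competing potential may even satisfy the other of the two hypotheses.\<close>

lemma division_memE_real: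
  fixes D :: "real set set"
  assumes "D division_of S" "K \<in> D"
  obtains u v where "K = {u..v}" "u \<le> v"
  using division_ofD(3,4)[OF assms] that by (metis atLeastatMost_empty_iff box_real(2))

text \<open>Lengths become Lebesgue measures, the form in which divisions and Vitali coverings are
  summed.\<close>

lemma abs_cont_onD:
  assumes "abs_cont_on a b f" "e > 0"
  obtains d where "d > 0"
    "\<And>D. D division_of \<Union>D \<Longrightarrow> \<Union>D \<subseteq> {a..b} \<Longrightarrow> (\<Sum>K\<in>D. measure lborel K) < d \<Longrightarrow>
       (\<Sum>K\<in>D. norm (f (Sup K) - f (Inf K))) < e"
proof -
  obtain d where d: "d > 0" and *: "\<And>D. D division_of \<Union>D \<Longrightarrow> \<Union>D \<subseteq> {a..b} \<Longrightarrow> (\<Sum>K\<in>D. Sup K - Inf K) < d \<Longrightarrow>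
       (\<Sum>K\<in>D. norm (f (Sup K) - f (Inf K))) < e"
    using assms(1)[unfolded abs_cont_on_def, rule_format, OF assms(2)] by (elim exE conjE) auto
  have "(\<Sum>K\<in>D. norm (f (Sup K) - f (Inf K))) < e"
    if D: "D division_of \<Union>D" "\<Union>D \<subseteq> {a..b}" "(\<Sum>K\<in>D. measure lborel K) < d" for D
  proof -
    have "measure lborel K = Sup K - Inf K" if KD: "K \<in> D" for K
    proof -
      obtain u v where "K = {u..v}" "u \<le> v"
        using division_memE_real[OF D(1) KD] by blast
      then show ?thesis by simp
    qed
    then show ?thesis using *[OF D(1,2)] D(3) by simp
  qed
  then show thesis using d that by blast
qed

lemma abs_cont_on_singleton:
  assumes "abs_cont_on a b f" "e > 0"
  obtains d where "d > 0" "\<And>u v. a \<le> u \<Longrightarrow> u \<le> v \<Longrightarrow> v \<le> b \<Longrightarrow> v - u < d \<Longrightarrow> norm (f v - f u) < e"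
proof -
  obtain d where d: "d > 0"
    "\<And>D. D division_of \<Union>D \<Longrightarrow> \<Union>D \<subseteq> {a..b} \<Longrightarrow> (\<Sum>K\<in>D. measure lborel K) < d \<Longrightarrow>
       (\<Sum>K\<in>D. norm (f (Sup K) - f (Inf K))) < e"
    using abs_cont_onD[OF assms] by blast
  have "norm (f v - f u) < e" if "a \<le> u" "u \<le> v" "v \<le> b" "v - u < d" for u v
    using d(2)[of "{{u..v}}"] that by (auto simp: division_of_def)
  then show thesis using d(1) that by blast
qed

lemma abs_cont_on_imp_continuous_on:
  assumes "abs_cont_on a b f" shows "continuous_on {a..b} f"
  unfolding continuous_on_iff
proof (intro ballI allI impI)
  fix x e :: real assume x: "x \<in> {a..b}" and e: "e > 0"
  obtain d where d: "d > 0" "\<And>u v. a \<le> u \<Longrightarrow> u \<le> v \<Longrightarrow> v \<le> b \<Longrightarrow> v - u < d \<Longrightarrow> norm (f v - f u) < e"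
    using abs_cont_on_singleton[OF assms e] by blast
  show "\<exists>d>0. \<forall>x'\<in>{a..b}. dist x' x < d \<longrightarrow> dist (f x') (f x) < e"
  proof (intro exI[of _ d] conjI ballI impI)
    fix y assume y: "y \<in> {a..b}" "dist y x < d"
    show "dist (f y) (f x) < e"
      using d(2)[of x y] d(2)[of y x] x y by (cases "x \<le> y") (auto simp: dist_norm norm_minus_commute)
  qed (use d in auto)
qed

lemma abs_cont_on_subset:
  assumes "abs_cont_on a b f" "a \<le> c" "d \<le> b" shows "abs_cont_on c d f"
proof -
  have "{c..d} \<subseteq> {a..b}" using assms by auto
  then show ?thesis using assms(1) unfolding abs_cont_on_def by (meson order_trans)
qed

text \<open>The common source of the closure properties below: differences, products, components and
  compositions with Lipschitz functions all have increments controlled by those of functions already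
  known to be absolutely continuous.\<close>

lemma abs_cont_on_dominated:
  assumes "abs_cont_on a b f" "abs_cont_on a b g"
    and le: "\<And>u v. a \<le> u \<Longrightarrow> u \<le> v \<Longrightarrow> v \<le> b \<Longrightarrow> norm (h v - h u) \<le> A * norm (f v - f u) + B * norm (g v - g u)"
  shows "abs_cont_on a b h"
  unfolding abs_cont_on_def
proof (intro allI impI)
  fix e :: real assume e: "e > 0"
  define C where "C = \<bar>A\<bar> + \<bar>B\<bar> + 1"
  have C: "C > 0" "A \<le> C" "B \<le> C" unfolding C_def by auto
  define e' where "e' = e / (2 * C)"
  have e': "e' > 0" using e C by (simp add: e'_def)
  obtain d1 where d1: "d1 > 0" "\<And>D. D division_of \<Union>D \<Longrightarrow> \<Union>D \<subseteq> {a..b} \<Longrightarrow> (\<Sum>K\<in>D. Sup K - Inf K) < d1 \<Longrightarrow>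
       (\<Sum>K\<in>D. norm (f (Sup K) - f (Inf K))) < e'"
    using assms(1)[unfolded abs_cont_on_def, rule_format, OF e'] by (elim exE conjE) auto
  obtain d2 where d2: "d2 > 0" "\<And>D. D division_of \<Union>D \<Longrightarrow> \<Union>D \<subseteq> {a..b} \<Longrightarrow> (\<Sum>K\<in>D. Sup K - Inf K) < d2 \<Longrightarrow>
       (\<Sum>K\<in>D. norm (g (Sup K) - g (Inf K))) < e'"
    using assms(2)[unfolded abs_cont_on_def, rule_format, OF e'] by (elim exE conjE) auto
  show "\<exists>d>0. \<forall>D. D division_of \<Union>D \<and> \<Union>D \<subseteq> {a..b} \<and> (\<Sum>K\<in>D. Sup K - Inf K) < d \<longrightarrow>
       (\<Sum>K\<in>D. norm (h (Sup K) - h (Inf K))) < e"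
  proof (intro exI[of _ "min d1 d2"] conjI allI impI)
    fix D assume D: "D division_of \<Union>D \<and> \<Union>D \<subseteq> {a..b} \<and> (\<Sum>K\<in>D. Sup K - Inf K) < min d1 d2"
    have *: "norm (h (Sup K) - h (Inf K)) \<le> C * norm (f (Sup K) - f (Inf K)) + C * norm (g (Sup K) - g (Inf K))"
      if KD: "K \<in> D" for K
    proof -
      obtain u v where uv: "K = {u..v}" "u \<le> v"
        using division_memE_real[OF conjunct1[OF D] KD] by blast
      have "K \<subseteq> {a..b}" using D KD by auto
      then have "a \<le> u" "v \<le> b" using uv by auto
      then have "norm (h v - h u) \<le> A * norm (f v - f u) + B * norm (g v - g u)" using le uv by auto
      also have "\<dots> \<le> C * norm (f v - f u) + C * norm (g v - g u)"
        using C by (intro add_mono mult_right_mono) auto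
      finally show ?thesis using uv by simp
    qed
    have "(\<Sum>K\<in>D. norm (h (Sup K) - h (Inf K))) \<le> C * (\<Sum>K\<in>D. norm (f (Sup K) - f (Inf K))) + C * (\<Sum>K\<in>D. norm (g (Sup K) - g (Inf K)))"
      unfolding sum_distrib_left sum.distrib[symmetric] by (rule sum_mono) (rule *)
    also have "\<dots> < C * e' + C * e'" using d1(2)[of D] d2(2)[of D] D C
      by (intro add_strict_mono mult_strict_left_mono) auto
    also have "\<dots> = e" using C by (simp add: e'_def field_simps)
    finally show "(\<Sum>K\<in>D. norm (h (Sup K) - h (Inf K))) < e" .
  qed (use d1 d2 in auto)
qed

lemma abs_cont_on_lipschitz:
  assumes "\<And>u v. a \<le> u \<Longrightarrow> u \<le> v \<Longrightarrow> v \<le> b \<Longrightarrow> norm (h v - h u) \<le> A * (v - u)"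
  shows "abs_cont_on a b h"
proof -
  have "abs_cont_on a b (\<lambda>x. x::real)" unfolding abs_cont_on_def
  proof (intro allI impI)
    fix e :: real assume "e > 0"
    have *: "norm (Sup K - Inf K) = Sup K - Inf K" if DK: "D division_of \<Union>D" "K \<in> D" for D :: "real set set" and K
    proof -
      obtain u v where "K = {u..v}" "u \<le> v"
        using division_memE_real[OF DK] by blast
      then show ?thesis by simp
    qed
    then show "\<exists>d>0. \<forall>D. D division_of \<Union> D \<and> \<Union> D \<subseteq> {a..b} \<and> (\<Sum>K\<in>D. Sup K - Inf K) < d \<longrightarrow>
           (\<Sum>K\<in>D. norm (Sup K - Inf K)) < e"
      using \<open>e > 0\<close> by (intro exI[of _ e]) (auto simp: * cong: sum.cong)
  qed
  from abs_cont_on_dominated[OF this this, of h A 0] show ?thesis using assms by simp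
qed

lemma abs_cont_on_cong:
  assumes "abs_cont_on a b f" "\<And>x. x \<in> {a..b} \<Longrightarrow> g x = f x"
  shows "abs_cont_on a b g"
  by (rule abs_cont_on_dominated[OF assms(1) assms(1), of _ 1 0]) (use assms(2) in auto)

lemma abs_cont_on_mult:
  fixes f g :: "real \<Rightarrow> 'a::real_normed_algebra"
  assumes f: "abs_cont_on a b f" and g: "abs_cont_on a b g"
  shows "abs_cont_on a b (\<lambda>x. f x * g x)"
proof -
  obtain F where F: "\<And>x. x \<in> {a..b} \<Longrightarrow> norm (f x) \<le> F"
    using compact_imp_bounded[OF compact_continuous_image[OF abs_cont_on_imp_continuous_on[OF f] compact_Icc]]
    unfolding bounded_iff by blast
  obtain G where G: "\<And>x. x \<in> {a..b} \<Longrightarrow> norm (g x) \<le> G"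
    using compact_imp_bounded[OF compact_continuous_image[OF abs_cont_on_imp_continuous_on[OF g] compact_Icc]]
    unfolding bounded_iff by blast
  show ?thesis
  proof (rule abs_cont_on_dominated[OF f g])
    fix u v assume uv: "a \<le> u" "u \<le> v" "v \<le> b"
    have "f v * g v - f u * g u = (f v - f u) * g v + f u * (g v - g u)" by (simp add: algebra_simps)
    then have "norm (f v * g v - f u * g u) \<le> norm ((f v - f u) * g v) + norm (f u * (g v - g u))"
      by (metis norm_triangle_ineq)
    also have "\<dots> \<le> norm (f v - f u) * norm (g v) + norm (f u) * norm (g v - g u)"
      by (intro add_mono norm_mult_ineq)
    also have "\<dots> \<le> norm (f v - f u) * G + F * norm (g v - g u)"
      using F[of u] G[of v] uv by (intro add_mono mult_left_mono mult_right_mono) auto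
    finally show "norm (f v * g v - f u * g u) \<le> G * norm (f v - f u) + F * norm (g v - g u)"
      by (simp add: mult.commute)
  qed
qed

lemma abs_cont_on_diff:
  assumes f: "abs_cont_on a b f" and g: "abs_cont_on a b g"
  shows "abs_cont_on a b (\<lambda>x. f x - g x)"
proof (rule abs_cont_on_dominated[OF f g, of _ 1 1])
  fix u v
  have "f v - g v - (f u - g u) = (f v - f u) - (g v - g u)" by simp
  then show "norm (f v - g v - (f u - g u)) \<le> 1 * norm (f v - f u) + 1 * norm (g v - g u)"
    by (metis mult_1 norm_triangle_ineq4)
qed

text \<open>The fundamental theorem of calculus with a null exceptional set. Intervals tagged
  outside \<open>N\<close> are handled by the derivative; those tagged in \<open>N\<close> lie in an
  open set of small measure, where absolute continuity bounds the increments.\<close>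

lemma abs_cont_on_has_integral:
  fixes f :: "real \<Rightarrow> 'a::banach"
  assumes ab: "a \<le> b" and ac: "abs_cont_on a b f" and N: "negligible N"
    and der: "\<And>x. x \<in> {a..b} - N \<Longrightarrow> (f has_vector_derivative g x) (at x within {a..b})"
  shows "(g has_integral (f b - f a)) {a..b}"
proof -
  define h where "h x = (if x \<in> N then 0 else g x)" for x
  have "(h has_integral (f b - f a)) (cbox a b)"
    unfolding has_integral
  proof (intro allI impI)
    fix e :: real assume e: "e > 0"
    \<comment> \<open>The \<open>+ 1\<close> covers the case \<open>a = b\<close>; the intervals
      tagged outside \<open>N\<close> then contribute at most \<open>e/4\<close> altogether.\<close>
    define e' where "e' = e / (4 * (b - a + 1))"
    have e': "e' > 0" using e ab by (simp add: e'_def)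
    obtain d where d: "d > 0" "\<And>D. D division_of \<Union>D \<Longrightarrow> \<Union>D \<subseteq> {a..b} \<Longrightarrow> (\<Sum>K\<in>D. measure lborel K) < d \<Longrightarrow>
       (\<Sum>K\<in>D. norm (f (Sup K) - f (Inf K))) < e/2"
      using abs_cont_onD[OF ac half_gt_zero[OF e]] by blast
    have "N \<in> sets lebesgue" using N by (simp add: negligible_imp_sets)
    then obtain G where G: "open G" "N \<subseteq> G" "G - N \<in> lmeasurable" "emeasure lebesgue (G - N) < ennreal d"
      using sets_lebesgue_outer_open[of N d] d by blast
    have Gm: "G \<in> lmeasurable" "measure lebesgue G < d"
    proof -
      have G1: "G = (G - N) \<union> N" using G by auto
      show Gl: "G \<in> lmeasurable" using G(3) N by (subst G1) (intro fmeasurable.Un; simp add: negligible_imp_measurable)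
      have "measure lebesgue G = measure lebesgue (G - N)"
        using N G(1) by (simp add: measure_Diff_null_set negligible_iff_null_sets)
      also have "\<dots> < d" using G(3,4) d(1)
        by (metis emeasure_eq_measure2 ennreal_less_iff measure_nonneg)
      finally show "measure lebesgue G < d" .
    qed
    have "\<forall>x\<in>{a..b} - N. \<exists>r>0. \<forall>y\<in>{a..b}. norm (y - x) < r \<longrightarrow> norm (f y - f x - (y - x) *\<^sub>R g x) \<le> e' * norm (y - x)"
      using der e' unfolding has_vector_derivative_def has_derivative_within_alt by (metis real_norm_def)
    then obtain r where r: "\<And>x. x \<in> {a..b} - N \<Longrightarrow> r x > 0"
      "\<And>x y. x \<in> {a..b} - N \<Longrightarrow> y \<in> {a..b} \<Longrightarrow> norm (y - x) < r x \<Longrightarrow> norm (f y - f x - (y - x) *\<^sub>R g x) \<le> e' * norm (y - x)"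
      by metis
    \<comment> \<open>At tags in \<open>N\<close> the gauge is the whole of \<open>G\<close>, so
      that the intervals tagged there have total length below \<open>d\<close>.\<close>
    define \<gamma> where "\<gamma> x = (if x \<in> N then G else if x \<in> {a..b} then ball x (r x) else ball x 1)" for x
    have gauge: "gauge \<gamma>" unfolding gauge_def \<gamma>_def using G r(1) by auto
    show "\<exists>\<gamma>. gauge \<gamma> \<and> (\<forall>p. p tagged_division_of cbox a b \<and> \<gamma> fine p \<longrightarrow>
            norm ((\<Sum>(x,k)\<in>p. measure lborel k *\<^sub>R h x) - (f b - f a)) < e)"
    proof (intro exI[of _ \<gamma>] conjI allI impI gauge)
      fix p assume p: "p tagged_division_of cbox a b \<and> \<gamma> fine p"
      note pt = tagged_division_ofD[OF conjunct1[OF p]]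
      define p1 where "p1 = {xk\<in>p. fst xk \<in> N}"
      define p2 where "p2 = {xk\<in>p. fst xk \<notin> N}"
      have fin: "finite p" "finite p1" "finite p2" using pt(1) by (auto simp: p1_def p2_def)
      have p12: "p = p1 \<union> p2" "p1 \<inter> p2 = {}" by (auto simp: p1_def p2_def)
      have fine: "k \<subseteq> \<gamma> x" if "(x,k) \<in> p" for x k using p that by (auto simp: fine_def)
      define T where "T = (\<lambda>(x,k). measure lborel k *\<^sub>R h x - (f (Sup k) - f (Inf k)))"
      have sum1: "(\<Sum>(x,k)\<in>p. f (Sup k) - f (Inf k)) = f b - f a"
        by (rule additive_tagged_division_1) (use ab p in auto)
      have lhs: "(\<Sum>(x,k)\<in>p. measure lborel k *\<^sub>R h x) - (f b - f a) = (\<Sum>xk\<in>p. T xk)"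
        unfolding sum1[symmetric] T_def by (simp add: sum_subtractf[symmetric] case_prod_unfold)
      have part1: "norm (\<Sum>xk\<in>p1. T xk) < e/2"
      proof -
        have tp1: "p1 tagged_partial_division_of cbox a b"
          using tagged_partial_division_subset[of p "cbox a b" p1] p tagged_division_of_def p12 by blast
        have td1: "p1 tagged_division_of \<Union>(snd ` p1)" using tagged_partial_division_of_Union_self[OF tp1] .
        have div: "(snd ` p1) division_of \<Union>(snd ` p1)" using division_of_tagged_division[OF td1] .
        have sub: "\<Union>(snd ` p1) \<subseteq> {a..b}" using pt(3) p12 by fastforce
        have subG: "\<Union>(snd ` p1) \<subseteq> G" using fine by (fastforce simp: p1_def \<gamma>_def)
        have "(\<Sum>K\<in>snd ` p1. measure lborel K) = (\<Sum>K\<in>snd ` p1. measure lebesgue K)"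
        proof (rule sum.cong[OF refl])
          fix K assume "K \<in> snd ` p1"
          then obtain u v where "K = cbox u v" using division_ofD(4)[OF div] by blast
          then show "measure lborel K = measure lebesgue K" by simp
        qed
        also have "\<dots> = measure lebesgue (\<Union>(snd ` p1))" using content_division[OF div] .
        also have "\<dots> \<le> measure lebesgue G"
          by (rule measure_mono_fmeasurable[OF subG _ Gm(1)]) (use lmeasurable_division[OF div] in auto)
        also have "\<dots> < d" by (rule Gm)
        finally have small: "(\<Sum>K\<in>snd ` p1. norm (f (Sup K) - f (Inf K))) < e/2"
          using d(2)[OF div sub] by blast
        have ne: "k \<noteq> {}" if "(x,k) \<in> p1" for x k using pt(2)[of x k] that p12 by auto
        have "norm (\<Sum>xk\<in>p1. T xk) \<le> (\<Sum>xk\<in>p1. norm (T xk))" by (rule norm_sum)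
        also have "\<dots> = (\<Sum>(x,k)\<in>p1. norm (f (Sup k) - f (Inf k)))"
          by (rule sum.cong) (auto simp: T_def p1_def h_def norm_minus_commute)
        \<comment> \<open>Passing from tagged pairs to intervals requires a function that vanishes
          on every box without interior. For the empty set \<open>Sup\<close> and \<open>Inf\<close>
          carry no information, hence the conditional.\<close>
        also have "\<dots> = (\<Sum>(x,k)\<in>p1. if k = {} then 0 else norm (f (Sup k) - f (Inf k)))"
          using ne by (intro sum.cong) auto
        also have "\<dots> = (\<Sum>K\<in>snd ` p1. if K = {} then 0 else norm (f (Sup K) - f (Inf K)))"
        proof (rule sum.over_tagged_division_lemma[OF td1])
          fix u v :: real assume "box u v = {}"
          then have "v \<le> u" by simp
          then show "(if cbox u v = {} then 0 else norm (f (Sup (cbox u v)) - f (Inf (cbox u v)))) = 0"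
            by (cases "u = v") auto
        qed
        also have "\<dots> = (\<Sum>K\<in>snd ` p1. norm (f (Sup K) - f (Inf K)))"
          using ne by (intro sum.cong) auto
        finally show ?thesis using small by linarith
      qed
      have part2: "norm (\<Sum>xk\<in>p2. T xk) \<le> e/4"
      proof -
        have "norm (T (x,k)) \<le> e' * measure lborel k" if xk: "(x,k) \<in> p2" for x k
        proof -
          have xkp: "(x,k) \<in> p" and xN: "x \<notin> N" using xk by (auto simp: p2_def)
          obtain u v where uv: "k = {u..v}" using pt(4)[OF xkp] by auto
          have x: "x \<in> {u..v}" "u \<le> x" "x \<le> v" using pt(2)[OF xkp] uv by auto
          have kab: "{u..v} \<subseteq> {a..b}" using pt(3)[OF xkp] uv by auto
          then have xab: "x \<in> {a..b}" using x by auto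
          have kb: "{u..v} \<subseteq> ball x (r x)" using fine[OF xkp] uv xN xab by (auto simp: \<gamma>_def)
          have uvin: "u \<in> {u..v}" "v \<in> {u..v}" using x by auto
          have "norm (u - x) < r x" "norm (v - x) < r x"
            using subsetD[OF kb uvin(1)] subsetD[OF kb uvin(2)] by (auto simp: dist_norm norm_minus_commute)
          then have 1: "norm (f u - f x - (u - x) *\<^sub>R g x) \<le> e' * (x - u)" "norm (f v - f x - (v - x) *\<^sub>R g x) \<le> e' * (v - x)"
            using r(2)[of x u] r(2)[of x v] xab xN kab uvin x by auto
          have "T (x,k) = (f u - f x - (u - x) *\<^sub>R g x) - (f v - f x - (v - x) *\<^sub>R g x)"
            using uv x xN by (simp add: T_def h_def algebra_simps)
          then have "norm (T (x,k)) \<le> norm (f u - f x - (u - x) *\<^sub>R g x) + norm (f v - f x - (v - x) *\<^sub>R g x)"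
            by (metis norm_triangle_ineq4)
          also have "\<dots> \<le> e' * (x - u) + e' * (v - x)" using 1 by linarith
          also have "\<dots> = e' * measure lborel k" using uv x by (simp add: algebra_simps)
          finally show ?thesis .
        qed
        then have "norm (\<Sum>xk\<in>p2. T xk) \<le> (\<Sum>xk\<in>p2. e' * measure lborel (snd xk))"
          by (intro sum_norm_le) auto
        also have "\<dots> \<le> (\<Sum>xk\<in>p. e' * measure lborel (snd xk))"
          using fin p12 e' by (intro sum_mono2) auto
        also have "\<dots> = e' * (\<Sum>(x,k)\<in>p. measure lborel k)" by (simp add: sum_distrib_left case_prod_unfold)
        also have "\<dots> = e' * (b - a)" using additive_content_tagged_division[OF conjunct1[OF p]] ab by simp
        also have "\<dots> \<le> e/4" using ab e by (simp add: e'_def field_simps)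
        finally show ?thesis .
      qed
      have "norm (\<Sum>xk\<in>p. T xk) \<le> norm (\<Sum>xk\<in>p1. T xk) + norm (\<Sum>xk\<in>p2. T xk)"
        unfolding p12(1) using fin p12(2) by (simp add: sum.union_disjoint norm_triangle_ineq)
      then show "norm ((\<Sum>(x,k)\<in>p. measure lborel k *\<^sub>R h x) - (f b - f a)) < e"
        unfolding lhs using part1 part2 e by linarith
    qed
  qed
  then have "(h has_integral (f b - f a)) {a..b}" by simp
  moreover have "(h has_integral (f b - f a)) {a..b} = (g has_integral (f b - f a)) {a..b}"
    by (rule has_integral_spike_eq[OF N]) (auto simp: h_def)
  ultimately show ?thesis by simp
qed

section \<open>Differentiability almost everywhere\<close>

text \<open>Vitali's covering theorem for balls, recast for intervals: they only have to contain
  \<open>x\<close>, not be centred there, and may be restricted by any property \<open>P\<close>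
  that occurs at arbitrarily small scales. The countable family exhausts \<open>S\<close> up to a
  null set, the finite one exhausts its measure up to \<open>e\<close>.\<close>

lemma Vitali_intervals:
  fixes G S :: "real set"
  assumes "open G" "S \<subseteq> G" "G \<subseteq> {a..b}" "e > 0"
    and S: "\<And>x d. x \<in> S \<Longrightarrow> d > 0 \<Longrightarrow> \<exists>u v. u < v \<and> x \<in> {u..v} \<and> v - u < d \<and> P u v"
  obtains C F where "countable C" "negligible (S - \<Union>C)" "\<Union>C \<in> lmeasurable" "\<Union>C \<subseteq> G"
    "finite F" "F \<subseteq> C" "measure lebesgue (\<Union>C) - e < measure lebesgue (\<Union>F)"
    "\<And>K. K \<in> F \<Longrightarrow> \<exists>u v. u < v \<and> K = {u..v} \<and> {u..v} \<subseteq> G \<and> P u v"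
    "pairwise disjnt F"
proof -
  define K where "K = {(u,v). u < v \<and> {u..v} \<subseteq> G \<and> P u v}"
  define c where "c = (\<lambda>(u::real,v::real). (u+v)/2)"
  define r where "r = (\<lambda>(u::real,v::real). (v-u)/2)"
  have cb: "cball (c i) (r i) = {fst i..snd i}" for i
    by (cases i) (auto simp: c_def r_def cball_eq_atLeastAtMost field_simps)
  have 1: "0 < r i" if "i \<in> K" for i using that by (auto simp: K_def r_def)
  have 2: "\<exists>i. i \<in> K \<and> x \<in> cball (c i) (r i) \<and> r i < d" if xd: "x \<in> S" "0 < d" for x d
  proof -
    have "x \<in> G" using xd(1) assms(2) by blast
    then obtain g where g: "g > 0" "ball x g \<subseteq> G" using assms(1) openE by blast
    obtain u v where uv: "u < v" "x \<in> {u..v}" "v - u < min d g" "P u v"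
      using S[OF xd(1), of "min d g"] xd(2) g(1) by (metis min_less_iff_conj)
    have "{u..v} \<subseteq> ball x g" using uv by (auto simp: dist_real_def)
    then have "(u,v) \<in> K" using uv g by (auto simp: K_def)
    then show ?thesis using uv cb[of "(u,v)"] by (intro exI[of _ "(u,v)"]) (auto simp: r_def)
  qed
  obtain C0 where C0: "countable C0" "C0 \<subseteq> K"
     "pairwise (\<lambda>i j. disjnt (cball (c i) (r i)) (cball (c j) (r j))) C0"
     "negligible(S - (\<Union>i \<in> C0. cball (c i) (r i)))"
    using Vitali_covering_theorem_cballs[of K r S c] 1 2 by blast
  define C where "C = (\<lambda>i. {fst i..snd i}) ` C0"
  have C: "countable C" "negligible (S - \<Union>C)" using C0 by (auto simp: C_def cb)
  have pd: "pairwise disjnt C" using C0(3) by (auto simp: C_def cb pairwise_def)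
  have CK: "\<exists>u v. u < v \<and> k = {u..v} \<and> {u..v} \<subseteq> G \<and> P u v" if "k \<in> C" for k
    using that C0(2) by (auto simp: C_def K_def)
  have CG: "\<Union>C \<subseteq> G" using CK by blast
  have Cs: "k \<in> lmeasurable" if "k \<in> C" for k using CK[OF that] by auto
  have B: "measure lebesgue (\<Union>D) \<le> measure lebesgue {a..b}" if "D \<subseteq> C" "finite D" for D
    by (rule measure_mono_fmeasurable) (use that CG assms(3) Cs in \<open>auto intro!: fmeasurableD fmeasurable.finite_Union\<close>)
  have Cl: "\<Union>C \<in> lmeasurable" by (rule fmeasurable_Union_bound[OF C(1)]) (use Cs B in auto)
  obtain F where F: "F \<subseteq> C" "finite F" "measure lebesgue (\<Union>C) - e < measure lebesgue (\<Union>F)"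
    using measure_countable_Union_approachable[OF C(1) \<open>e > 0\<close> Cs B] by blast
  show thesis
    by (rule that[OF C Cl CG F(2,1,3)]) (use F CK in \<open>blast intro: pairwise_subset[OF pd]\<close>)+
qed

lemma division_of_disjoint_intervals:
  fixes F :: "real set set"
  assumes "finite F" "pairwise disjnt F" "\<And>K. K \<in> F \<Longrightarrow> \<exists>u v. u < v \<and> K = {u..v}"
  shows "F division_of \<Union>F"
proof (rule division_ofI)
  fix K assume "K \<in> F"
  then obtain u v where "u < v" "K = {u..v}" using assms by blast
  then show "K \<noteq> {}" "\<exists>a b. K = cbox a b" by auto
next
  fix K1 K2 assume "K1 \<in> F" "K2 \<in> F" "K1 \<noteq> K2"
  then have "K1 \<inter> K2 = {}" using assms(2) by (auto simp: pairwise_def disjnt_def)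
  then show "interior K1 \<inter> interior K2 = {}" using interior_subset by blast
qed (use assms in auto)

text \<open>Increments are additive under cutting an interval, which makes them telescope over
  arbitrary divisions.\<close>

lemma operative_increment:
  fixes f :: "real \<Rightarrow> real"
  shows "operative (+) 0 (\<lambda>K. if K = {} then 0 else f (Sup K) - f (Inf K))"
proof (rule operative.intro)
  show "comm_monoid_set (+) (0::real)" by (rule sum.comm_monoid_set_axioms)
  show "operative_axioms (+) 0 (\<lambda>K. if K = {} then 0 else f (Sup K) - f (Inf K))"
  proof
    fix a b :: real assume "box a b = {}"
    then show "(if cbox a b = {} then 0 else f (Sup (cbox a b)) - f (Inf (cbox a b))) = 0"
      by (cases "a = b") auto
  next
    fix a b c k :: real assume "k \<in> Basis"
    then have [simp]: "k = 1" by simp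
    have "cbox a b \<inter> {x. x \<le> c} = {a..min b c}" "cbox a b \<inter> {x. c \<le> x} = {max a c..b}" by auto
    then show "(if cbox a b = {} then 0 else f (Sup (cbox a b)) - f (Inf (cbox a b))) =
       (if cbox a b \<inter> {x. x \<bullet> k \<le> c} = {} then 0 else f (Sup (cbox a b \<inter> {x. x \<bullet> k \<le> c})) - f (Inf (cbox a b \<inter> {x. x \<bullet> k \<le> c}))) +
       (if cbox a b \<inter> {x. c \<le> x \<bullet> k} = {} then 0 else f (Sup (cbox a b \<inter> {x. c \<le> x \<bullet> k})) - f (Inf (cbox a b \<inter> {x. c \<le> x \<bullet> k})))"
      by (auto simp: min_def max_def)
  qed
qed

lemma division_increment:
  fixes f :: "real \<Rightarrow> real"
  assumes "D division_of {a..b}" "a \<le> b"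
  shows "(\<Sum>K\<in>D. f (Sup K) - f (Inf K)) = f b - f a"
proof -
  have "sum (\<lambda>K. if K = {} then 0 else f (Sup K) - f (Inf K)) D = f b - f a"
    using operative.division[OF operative_increment, of D a b f] assms by (simp add: sum_def)
  moreover have "sum (\<lambda>K. if K = {} then 0 else f (Sup K) - f (Inf K)) D = (\<Sum>K\<in>D. f (Sup K) - f (Inf K))"
    using division_ofD(3)[OF assms(1)] by (intro sum.cong) auto
  ultimately show ?thesis by simp
qed

lemma division_measure:
  fixes D :: "real set set"
  assumes "D division_of S" shows "(\<Sum>K\<in>D. measure lborel K) = measure lebesgue S"
proof -
  have "(\<Sum>K\<in>D. measure lborel K) = (\<Sum>K\<in>D. measure lebesgue K)"
  proof (rule sum.cong[OF refl])
    fix K assume "K \<in> D"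
    then obtain u v where "K = cbox u v" using division_ofD(4)[OF assms] by blast
    then show "measure lborel K = measure lebesgue K" by simp
  qed
  then show ?thesis using content_division[OF assms] by simp
qed

lemma outer_open:
  fixes S :: "real set"
  assumes "S \<subseteq> {a<..<b}"
  obtains \<mu> where "\<mu> \<ge> 0"
    "\<And>M. M \<in> lmeasurable \<Longrightarrow> negligible (S - M) \<Longrightarrow> \<mu> \<le> measure lebesgue M"
    "\<And>e. e > 0 \<Longrightarrow> \<exists>G. open G \<and> S \<subseteq> G \<and> G \<subseteq> {a<..<b} \<and> G \<in> lmeasurable \<and> measure lebesgue G < \<mu> + e"
    "\<mu> = 0 \<Longrightarrow> negligible S"
proof -
  define X where "X = {measure lebesgue G | G. open G \<and> S \<subseteq> G \<and> G \<subseteq> {a<..<b}}"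
  define \<mu> where "\<mu> = Inf X"
  have ne: "X \<noteq> {}" unfolding X_def using assms open_greaterThanLessThan by blast
  have bdd: "bdd_below X" by (rule bdd_belowI[of _ 0]) (auto simp: X_def)
  have lm: "G \<in> lmeasurable" if "open G" "G \<subseteq> {a<..<b}" for G
    using lmeasurable_open[OF bounded_subset[OF bounded_box, of G a b]] that by (simp add: box_real)
  have 3: "\<exists>G. open G \<and> S \<subseteq> G \<and> G \<subseteq> {a<..<b} \<and> G \<in> lmeasurable \<and> measure lebesgue G < \<mu> + e" if e0: "e > 0" for e
  proof -
    obtain x where "x \<in> X" "x < \<mu> + e" using cInf_lessD[OF ne, of "\<mu> + e"] e0 by (auto simp: \<mu>_def)
    then show ?thesis using lm by (auto simp: X_def)
  qed
  have 2: "\<mu> \<le> measure lebesgue M" if M: "M \<in> lmeasurable" "negligible (S - M)" for M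
  proof (rule field_le_epsilon)
    fix e :: real assume e: "e > 0"
    define M' where "M' = M \<union> (S - M)"
    have M': "M' \<in> lmeasurable" "measure lebesgue M' = measure lebesgue M"
      unfolding M'_def using M measure_Un_null_set[of M lebesgue "S - M"]
      by (auto simp only: negligible_imp_measurable negligible_iff_null_sets[symmetric] fmeasurableD intro!: fmeasurable.Un)
    obtain T where T: "open T" "M' \<subseteq> T" "T - M' \<in> lmeasurable" "emeasure lebesgue (T - M') < ennreal e"
      using sets_lebesgue_outer_open[OF fmeasurableD[OF M'(1)] e] by blast
    have Te: "measure lebesgue (T - M') < e" using T(3,4) e
      by (metis emeasure_eq_measure2 ennreal_less_iff measure_nonneg)
    have TM: "T = M' \<union> (T - M')" using T by auto
    have Tl: "T \<in> lmeasurable" using M' T by (subst TM) (intro fmeasurable.Un)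
    have "open (T \<inter> {a<..<b})" "S \<subseteq> T \<inter> {a<..<b}" using T(1,2) assms by (auto simp: M'_def)
    then have "measure lebesgue (T \<inter> {a<..<b}) \<in> X" unfolding X_def by blast
    then have "\<mu> \<le> measure lebesgue (T \<inter> {a<..<b})" unfolding \<mu>_def using bdd by (rule cInf_lower)
    also have "\<dots> \<le> measure lebesgue T" by (rule measure_mono_fmeasurable) (use Tl T in auto)
    also have "\<dots> \<le> measure lebesgue M' + measure lebesgue (T - M')"
      by (subst (1) TM) (rule measure_Un_le; use M' T in auto)
    finally show "\<mu> \<le> measure lebesgue M + e" using Te M' by simp
  qed
  have 1: "\<mu> \<ge> 0" unfolding \<mu>_def by (rule cInf_greatest[OF ne]) (auto simp: X_def)
  have 4: "negligible S" if "\<mu> = 0" unfolding negligible_outer using 3 that by (metis add_0)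
  show thesis using that[OF 1 2 3 4] by blast
qed

text \<open>By Vitali's theorem almost all of \<open>S\<close> is covered by disjoint intervals on which \<open>f\<close> falls with slope below \<open>- k\<close>
  and, inside these, by disjoint intervals on which it rises with slope above \<open>k\<close>. What the second family leaves of the
  first has small measure, so by absolute continuity it cannot make up for the difference.\<close>

lemma AC_derivates_opposite_negligible:
  fixes f :: "real \<Rightarrow> real"
  assumes ac: "abs_cont_on a b f" and k: "k > 0" and S: "S \<subseteq> {a<..<b}"
    and dec: "\<And>x d. x \<in> S \<Longrightarrow> d > 0 \<Longrightarrow> \<exists>u v. u < v \<and> x \<in> {u..v} \<and> v - u < d \<and> f v - f u < - k * (v - u)"
    and inc: "\<And>x d. x \<in> S \<Longrightarrow> d > 0 \<Longrightarrow> \<exists>u v. u < v \<and> x \<in> {u..v} \<and> v - u < d \<and> f v - f u > k * (v - u)"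
  shows "negligible S"
proof -
  obtain \<mu> where mu: "\<mu> \<ge> 0"
    "\<And>M. M \<in> lmeasurable \<Longrightarrow> negligible (S - M) \<Longrightarrow> \<mu> \<le> measure lebesgue M"
    "\<And>e. e > 0 \<Longrightarrow> \<exists>G. open G \<and> S \<subseteq> G \<and> G \<subseteq> {a<..<b} \<and> G \<in> lmeasurable \<and> measure lebesgue G < \<mu> + e"
    "\<mu> = 0 \<Longrightarrow> negligible S" using outer_open[OF S] by metis
  have "\<mu> = 0"
  proof (rule ccontr)
    assume "\<mu> \<noteq> 0"
    then have mup: "\<mu> > 0" using mu(1) by simp
    define e where "e = k * \<mu> / 2"
    have e: "e > 0" using k mup by (simp add: e_def)
    obtain d where d: "d > 0" "\<And>D. D division_of \<Union>D \<Longrightarrow> \<Union>D \<subseteq> {a..b} \<Longrightarrow> (\<Sum>K\<in>D. measure lborel K) < d \<Longrightarrow>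
       (\<Sum>K\<in>D. norm (f (Sup K) - f (Inf K))) < e"
      using abs_cont_onD[OF ac e] by blast
    \<comment> \<open>The bound \<open>\<mu>/4\<close> keeps the measure of the first family above
      three quarters of \<open>\<mu>\<close>; the bound \<open>d/4\<close> makes what the second
      family leaves of the first, less than \<open>2 * h\<close>, shorter than
      \<open>d\<close>.\<close>
    define h where "h = min (d/4) (\<mu>/4)"
    have h: "h > 0" "3 * h < d" "h \<le> \<mu>/4" using d mup by (auto simp: h_def)
    obtain G where G: "open G" "S \<subseteq> G" "G \<subseteq> {a<..<b}" "G \<in> lmeasurable" "measure lebesgue G < \<mu> + h"
      using mu(3)[OF h(1)] by blast
    have Gab: "G \<subseteq> {a..b}" using G by auto
    obtain C F where C: "negligible (S - \<Union>C)" "\<Union>C \<in> lmeasurable" "\<Union>C \<subseteq> G"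
      and F: "finite F" "F \<subseteq> C" "measure lebesgue (\<Union>C) - h < measure lebesgue (\<Union>F)"
      and FK: "\<And>K. K \<in> F \<Longrightarrow> \<exists>u v. u < v \<and> K = {u..v} \<and> {u..v} \<subseteq> G \<and> f v - f u < - k * (v - u)"
      and Fd: "pairwise disjnt F"
      by (rule Vitali_intervals[of G S a b h "\<lambda>u v. f v - f u < - k * (v - u)"]) (use G Gab h dec in auto)
    have Fdiv: "F division_of \<Union>F" by (rule division_of_disjoint_intervals[OF F(1) Fd]) (use FK in blast)
    have FG: "\<Union>F \<subseteq> G" using FK by blast
    have Fl: "\<Union>F \<in> lmeasurable" using lmeasurable_division[OF Fdiv] .
    have mF: "measure lebesgue (\<Union>F) > \<mu> - h" using mu(2)[OF C(2,1)] F(3) by simp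
    \<comment> \<open>The rising intervals are sought in the open union of the interiors, so that
      each lies in a single falling interval. Only finitely many endpoints of \<open>S\<close> are
      lost.\<close>
    define G' where "G' = (\<Union>K\<in>F. interior K)"
    have G': "open G'" "G' \<subseteq> \<Union>F" using interior_subset by (auto simp: G'_def)
    define P where "P u v \<longleftrightarrow> f v - f u > k * (v - u) \<and> (\<exists>K\<in>F. {u..v} \<subseteq> K)" for u v
    have inc': "\<exists>u v. u < v \<and> x \<in> {u..v} \<and> v - u < d \<and> P u v" if x: "x \<in> S \<inter> G'" and d: "d > 0" for x d
    proof -
      obtain K where K: "K \<in> F" "x \<in> interior K" using x by (auto simp: G'_def)
      obtain g where g: "g > 0" "ball x g \<subseteq> K" using K(2) by (meson mem_interior)
      obtain u v where uv: "u < v" "x \<in> {u..v}" "v - u < min d g" "f v - f u > k * (v - u)"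
        using inc[of x "min d g"] x d g by auto
      have "{u..v} \<subseteq> ball x g" using uv by (auto simp: dist_real_def)
      then have "{u..v} \<subseteq> K" using g by blast
      then have "P u v" unfolding P_def using uv K(1) by blast
      then show ?thesis using uv by (intro exI[of _ u] exI[of _ v]) auto
    qed
    obtain C2 F2 where C2: "negligible (S \<inter> G' - \<Union>C2)" "\<Union>C2 \<in> lmeasurable" "\<Union>C2 \<subseteq> G'"
      and F2: "finite F2" "F2 \<subseteq> C2" "measure lebesgue (\<Union>C2) - h < measure lebesgue (\<Union>F2)"
      and F2K: "\<And>K. K \<in> F2 \<Longrightarrow> \<exists>u v. u < v \<and> K = {u..v} \<and> {u..v} \<subseteq> G' \<and> P u v"
      and F2d: "pairwise disjnt F2"
      by (rule Vitali_intervals[of G' "S \<inter> G'" a b h P]) (use G' FG Gab h inc' in auto)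
    have F2div: "F2 division_of \<Union>F2" by (rule division_of_disjoint_intervals[OF F2(1) F2d]) (use F2K in blast)
    \<comment> \<open>Together with the part of \<open>G\<close> outside the first family, the
      second family still covers \<open>S\<close> almost entirely. As \<open>G\<close> exceeds
      \<open>\<mu>\<close> by less than \<open>h\<close>, the second family must fill the first one
      up to \<open>2 * h\<close>.\<close>
    have "\<mu> \<le> measure lebesgue (\<Union>C2 \<union> (G - \<Union>F))"
    proof (rule mu(2))
      show "\<Union>C2 \<union> (G - \<Union>F) \<in> lmeasurable" using C2 G(4) Fl by (intro fmeasurable.Un fmeasurable.Diff) auto
      have "S - (\<Union>C2 \<union> (G - \<Union>F)) \<subseteq> (S \<inter> G' - \<Union>C2) \<union> (\<Union>K\<in>F. K - interior K)"
        using G(2) by (auto simp: G'_def)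
      moreover have "negligible (\<Union>K\<in>F. K - interior K)"
      proof (rule negligible_Union)
        fix T assume "T \<in> (\<lambda>K. K - interior K) ` F"
        then obtain u v where "T = {u..v} - interior {u..v}" using FK by blast
        then have "T \<subseteq> {u,v}" by auto
        then show "negligible T" by (meson finite.emptyI finite_insert negligible_finite negligible_subset)
      qed (use F in auto)
      ultimately show "negligible (S - (\<Union>C2 \<union> (G - \<Union>F)))" using C2(1) by (meson negligible_Un negligible_subset)
    qed
    also have "\<dots> \<le> measure lebesgue (\<Union>C2) + measure lebesgue (G - \<Union>F)"
      by (rule measure_Un_le) (use C2 G(4) Fl in auto)
    also have "measure lebesgue (G - \<Union>F) = measure lebesgue G - measure lebesgue (\<Union>F)"
      by (rule measurable_measure_Diff) (use G(4) Fl FG in auto)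
    finally have mF2: "measure lebesgue (\<Union>F2) > measure lebesgue (\<Union>F) - 2 * h" using F2(3) G(5) by linarith
    \<comment> \<open>Each falling interval is divided completely, starting from the rising
      intervals inside it. Its increment then splits into nonnegative terms and terms from the short
      leftover \<open>R\<close>.\<close>
    have "\<exists>r. {K'\<in>F2. K' \<subseteq> K} \<subseteq> r \<and> r division_of K" if K: "K \<in> F" for K
    proof -
      have "{K'\<in>F2. K' \<subseteq> K} division_of \<Union>{K'\<in>F2. K' \<subseteq> K}"
        by (rule division_of_subset[OF F2div]) auto
      moreover obtain u v where "K = cbox u v" using division_ofD(4)[OF Fdiv K] by blast
      ultimately show ?thesis using partial_division_extend_interval[of "{K'\<in>F2. K' \<subseteq> K}" u v] by (metis (no_types, lifting) Sup_le_iff mem_Collect_eq)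
    qed
    then obtain r where r: "\<And>K. K \<in> F \<Longrightarrow> {K'\<in>F2. K' \<subseteq> K} \<subseteq> r K" "\<And>K. K \<in> F \<Longrightarrow> r K division_of K" by metis
    have rin: "L \<subseteq> K" "L \<noteq> {}" if "K \<in> F" "L \<in> r K" for K L using division_ofD(2,3)[OF r(2)[OF that(1)] that(2)] by auto
    have rdisj: "r K \<inter> r K' = {}" if "K \<in> F" "K' \<in> F" "K \<noteq> K'" for K K'
    proof -
      have KK: "K \<inter> K' = {}" using Fd that by (auto simp: pairwise_def disjnt_def)
      have False if L: "L \<in> r K" "L \<in> r K'" for L
        using rin(1)[OF \<open>K \<in> F\<close> L(1)] rin(1)[OF \<open>K' \<in> F\<close> L(2)] rin(2)[OF \<open>K \<in> F\<close> L(1)] KK by auto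
      then show ?thesis by blast
    qed
    have fr: "finite (r K)" if "K \<in> F" for K using division_ofD(1)[OF r(2)[OF that]] .
    have rd1: "\<forall>i\<in>F. \<forall>j\<in>F. i \<noteq> j \<longrightarrow> (r i \<inter> F2) \<inter> (r j \<inter> F2) = {}"
      and rd2: "\<forall>i\<in>F. \<forall>j\<in>F. i \<noteq> j \<longrightarrow> (r i - F2) \<inter> (r j - F2) = {}" using rdisj by blast+
    define R where "R = (\<Union>K\<in>F. r K - F2)"
    have F2eq: "(\<Union>K\<in>F. r K \<inter> F2) = F2"
    proof
      show "F2 \<subseteq> (\<Union>K\<in>F. r K \<inter> F2)"
      proof
        fix L assume L: "L \<in> F2"
        then obtain K where "K \<in> F" "L \<subseteq> K" using F2K[OF L] unfolding P_def by blast
        then show "L \<in> (\<Union>K\<in>F. r K \<inter> F2)" using r(1) L by blast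
      qed
    qed auto
    have split: "(\<Sum>K\<in>F. \<Sum>L\<in>r K. g L) = (\<Sum>L\<in>F2. g L) + (\<Sum>L\<in>R. g L)" for g :: "real set \<Rightarrow> real"
    proof -
      have "(\<Sum>K\<in>F. \<Sum>L\<in>r K. g L) = (\<Sum>K\<in>F. (\<Sum>L\<in>r K \<inter> F2. g L) + (\<Sum>L\<in>r K - F2. g L))"
        using fr by (intro sum.cong[OF refl]) (metis sum.Int_Diff)
      also have "\<dots> = (\<Sum>K\<in>F. \<Sum>L\<in>r K \<inter> F2. g L) + (\<Sum>K\<in>F. \<Sum>L\<in>r K - F2. g L)" by (rule sum.distrib)
      also have "(\<Sum>K\<in>F. \<Sum>L\<in>r K \<inter> F2. g L) = (\<Sum>L\<in>(\<Union>K\<in>F. r K \<inter> F2). g L)"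
        using F(1) fr rd1 by (intro sum.UNION_disjoint[symmetric]) simp_all
      also have "(\<Sum>K\<in>F. \<Sum>L\<in>r K - F2. g L) = (\<Sum>L\<in>R. g L)"
        unfolding R_def using F(1) fr rd2 by (intro sum.UNION_disjoint[symmetric]) simp_all
      finally show ?thesis unfolding F2eq .
    qed
    have Rdiv: "R division_of \<Union>R"
    proof (rule division_ofI)
      show "finite R" unfolding R_def using F fr by auto
      fix L assume "L \<in> R"
      then obtain K where K: "K \<in> F" "L \<in> r K" by (auto simp: R_def)
      show "L \<noteq> {}" using rin K by blast
      show "\<exists>a b. L = cbox a b" using division_ofD(4)[OF r(2)[OF K(1)] K(2)] .
    next
      fix L1 L2 assume L: "L1 \<in> R" "L2 \<in> R" "L1 \<noteq> L2"
      then obtain K1 K2 where K: "K1 \<in> F" "L1 \<in> r K1" "K2 \<in> F" "L2 \<in> r K2" by (auto simp: R_def)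
      show "interior L1 \<inter> interior L2 = {}"
      proof (cases "K1 = K2")
        case True then show ?thesis using division_ofD(5)[OF r(2)[OF K(1)]] K L by blast
      next
        case False
        then have "K1 \<inter> K2 = {}" using Fd K by (auto simp: pairwise_def disjnt_def)
        then have "L1 \<inter> L2 = {}" using rin K by blast
        then show ?thesis using interior_subset by blast
      qed
    qed auto
    have Rsub: "\<Union>R \<subseteq> {a..b}" using rin FG Gab unfolding R_def by blast
    have "(\<Sum>K\<in>F. measure lborel K) = (\<Sum>K\<in>F. \<Sum>L\<in>r K. measure lborel L)"
    proof (rule sum.cong[OF refl])
      fix K assume K: "K \<in> F"
      then obtain u v where "K = cbox u v" using division_ofD(4)[OF Fdiv K] by blast
      then show "measure lborel K = (\<Sum>L\<in>r K. measure lborel L)" using additive_content_division r(2)[OF K] by metis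
    qed
    then have "(\<Sum>L\<in>R. measure lborel L) = measure lebesgue (\<Union>F) - measure lebesgue (\<Union>F2)"
      using split[of "measure lborel"] division_measure[OF Fdiv] division_measure[OF F2div] by simp
    then have "(\<Sum>L\<in>R. measure lborel L) < d" using mF2 h by linarith
    then have small: "(\<Sum>L\<in>R. norm (f (Sup L) - f (Inf L))) < e" using d(2)[OF Rdiv Rsub] by blast
    have "(\<Sum>K\<in>F. f (Sup K) - f (Inf K)) = (\<Sum>K\<in>F. \<Sum>L\<in>r K. f (Sup L) - f (Inf L))"
    proof (rule sum.cong[OF refl])
      fix K assume K: "K \<in> F"
      then obtain u v where uv: "K = {u..v}" "u < v" using FK by blast
      then show "f (Sup K) - f (Inf K) = (\<Sum>L\<in>r K. f (Sup L) - f (Inf L))"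
        using division_increment[of "r K" u v f] r(2)[OF K] by simp
    qed
    also have "\<dots> = (\<Sum>L\<in>F2. f (Sup L) - f (Inf L)) + (\<Sum>L\<in>R. f (Sup L) - f (Inf L))" by (rule split)
    also have "\<dots> \<ge> 0 - (\<Sum>L\<in>R. norm (f (Sup L) - f (Inf L)))"
    proof -
      have "(\<Sum>L\<in>F2. f (Sup L) - f (Inf L)) \<ge> 0"
      proof (rule sum_nonneg)
        fix L assume "L \<in> F2"
        then obtain u v where uv: "u < v" "L = {u..v}" "P u v" using F2K by blast
        have "0 \<le> k * (v - u)" using k uv by simp
        then show "0 \<le> f (Sup L) - f (Inf L)" using uv by (simp add: P_def)
      qed
      moreover have "(\<Sum>L\<in>R. f (Sup L) - f (Inf L)) \<ge> - (\<Sum>L\<in>R. norm (f (Sup L) - f (Inf L)))"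
        unfolding sum_negf[symmetric] by (rule sum_mono) (simp add: abs_ge_minus_self minus_le_iff)
      ultimately show ?thesis by linarith
    qed
    finally have low: "(\<Sum>K\<in>F. f (Sup K) - f (Inf K)) > - e" using small by linarith
    have "(\<Sum>K\<in>F. f (Sup K) - f (Inf K)) \<le> (\<Sum>K\<in>F. - k * measure lborel K)"
    proof (rule sum_mono)
      fix K assume "K \<in> F"
      then obtain u v where uv: "u < v" "K = {u..v}" "f v - f u < - k * (v - u)" using FK by blast
      then show "f (Sup K) - f (Inf K) \<le> - k * measure lborel K" by simp
    qed
    also have "\<dots> = - k * measure lebesgue (\<Union>F)" using division_measure[OF Fdiv] by (simp add: sum_distrib_left[symmetric] sum_negf)
    also have "\<dots> \<le> - k * (3 * \<mu> / 4)" using k mF h by (simp add: )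
    finally have "k * (3 * \<mu> / 4) < k * \<mu> / 2" using low unfolding e_def by linarith
    moreover have "k * \<mu> > 0" using k mup by simp
    ultimately show False by linarith
  qed
  then show ?thesis by (rule mu(4))
qed

text \<open>Weights below \<open>h\<close> cannot jump over the range from \<open>h\<close> to
  \<open>2 * h\<close> when added one at a time.\<close>

lemma finite_subset_sum_between:
  fixes w :: "'b \<Rightarrow> real"
  assumes "finite F" "\<And>k. k \<in> F \<Longrightarrow> 0 \<le> w k \<and> w k < h" "sum w F \<ge> h" "h > 0"
  shows "\<exists>F'\<subseteq>F. h \<le> sum w F' \<and> sum w F' < 2 * h"
  using assms
proof (induction F rule: finite_induct)
  case empty
  then show ?case by (intro exI[of _ "{}"]) auto
next
  case (insert x F)
  show ?case
  proof (cases "sum w F \<ge> h")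
    case True
    then show ?thesis using insert by (meson insertCI subset_insertI2)
  next
    case False
    then have "sum w (insert x F) < 2 * h" using insert.hyps insert.prems(1)[of x] by simp
    then show ?thesis using insert by blast
  qed
qed

text \<open>If the set had positive outer measure, disjoint intervals of slope above
  \<open>1/h\<close> could be selected with total length between \<open>h\<close> and
  \<open>2 * h\<close>: short enough for absolute continuity to keep the sum of increments below 1,
  yet long enough to force it to be at least 1.\<close>

lemma AC_derivates_infinite_negligible:
  fixes f :: "real \<Rightarrow> real"
  assumes ac: "abs_cont_on a b f" and S: "S \<subseteq> {a<..<b}"
    and inf: "\<And>x d K. x \<in> S \<Longrightarrow> d > 0 \<Longrightarrow> \<exists>u v. u < v \<and> x \<in> {u..v} \<and> v - u < d \<and> norm (f v - f u) > K * (v - u)"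
  shows "negligible S"
proof -
  obtain \<mu> where mu: "\<mu> \<ge> 0"
    "\<And>M. M \<in> lmeasurable \<Longrightarrow> negligible (S - M) \<Longrightarrow> \<mu> \<le> measure lebesgue M"
    "\<And>e. e > 0 \<Longrightarrow> \<exists>G. open G \<and> S \<subseteq> G \<and> G \<subseteq> {a<..<b} \<and> G \<in> lmeasurable \<and> measure lebesgue G < \<mu> + e"
    "\<mu> = 0 \<Longrightarrow> negligible S" using outer_open[OF S] by metis
  have "\<mu> = 0"
  proof (rule ccontr)
    assume "\<mu> \<noteq> 0"
    then have mup: "\<mu> > 0" using mu(1) by simp
    obtain d where d: "d > 0" "\<And>D. D division_of \<Union>D \<Longrightarrow> \<Union>D \<subseteq> {a..b} \<Longrightarrow> (\<Sum>K\<in>D. measure lborel K) < d \<Longrightarrow>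
       (\<Sum>K\<in>D. norm (f (Sup K) - f (Inf K))) < 1"
      using abs_cont_onD[OF ac zero_less_one] by blast
    define h where "h = min (d/2) (\<mu>/2)"
    have h: "h > 0" "2 * h \<le> d" "h \<le> \<mu>/2" using d mup by (auto simp: h_def)
    define P where "P u v \<longleftrightarrow> norm (f v - f u) > (1/h) * (v - u) \<and> v - u < h" for u v
    have Pex: "\<exists>u v. u < v \<and> x \<in> {u..v} \<and> v - u < d \<and> P u v" if "x \<in> S" "d > 0" for x d
      using inf[of x "min d h" "1/h"] that h unfolding P_def by auto
    obtain C F where C: "negligible (S - \<Union>C)" "\<Union>C \<in> lmeasurable" "\<Union>C \<subseteq> {a<..<b}"
      and F: "finite F" "F \<subseteq> C" "measure lebesgue (\<Union>C) - h < measure lebesgue (\<Union>F)"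
      and FK: "\<And>K. K \<in> F \<Longrightarrow> \<exists>u v. u < v \<and> K = {u..v} \<and> {u..v} \<subseteq> {a<..<b} \<and> P u v"
      and Fd: "pairwise disjnt F"
      by (rule Vitali_intervals[of "{a<..<b}" S a b h P]) (use S h Pex in auto)
    have Fdiv: "F division_of \<Union>F" by (rule division_of_disjoint_intervals[OF F(1) Fd]) (use FK in blast)
    have "measure lebesgue (\<Union>F) \<ge> h" using mu(2)[OF C(2,1)] F(3) h by linarith
    then have "(\<Sum>K\<in>F. measure lborel K) \<ge> h" using division_measure[OF Fdiv] by simp
    moreover have "0 \<le> measure lborel K \<and> measure lborel K < h" if "K \<in> F" for K
      using FK[OF that] by (auto simp: P_def)
    ultimately obtain F' where F': "F' \<subseteq> F" "h \<le> (\<Sum>K\<in>F'. measure lborel K)" "(\<Sum>K\<in>F'. measure lborel K) < 2 * h"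
      using finite_subset_sum_between[OF F(1), of "measure lborel" h] h(1) by blast
    have F'div: "F' division_of \<Union>F'" using division_of_subset[OF Fdiv F'(1)] .
    have "\<Union>F' \<subseteq> {a..b}"
    proof
      fix x assume "x \<in> \<Union>F'"
      then obtain K where K: "K \<in> F" "x \<in> K" using F' by blast
      have "K \<subseteq> {a<..<b}" using FK[OF K(1)] by blast
      then show "x \<in> {a..b}" using K by auto
    qed
    then have less1: "(\<Sum>K\<in>F'. norm (f (Sup K) - f (Inf K))) < 1" using d(2)[OF F'div] F'(3) h by linarith
    have "(1/h) * h \<le> (1/h) * (\<Sum>K\<in>F'. measure lborel K)" using F'(2) h by (intro mult_left_mono) auto
    also have "\<dots> = (\<Sum>K\<in>F'. (1/h) * measure lborel K)" by (simp add: sum_distrib_left)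
    also have "\<dots> \<le> (\<Sum>K\<in>F'. norm (f (Sup K) - f (Inf K)))"
    proof (rule sum_mono)
      fix K assume "K \<in> F'"
      then obtain u v where "u < v" "K = {u..v}" "P u v" using FK F'(1) by blast
      then show "1 / h * measure lborel K \<le> norm (f (Sup K) - f (Inf K))" by (simp add: P_def)
    qed
    finally have "(1/h) * h \<le> (\<Sum>K\<in>F'. norm (f (Sup K) - f (Inf K)))" .
    then have "(1/h) * h < 1" using less1 by (rule le_less_trans)
    then show False using h(1) by simp
  qed
  then show ?thesis by (rule mu(4))
qed

text \<open>Derivates are taken over all small intervals containing \<open>x\<close>, not only those
  with endpoint \<open>x\<close>; this matches Vitali coverings. \<open>Lo p\<close> and
  \<open>Hi q\<close> with rational \<open>p < q\<close> say that slopes below \<open>p\<close> and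
  above \<open>q\<close> both occur at every scale.\<close>

lemma AC_real_differentiable_ae:
  fixes f :: "real \<Rightarrow> real"
  assumes ac: "abs_cont_on a b f"
  shows "negligible {x\<in>{a..b}. \<not> f differentiable (at x)}"
proof -
  define Lo where "Lo p = {x\<in>{a<..<b}. \<forall>d>0. \<exists>u v. u < v \<and> x \<in> {u..v} \<and> v - u < d \<and> f v - f u < p * (v - u)}" for p
  define Hi where "Hi p = {x\<in>{a<..<b}. \<forall>d>0. \<exists>u v. u < v \<and> x \<in> {u..v} \<and> v - u < d \<and> f v - f u > p * (v - u)}" for p
  define Sinf where "Sinf = {x\<in>{a<..<b}. \<forall>K. \<forall>d>0. \<exists>u v. u < v \<and> x \<in> {u..v} \<and> v - u < d \<and> norm (f v - f u) > K * (v - u)}"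
  have n1: "negligible (Lo p \<inter> Hi q)" if pq: "p < q" for p q
  proof -
    \<comment> \<open>Subtracting the linear function of mean slope \<open>m\<close> turns the two
      slopes into \<open>- k\<close> and \<open>k\<close>, the symmetric situation treated
      above.\<close>
    define m where "m = (p + q) / 2"
    define k where "k = (q - p) / 2"
    have mk: "p = m - k" "q = m + k" "k > 0" using pq by (auto simp: m_def k_def field_simps)
    have "abs_cont_on a b (\<lambda>x. m * x)"
      by (rule abs_cont_on_lipschitz[where A="\<bar>m\<bar>"]) (simp add: right_diff_distrib[symmetric] abs_mult)
    then have "abs_cont_on a b (\<lambda>x. f x - m * x)" using abs_cont_on_diff[OF ac] by blast
    then show ?thesis
    proof (rule AC_derivates_opposite_negligible[OF _ mk(3)])
      fix x d :: real assume "x \<in> Lo p \<inter> Hi q" "d > 0"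
      then obtain u v u' v' where 1: "u < v \<and> x \<in> {u..v} \<and> v - u < d \<and> f v - f u < p * (v - u)"
        and 2: "u' < v' \<and> x \<in> {u'..v'} \<and> v' - u' < d \<and> f v' - f u' > q * (v' - u')"
        unfolding Lo_def Hi_def by blast
      show "\<exists>u v. u < v \<and> x \<in> {u..v} \<and> v - u < d \<and> f v - m * v - (f u - m * u) < - k * (v - u)"
        using 1 mk(1) by (intro exI[of _ u] exI[of _ v]) (auto simp: algebra_simps)
      show "\<exists>u v. u < v \<and> x \<in> {u..v} \<and> v - u < d \<and> f v - m * v - (f u - m * u) > k * (v - u)"
        using 2 mk(2) by (intro exI[of _ u'] exI[of _ v']) (auto simp: algebra_simps)
    qed (auto simp: Lo_def)
  qed
  have n2: "negligible Sinf"
    by (rule AC_derivates_infinite_negligible[OF ac]) (auto simp: Sinf_def)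
  define I where "I = {(p,q). p \<in> \<rat> \<and> q \<in> \<rat> \<and> p < (q::real)}"
  define N where "N = (\<Union>(p,q)\<in>I. Lo p \<inter> Hi q) \<union> Sinf \<union> {a,b}"
  have "I \<subseteq> \<rat> \<times> \<rat>" by (auto simp: I_def)
  then have "countable I" by (rule countable_subset) (auto intro: countable_rat)
  then have "negligible (\<Union>(p,q)\<in>I. Lo p \<inter> Hi q)"
    by (intro negligible_countable_Union countable_image) (auto simp: I_def n1)
  then have "negligible N" unfolding N_def using n2 by (intro negligible_Un) auto
  moreover have "{x\<in>{a..b}. \<not> f differentiable (at x)} \<subseteq> N"
  proof (rule subsetI, rule ccontr)
    fix x assume x: "x \<in> {x\<in>{a..b}. \<not> f differentiable (at x)}" and xN: "x \<notin> N"
    have xab: "x \<in> {a<..<b}" using x xN by (auto simp: N_def)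
    have alt: "x \<notin> Lo p \<or> x \<notin> Hi q" if "p \<in> \<rat>" "q \<in> \<rat>" "p < q" for p q
      using xN that unfolding N_def I_def by blast
    have "x \<notin> Sinf" using xN by (auto simp: N_def)
    then obtain K where "\<not> (\<forall>d>0. \<exists>u v. u < v \<and> x \<in> {u..v} \<and> v - u < d \<and> norm (f v - f u) > K * (v - u))"
      using xab unfolding Sinf_def by blast
    then have "\<exists>d0>0. \<forall>u v. u < v \<longrightarrow> x \<in> {u..v} \<longrightarrow> v - u < d0 \<longrightarrow> norm (f v - f u) \<le> K * (v - u)"
      by (meson not_le)
    then obtain d0 where Kd: "d0 > 0" and K: "\<And>u v. u < v \<Longrightarrow> x \<in> {u..v} \<Longrightarrow> v - u < d0 \<Longrightarrow> norm (f v - f u) \<le> K * (v - u)"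
      by blast
    define A where "A = {p. \<exists>d>0. \<forall>u v. u < v \<and> x \<in> {u..v} \<and> v - u < d \<longrightarrow> f v - f u \<ge> p * (v - u)}"
    have "- K \<in> A" unfolding A_def
    proof (safe intro!: exI[of _ d0] Kd)
      fix u v assume "u < v" "x \<in> {u..v}" "v - u < d0"
      from K[OF this] show "- K * (v - u) \<le> f v - f u" by (simp add: abs_le_iff)
    qed
    then have Ane: "A \<noteq> {}" by blast
    have Ab: "p \<le> K" if p: "p \<in> A" for p
    proof -
      obtain d where d: "d > 0" "\<And>u v. u < v \<Longrightarrow> x \<in> {u..v} \<Longrightarrow> v - u < d \<Longrightarrow> f v - f u \<ge> p * (v - u)"
        using p unfolding A_def by auto
      define s where "s = min d d0 / 2"
      have s: "s > 0" "s < d" "s < d0" using d Kd by (auto simp: s_def)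
      have "p * s \<le> f (x + s) - f x" using d(2)[of x "x + s"] s by simp
      also have "\<dots> \<le> K * s" using K[of x "x + s"] s by (simp add: abs_le_iff)
      finally show ?thesis using s by simp
    qed
    have bdd: "bdd_above A" using Ab by (rule bdd_aboveI)
    \<comment> \<open>\<open>L\<close> is the lower derivate at \<open>x\<close>. It is finite
      because \<open>x\<close> avoids \<open>Sinf\<close>, and it turns out to be the
      derivative.\<close>
    define L where "L = Sup A"
    have key: "\<exists>d>0. \<forall>u v. u < v \<and> x \<in> {u..v} \<and> v - u < d \<longrightarrow> \<bar>f v - f u - L * (v - u)\<bar> \<le> e * (v - u)" if e: "e > 0" for e
    proof -
      obtain p where p: "p \<in> A" "p > L - e"
        using less_cSupE[OF _ Ane, of "L - e"] e unfolding L_def by auto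
      obtain d1 where d1: "d1 > 0" "\<And>u v. u < v \<Longrightarrow> x \<in> {u..v} \<Longrightarrow> v - u < d1 \<Longrightarrow> f v - f u \<ge> p * (v - u)"
        using p(1) unfolding A_def by auto
      \<comment> \<open>Two rationals just above \<open>L\<close>: the first is too large for
        \<open>A\<close>, which puts \<open>x\<close> into \<open>Lo p1\<close>; since
        \<open>x\<close> avoids all the exceptional pairs, it is not in \<open>Hi q1\<close>, and
        this bounds the slopes from above.\<close>
      obtain p1 where p1: "p1 \<in> \<rat>" "L < p1" "p1 < L + e" using Rats_dense_in_real[of L "L+e"] e by auto
      obtain q1 where q1: "q1 \<in> \<rat>" "p1 < q1" "q1 < L + e" using Rats_dense_in_real[of p1 "L+e"] p1 by auto
      have "p1 \<notin> A" using cSup_upper[OF _ bdd, of p1] p1 unfolding L_def by auto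
      then have "x \<in> Lo p1" unfolding A_def Lo_def using xab by (auto simp: not_le)
      then have "x \<notin> Hi q1" using alt p1 q1 by blast
      then have "\<exists>d2>0. \<forall>u v. u < v \<longrightarrow> x \<in> {u..v} \<longrightarrow> v - u < d2 \<longrightarrow> f v - f u \<le> q1 * (v - u)"
        using xab unfolding Hi_def mem_Collect_eq by (meson not_le)
      then obtain d2 where d2: "d2 > 0" "\<And>u v. u < v \<Longrightarrow> x \<in> {u..v} \<Longrightarrow> v - u < d2 \<Longrightarrow> f v - f u \<le> q1 * (v - u)"
        by blast
      show ?thesis
      proof (intro exI[of _ "min d1 d2"] conjI allI impI)
        fix u v assume uv: "u < v \<and> x \<in> {u..v} \<and> v - u < min d1 d2"
        have "p * (v - u) \<le> f v - f u" "f v - f u \<le> q1 * (v - u)" using d1(2)[of u v] d2(2)[of u v] uv by auto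
        moreover have "(L - e) * (v - u) \<le> p * (v - u)" "q1 * (v - u) \<le> (L + e) * (v - u)"
          using uv p q1 by (auto intro!: mult_right_mono)
        ultimately show "\<bar>f v - f u - L * (v - u)\<bar> \<le> e * (v - u)"
          by (simp add: abs_le_iff algebra_simps)
      qed (use d1 d2 in auto)
    qed
    have "(f has_derivative (\<lambda>h. h * L)) (at x)"
      unfolding has_derivative_within_alt
    proof (intro conjI allI impI)
      show "bounded_linear (\<lambda>h. h * L)" by (rule bounded_linear_mult_left)
      fix e :: real assume "e > 0"
      then obtain d where d: "d > 0" "\<And>u v. u < v \<Longrightarrow> x \<in> {u..v} \<Longrightarrow> v - u < d \<Longrightarrow> \<bar>f v - f u - L * (v - u)\<bar> \<le> e * (v - u)"
        using key by meson
      show "\<exists>d>0. \<forall>y\<in>UNIV. norm (y - x) < d \<longrightarrow> norm (f y - f x - (y - x) * L) \<le> e * norm (y - x)"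
      proof (intro exI[of _ d] conjI ballI impI d(1))
        fix y assume y: "norm (y - x) < d"
        consider "y < x" | "y = x" | "x < y" by linarith
        then show "norm (f y - f x - (y - x) * L) \<le> e * norm (y - x)"
        proof cases
          case 1
          have "\<bar>f x - f y - L * (x - y)\<bar> \<le> e * (x - y)" using d(2)[of y x] 1 y by simp
          then show ?thesis using 1 by (simp add: abs_le_iff algebra_simps)
        next
          case 3
          have "\<bar>f y - f x - L * (y - x)\<bar> \<le> e * (y - x)" using d(2)[of x y] 3 y by simp
          then show ?thesis using 3 by (simp add: abs_le_iff algebra_simps)
        qed simp
      qed
    qed
    then show False using x by (auto simp: differentiable_def)
  qed
  ultimately show ?thesis by (rule negligible_subset)
qed

lemma AC_differentiable_ae:
  fixes f :: "real \<Rightarrow> 'a::euclidean_space"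
  assumes ac: "abs_cont_on a b f"
  shows "negligible {x\<in>{a..b}. \<not> f differentiable (at x)}"
proof -
  have "{x\<in>{a..b}. \<not> f differentiable (at x)} \<subseteq> (\<Union>i\<in>Basis. {x\<in>{a..b}. \<not> (\<lambda>x. f x \<bullet> i) differentiable (at x)})"
    using differentiable_componentwise_within[of f _ UNIV] by auto
  moreover have "negligible (\<Union>i\<in>(Basis::'a set). {x\<in>{a..b}. \<not> (\<lambda>x. f x \<bullet> i) differentiable (at x)})"
  proof (rule negligible_Union)
    fix T assume "T \<in> (\<lambda>i::'a. {x\<in>{a..b}. \<not> (\<lambda>x. f x \<bullet> i) differentiable (at x)}) ` Basis"
    then obtain i :: 'a where i: "i \<in> Basis" "T = {x\<in>{a..b}. \<not> (\<lambda>x. f x \<bullet> i) differentiable (at x)}" by blast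
    have "abs_cont_on a b (\<lambda>x. f x \<bullet> i)"
      by (rule abs_cont_on_dominated[OF ac ac, of _ 1 0])
        (use i in \<open>simp add: inner_diff_left[symmetric] Basis_le_norm\<close>)
    then show "negligible T" using AC_real_differentiable_ae i by blast
  qed auto
  ultimately show ?thesis using negligible_subset by blast
qed

section \<open>Functions with an absolutely continuous derivative\<close>

lemma AE_lebesgue_on_iff:
  assumes "S \<in> sets lebesgue"
  shows "(AE x in lebesgue_on S. P x) \<longleftrightarrow> negligible {x\<in>S. \<not> P x}"
proof -
  have "(AE x in lebesgue_on S. P x) \<longleftrightarrow> (AE x in lebesgue. x \<in> S \<longrightarrow> P x)"
    using assms by (simp add: AE_restrict_space_iff)
  also have "\<dots> \<longleftrightarrow> (\<exists>N. negligible N \<and> {x\<in>S. \<not> P x} \<subseteq> N)"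
    unfolding eventually_ae_filter negligible_iff_null_sets by (auto simp: Bex_def)
  also have "\<dots> \<longleftrightarrow> negligible {x\<in>S. \<not> P x}"
    using negligible_subset by blast
  finally show ?thesis .
qed

lemma absolutely_integrable_continuous_mult:
  fixes u g :: "real \<Rightarrow> 'a::{euclidean_space,real_normed_field}"
  assumes "continuous_on {a..b} u" "g absolutely_integrable_on {a..b}"
  shows "(\<lambda>x. u x * g x) absolutely_integrable_on {a..b}"
proof (rule absolutely_integrable_bounded_measurable_product[OF bilinear_times _ _ _ assms(2)])
  show "u \<in> borel_measurable (lebesgue_on {a..b})"
    by (rule continuous_imp_measurable_on_sets_lebesgue[OF assms(1)]) simp
  show "bounded (u ` {a..b})"
    using compact_continuous_image[OF assms(1) compact_Icc] by (rule compact_imp_bounded)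
qed simp

text \<open>Uniform integrability: up to an error \<open>e\<close> in the integral,
  \<open>norm (g x)\<close> is bounded by \<open>n\<close>.\<close>

lemma integral_tail_small:
  fixes g :: "real \<Rightarrow> 'a::euclidean_space"
  assumes g: "g absolutely_integrable_on {a..b}" and e: "e > 0"
  obtains n :: nat where "(\<lambda>x. max 0 (norm (g x) - real n)) integrable_on {a..b}"
    "integral {a..b} (\<lambda>x. max 0 (norm (g x) - real n)) < e"
proof -
  define h where "h n x = max 0 (norm (g x) - real n)" for n x
  have ng: "(\<lambda>x. norm (g x)) absolutely_integrable_on {a..b}" using g by (rule set_integrable_norm)
  have hi: "h n integrable_on {a..b}" for n
  proof -
    have "(\<lambda>x. norm (g x) - real n) absolutely_integrable_on {a..b}"
      using set_integral_diff(1)[OF ng, of "\<lambda>x. real n"] by simp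
    then have "h n absolutely_integrable_on {a..b}"
      unfolding h_def by (intro absolutely_integrable_max_1) auto
    then show ?thesis by (rule absolutely_integrable_on_def[THEN iffD1, THEN conjunct1])
  qed
  have lim: "(\<lambda>n. h n x) \<longlonglongrightarrow> 0" for x
  proof -
    obtain m :: nat where m: "norm (g x) \<le> real m" using real_arch_simple by blast
    have "eventually (\<lambda>n. h n x = 0) sequentially"
      using eventually_ge_at_top[of m] by eventually_elim (use m in \<open>auto simp: h_def\<close>)
    then show ?thesis by (rule tendsto_eventually)
  qed
  have "(\<lambda>n. integral {a..b} (h n)) \<longlonglongrightarrow> integral {a..b} (\<lambda>x. 0)"
    by (rule dominated_convergence(2)[OF hi _ _ lim, of "\<lambda>x. norm (g x)"])
      (use ng in \<open>auto simp: h_def absolutely_integrable_on_def\<close>)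
  then have "eventually (\<lambda>n. integral {a..b} (h n) < e) sequentially"
    using e by (auto intro: order_tendstoD)
  then obtain n where "integral {a..b} (h n) < e" by (auto simp: eventually_sequentially)
  then show thesis using that[of n] hi[of n] unfolding h_def by blast
qed

text \<open>Over intervals of total length \<open>d\<close> the integral of the norm is at most the
  excess over \<open>n\<close>, which is small everywhere, plus \<open>n * d\<close>.\<close>

lemma abs_cont_on_indefinite_integral:
  fixes g :: "real \<Rightarrow> 'a::euclidean_space"
  assumes g: "g absolutely_integrable_on {a..b}"
    and F: "\<And>u v. a \<le> u \<Longrightarrow> u \<le> v \<Longrightarrow> v \<le> b \<Longrightarrow> (g has_integral (F v - F u)) {u..v}"
  shows "abs_cont_on a b F"
  unfolding abs_cont_on_def
proof (intro allI impI)
  fix e :: real assume e: "e > 0"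
  obtain n :: nat where n: "(\<lambda>x. max 0 (norm (g x) - real n)) integrable_on {a..b}"
    "integral {a..b} (\<lambda>x. max 0 (norm (g x) - real n)) < e/2"
    using integral_tail_small[OF g half_gt_zero[OF e]] by blast
  define h where "h x = max 0 (norm (g x) - real n)" for x
  show "\<exists>d>0. \<forall>D. D division_of \<Union>D \<and> \<Union>D \<subseteq> {a..b} \<and> (\<Sum>K\<in>D. Sup K - Inf K) < d \<longrightarrow>
       (\<Sum>K\<in>D. norm (F (Sup K) - F (Inf K))) < e"
  proof (intro exI[of _ "e / (2 * (real n + 1))"] conjI allI impI)
    fix D assume D: "D division_of \<Union>D \<and> \<Union>D \<subseteq> {a..b} \<and> (\<Sum>K\<in>D. Sup K - Inf K) < e / (2 * (real n + 1))"
    have "norm (F (Sup K) - F (Inf K)) \<le> integral K h + real n * (Sup K - Inf K)" if KD: "K \<in> D" for K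
    proof -
      obtain u v where uv: "K = {u..v}" "u \<le> v"
        using division_memE_real[OF conjunct1[OF D] KD] by blast
      have "K \<subseteq> {a..b}" using D KD by auto
      then have uvab: "a \<le> u" "v \<le> b" using uv by auto
      have gi: "g absolutely_integrable_on {u..v}" using g by (rule absolutely_integrable_on_subinterval) (use uvab in auto)
      have hi: "h integrable_on {u..v}" using n(1) unfolding h_def[symmetric]
        by (rule integrable_on_subinterval) (use uvab in auto)
      have "F v - F u = integral {u..v} g" using F[OF uvab(1) uv(2) uvab(2)] by (simp add: integral_unique)
      also have "norm \<dots> \<le> integral {u..v} (\<lambda>x. h x + real n)"
      proof (rule integral_norm_bound_integral)
        show "norm (g x) \<le> h x + real n" for x by (simp add: h_def)
      qed (use gi hi in \<open>auto simp: absolutely_integrable_on_def intro!: integrable_add\<close>)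
      also have "\<dots> = integral {u..v} h + real n * (v - u)"
        using hi uv by (subst Henstock_Kurzweil_Integration.integral_add) auto
      finally show ?thesis using uv by simp
    qed
    then have "(\<Sum>K\<in>D. norm (F (Sup K) - F (Inf K))) \<le> (\<Sum>K\<in>D. integral K h + real n * (Sup K - Inf K))"
      by (rule sum_mono)
    also have "\<dots> = (\<Sum>K\<in>D. integral K h) + real n * (\<Sum>K\<in>D. Sup K - Inf K)"
      by (simp add: sum.distrib sum_distrib_left)
    also have "(\<Sum>K\<in>D. integral K h) \<le> integral {a..b} h"
    proof -
      have hD: "h integrable_on \<Union>D" using integrable_on_subdivision[OF conjunct1[OF D], of h "{a..b}"] n(1) D
        unfolding h_def[symmetric] by blast
      then have "(\<Sum>K\<in>D. integral K h) = integral (\<Union>D) h"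
        using integral_combine_division_topdown D by metis
      also have "\<dots> \<le> integral {a..b} h"
        by (rule integral_subset_le) (use D n hD in \<open>auto simp: h_def[symmetric]\<close>, simp add: h_def)
      finally show ?thesis .
    qed
    also have "integral {a..b} h < e/2" using n(2) unfolding h_def[symmetric] .
    also have "real n * (\<Sum>K\<in>D. Sup K - Inf K) \<le> real n * (e / (2 * (real n + 1)))"
      using D by (intro mult_left_mono) auto
    also have "\<dots> \<le> e/2" using e by (simp add: field_simps)
    finally show "(\<Sum>K\<in>D. norm (F (Sup K) - F (Inf K))) < e" by simp
  qed (use e in auto)
qed

text \<open>Differentiability almost everywhere comes from absolute continuity. It remains to
  identify the derivative, and for that the averages over intervals to the right of \<open>x\<close>
  suffice.\<close>

lemma indefinite_integral_derivative_ae: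
  fixes g :: "real \<Rightarrow> 'a::euclidean_space"
  assumes g: "g absolutely_integrable_on {a..b}"
    and F: "\<And>u v. a \<le> u \<Longrightarrow> u \<le> v \<Longrightarrow> v \<le> b \<Longrightarrow> (g has_integral (F v - F u)) {u..v}"
  shows "negligible {x\<in>{a..b}. \<not> (F has_vector_derivative g x) (at x)}"
proof -
  define g0 where "g0 x = (if x \<in> {a..b} then g x else 0)" for x
  have "g0 integrable_on UNIV" using g unfolding g0_def absolutely_integrable_on_def
    by (subst integrable_restrict_UNIV) auto
  then have "g0 integrable_on cbox u v" for u v by (rule integrable_on_subcbox) auto
  then obtain N where N: "negligible N"
    "\<And>x e. x \<notin> N \<Longrightarrow> 0 < e \<Longrightarrow> \<exists>d>0. \<forall>h. 0 < h \<and> h < d \<longrightarrow>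
      norm (integral (cbox x (x + h *\<^sub>R One)) g0 /\<^sub>R h ^ DIM(real) - g0 x) < e"
    using integrable_ccontinuous_explicit[of g0] by blast
  have "abs_cont_on a b F" using abs_cont_on_indefinite_integral[OF assms] .
  then have nd: "negligible {x\<in>{a..b}. \<not> F differentiable (at x)}" by (rule AC_differentiable_ae)
  have "{x\<in>{a..b}. \<not> (F has_vector_derivative g x) (at x)} \<subseteq> N \<union> {x\<in>{a..b}. \<not> F differentiable (at x)} \<union> {a,b}"
  proof (rule subsetI, rule ccontr)
    fix x assume x: "x \<in> {x\<in>{a..b}. \<not> (F has_vector_derivative g x) (at x)}"
      and xn: "x \<notin> N \<union> {x\<in>{a..b}. \<not> F differentiable (at x)} \<union> {a,b}"
    have xab: "a < x" "x < b" using x xn by auto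
    have "F differentiable (at x)" using x xn by auto
    then obtain D where D: "(F has_vector_derivative D) (at x)" using vector_derivative_works by blast
    have "D = g x"
    proof (rule ccontr)
      assume "D \<noteq> g x"
      define e where "e = norm (D - g x) / 2"
      have e: "e > 0" using \<open>D \<noteq> g x\<close> by (simp add: e_def)
      obtain d1 where d1: "d1 > 0" "\<And>y. norm (y - x) < d1 \<Longrightarrow> norm (F y - F x - (y - x) *\<^sub>R D) \<le> e/2 * norm (y - x)"
        using D half_gt_zero[OF e] unfolding has_vector_derivative_def has_derivative_within_alt by (metis UNIV_I)
      obtain d2 where d2: "d2 > 0" "\<And>h. 0 < h \<and> h < d2 \<Longrightarrow> norm (integral (cbox x (x + h *\<^sub>R One)) g0 /\<^sub>R h ^ DIM(real) - g0 x) < e"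
        using N(2)[of x e] e xn by auto
      define h where "h = min (min d1 d2) (b - x) / 2"
      have h: "h > 0" "h < d1" "h < d2" "x + h \<le> b" using d1 d2 xab by (auto simp: h_def min_def field_simps)
      have "integral {x..x+h} g0 = integral {x..x+h} g"
        by (rule integral_cong) (use h xab in \<open>auto simp: g0_def\<close>)
      also have "\<dots> = F (x+h) - F x" using F[of x "x+h"] h xab by (simp add: integral_unique)
      finally have "norm ((F (x+h) - F x) /\<^sub>R h - g x) < e"
        using d2(2)[of h] h xab by (simp add: g0_def)
      moreover have "norm ((F (x+h) - F x) /\<^sub>R h - D) \<le> e/2"
      proof -
        have "(F (x+h) - F x) /\<^sub>R h - D = (F (x+h) - F x - h *\<^sub>R D) /\<^sub>R h"
          using h by (simp add: scaleR_diff_right)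
        then have "norm ((F (x+h) - F x) /\<^sub>R h - D) = norm (F (x+h) - F x - h *\<^sub>R D) / h"
          using h by (simp add: divide_inverse mult.commute)
        also have "\<dots> \<le> (e/2 * h) / h" using d1(2)[of "x+h"] h by (intro divide_right_mono) auto
        finally show ?thesis using h by simp
      qed
      ultimately have "norm (D - g x) < e + e/2"
        using norm_triangle_ineq4[of "(F (x+h) - F x) /\<^sub>R h - g x" "(F (x+h) - F x) /\<^sub>R h - D"] by simp
      then show False using e unfolding e_def by simp
    qed
    then show False using D x by simp
  qed
  moreover have "negligible (N \<union> {x\<in>{a..b}. \<not> F differentiable (at x)} \<union> {a,b})"
    using N nd by (intro negligible_Un) auto
  ultimately show ?thesis by (rule negligible_subset[rotated])
qed

text \<open>This encodes that \<open>y\<close> and \<open>y'\<close> are absolutely continuous on \<open>[a, b]\<close> and that \<open>y'' = y2\<close> almost everywhere.\<close>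

definition weak2 :: "real \<Rightarrow> real \<Rightarrow> (real \<Rightarrow> 'a::euclidean_space) \<Rightarrow> (real \<Rightarrow> 'a) \<Rightarrow> (real \<Rightarrow> 'a) \<Rightarrow> bool" where
  "weak2 a b y y' y2 \<longleftrightarrow>
     (\<forall>x\<in>{a..b}. (y has_vector_derivative y' x) (at x within {a..b})) \<and>
     y2 absolutely_integrable_on {a..b} \<and>
     (\<forall>u v. a \<le> u \<and> u \<le> v \<and> v \<le> b \<longrightarrow> (y2 has_integral (y' v - y' u)) {u..v})"

lemma weak2D:
  assumes "weak2 a b y y' y2"
  shows "x \<in> {a..b} \<Longrightarrow> (y has_vector_derivative y' x) (at x within {a..b})"
    "y2 absolutely_integrable_on {a..b}"
    "a \<le> u \<Longrightarrow> u \<le> v \<Longrightarrow> v \<le> b \<Longrightarrow> (y2 has_integral (y' v - y' u)) {u..v}"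
  using assms unfolding weak2_def by blast+

lemma weak2I_from_left:
  fixes y :: "real \<Rightarrow> 'a::euclidean_space"
  assumes "\<And>x. x \<in> {a..b} \<Longrightarrow> (y has_vector_derivative y' x) (at x within {a..b})"
    "y2 absolutely_integrable_on {a..b}"
    and F: "\<And>x. x \<in> {a..b} \<Longrightarrow> (y2 has_integral (y' x - y' a)) {a..x}"
  shows "weak2 a b y y' y2"
  unfolding weak2_def
proof (intro conjI allI impI ballI)
  fix u v assume uv: "a \<le> u \<and> u \<le> v \<and> v \<le> b"
  have i: "y2 integrable_on {a..v}" using F[of v] uv by auto
  have "integral {a..u} y2 + integral {u..v} y2 = integral {a..v} y2"
    by (rule Henstock_Kurzweil_Integration.integral_combine) (use uv i in auto)
  moreover have "integral {a..u} y2 = y' u - y' a" "integral {a..v} y2 = y' v - y' a"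
    using F[of u] F[of v] uv by (auto simp: integral_unique)
  ultimately have "integral {u..v} y2 = y' v - y' u" by (simp add: algebra_simps)
  moreover have "y2 integrable_on {u..v}" using i by (rule integrable_on_subinterval) (use uv in auto)
  ultimately show "(y2 has_integral (y' v - y' u)) {u..v}" using integrable_integral by metis
qed (use assms in auto)

lemma weak2_subset:
  assumes "weak2 a b y y' y2" "a \<le> c" "d \<le> b" shows "weak2 c d y y' y2"
  unfolding weak2_def
proof (intro conjI ballI allI impI)
  fix x assume "x \<in> {c..d}"
  then show "(y has_vector_derivative y' x) (at x within {c..d})"
    using has_vector_derivative_within_subset[OF weak2D(1)[OF assms(1)], of x "{c..d}"] assms by auto
next
  show "y2 absolutely_integrable_on {c..d}"
    using weak2D(2)[OF assms(1)] by (rule absolutely_integrable_on_subinterval) (use assms in auto)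
qed (use weak2D(3)[OF assms(1)] assms in auto)

lemma weak2_continuous:
  assumes "weak2 a b y y' y2" shows "continuous_on {a..b} y" "continuous_on {a..b} y'"
proof -
  show "continuous_on {a..b} y"
    unfolding continuous_on_eq_continuous_within
    using weak2D(1)[OF assms] has_vector_derivative_continuous by blast
  show "continuous_on {a..b} y'"
    using abs_cont_on_indefinite_integral[OF weak2D(2,3)[OF assms]] by (rule abs_cont_on_imp_continuous_on)
qed

lemma weak2_abs_cont:
  assumes "weak2 a b y y' y2" shows "abs_cont_on a b y" "abs_cont_on a b y'"
proof -
  obtain B where B: "\<And>x. x \<in> {a..b} \<Longrightarrow> norm (y' x) \<le> B"
    using compact_imp_bounded[OF compact_continuous_image[OF weak2_continuous(2)[OF assms] compact_Icc]]
    unfolding bounded_iff by blast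
  show "abs_cont_on a b y"
  proof (rule abs_cont_on_lipschitz)
    fix u v assume uv: "a \<le> u" "u \<le> v" "v \<le> b"
    have "norm (y v - y u) \<le> B * norm (v - u)"
    proof (rule differentiable_bound[of "{a..b}" y "\<lambda>x h. h *\<^sub>R y' x"])
      fix x assume "x \<in> {a..b}"
      then show "(y has_derivative (\<lambda>h. h *\<^sub>R y' x)) (at x within {a..b})"
        using weak2D(1)[OF assms] by (simp add: has_vector_derivative_def)
      show "onorm (\<lambda>h. h *\<^sub>R y' x) \<le> B"
        by (rule onorm_le) (use B[OF \<open>x \<in> {a..b}\<close>] in \<open>simp add: mult.commute[of B] mult_left_mono\<close>)
    qed (use uv in auto)
    then show "norm (y v - y u) \<le> B * (v - u)" using uv by simp
  qed
  show "abs_cont_on a b y'"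
    using abs_cont_on_indefinite_integral[OF weak2D(2,3)[OF assms]] .
qed

lemma weak2_ae:
  assumes "weak2 a b y y' y2"
  shows "negligible {x\<in>{a..b}. \<not> (y' has_vector_derivative y2 x) (at x)}"
  using indefinite_integral_derivative_ae[OF weak2D(2,3)[OF assms]] .

lemma weak2_spike:
  assumes "weak2 a b y y' y2" "negligible N" "\<And>x. x \<in> {a..b} - N \<Longrightarrow> z2 x = y2 x"
  shows "weak2 a b y y' z2"
  unfolding weak2_def
proof (intro conjI ballI allI impI)
  show "z2 absolutely_integrable_on {a..b}"
    using absolutely_integrable_spike[OF weak2D(2)[OF assms(1)] assms(2)] assms(3) by blast
  fix u v assume "a \<le> u \<and> u \<le> v \<and> v \<le> b"
  then show "(z2 has_integral (y' v - y' u)) {u..v}"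
    using has_integral_spike[OF assms(2) _ weak2D(3)[OF assms(1)], of u v z2] assms(3) by auto
qed (use weak2D(1)[OF assms(1)] in auto)

lemma weak2_cong:
  assumes "weak2 a b y y' y2" "\<And>x. x \<in> {a..b} \<Longrightarrow> z x = y x" "\<And>x. x \<in> {a..b} \<Longrightarrow> z' x = y' x"
    "\<And>x. x \<in> {a..b} \<Longrightarrow> z2 x = y2 x"
  shows "weak2 a b z z' z2"
proof -
  have 1: "weak2 a b y y' z2" by (rule weak2_spike[OF assms(1) negligible_empty]) (use assms in auto)
  show ?thesis
    unfolding weak2_def
  proof (intro conjI ballI allI impI)
    fix x assume x: "x \<in> {a..b}"
    show "(z has_vector_derivative z' x) (at x within {a..b})"
      unfolding assms(3)[OF x]
      by (rule has_vector_derivative_transform[OF x _ weak2D(1)[OF 1 x]]) (use assms(2) in auto)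
  qed (use weak2D(2,3)[OF 1] assms(3) in auto)
qed

lemma weak2_combine:
  assumes "weak2 a b y y' y2" "weak2 b c y y' y2" "a \<le> b" "b \<le> c"
  shows "weak2 a c y y' y2"
proof (cases "a = b \<or> b = c")
  case True then show ?thesis using assms by auto
next
  case False
  then have abc: "a < b" "b < c" using assms by auto
  have U: "{a..b} \<union> {b..c} = {a..c}" using abc by auto
  show ?thesis
  proof (rule weak2I_from_left)
    fix x assume x: "x \<in> {a..c}"
    show "(y has_vector_derivative y' x) (at x within {a..c})"
    proof -
      consider "x < b" | "x = b" | "x > b" by linarith
      then show ?thesis
      proof cases
        case 1
        have "at x within {a..c} = at x within {a..b}"
          by (rule at_within_nhd[of x "{..<b}"]) (use 1 abc in auto)
        then show ?thesis using weak2D(1)[OF assms(1), of x] x 1 by auto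
      next
        case 3
        have "at x within {a..c} = at x within {b..c}"
          by (rule at_within_nhd[of x "{b<..}"]) (use 3 abc in auto)
        then show ?thesis using weak2D(1)[OF assms(2), of x] x 3 by auto
      next
        case 2
        have "(y has_derivative (\<lambda>h. h *\<^sub>R y' x)) (at x within {a..b} \<union> {b..c})"
          using weak2D(1)[OF assms(1), of x] weak2D(1)[OF assms(2), of x] 2 abc
          unfolding has_vector_derivative_def has_derivative_within Lim_within_Un by auto
        then show ?thesis unfolding U has_vector_derivative_def .
      qed
    qed
    show "(y2 has_integral (y' x - y' a)) {a..x}"
    proof (cases "x \<le> b")
      case True then show ?thesis using weak2D(3)[OF assms(1), of a x] x by auto
    next
      case False
      have "(y2 has_integral (y' b - y' a) + (y' x - y' b)) {a..x}"
        by (rule has_integral_combine[of a b x]) (use False abc x weak2D(3)[OF assms(1), of a b] weak2D(3)[OF assms(2), of b x] in auto)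
      then show ?thesis by simp
    qed
  next
    show "y2 absolutely_integrable_on {a..c}"
      using absolutely_integrable_Un[OF weak2D(2)[OF assms(1)] weak2D(2)[OF assms(2)]] U by simp
  qed
qed

lemma weak2_scaleR:
  assumes "weak2 a b y y' y2" shows "weak2 a b (\<lambda>x. c *\<^sub>R y x) (\<lambda>x. c *\<^sub>R y' x) (\<lambda>x. c *\<^sub>R y2 x)"
  unfolding weak2_def
proof (intro conjI ballI allI impI)
  fix x assume "x \<in> {a..b}"
  then show "((\<lambda>x. c *\<^sub>R y x) has_vector_derivative c *\<^sub>R y' x) (at x within {a..b})"
    using bounded_linear.has_vector_derivative[OF bounded_linear_scaleR_right weak2D(1)[OF assms]] by blast
next
  show "(\<lambda>x. c *\<^sub>R y2 x) absolutely_integrable_on {a..b}"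
    using absolutely_integrable_scaleR_left[OF weak2D(2)[OF assms]] .
next
  fix u v assume "a \<le> u \<and> u \<le> v \<and> v \<le> b"
  then show "((\<lambda>x. c *\<^sub>R y2 x) has_integral c *\<^sub>R y' v - c *\<^sub>R y' u) {u..v}"
    using has_integral_cmul[OF weak2D(3)[OF assms], of u v c] by (simp add: scaleR_diff_right)
qed

lemma weak2_linear_image:
  fixes y :: "real \<Rightarrow> 'a::euclidean_space" and f :: "'a \<Rightarrow> 'b::euclidean_space"
  assumes "weak2 a b y y' y2" "bounded_linear f"
  shows "weak2 a b (\<lambda>x. f (y x)) (\<lambda>x. f (y' x)) (\<lambda>x. f (y2 x))"
  unfolding weak2_def
proof (intro conjI ballI allI impI)
  interpret bounded_linear f by fact
  fix x assume "x \<in> {a..b}"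
  then show "((\<lambda>x. f (y x)) has_vector_derivative f (y' x)) (at x within {a..b})"
    using has_vector_derivative[OF weak2D(1)[OF assms(1)]] by blast
next
  show "(\<lambda>x. f (y2 x)) absolutely_integrable_on {a..b}"
    using absolutely_integrable_linear[OF weak2D(2)[OF assms(1)] assms(2)] by (simp add: o_def)
next
  fix u v assume "a \<le> u \<and> u \<le> v \<and> v \<le> b"
  then show "((\<lambda>x. f (y2 x)) has_integral f (y' v) - f (y' u)) {u..v}"
    using has_integral_linear[OF weak2D(3)[OF assms(1)] assms(2), of u v]
    by (simp add: o_def linear_diff bounded_linear.linear[OF assms(2)])
qed

lemma weak2_add:
  assumes "weak2 a b y y' y2" "weak2 a b z z' z2"
  shows "weak2 a b (\<lambda>x. y x + z x) (\<lambda>x. y' x + z' x) (\<lambda>x. y2 x + z2 x)"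
  unfolding weak2_def
proof (intro conjI ballI allI impI)
  fix u v assume "a \<le> u \<and> u \<le> v \<and> v \<le> b"
  then show "((\<lambda>x. y2 x + z2 x) has_integral y' v + z' v - (y' u + z' u)) {u..v}"
    using has_integral_add[OF weak2D(3)[OF assms(1)] weak2D(3)[OF assms(2)], of u v] by (simp add: add_diff_add)
qed (use weak2D(1,2)[OF assms(1)] weak2D(1,2)[OF assms(2)] in \<open>auto intro!: has_vector_derivative_add set_integral_add\<close>)

text \<open>The product of \<open>y\<close> and \<open>z'\<close> is absolutely continuous and obeys
  the product rule wherever \<open>z'\<close> has derivative \<open>z2\<close>, that is, almost
  everywhere.\<close>

lemma weak2_by_parts:
  fixes y z :: "real \<Rightarrow> 'a::{euclidean_space,real_normed_field}"
  assumes y: "weak2 a b y y' y2" and z: "weak2 a b z z' z2" and uv: "a \<le> u" "u \<le> v" "v \<le> b"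
  shows "((\<lambda>x. y x * z2 x + y' x * z' x) has_integral (y v * z' v - y u * z' u)) {u..v}"
    "(\<lambda>x. y x * z2 x) absolutely_integrable_on {u..v}"
proof -
  have y': "weak2 u v y y' y2" and z': "weak2 u v z z' z2" using weak2_subset y z uv by blast+
  define N where "N = {x\<in>{u..v}. \<not> (z' has_vector_derivative z2 x) (at x)}"
  show "((\<lambda>x. y x * z2 x + y' x * z' x) has_integral (y v * z' v - y u * z' u)) {u..v}"
  proof (rule abs_cont_on_has_integral[OF uv(2), where f = "\<lambda>x. y x * z' x" and N = N])
    show "abs_cont_on u v (\<lambda>x. y x * z' x)"
      using abs_cont_on_mult weak2_abs_cont y' z' by blast
    show "negligible N" unfolding N_def by (rule weak2_ae[OF z'])
    fix x assume x: "x \<in> {u..v} - N"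
    then have "(z' has_vector_derivative z2 x) (at x within {u..v})" by (auto simp: N_def intro: has_vector_derivative_at_within)
    moreover have "(y has_vector_derivative y' x) (at x within {u..v})" using weak2D(1)[OF y'] x by auto
    ultimately show "((\<lambda>x. y x * z' x) has_vector_derivative y x * z2 x + y' x * z' x) (at x within {u..v})"
      by (rule has_vector_derivative_mult[rotated])
  qed
  show "(\<lambda>x. y x * z2 x) absolutely_integrable_on {u..v}"
    by (rule absolutely_integrable_continuous_mult[OF weak2_continuous(1)[OF y'] weak2D(2)[OF z']])
qed

lemma weak2_wronskian:
  fixes y z :: "real \<Rightarrow> 'a::{euclidean_space,real_normed_field}"
  assumes y: "weak2 a b y y' y2" and z: "weak2 a b z z' z2" and uv: "a \<le> u" "u \<le> v" "v \<le> b"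
  shows "((\<lambda>x. y x * z2 x - z x * y2 x) has_integral
           ((y v * z' v - z v * y' v) - (y u * z' u - z u * y' u))) {u..v}"
proof -
  have eq: "(\<lambda>x. y x * z2 x - z x * y2 x) = (\<lambda>x. (y x * z2 x + y' x * z' x) - (z x * y2 x + z' x * y' x))"
    by (auto simp: mult.commute)
  show ?thesis unfolding eq using has_integral_diff[OF weak2_by_parts(1)[OF y z uv] weak2_by_parts(1)[OF z y uv]]
    by (simp add: algebra_simps)
qed

section \<open>Local versions on the half-line and on the punctured half-line\<close>

lemma continuous_on_atLeast:
  fixes f :: "real \<Rightarrow> 'a::topological_space"
  assumes "\<And>b. b > a \<Longrightarrow> continuous_on {a..b} f"
  shows "continuous_on {a..} f"
  unfolding continuous_on_eq_continuous_within
proof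
  fix x assume x: "x \<in> {a..}"
  have "at x within {a..} = at x within {a..x+1}"
    by (rule at_within_nhd[of x "{..<x+1}"]) (use x in auto)
  moreover have "continuous (at x within {a..x+1}) f"
    using assms[of "x+1"] x unfolding continuous_on_eq_continuous_within by auto
  ultimately show "continuous (at x within {a..}) f" by simp
qed

text \<open>Stated through compact subintervals so that \<open>I\<close> may be the half-line
  without the point \<open>t\<close>: nothing is then claimed across the gap.\<close>

definition weak2_on :: "real set \<Rightarrow> (real \<Rightarrow> 'a::euclidean_space) \<Rightarrow> (real \<Rightarrow> 'a) \<Rightarrow> (real \<Rightarrow> 'a) \<Rightarrow> bool" where
  "weak2_on I y y' y2 \<longleftrightarrow> (\<forall>a b. a < b \<and> {a..b} \<subseteq> I \<longrightarrow> weak2 a b y y' y2)"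

lemma weak2_onD: "weak2_on I y y' y2 \<Longrightarrow> a < b \<Longrightarrow> {a..b} \<subseteq> I \<Longrightarrow> weak2 a b y y' y2"
  unfolding weak2_on_def by blast

lemma weak2_on_subset: "weak2_on I y y' y2 \<Longrightarrow> J \<subseteq> I \<Longrightarrow> weak2_on J y y' y2"
  unfolding weak2_on_def by (meson order_trans)

lemma has_vector_derivative_D\<^sub>x:
  assumes "x \<ge> 0" "(y has_vector_derivative d) (at x within {0..})"
  shows "D\<^sub>x y x = d"
  unfolding D\<^sub>x_def
proof (rule vector_derivative_within)
  have "x islimpt {0..}"
    by (rule islimpt_subset[of x "{x..x+1}"]) (use assms(1) in \<open>auto simp: islimpt_Icc\<close>)
  then show "at x within {0..} \<noteq> bot" by (simp add: trivial_limit_within)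
qed (rule assms(2))

lemma has_vector_derivative_D\<^sub>x_at:
  assumes "x > 0" "(y has_vector_derivative d) (at x)"
  shows "D\<^sub>x y x = d"
  by (rule has_vector_derivative_D\<^sub>x) (use assms in \<open>auto intro: has_vector_derivative_at_within\<close>)

lemma AC1_loc_imp_weak2_on:
  fixes y :: "real \<Rightarrow> 'a::euclidean_space"
  assumes y: "AC1_loc I y" and I: "I \<subseteq> {0..}"
    and i: "\<And>a b. a < b \<Longrightarrow> {a..b} \<subseteq> I \<Longrightarrow> D\<^sub>x (D\<^sub>x y) absolutely_integrable_on {a..b}"
  shows "weak2_on I y (D\<^sub>x y) (D\<^sub>x (D\<^sub>x y))"
  unfolding weak2_on_def
proof (intro allI impI)
  fix a b :: real assume ab: "a < b \<and> {a..b} \<subseteq> I"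
  then have "a \<in> {a..b}" by auto
  then have "a \<in> {0..}" and a02: "{a..b} \<subseteq> {0..}" using ab I by blast+
  then have a0: "a \<ge> 0" "{a..b} \<subseteq> {0..}" by auto
  show "weak2 a b y (D\<^sub>x y) (D\<^sub>x (D\<^sub>x y))"
    unfolding weak2_def
  proof (intro conjI ballI allI impI)
    fix x assume x: "x \<in> {a..b}"
    then have "y differentiable (at x within {0..})" using y ab unfolding AC1_loc_def by auto
    then have "(y has_vector_derivative D\<^sub>x y x) (at x within {0..})"
      unfolding D\<^sub>x_def by (simp add: vector_derivative_works)
    then show "(y has_vector_derivative D\<^sub>x y x) (at x within {a..b})"
      using a0(2) by (rule has_vector_derivative_within_subset)
  next
    show "D\<^sub>x (D\<^sub>x y) absolutely_integrable_on {a..b}" using i ab by blast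
  next
    fix u v assume uv: "a \<le> u \<and> u \<le> v \<and> v \<le> b"
    have ac: "abs_cont_on u v (D\<^sub>x y)"
      using y ab uv unfolding AC1_loc_def AC_loc_def by (meson abs_cont_on_subset)
    show "(D\<^sub>x (D\<^sub>x y) has_integral D\<^sub>x y v - D\<^sub>x y u) {u..v}"
    proof (rule abs_cont_on_has_integral[OF _ ac])
      show "negligible ({x\<in>{u..v}. \<not> D\<^sub>x y differentiable (at x)} \<union> {0})"
        using AC_differentiable_ae[OF ac] by (intro negligible_Un) auto
      fix x assume x: "x \<in> {u..v} - ({x\<in>{u..v}. \<not> D\<^sub>x y differentiable (at x)} \<union> {0})"
      then have "D\<^sub>x y differentiable (at x)" "x > 0" using a0 uv by auto
      then obtain d where d: "(D\<^sub>x y has_vector_derivative d) (at x)" using vector_derivative_works by blast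
      show "(D\<^sub>x y has_vector_derivative D\<^sub>x (D\<^sub>x y) x) (at x within {u..v})"
        unfolding has_vector_derivative_D\<^sub>x_at[OF \<open>x > 0\<close> d] using d by (rule has_vector_derivative_at_within)
    qed (use uv in auto)
  qed
qed

text \<open>The covering condition says that \<open>I\<close> is open relative to the half-line, so
  that derivatives within a subinterval are derivatives within \<open>{0..}\<close>, as
  \<open>D\<^sub>x\<close> demands.\<close>

lemma weak2_on_imp_AC1_loc:
  fixes y :: "real \<Rightarrow> 'a::euclidean_space"
  assumes w: "weak2_on I y y' y2" and I: "I \<subseteq> {0..}"
    and cov: "\<And>x. x \<in> I \<Longrightarrow> \<exists>a b. (a < x \<or> x = 0 \<and> a = 0) \<and> x < b \<and> {a..b} \<subseteq> I"
  shows "AC1_loc I y" "\<And>x. x \<in> I \<Longrightarrow> D\<^sub>x y x = y' x" "negligible {x\<in>I. D\<^sub>x (D\<^sub>x y) x \<noteq> y2 x}"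
proof -
  have der: "(y has_vector_derivative y' x) (at x within {0..})" if x: "x \<in> I" for x
  proof -
    obtain a b where ab: "a < x \<or> x = 0 \<and> a = 0" "x < b" "{a..b} \<subseteq> I" using cov[OF x] by blast
    have "weak2 a b y y' y2" using w ab by (intro weak2_onD) auto
    then have d: "(y has_vector_derivative y' x) (at x within {a..b})" using ab by (intro weak2D(1)) auto
    have a0: "a \<ge> 0" using ab I by (auto simp: subset_iff)
    have "at x within {0..} = at x within {a..b}"
    proof (cases "a < x")
      case True
      show ?thesis by (rule at_within_nhd[of x "{a<..<b}"]) (use True ab a0 in auto)
    next
      case False
      show ?thesis by (rule at_within_nhd[of x "{..<b}"]) (use False ab a0 in auto)
    qed
    then show ?thesis using d by simp
  qed
  show D: "D\<^sub>x y x = y' x" if "x \<in> I" for x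
    by (rule has_vector_derivative_D\<^sub>x[OF _ der[OF that]]) (use that I in auto)
  have ac: "abs_cont_on a b y \<and> abs_cont_on a b (D\<^sub>x y)" if "{a..b} \<subseteq> I" for a b
  proof (cases "a < b")
    case True
    then have w1: "weak2 a b y y' y2" using w that by (intro weak2_onD) auto
    have "abs_cont_on a b (D\<^sub>x y)"
      by (rule abs_cont_on_cong[OF weak2_abs_cont(2)[OF w1]]) (use D that in blast)
    then show ?thesis using weak2_abs_cont(1)[OF w1] by blast
  next
    case False
    have "abs_cont_on a b g" for g :: "real \<Rightarrow> 'a"
    proof (rule abs_cont_on_lipschitz[where A=0])
      fix u v assume "a \<le> u" "u \<le> v" "v \<le> b"
      then have "v = u" using False by linarith
      then show "norm (g v - g u) \<le> 0 * (v - u)" by simp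
    qed
    then show ?thesis by blast
  qed
  show "AC1_loc I y" unfolding AC1_loc_def AC_loc_def
    using ac der by (auto simp: differentiable_def has_vector_derivative_def)
  \<comment> \<open>The exceptional set depends on the subinterval; rational endpoints leave
    countably many of them.\<close>
  define R where "R = {(a,b). a \<in> \<rat> \<and> b \<in> \<rat> \<and> a < b \<and> {a..b} \<subseteq> I}"
  have "countable R" by (rule countable_subset[of _ "\<rat> \<times> \<rat>"]) (auto simp: R_def intro: countable_rat)
  define N where "N = (\<Union>(a,b)\<in>R. {x\<in>{a..b}. \<not> (y' has_vector_derivative y2 x) (at x)}) \<union> {0}"
  have nR: "negligible {x\<in>{a..b}. \<not> (y' has_vector_derivative y2 x) (at x)}" if "(a,b) \<in> R" for a b
    by (rule weak2_ae[OF weak2_onD[OF w]]) (use that in \<open>auto simp: R_def\<close>)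
  have "negligible N" unfolding N_def
  proof (rule negligible_Un)
    show "negligible (\<Union>(a,b)\<in>R. {x\<in>{a..b}. \<not> (y' has_vector_derivative y2 x) (at x)})"
    proof (rule negligible_countable_Union)
      fix T assume "T \<in> (\<lambda>(a,b). {x\<in>{a..b}. \<not> (y' has_vector_derivative y2 x) (at x)}) ` R"
      then obtain a b where "(a,b) \<in> R" "T = {x\<in>{a..b}. \<not> (y' has_vector_derivative y2 x) (at x)}"
        by (elim imageE) (simp add: case_prod_unfold, metis prod.collapse)
      then show "negligible T" using nR by simp
    qed (rule countable_image[OF \<open>countable R\<close>])
  qed auto
  moreover have "{x\<in>I. D\<^sub>x (D\<^sub>x y) x \<noteq> y2 x} \<subseteq> N"
  proof (rule subsetI, rule ccontr)
    fix x assume x: "x \<in> {x\<in>I. D\<^sub>x (D\<^sub>x y) x \<noteq> y2 x}" and xN: "x \<notin> N"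
    have x0: "x > 0" using x xN I by (auto simp: N_def less_le)
    obtain a b where ab: "a < x" "x < b" "{a..b} \<subseteq> I" using cov[of x] x x0 by auto
    obtain r1 where r1: "r1 \<in> \<rat>" "a < r1" "r1 < x" using Rats_dense_in_real[OF ab(1)] by blast
    obtain r2 where r2: "r2 \<in> \<rat>" "x < r2" "r2 < b" using Rats_dense_in_real[OF ab(2)] by blast
    have sub: "{r1..r2} \<subseteq> I" using ab r1 r2 by auto
    then have "(r1,r2) \<in> R" using r1 r2 by (auto simp: R_def)
    then have d: "(y' has_vector_derivative y2 x) (at x)" using xN r1 r2 by (fastforce simp: N_def)
    have "(D\<^sub>x y has_vector_derivative y2 x) (at x)"
    proof (rule has_vector_derivative_transform_within_open[OF d, of "{r1<..<r2}"])
      fix s assume "s \<in> {r1<..<r2}"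
      then have "s \<in> I" using sub by auto
      then show "y' s = D\<^sub>x y s" using D by simp
    qed (use r1 r2 in auto)
    then have "D\<^sub>x (D\<^sub>x y) x = y2 x" by (rule has_vector_derivative_D\<^sub>x_at[OF x0])
    then show False using x by simp
  qed
  ultimately show "negligible {x\<in>I. D\<^sub>x (D\<^sub>x y) x \<noteq> y2 x}" by (rule negligible_subset)
qed

section \<open>The initial value problem\<close>

lemma integral_exp_primitive:
  fixes p :: "real \<Rightarrow> real"
  assumes p: "p absolutely_integrable_on {0..x}" and x: "x \<ge> 0"
  defines "P \<equiv> (\<lambda>x. integral {0..x} p)"
  shows "((\<lambda>s. p s * exp (2 * P s)) has_integral (exp (2 * P x) - 1) / 2) {0..x}"
proof -
  have pi: "p integrable_on {0..x}" using p by (simp add: absolutely_integrable_on_def)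
  have P: "(p has_integral (P v - P u)) {u..v}" if uv: "0 \<le> u" "u \<le> v" "v \<le> x" for u v
  proof -
    have "integral {0..u} p + integral {u..v} p = integral {0..v} p"
      by (rule Henstock_Kurzweil_Integration.integral_combine)
        (use uv in \<open>auto intro: integrable_on_subinterval[OF pi]\<close>)
    moreover have "p integrable_on {u..v}" by (rule integrable_on_subinterval[OF pi]) (use uv in auto)
    ultimately show ?thesis unfolding P_def by (metis add_diff_cancel_left' integrable_integral)
  qed
  have acP: "abs_cont_on 0 x P" by (rule abs_cont_on_indefinite_integral[OF p P])
  obtain B where B: "\<And>s. s \<in> {0..x} \<Longrightarrow> norm (P s) \<le> B"
    using compact_imp_bounded[OF compact_continuous_image[OF abs_cont_on_imp_continuous_on[OF acP] compact_Icc]]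
    unfolding bounded_iff by blast
  \<comment> \<open>The exponential is Lipschitz on the bounded range of \<open>P\<close>, so the
    composition remains absolutely continuous and the chain rule, valid wherever \<open>P\<close>
    has derivative \<open>p\<close>, can be integrated.\<close>
  have "abs_cont_on 0 x (\<lambda>s. exp (2 * P s) / 2)"
  proof (rule abs_cont_on_dominated[OF acP acP])
    fix u v assume uv: "0 \<le> u" "u \<le> v" "v \<le> x"
    have "norm (exp (2 * P v) / 2 - exp (2 * P u) / 2) \<le> exp (2 * B) * norm (P v - P u)"
    proof (rule differentiable_bound[of "{-B..B}" "\<lambda>t. exp (2 * t) / 2" "\<lambda>t h. h * exp (2*t)"])
      fix t assume t: "t \<in> {-B..B}"
      show "((\<lambda>t. exp (2 * t) / 2) has_derivative (\<lambda>h. h * exp (2*t))) (at t within {-B..B})"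
        by (auto intro!: derivative_eq_intros)
      show "onorm (\<lambda>h. h * exp (2*t)) \<le> exp (2*B)"
        by (rule onorm_le) (use t in \<open>auto simp: abs_mult mult.commute[of "exp (2*B)"] intro!: mult_left_mono\<close>)
    qed (use B[of u] B[of v] uv in \<open>auto simp: abs_le_iff\<close>)
    then show "norm (exp (2 * P v) / 2 - exp (2 * P u) / 2) \<le> exp (2 * B) * norm (P v - P u) + 0 * norm (P v - P u)"
      by simp
  qed
  then have "((\<lambda>s. p s * exp (2 * P s)) has_integral (exp (2 * P x) / 2 - exp (2 * P 0) / 2)) {0..x}"
  proof (rule abs_cont_on_has_integral[OF x])
    show "negligible {s\<in>{0..x}. \<not> (P has_vector_derivative p s) (at s)}"
      by (rule indefinite_integral_derivative_ae[OF p P])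
    fix s assume "s \<in> {0..x} - {s\<in>{0..x}. \<not> (P has_vector_derivative p s) (at s)}"
    then have d: "(P has_real_derivative p s) (at s)" by (simp add: has_real_derivative_iff_has_vector_derivative)
    have "((\<lambda>s. exp (2 * P s) / 2) has_real_derivative p s * exp (2 * P s)) (at s)"
      by (auto intro!: derivative_eq_intros d)
    then show "((\<lambda>s. exp (2 * P s) / 2) has_vector_derivative p s * exp (2 * P s)) (at s within {0..x})"
      by (auto simp: has_real_derivative_iff_has_vector_derivative intro: has_vector_derivative_at_within)
  qed
  moreover have "P 0 = 0" by (simp add: P_def)
  ultimately show ?thesis by (simp add: diff_divide_distrib)
qed

text \<open>Picard iteration on the whole half-line: in the norm \<open>sup e\<^sup>-\<^sup>\<rho> \<bar>y\<bar>\<close> with \<open>\<rho>' = 1 + 2 \<bar>Q\<bar>\<close> the integral operator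
  is a contraction.\<close>

theorem ivp_exists:
  fixes Q :: "real \<Rightarrow> 'a::{euclidean_space,real_normed_field}" and A B :: 'a
  assumes Q: "\<And>b. b > 0 \<Longrightarrow> Q absolutely_integrable_on {0..b}"
  shows "\<exists>y y'. y 0 = A \<and> y' 0 = B \<and> (\<forall>b>0. weak2 0 b y y' (\<lambda>x. Q x * y x))"
proof -
  define p where "p x = norm (Q x)" for x
  define P where "P x = integral {0..x} p" for x
  \<comment> \<open>The two summands pay for the two integrations. The weight
    \<open>exp (2 * P s)\<close> against \<open>p\<close> integrates to at most half its final
    value, which is the contraction constant 1/2; the weight \<open>exp s\<close> absorbs the second
    integration without loss.\<close>
  define \<rho> where "\<rho> x = x + 2 * P x" for x
  have pa: "p absolutely_integrable_on {0..b}" if "b > 0" for b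
    unfolding p_def using Q[OF that] by (rule set_integrable_norm)
  have pint: "p integrable_on {0..b}" for b
  proof (cases "b > 0")
    case True then show ?thesis using pa[of b] by (simp add: absolutely_integrable_on_def)
  next
    case False
    then have "negligible {0..b}" by (cases "b = 0") auto
    then show ?thesis by (rule integrable_negligible)
  qed
  have Pc: "continuous_on {0..b} P" for b
    unfolding P_def by (rule indefinite_integral_continuous_1[OF pint])
  have \<rho>c: "continuous_on {0..b} \<rho>" for b unfolding \<rho>_def by (intro continuous_intros Pc)
  have P0: "P x \<ge> 0" for x unfolding P_def by (rule integral_nonneg[OF pint]) (simp add: p_def)
  have Pmono: "P u \<le> P v" if "u \<le> v" for u v
    unfolding P_def by (rule integral_subset_le) (use pint that in \<open>auto simp: p_def\<close>)
  have \<rho>0: "\<rho> x \<ge> x" for x using P0[of x] by (simp add: \<rho>_def)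
  have Qu: "(\<lambda>s. Q s * u s) absolutely_integrable_on {0..b}" if "continuous_on {0..b} u" "b > 0" for u b
    using absolutely_integrable_continuous_mult[OF that(1) Q[OF that(2)]] by (simp add: mult.commute)
  \<comment> \<open>The unknown \<open>g\<close> stands for the solution divided by
    \<open>exp (\<rho> x)\<close>; \<open>zd\<close> and \<open>zz\<close> are the derivative and
    the value of the Picard iterate before rescaling.\<close>
  define zd where "zd g x = B + integral {0..x} (\<lambda>s. Q s * (exp (\<rho> s) *\<^sub>R apply_bcontfun g s))" for g x
  define zz where "zz g x = A + integral {0..x} (zd g)" for g x
  have ec: "continuous_on {0..b} (\<lambda>s. exp (\<rho> s) *\<^sub>R apply_bcontfun g s)" for b and g :: "real \<Rightarrow>\<^sub>C 'a"
    by (intro continuous_intros \<rho>c) auto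
  have zdc: "continuous_on {0..b} (zd g)" if "b > 0" for g b
    unfolding zd_def by (intro continuous_intros indefinite_integral_continuous_1)
      (use Qu[OF ec that, of g] in \<open>auto simp: absolutely_integrable_on_def\<close>)
  have zzc: "continuous_on {0..b} (zz g)" if "b > 0" for g b
    unfolding zz_def by (intro continuous_intros indefinite_integral_continuous_1 integrable_continuous_real zdc that)
  have w: "weak2 0 b (zz g) (zd g) (\<lambda>s. Q s * (exp (\<rho> s) *\<^sub>R apply_bcontfun g s))" if b: "b > 0" for g b
  proof (rule weak2I_from_left)
    show "(\<lambda>s. Q s * (exp (\<rho> s) *\<^sub>R apply_bcontfun g s)) absolutely_integrable_on {0..b}" by (rule Qu[OF ec b])
    fix x assume x: "x \<in> {0..b}"
    have "((\<lambda>u. integral {0..u} (zd g)) has_vector_derivative zd g x) (at x within {0..b})"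
      by (rule integral_has_vector_derivative[OF zdc[OF b] x])
    then show "(zz g has_vector_derivative zd g x) (at x within {0..b})"
      unfolding zz_def using has_vector_derivative_add[OF has_vector_derivative_const[of A]] by fastforce
    have "(\<lambda>s. Q s * (exp (\<rho> s) *\<^sub>R apply_bcontfun g s)) integrable_on {0..x}"
      by (rule integrable_on_subinterval[of _ "{0..b}"]) (use Qu[OF ec b, of g] x in \<open>auto simp: absolutely_integrable_on_def\<close>)
    then show "((\<lambda>s. Q s * (exp (\<rho> s) *\<^sub>R apply_bcontfun g s)) has_integral zd g x - zd g 0) {0..x}"
      unfolding zd_def by (simp add: integrable_integral)
  qed
  have dd: "norm (zd g x - zd h x) \<le> exp (\<rho> x) / 2 * dist g h" if x: "x > 0" for g h x
  proof -
    have i: "(\<lambda>s. Q s * (exp (\<rho> s) *\<^sub>R apply_bcontfun g s)) integrable_on {0..x}" for g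
      using Qu[OF ec x, of g] by (auto simp: absolutely_integrable_on_def)
    have "zd g x - zd h x = integral {0..x} (\<lambda>s. Q s * (exp (\<rho> s) *\<^sub>R apply_bcontfun g s) - Q s * (exp (\<rho> s) *\<^sub>R apply_bcontfun h s))"
      unfolding zd_def by (subst Henstock_Kurzweil_Integration.integral_diff[OF i i]) simp
    also have "norm \<dots> \<le> integral {0..x} (\<lambda>s. (exp x * dist g h) * (p s * exp (2 * P s)))"
    proof (rule integral_norm_bound_integral)
      show "(\<lambda>s. (exp x * dist g h) * (p s * exp (2 * P s))) integrable_on {0..x}"
        using integral_exp_primitive[OF pa[OF x]] x unfolding P_def by (intro integrable_on_mult_right) auto
      fix s assume s: "s \<in> {0..x}"
      have "norm (Q s * (exp (\<rho> s) *\<^sub>R apply_bcontfun g s) - Q s * (exp (\<rho> s) *\<^sub>R apply_bcontfun h s))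
         = p s * exp (\<rho> s) * norm (apply_bcontfun g s - apply_bcontfun h s)"
        by (simp add: right_diff_distrib[symmetric] scaleR_diff_right[symmetric] norm_mult p_def del: scaleR_scaleR mult_scaleR_right)
      also have "\<dots> \<le> p s * exp (\<rho> s) * dist g h"
        using dist_bounded[of g s h] by (intro mult_left_mono) (auto simp: dist_norm p_def)
      also have "\<dots> \<le> (exp x * dist g h) * (p s * exp (2 * P s))"
      proof -
        have "exp (\<rho> s) \<le> exp x * exp (2 * P s)" using s by (simp add: \<rho>_def exp_add)
        then have "p s * exp (\<rho> s) * dist g h \<le> p s * (exp x * exp (2 * P s)) * dist g h"
          by (intro mult_right_mono mult_left_mono) (auto simp: p_def)
        then show ?thesis by (simp add: mult_ac)
      qed
      finally show "norm (Q s * (exp (\<rho> s) *\<^sub>R apply_bcontfun g s) - Q s * (exp (\<rho> s) *\<^sub>R apply_bcontfun h s))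
         \<le> (exp x * dist g h) * (p s * exp (2 * P s))" .
    qed (intro integrable_diff i)
    also have "\<dots> = (exp x * dist g h) * ((exp (2 * P x) - 1) / 2)"
      using integral_exp_primitive[OF pa[OF x]] x unfolding P_def
      by (subst integral_mult_right) (auto simp: integral_unique)
    also have "\<dots> \<le> (exp x * dist g h) * (exp (2 * P x) / 2)" by (intro mult_left_mono) auto
    also have "\<dots> = exp (\<rho> x) / 2 * dist g h" by (simp add: \<rho>_def exp_add)
    finally show ?thesis .
  qed
  have zdiff: "norm (zz g x - zz h x) \<le> exp (\<rho> x) / 2 * dist g h" if x: "x > 0" for g h x
  proof -
    have i: "zd g integrable_on {0..x}" for g by (rule integrable_continuous_real[OF zdc[OF x]])
    have ei: "((\<lambda>s. exp s) has_integral (exp x - exp 0)) {0..x}"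
      using x by (intro fundamental_theorem_of_calculus) (auto intro!: derivative_eq_intros simp flip: has_real_derivative_iff_has_vector_derivative)
    have "zz g x - zz h x = integral {0..x} (\<lambda>s. zd g s - zd h s)"
      unfolding zz_def by (subst Henstock_Kurzweil_Integration.integral_diff[OF i i]) simp
    also have "norm \<dots> \<le> integral {0..x} (\<lambda>s. (exp (2 * P x) / 2 * dist g h) * exp s)"
    proof (rule integral_norm_bound_integral)
      show "(\<lambda>s. (exp (2 * P x) / 2 * dist g h) * exp s) integrable_on {0..x}"
        using ei by (intro integrable_on_mult_right) auto
      fix s assume s: "s \<in> {0..x}"
      have "norm (zd g s - zd h s) \<le> exp (\<rho> s) / 2 * dist g h"
      proof (cases "s = 0")
        case True
        then show ?thesis by (simp add: zd_def)
      qed (use dd s in auto)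
      also have "\<dots> \<le> (exp (2 * P x) * exp s) / 2 * dist g h"
        using Pmono[of s x] s by (intro mult_right_mono divide_right_mono) (auto simp: \<rho>_def exp_add[symmetric])
      finally show "norm (zd g s - zd h s) \<le> (exp (2 * P x) / 2 * dist g h) * exp s" by (simp add: mult_ac)
    qed (intro integrable_diff i)
    also have "\<dots> = (exp (2 * P x) / 2 * dist g h) * (exp x - 1)"
      using ei by (subst integral_mult_right) (auto simp: integral_unique)
    also have "\<dots> \<le> (exp (2 * P x) / 2 * dist g h) * exp x" by (intro mult_left_mono) auto
    also have "\<dots> = exp (\<rho> x) / 2 * dist g h" by (simp add: \<rho>_def exp_add)
    finally show ?thesis .
  qed
  \<comment> \<open>Freezing the argument at \<open>max 0 x\<close> extends the iterate to the whole
    line, on which the Banach space of bounded continuous functions is based.\<close>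
  define S where "S g x = exp (- \<rho> (max 0 x)) *\<^sub>R zz g (max 0 x)" for g x
  have z0: "zz 0 x = A + x *\<^sub>R B" if "x \<ge> 0" for x
  proof -
    have "zd 0 = (\<lambda>x. B)" by (simp add: zd_def fun_eq_iff)
    then show ?thesis using that by (simp add: zz_def)
  qed
  have Sdiff: "norm (S g x - S h x) \<le> 1/2 * dist g h" for g h x
  proof (cases "x > 0")
    case True
    have "norm (S g x - S h x) = exp (- \<rho> x) * norm (zz g x - zz h x)"
      using True by (simp add: S_def scaleR_diff_right[symmetric])
    also have "\<dots> \<le> exp (- \<rho> x) * (exp (\<rho> x) / 2 * dist g h)"
      using zdiff[OF True] by (intro mult_left_mono) auto
    also have "\<dots> = 1/2 * dist g h" by (simp add: exp_minus field_simps)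
    finally show ?thesis .
  next
    case False then show ?thesis by (simp add: S_def zz_def)
  qed
  have S0: "norm (S 0 x) \<le> norm A + norm B" for x
  proof -
    define m where "m = max 0 x"
    have m: "m \<ge> 0" by (simp add: m_def)
    have "norm (S 0 x) = exp (- \<rho> m) * norm (A + m *\<^sub>R B)" using z0[OF m] by (simp add: S_def m_def[symmetric])
    also have "\<dots> \<le> exp (- m) * (norm A + m * norm B)"
      using \<rho>0[of m] m by (intro mult_mono order_trans[OF norm_triangle_ineq]) auto
    also have "\<dots> = exp (-m) * norm A + (exp (-m) * m) * norm B" by (simp add: algebra_simps)
    also have "\<dots> \<le> 1 * norm A + 1 * norm B"
    proof (intro add_mono mult_right_mono)
      have "m \<le> exp m" using exp_ge_add_one_self[of m] by linarith
      then have "exp (-m) * m \<le> exp (-m) * exp m" by (intro mult_left_mono) auto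
      then show "exp (-m) * m \<le> 1" by (simp add: exp_minus)
    qed (use m in auto)
    finally show ?thesis by simp
  qed
  have Sb: "S g \<in> bcontfun" for g
  unfolding bcontfun_def mem_Collect_eq bounded_iff
  proof (intro conjI exI ballI)
    fix y assume "y \<in> range (S g)"
    then obtain x where "y = S g x" by blast
    then show "norm y \<le> norm A + norm B + 1/2 * dist g 0"
      using S0[of x] Sdiff[of g x 0] norm_triangle_ineq[of "S 0 x" "S g x - S 0 x"] by simp
  next
    have c: "continuous_on {0..} (\<lambda>x. exp (- \<rho> x) *\<^sub>R zz g x)"
      by (rule continuous_on_atLeast) (intro continuous_intros \<rho>c zzc)
    have "continuous_on UNIV ((\<lambda>x. exp (- \<rho> x) *\<^sub>R zz g x) \<circ> (\<lambda>x. max 0 x))"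
      by (rule continuous_on_compose) (auto intro!: continuous_intros continuous_on_subset[OF c])
    then show "continuous_on UNIV (S g)" by (simp add: S_def o_def)
  qed
  define T where "T g = Bcontfun (S g)" for g
  have Tapp: "apply_bcontfun (T g) x = S g x" for g x
    unfolding T_def using Sb[of g] by (simp add: Bcontfun_inverse)
  have "dist (T g) (T h) \<le> 1/2 * dist g h" for g h
    by (rule dist_bound) (simp only: Tapp dist_norm[of "S g _"] Sdiff)
  then have "\<exists>!g. T g = g" by (intro banach_fix_type[of "1/2"]) auto
  then obtain g where g: "T g = g" by blast
  have geq: "exp (\<rho> x) *\<^sub>R apply_bcontfun g x = zz g x" if "x \<ge> 0" for x
    using Tapp[of g x] that unfolding g S_def by (simp add: exp_minus)
  show ?thesis
  proof (rule exI[of _ "zz g"], rule exI[of _ "zd g"], intro conjI allI impI)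
    show "zz g 0 = A" "zd g 0 = B" by (simp_all add: zz_def zd_def)
    fix b :: real assume b: "b > 0"
    show "weak2 0 b (zz g) (zd g) (\<lambda>x. Q x * zz g x)"
      by (rule weak2_cong[OF w[OF b]]) (use geq in \<open>auto simp del: mult_scaleR_right\<close>)
  qed
qed

section \<open>Square integrable functions\<close>

text \<open>Square integrability on a tail, because functions glued at \<open>t\<close> are studied
  on the right part alone. For \<open>T = 0\<close> and complex values this is
  \<open>L2\<close>.\<close>

definition sq_int :: "real \<Rightarrow> (real \<Rightarrow> 'a::euclidean_space) \<Rightarrow> bool" where
  "sq_int T y \<longleftrightarrow> y \<in> borel_measurable (lebesgue_on {T..}) \<and> (\<lambda>x. (norm (y x))\<^sup>2) integrable_on {T..}"

lemma sq_intD: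
  assumes "sq_int T y"
  shows "y \<in> borel_measurable (lebesgue_on {T..})" "(\<lambda>x. (norm (y x))\<^sup>2) integrable_on {T..}"
  using assms unfolding sq_int_def by auto

lemma sq_int_absolutely_integrable:
  assumes "sq_int T y" shows "(\<lambda>x. (norm (y x))\<^sup>2) absolutely_integrable_on {T..}"
  using sq_intD(2)[OF assms] by (rule nonnegative_absolutely_integrable_1) auto

lemma sq_int_mono:
  assumes "sq_int T y" "T \<le> T'" shows "sq_int T' y"
  unfolding sq_int_def
proof
  show "y \<in> borel_measurable (lebesgue_on {T'..})"
    using measurable_restrict_mono[OF sq_intD(1)[OF assms(1)], of "{T'..}"] assms(2) by auto
  have "{T'..} \<in> sets lebesgue" by simp
  then have "(\<lambda>x. (norm (y x))\<^sup>2) absolutely_integrable_on {T'..}"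
    by (rule set_integrable_subset[OF sq_int_absolutely_integrable[OF assms(1)]]) (use assms(2) in auto)
  then show "(\<lambda>x. (norm (y x))\<^sup>2) integrable_on {T'..}" by (simp add: absolutely_integrable_on_def)
qed

lemma sq_int_dominated:
  fixes y :: "real \<Rightarrow> 'a::euclidean_space" and z :: "real \<Rightarrow> 'b::euclidean_space"
  assumes "sq_int T z" "y \<in> borel_measurable (lebesgue_on {T..})" "\<And>x. x \<ge> T \<Longrightarrow> norm (y x) \<le> C * norm (z x)"
  shows "sq_int T y"
  unfolding sq_int_def
proof
  have "(\<lambda>x. (norm (y x))\<^sup>2) absolutely_integrable_on {T..}"
  proof (rule measurable_bounded_by_integrable_imp_absolutely_integrable)
    show "(\<lambda>x. (norm (y x))\<^sup>2) \<in> borel_measurable (lebesgue_on {T..})" using assms(2) by measurable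
    show "(\<lambda>x. C\<^sup>2 * (norm (z x))\<^sup>2) integrable_on {T..}"
      using sq_intD(2)[OF assms(1)] by (rule integrable_on_mult_right)
    fix x assume "x \<in> {T..}"
    then have "(norm (y x))\<^sup>2 \<le> (C * norm (z x))\<^sup>2" using assms(3) by (intro power_mono) auto
    then show "norm ((norm (y x))\<^sup>2) \<le> C\<^sup>2 * (norm (z x))\<^sup>2" by (simp add: power_mult_distrib)
  qed auto
  then show "(\<lambda>x. (norm (y x))\<^sup>2) integrable_on {T..}" by (simp add: absolutely_integrable_on_def)
qed (rule assms(2))

lemma sq_int_add:
  fixes y z :: "real \<Rightarrow> 'a::euclidean_space"
  assumes y: "sq_int T y" and z: "sq_int T z" shows "sq_int T (\<lambda>x. y x + z x)"
  unfolding sq_int_def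
proof
  show m: "(\<lambda>x. y x + z x) \<in> borel_measurable (lebesgue_on {T..})"
    using sq_intD(1)[OF y] sq_intD(1)[OF z] by measurable
  have "(\<lambda>x. (norm (y x + z x))\<^sup>2) absolutely_integrable_on {T..}"
  proof (rule measurable_bounded_by_integrable_imp_absolutely_integrable)
    show "(\<lambda>x. (norm (y x + z x))\<^sup>2) \<in> borel_measurable (lebesgue_on {T..})" using m by measurable
    show "(\<lambda>x. 2 * (norm (y x))\<^sup>2 + 2 * (norm (z x))\<^sup>2) integrable_on {T..}"
      using sq_intD(2)[OF y] sq_intD(2)[OF z] by (intro integrable_add integrable_on_mult_right)
    fix x
    have "(norm (y x + z x))\<^sup>2 \<le> (norm (y x) + norm (z x))\<^sup>2" by (intro power_mono norm_triangle_ineq) auto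
    also have "\<dots> \<le> 2 * (norm (y x))\<^sup>2 + 2 * (norm (z x))\<^sup>2"
      using sum_squares_bound[of "norm (y x)" "norm (z x)"] by (simp add: power2_sum)
    finally show "norm ((norm (y x + z x))\<^sup>2) \<le> 2 * (norm (y x))\<^sup>2 + 2 * (norm (z x))\<^sup>2" by simp
  qed auto
  then show "(\<lambda>x. (norm (y x + z x))\<^sup>2) integrable_on {T..}" by (simp add: absolutely_integrable_on_def)
qed

lemma sq_int_linear_image:
  fixes f :: "'a::euclidean_space \<Rightarrow> 'b::euclidean_space"
  assumes "sq_int T y" "bounded_linear f" shows "sq_int T (\<lambda>x. f (y x))"
proof -
  obtain C where C: "\<And>x. norm (f x) \<le> norm x * C" using bounded_linear.bounded[OF assms(2)] by blast
  have "f \<in> borel_measurable borel"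
    using bounded_linear.continuous_on[OF assms(2) continuous_on_id] by (rule borel_measurable_continuous_onI)
  then have "(\<lambda>x. f (y x)) \<in> borel_measurable (lebesgue_on {T..})"
    using sq_intD(1)[OF assms(1)] by (rule measurable_compose[rotated])
  then show ?thesis
    by (rule sq_int_dominated[OF assms(1)]) (use C in \<open>simp add: mult.commute\<close>)
qed

lemma sq_int_scaleR:
  assumes "sq_int T y" shows "sq_int T (\<lambda>x. c *\<^sub>R y x)"
  using sq_int_linear_image[OF assms bounded_linear_scaleR_right] .

lemma sq_int_mult:
  fixes y z :: "real \<Rightarrow> 'a::{euclidean_space,real_normed_field}"
  assumes y: "sq_int T y" and z: "sq_int T z"
  shows "(\<lambda>x. y x * z x) absolutely_integrable_on {T..}"
proof (rule measurable_bounded_by_integrable_imp_absolutely_integrable)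
  show "(\<lambda>x. y x * z x) \<in> borel_measurable (lebesgue_on {T..})"
    using sq_intD(1)[OF y] sq_intD(1)[OF z] by measurable
  show "(\<lambda>x. (norm (y x))\<^sup>2 + (norm (z x))\<^sup>2) integrable_on {T..}"
    using sq_intD(2)[OF y] sq_intD(2)[OF z] by (intro integrable_add)
  fix x
  have "norm (y x) * norm (z x) \<le> (norm (y x))\<^sup>2 + (norm (z x))\<^sup>2"
  proof -
    have "0 \<le> norm (y x) * norm (z x)" by simp
    then show ?thesis using sum_squares_bound[of "norm (y x)" "norm (z x)"] by linarith
  qed
  then show "norm (y x * z x) \<le> (norm (y x))\<^sup>2 + (norm (z x))\<^sup>2" by (simp add: norm_mult)
qed auto

lemma sq_int_extend:
  fixes y :: "real \<Rightarrow> 'a::euclidean_space"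
  assumes "sq_int T' y" "T \<le> T'" and c: "continuous_on {T..T'} y"
  shows "sq_int T y"
  unfolding sq_int_def
proof
  have U: "{T..} = {T..T'} \<union> {T'..}" using assms(2) by auto
  have cc: "continuous_on {T..T'} (\<lambda>x. (norm (y x))\<^sup>2)" by (intro continuous_intros c)
  have "(\<lambda>x. (norm (y x))\<^sup>2) absolutely_integrable_on {T..}"
    unfolding U by (rule absolutely_integrable_Un[OF absolutely_integrable_continuous_real[OF cc] sq_int_absolutely_integrable[OF assms(1)]])
  then show "(\<lambda>x. (norm (y x))\<^sup>2) integrable_on {T..}" by (simp add: absolutely_integrable_on_def)
  show "y \<in> borel_measurable (lebesgue_on {T..})"
  proof -
    have s: "{T..} \<in> sets lebesgue" "{T'..} \<in> sets lebesgue" "{T..T'} \<in> sets lebesgue" by auto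
    have "(\<lambda>x. if x \<in> {T'..} then y x else 0) \<in> borel_measurable lebesgue"
      using sq_intD(1)[OF assms(1)] borel_measurable_if[OF s(2)] by blast
    moreover have "(\<lambda>x. if x \<in> {T..T'} then y x else 0) \<in> borel_measurable lebesgue"
      using continuous_imp_measurable_on_sets_lebesgue[OF c s(3)] borel_measurable_if[OF s(3)] by blast
    ultimately have "(\<lambda>x. if x \<in> {T'..} then (if x \<in> {T'..} then y x else 0) else (if x \<in> {T..T'} then y x else 0)) \<in> borel_measurable lebesgue"
      by (rule measurable_If) (use s in auto)
    also have "(\<lambda>x. if x \<in> {T'..} then (if x \<in> {T'..} then y x else 0) else (if x \<in> {T..T'} then y x else 0)) = (\<lambda>x. if x \<in> {T..} then y x else 0)"
      using assms(2) by (auto simp: fun_eq_iff)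
    finally show ?thesis using borel_measurable_if[OF s(1)] by blast
  qed
qed

lemma integral_tendsto_at_top:
  fixes f :: "real \<Rightarrow> 'a::euclidean_space"
  assumes "f absolutely_integrable_on {T..}"
  shows "((\<lambda>x. integral {T..x} f) \<longlongrightarrow> integral {T..} f) at_top"
proof -
  have "((\<lambda>x. set_lebesgue_integral lebesgue {T..x} f) \<longlongrightarrow> set_lebesgue_integral lebesgue {T..} f) at_top"
    by (rule tendsto_set_lebesgue_integral_at_top[OF _ assms]) simp
  moreover have "set_lebesgue_integral lebesgue {T..x} f = integral {T..x} f" for x
    by (rule set_lebesgue_integral_eq_integral(2)[OF set_integrable_subset[OF assms]]) auto
  ultimately show ?thesis using set_lebesgue_integral_eq_integral(2)[OF assms] by simp
qed

lemma absolutely_integrable_atLeast_subinterval: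
  fixes f :: "real \<Rightarrow> 'a::euclidean_space"
  assumes "f absolutely_integrable_on {T..}" "T \<le> a"
  shows "f absolutely_integrable_on {a..b}" "f absolutely_integrable_on {a..}"
  by (rule set_integrable_subset[OF assms(1)]; use assms(2) in auto)+

text \<open>Otherwise the integral of the modulus would grow linearly. This removes boundary terms
  at infinity: their limits exist by Green's formula, and they are products of square integrable
  functions.\<close>

lemma tendsto_absolutely_integrable_zero:
  fixes F :: "real \<Rightarrow> real"
  assumes F: "(F \<longlongrightarrow> L) at_top" and i: "F absolutely_integrable_on {T..}"
  shows "L = 0"
proof (rule ccontr)
  assume "L \<noteq> 0"
  then have L: "\<bar>L\<bar> / 2 > 0" by simp
  have "eventually (\<lambda>x. dist (F x) L < \<bar>L\<bar>/2) at_top" using F L by (rule tendstoD)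
  then obtain N0 where N0: "\<And>x. x \<ge> N0 \<Longrightarrow> dist (F x) L < \<bar>L\<bar>/2" by (auto simp: eventually_at_top_linorder)
  define N where "N = max N0 T"
  define M where "M = integral {T..} (\<lambda>x. \<bar>F x\<bar>)"
  have ia: "(\<lambda>x. \<bar>F x\<bar>) absolutely_integrable_on {T..}" using set_integrable_norm[OF i] by simp
  define x where "x = N + (M + 1) / (\<bar>L\<bar>/2)"
  have M0: "M \<ge> 0" unfolding M_def using ia by (intro integral_nonneg) (auto simp: absolutely_integrable_on_def)
  have x: "x \<ge> N" using M0 L by (simp add: x_def)
  have ix: "(\<lambda>x. \<bar>F x\<bar>) integrable_on {N..x}"
    using absolutely_integrable_atLeast_subinterval(1)[OF ia, of N x] by (simp add: absolutely_integrable_on_def N_def)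
  have "M + 1 = integral {N..x} (\<lambda>s. \<bar>L\<bar>/2)" using x L by (simp add: x_def)
  also have "\<dots> \<le> integral {N..x} (\<lambda>s. \<bar>F s\<bar>)"
  proof (rule integral_le[OF _ ix])
    fix s assume "s \<in> {N..x}"
    then have "dist (F s) L < \<bar>L\<bar>/2" using N0 by (auto simp: N_def)
    then show "\<bar>L\<bar>/2 \<le> \<bar>F s\<bar>" unfolding dist_real_def by linarith
  qed auto
  also have "\<dots> \<le> M" unfolding M_def
    by (rule integral_subset_le[OF _ ix]) (use ia in \<open>auto simp: absolutely_integrable_on_def N_def\<close>)
  finally show False by simp
qed

lemma nonneg_bounded_integral_integrable:
  fixes f :: "real \<Rightarrow> real"
  assumes i: "\<And>b. b \<ge> T \<Longrightarrow> f integrable_on {T..b}" and nn: "\<And>x. x \<ge> T \<Longrightarrow> f x \<ge> 0"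
    and C: "\<And>b. b \<ge> T \<Longrightarrow> integral {T..b} f \<le> C"
  shows "f integrable_on {T..}"
proof -
  define g where "g n x = (if x \<in> {T..T + real n} then f x else 0)" for n :: nat and x
  have ig: "g n integrable_on {T..}" "integral {T..} (g n) = integral {T..T + real n} f" for n
  proof -
    have "(g n has_integral integral {T..T + real n} f) {T..}"
      unfolding g_def using i[of "T + real n"]
      by (subst has_integral_restrict) (auto intro: integrable_integral)
    then show "g n integrable_on {T..}" "integral {T..} (g n) = integral {T..T + real n} f" by (auto simp: integral_unique)
  qed
  have "f integrable_on {T..} \<and> (\<lambda>n. integral {T..} (g n)) \<longlonglongrightarrow> integral {T..} f"
  proof (rule monotone_convergence_increasing)
    fix n x assume "x \<in> {T..}"
    then show "g n x \<le> g (Suc n) x" using nn by (auto simp: g_def)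
  next
    fix x assume x: "x \<in> {T..}"
    obtain m :: nat where m: "x - T \<le> real m" using real_arch_simple by blast
    have "eventually (\<lambda>n. g n x = f x) sequentially"
      using eventually_ge_at_top[of m] by eventually_elim (use m x in \<open>auto simp: g_def\<close>)
    then show "(\<lambda>n. g n x) \<longlonglongrightarrow> f x" by (rule tendsto_eventually)
  next
    show "bounded (range (\<lambda>n. integral {T..} (g n)))"
      unfolding bounded_iff
    proof (intro exI ballI)
      fix v assume "v \<in> range (\<lambda>n. integral {T..} (g n))"
      then obtain n where "v = integral {T..T + real n} f" using ig by auto
      moreover have "integral {T..T + real n} f \<ge> 0" using i[of "T + real n"] nn by (intro integral_nonneg) auto
      ultimately show "norm v \<le> C" using C[of "T + real n"] by simp
    qed
  qed (rule ig)
  then show ?thesis by blast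
qed

text \<open>Behind two Cauchy-Schwarz inequalities: the one for integrals, and the one for the
  quadratic form of the operator shifted to the bottom of its numerical range.\<close>

lemma discriminant_nonpos:
  fixes a b c :: real
  assumes "\<And>s. 0 \<le> a + 2 * s * b + s\<^sup>2 * c"
  shows "b\<^sup>2 \<le> a * c"
proof (cases "c = 0")
  case True
  have "b = 0"
  proof (rule ccontr)
    assume "b \<noteq> 0"
    then show False using assms[of "- (a + 1) / (2 * b)"] True by (simp add: field_simps)
  qed
  then show ?thesis using True by simp
next
  case False
  have c0: "c > 0"
  proof (rule ccontr)
    assume "\<not> c > 0"
    then have c: "c < 0" using False by simp
    define s where "s = (\<bar>a\<bar> + 2 * \<bar>b\<bar> + 1) / (- c) + 1"
    have s1: "s \<ge> 1" using c by (simp add: s_def divide_nonneg_neg)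
    have "s * (- c) > \<bar>a\<bar> + 2 * \<bar>b\<bar>" using c by (simp add: s_def field_simps)
    then have "s * (s * (- c)) > s * (\<bar>a\<bar> + 2 * \<bar>b\<bar>)" using s1 by (intro mult_strict_left_mono) auto
    moreover have "s * \<bar>a\<bar> \<ge> a" using s1 mult_right_mono[of 1 s "\<bar>a\<bar>"] by auto
    moreover have "s * \<bar>b\<bar> \<ge> s * b" using s1 by (intro mult_left_mono) auto
    ultimately have "a + 2 * s * b + s\<^sup>2 * c < 0" by (simp add: power2_eq_square algebra_simps)
    then show False using assms[of s] by simp
  qed
  have "0 \<le> c * (a + 2 * (- b / c) * b + (- b / c)\<^sup>2 * c)" using assms[of "- b / c"] c0 by (intro mult_nonneg_nonneg) auto
  also have "\<dots> = a * c - b\<^sup>2" using c0 by (simp add: field_simps power2_eq_square)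
  finally show ?thesis by simp
qed

lemma integral_Cauchy_Schwarz:
  fixes y z :: "real \<Rightarrow> real"
  assumes y: "(\<lambda>x. (y x)\<^sup>2) integrable_on S" and z: "(\<lambda>x. (z x)\<^sup>2) integrable_on S" and yz: "(\<lambda>x. y x * z x) integrable_on S"
  shows "(integral S (\<lambda>x. y x * z x))\<^sup>2 \<le> integral S (\<lambda>x. (y x)\<^sup>2) * integral S (\<lambda>x. (z x)\<^sup>2)"
proof -
  define a b c where "a = integral S (\<lambda>x. (y x)\<^sup>2)" and "b = integral S (\<lambda>x. y x * z x)" and "c = integral S (\<lambda>x. (z x)\<^sup>2)"
  have "0 \<le> a + 2 * t * b + t\<^sup>2 * c" for t
  proof -
    have "((\<lambda>x. (y x)\<^sup>2 + (2 * t) * (y x * z x) + t\<^sup>2 * (z x)\<^sup>2) has_integral (a + 2 * t * b + t\<^sup>2 * c)) S"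
      unfolding a_def b_def c_def
      by (intro has_integral_add has_integral_mult_right integrable_integral y z yz)
    moreover have "(y x)\<^sup>2 + (2 * t) * (y x * z x) + t\<^sup>2 * (z x)\<^sup>2 = (y x + t * z x)\<^sup>2" for x
      by (simp add: power2_sum power_mult_distrib)
    ultimately show ?thesis by (metis (no_types, lifting) has_integral_nonneg zero_le_power2)
  qed
  from discriminant_nonpos[OF this] show ?thesis by (simp add: a_def b_def c_def)
qed

lemma L2_iff_sq_int: "y \<in> L2 \<longleftrightarrow> sq_int 0 y"
proof -
  have "integrable (lebesgue_on {0..}) (\<lambda>x. (norm (y x))\<^sup>2) \<longleftrightarrow> (\<lambda>x. (norm (y x))\<^sup>2) absolutely_integrable_on {0..}"
    by (simp add: integrable_restrict_space set_integrable_def)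
  also have "\<dots> \<longleftrightarrow> (\<lambda>x. (norm (y x))\<^sup>2) integrable_on {0..}"
    by (auto simp: absolutely_integrable_on_def)
  finally show ?thesis by (simp add: L2_def sq_int_def)
qed

lemma sq_int_locally_integrable:
  fixes k :: "real \<Rightarrow> 'a::euclidean_space"
  assumes "sq_int T k" "T \<le> a" shows "k absolutely_integrable_on {a..b}"
proof (rule measurable_bounded_by_integrable_imp_absolutely_integrable)
  show "k \<in> borel_measurable (lebesgue_on {a..b})"
    by (rule measurable_restrict_mono[OF sq_intD(1)[OF assms(1)]]) (use assms(2) in auto)
  show "(\<lambda>x. 1 + (norm (k x))\<^sup>2) integrable_on {a..b}"
    using absolutely_integrable_atLeast_subinterval(1)[OF sq_int_absolutely_integrable[OF assms(1)] assms(2), of b]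
    by (intro integrable_add) (auto simp: absolutely_integrable_on_def)
  show "norm (k x) \<le> 1 + (norm (k x))\<^sup>2" for x
  proof -
    have "2 * norm (k x) \<le> 1 + (norm (k x))\<^sup>2" using sum_squares_bound[of 1 "norm (k x)"] by simp
    then show ?thesis using norm_ge_zero[of "k x"] by linarith
  qed
qed auto

lemma L1_locD: "L1_loc q \<Longrightarrow> b > 0 \<Longrightarrow> q absolutely_integrable_on {0..b}"
  unfolding L1_loc_def by simp

lemma L1_loc_subinterval: "L1_loc q \<Longrightarrow> 0 \<le> a \<Longrightarrow> q absolutely_integrable_on {a..b}"
proof -
  assume q: "L1_loc q" and a: "0 \<le> a"
  show "q absolutely_integrable_on {a..b}"
    by (rule absolutely_integrable_on_subinterval[OF L1_locD[OF q, of "max 1 b"]]) (use a in auto)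
qed

text \<open>By the definition of \<open>tau\<close> the second derivative equals
  \<open>q y - tau q y\<close> pointwise; its local integrability comes from the continuity of
  \<open>y\<close> and the square integrability of \<open>tau q y\<close>.\<close>

lemma AC1_loc_tau:
  assumes q: "L1_loc q" and y: "AC1_loc I y" and I: "I \<subseteq> {0..}" and k: "sq_int 0 (tau q y)"
  shows "weak2_on I y (D\<^sub>x y) (\<lambda>x. of_real (q x) * y x - tau q y x)"
proof -
  have eq: "D\<^sub>x (D\<^sub>x y) = (\<lambda>x. of_real (q x) * y x - tau q y x)" by (simp add: tau_def fun_eq_iff)
  show ?thesis unfolding eq[symmetric]
  proof (rule AC1_loc_imp_weak2_on[OF y I])
    fix a b :: real assume ab: "a < b" "{a..b} \<subseteq> I"
    then have a: "0 \<le> a" using subsetD[OF ab(2), of a] subsetD[OF I, of a] by simp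
    have "abs_cont_on a b y" using y ab unfolding AC1_loc_def AC_loc_def by blast
    then have c: "continuous_on {a..b} y" by (rule abs_cont_on_imp_continuous_on)
    have "(\<lambda>x. complex_of_real (q x)) absolutely_integrable_on {a..b}"
      using absolutely_integrable_linear[OF L1_loc_subinterval[OF q a] bounded_linear_of_real] by (simp add: o_def)
    then have "(\<lambda>x. y x * of_real (q x)) absolutely_integrable_on {a..b}" by (rule absolutely_integrable_continuous_mult[OF c])
    then have "(\<lambda>x. y x * of_real (q x) - tau q y x) absolutely_integrable_on {a..b}"
      using sq_int_locally_integrable[OF k a] by (rule set_integral_diff(1))
    then show "D\<^sub>x (D\<^sub>x y) absolutely_integrable_on {a..b}" unfolding eq by (simp add: mult.commute)
  qed
qed

section \<open>The boundary condition at infinity\<close>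

text \<open>The derivative is a separate argument because the functions tested here may be solutions
  on \<open>{t..}\<close> only, known through \<open>weak2\<close>.\<close>

fun bc_real :: "endpoint \<Rightarrow> (real \<Rightarrow> real) \<Rightarrow> (real \<Rightarrow> real) \<Rightarrow> bool" where
  "bc_real No_BC y y' \<longleftrightarrow> True"
| "bc_real (BC f g \<beta>) y y' \<longleftrightarrow>
    (\<exists>A B. ((\<lambda>x. y x * D\<^sub>x f x - f x * y' x) \<longlongrightarrow> A) at_top \<and>
           ((\<lambda>x. y x * D\<^sub>x g x - g x * y' x) \<longlongrightarrow> B) at_top \<and> A * sin \<beta> = B * cos \<beta>)"

text \<open>Membership in the maximal domain near infinity; \<open>k\<close> is the function
  \<open>tau q y\<close>.\<close>

definition end_sol :: "(real \<Rightarrow> real) \<Rightarrow> real \<Rightarrow> (real \<Rightarrow> real) \<Rightarrow> (real \<Rightarrow> real) \<Rightarrow> (real \<Rightarrow> real) \<Rightarrow> bool" where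
  "end_sol q T y y' k \<longleftrightarrow> weak2_on {T..} y y' (\<lambda>x. q x * y x - k x) \<and> sq_int T y \<and> sq_int T k"

lemma end_solD:
  assumes "end_sol q T y y' k"
  shows "T < b \<Longrightarrow> weak2 T b y y' (\<lambda>x. q x * y x - k x)" "sq_int T y" "sq_int T k"
  using assms unfolding end_sol_def by (auto intro: weak2_onD)

lemma end_sol_mono:
  assumes "end_sol q T y y' k" "T \<le> T'" shows "end_sol q T' y y' k"
  using assms unfolding end_sol_def by (auto intro: sq_int_mono weak2_on_subset)

lemma end_sol_continuous:
  assumes "end_sol q T y y' k" shows "continuous_on {T..} y" "continuous_on {T..} y'"
  by (rule continuous_on_atLeast, rule weak2_continuous[OF end_solD(1)[OF assms]], simp)+

lemma continuous_on_atLeast_measurable: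
  fixes f :: "real \<Rightarrow> 'a::euclidean_space"
  assumes "continuous_on {T..} f" shows "f \<in> borel_measurable (lebesgue_on {T..})"
  by (rule continuous_imp_measurable_on_sets_lebesgue[OF assms]) simp

lemma end_sol_wronskian_diff:
  assumes y: "end_sol q T y y' k" and z: "end_sol q T z z' m" and x: "x \<ge> T"
  shows "(y x * z' x - z x * y' x) = (y T * z' T - z T * y' T) + integral {T..x} (\<lambda>s. z s * k s - y s * m s)"
proof (cases "x = T")
  case False
  then have x: "x > T" using x by simp
  have "((\<lambda>s. y s * (q s * z s - m s) - z s * (q s * y s - k s)) has_integral
      ((y x * z' x - z x * y' x) - (y T * z' T - z T * y' T))) {T..x}"
    by (rule weak2_wronskian[OF end_solD(1)[OF y x] end_solD(1)[OF z x]]) (use x in auto)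
  moreover have "(\<lambda>s. y s * (q s * z s - m s) - z s * (q s * y s - k s)) = (\<lambda>s. z s * k s - y s * m s)"
    by (simp add: fun_eq_iff algebra_simps)
  ultimately show ?thesis by (simp add: integral_unique)
qed simp

lemma end_sol_wronskian_integrand:
  assumes y: "end_sol q T y y' k" and z: "end_sol q T z z' m"
  shows "(\<lambda>s. z s * k s - y s * m s) absolutely_integrable_on {T..}"
proof -
  have 1: "(\<lambda>s. z s * k s) absolutely_integrable_on {T..}" using end_solD(2)[OF z] end_solD(3)[OF y] by (rule sq_int_mult)
  have 2: "(\<lambda>s. y s * m s) absolutely_integrable_on {T..}" using end_solD(2)[OF y] end_solD(3)[OF z] by (rule sq_int_mult)
  show ?thesis using 1 2 by (rule set_integral_diff(1))
qed

lemma end_sol_wronskian_limit: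
  assumes y: "end_sol q T y y' k" and z: "end_sol q T z z' m"
  shows "((\<lambda>x. y x * z' x - z x * y' x) \<longlongrightarrow>
           (y T * z' T - z T * y' T) + integral {T..} (\<lambda>s. z s * k s - y s * m s)) at_top"
proof -
  have "((\<lambda>x. (y T * z' T - z T * y' T) + integral {T..x} (\<lambda>s. z s * k s - y s * m s)) \<longlongrightarrow>
           (y T * z' T - z T * y' T) + integral {T..} (\<lambda>s. z s * k s - y s * m s)) at_top"
    by (rule tendsto_add[OF tendsto_const integral_tendsto_at_top[OF end_sol_wronskian_integrand[OF y z]]])
  then show ?thesis
  proof (rule Lim_transform_eventually)
    show "eventually (\<lambda>x. (y T * z' T - z T * y' T) + integral {T..x} (\<lambda>s. z s * k s - y s * m s) = y x * z' x - z x * y' x) at_top"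
      using eventually_ge_at_top[of T] by eventually_elim (rule end_sol_wronskian_diff[OF y z, symmetric])
  qed
qed

text \<open>If the potential is non-negative, \<open>y y'\<close> differs by a convergent term from the nondecreasing function
  \<open>\<integral> y'\<^sup>2 + q y\<^sup>2\<close>; if the latter were unbounded, \<open>y\<^sup>2\<close> would grow at least linearly.\<close>

lemma end_sol_nonneg:
  assumes q: "AE x in lebesgue_on {0..}. 0 \<le> q x" and T: "T \<ge> 0" and y: "end_sol q T y y' k"
  shows "sq_int T y'" "((\<lambda>x. y x * y' x) \<longlongrightarrow> 0) at_top"
    "integral {T..} (\<lambda>x. y x * k x) \<ge> y T * y' T"
proof -
  define N where "N = {x\<in>{0..}. \<not> 0 \<le> q x}"
  have N: "negligible N" using q unfolding N_def by (subst (asm) AE_lebesgue_on_iff) auto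
  define J where "J x = y x * y' x - y T * y' T + integral {T..x} (\<lambda>s. y s * k s)" for x
  have yk: "(\<lambda>s. y s * k s) absolutely_integrable_on {T..}" using end_solD(2)[OF y] end_solD(3)[OF y] by (rule sq_int_mult)
  have ykl: "((\<lambda>x. integral {T..x} (\<lambda>s. y s * k s)) \<longlongrightarrow> integral {T..} (\<lambda>s. y s * k s)) at_top"
    by (rule integral_tendsto_at_top[OF yk])
  have y'c: "continuous_on {a..b} (\<lambda>s. (y' s)\<^sup>2)" if "T \<le> a" for a b
    by (intro continuous_intros continuous_on_subset[OF end_sol_continuous(2)[OF y]]) (use that in auto)
  have Jd: "J v - J u \<ge> integral {u..v} (\<lambda>s. (y' s)\<^sup>2)" if uv: "T \<le> u" "u \<le> v" for u v
  proof (cases "u = v")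
    case False
    then have v: "T < v" using uv by auto
    have 1: "((\<lambda>x. y x * (q x * y x - k x) + y' x * y' x) has_integral (y v * y' v - y u * y' u)) {u..v}"
      by (rule weak2_by_parts(1)[OF end_solD(1)[OF y v] end_solD(1)[OF y v]]) (use uv in auto)
    have iv: "(\<lambda>s. y s * k s) integrable_on {u..v}" "(\<lambda>s. y s * k s) integrable_on {T..v}" "(\<lambda>s. y s * k s) integrable_on {T..u}"
      using absolutely_integrable_atLeast_subinterval(1)[OF yk] uv by (auto simp: absolutely_integrable_on_def)
    have 2: "((\<lambda>s. y s * k s) has_integral (integral {T..v} (\<lambda>s. y s * k s) - integral {T..u} (\<lambda>s. y s * k s))) {u..v}"
      using Henstock_Kurzweil_Integration.integral_combine[of T u v, OF _ _ iv(2)] iv(1) uv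
      by (metis add_diff_cancel_left' integrable_integral)
    have 3: "((\<lambda>s. q s * (y s)\<^sup>2 + (y' s)\<^sup>2) has_integral (J v - J u)) {u..v}"
      using has_integral_add[OF 1 2] unfolding J_def
      by (rule has_integral_eq_rhs[OF has_integral_eq[rotated]]) (auto simp: algebra_simps power2_eq_square)
    \<comment> \<open>The potential may be negative on the null set \<open>N\<close>; the integrand
      is overwritten there to permit a pointwise comparison.\<close>
    have 4: "((\<lambda>s. if s \<in> N then (y' s)\<^sup>2 else q s * (y s)\<^sup>2 + (y' s)\<^sup>2) has_integral (J v - J u)) {u..v}"
      by (rule has_integral_spike[OF N _ 3]) auto
    show ?thesis
    proof (rule has_integral_le[OF integrable_integral 4])
      show "(\<lambda>s. (y' s)\<^sup>2) integrable_on {u..v}" by (rule integrable_continuous_real[OF y'c[OF uv(1)]])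
      fix s assume s: "s \<in> {u..v}"
      show "(y' s)\<^sup>2 \<le> (if s \<in> N then (y' s)\<^sup>2 else q s * (y s)\<^sup>2 + (y' s)\<^sup>2)"
        using s T uv by (auto simp: N_def)
    qed
  qed simp
  have Jmono: "J u \<le> J v" if uv: "T \<le> u" "u \<le> v" for u v
  proof -
    have "integral {u..v} (\<lambda>s. (y' s)\<^sup>2) \<ge> 0"
      by (rule integral_nonneg[OF integrable_continuous_real[OF y'c[OF uv(1)]]]) simp
    then show ?thesis using Jd[OF uv] by linarith
  qed
  have "\<exists>C. \<forall>x\<ge>T. J x \<le> C"
  proof (rule ccontr)
    assume unb: "\<not> (\<exists>C. \<forall>x\<ge>T. J x \<le> C)"
    define M where "M = integral {T..} (\<lambda>s. \<bar>y s * k s\<bar>)"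
    have Mb: "\<bar>integral {T..x} (\<lambda>s. y s * k s)\<bar> \<le> M" for x
    proof -
      have a: "(\<lambda>s. \<bar>y s * k s\<bar>) integrable_on {T..x}" "(\<lambda>s. \<bar>y s * k s\<bar>) integrable_on {T..}" "(\<lambda>s. y s * k s) integrable_on {T..x}"
        using absolutely_integrable_atLeast_subinterval(1)[OF yk, of T x] yk by (auto simp: absolutely_integrable_on_def)
      have "norm (integral {T..x} (\<lambda>s. y s * k s)) \<le> integral {T..x} (\<lambda>s. \<bar>y s * k s\<bar>)"
        by (rule integral_norm_bound_integral) (use a in auto)
      also have "\<dots> \<le> M" unfolding M_def by (rule integral_subset_le) (use a in auto)
      finally show ?thesis by simp
    qed
    obtain x0 where x0: "x0 \<ge> T" "J x0 > 1 + M - y T * y' T" using unb by (meson not_le)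
    have big: "y x * y' x \<ge> 1" if "x \<ge> x0" for x
      using Jmono[OF x0(1) that] x0(2) Mb[of x] unfolding J_def[of x] by (simp add: abs_le_iff)
    have ge: "(y x)\<^sup>2 \<ge> 2 * (x - x0)" if x: "x > x0" for x
    proof -
      have w: "weak2 T x y y' (\<lambda>x. q x * y x - k x)" using end_solD(1)[OF y] x x0 by auto
      have "((\<lambda>s. y s * y' s + y' s * y s) has_integral (y x * y x - y x0 * y x0)) {x0..x}"
      proof (rule fundamental_theorem_of_calculus)
        fix s assume s: "s \<in> {x0..x}"
        have "(y has_vector_derivative y' s) (at s within {x0..x})"
          by (rule has_vector_derivative_within_subset[OF weak2D(1)[OF w]]) (use s x0 in auto)
        from has_vector_derivative_mult[OF this this]
        show "((\<lambda>s. y s * y s) has_vector_derivative y s * y' s + y' s * y s) (at s within {x0..x})" .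
      qed (use x in auto)
      moreover have "((\<lambda>s. 2) has_integral 2 * (x - x0)) {x0..x}"
        by (rule has_integral_eq_rhs[OF has_integral_const_real]) (use x in simp)
      ultimately have i: "((\<lambda>s. y s * y' s + y' s * y s) has_integral (y x * y x - y x0 * y x0)) {x0..x}"
        "((\<lambda>s. 2) has_integral 2 * (x - x0)) {x0..x}" by blast+
      have "2 * (x - x0) \<le> y x * y x - y x0 * y x0"
      proof (rule has_integral_le[OF i(2,1)])
        fix s assume "s \<in> {x0..x}"
        then have "y s * y' s \<ge> 1" using big by auto
        then show "2 \<le> y s * y' s + y' s * y s" by (simp add: mult.commute)
      qed
      moreover have "y x0 * y x0 \<ge> 0" by simp
      ultimately show ?thesis unfolding power2_eq_square by linarith
    qed
    define S where "S = integral {T..} (\<lambda>s. (y s)\<^sup>2)"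
    have yi: "(\<lambda>s. (y s)\<^sup>2) absolutely_integrable_on {T..}" using sq_int_absolutely_integrable[OF end_solD(2)[OF y]] by simp
    have S0: "S \<ge> 0" unfolding S_def using yi by (intro integral_nonneg) (auto simp: absolutely_integrable_on_def)
    define a where "a = x0 + 1"
    have ia: "(\<lambda>s. (y s)\<^sup>2) integrable_on {a..a + S + 1}"
      using absolutely_integrable_atLeast_subinterval(1)[OF yi, of a] x0 by (auto simp: absolutely_integrable_on_def a_def)
    have "S + 1 \<le> integral {a..a + S + 1} (\<lambda>s. 2)" using S0 by simp
    also have "\<dots> \<le> integral {a..a + S + 1} (\<lambda>s. (y s)\<^sup>2)"
    proof (rule integral_le[OF _ ia])
      fix s assume "s \<in> {a..a + S + 1}"
      then show "2 \<le> (y s)\<^sup>2" using ge[of s] by (auto simp: a_def)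
    qed auto
    also have "\<dots> \<le> integral {T..} (\<lambda>s. (y s)\<^sup>2)"
      by (rule integral_subset_le[OF _ ia]) (use yi x0 in \<open>auto simp: absolutely_integrable_on_def a_def\<close>)
    finally show False unfolding S_def by simp
  qed
  then obtain C where C: "\<And>x. x \<ge> T \<Longrightarrow> J x \<le> C" by blast
  have JT: "J T = 0" by (simp add: J_def)
  show sq: "sq_int T y'"
    unfolding sq_int_def
  proof
    show "y' \<in> borel_measurable (lebesgue_on {T..})" by (rule continuous_on_atLeast_measurable[OF end_sol_continuous(2)[OF y]])
    have "(\<lambda>x. (y' x)\<^sup>2) integrable_on {T..}"
    proof (rule nonneg_bounded_integral_integrable)
      show "(\<lambda>x. (y' x)\<^sup>2) integrable_on {T..b}" for b by (rule integrable_continuous_real[OF y'c]) simp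
      show "integral {T..b} (\<lambda>x. (y' x)\<^sup>2) \<le> C" if "b \<ge> T" for b using Jd[of T b] C[OF that] that JT by simp
    qed auto
    then show "(\<lambda>x. (norm (y' x))\<^sup>2) integrable_on {T..}" by simp
  qed
  define L where "L = (SUP x\<in>{T..}. J x)"
  have bdd: "bdd_above (J ` {T..})" using C by (intro bdd_aboveI2) auto
  have Jl: "(J \<longlongrightarrow> L) at_top"
  proof (rule order_tendstoI)
    fix a assume "a < L"
    then obtain x where x: "x \<in> {T..}" "a < J x" unfolding L_def using less_cSUP_iff[OF _ bdd] by auto
    show "eventually (\<lambda>x. a < J x) at_top"
      using eventually_ge_at_top[of x] by eventually_elim (use Jmono x in \<open>auto intro: less_le_trans\<close>)
  next
    fix a assume a: "L < a"
    show "eventually (\<lambda>x. J x < a) at_top"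
      using eventually_ge_at_top[of T]
    proof eventually_elim
      case (elim x)
      then have "J x \<le> L" unfolding L_def using bdd by (intro cSUP_upper) auto
      then show ?case using a by linarith
    qed
  qed
  have L0: "L \<ge> 0" using JT bdd unfolding L_def by (intro cSUP_upper2[of _ _ T]) auto
  have "((\<lambda>x. J x + y T * y' T - integral {T..x} (\<lambda>s. y s * k s)) \<longlongrightarrow> L + y T * y' T - integral {T..} (\<lambda>s. y s * k s)) at_top"
    by (rule tendsto_diff[OF tendsto_add[OF Jl tendsto_const] ykl])
  then have lim: "((\<lambda>x. y x * y' x) \<longlongrightarrow> L + y T * y' T - integral {T..} (\<lambda>s. y s * k s)) at_top"
    by (simp add: J_def)
  \<comment> \<open>The product \<open>y y'\<close> has a limit and is integrable, so the limit is
    0. Hence \<open>L\<close>, the total energy, equals the difference of the two sides of the last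
    claim, and \<open>L\<close> is nonnegative.\<close>
  have z: "L + y T * y' T - integral {T..} (\<lambda>s. y s * k s) = 0"
  proof -
    have "(\<lambda>x. y x * y' x) absolutely_integrable_on {T..}" using end_solD(2)[OF y] sq by (rule sq_int_mult)
    with lim show ?thesis by (rule tendsto_absolutely_integrable_zero)
  qed
  show "((\<lambda>x. y x * y' x) \<longlongrightarrow> 0) at_top" using lim z by simp
  show "integral {T..} (\<lambda>x. y x * k x) \<ge> y T * y' T" using z L0 by linarith
qed

lemma max_dom_real:
  assumes q: "L1_loc q" and f: "(\<lambda>x. complex_of_real (f x)) \<in> max_dom q"
  shows "end_sol q 0 f (D\<^sub>x f) (\<lambda>x. Re (tau q (\<lambda>x. of_real (f x)) x))"
    "\<And>x. x \<ge> 0 \<Longrightarrow> D\<^sub>x (\<lambda>x. complex_of_real (f x)) x = of_real (D\<^sub>x f x)"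
proof -
  define F where "F x = complex_of_real (f x)" for x
  have F: "F \<in> L2" "AC1_loc {0..} F" "tau q F \<in> L2" using f by (auto simp: max_dom_def F_def[abs_def])
  have w: "weak2_on {0..} F (D\<^sub>x F) (\<lambda>x. of_real (q x) * F x - tau q F x)"
    using AC1_loc_tau[OF q F(2)] F(3) by (simp add: L2_iff_sq_int)
  have der: "D\<^sub>x F x = of_real (D\<^sub>x f x)" "Re (D\<^sub>x F x) = D\<^sub>x f x" if x: "x \<ge> 0" for x
  proof -
    have "F differentiable (at x within {0..})" using F(2) x by (auto simp: AC1_loc_def)
    then have d: "(F has_vector_derivative D\<^sub>x F x) (at x within {0..})"
      unfolding D\<^sub>x_def by (simp add: vector_derivative_works)
    have "((\<lambda>x. Re (F x)) has_vector_derivative Re (D\<^sub>x F x)) (at x within {0..})"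
      using bounded_linear.has_vector_derivative[OF bounded_linear_Re d] .
    then have "(f has_vector_derivative Re (D\<^sub>x F x)) (at x within {0..})" by (simp add: F_def)
    then show R: "Re (D\<^sub>x F x) = D\<^sub>x f x" by (rule has_vector_derivative_D\<^sub>x[OF x, symmetric])
    have "((\<lambda>x. Im (F x)) has_vector_derivative Im (D\<^sub>x F x)) (at x within {0..})"
      using bounded_linear.has_vector_derivative[OF bounded_linear_Im d] .
    then have "D\<^sub>x (\<lambda>x. Im (F x)) x = Im (D\<^sub>x F x)" by (rule has_vector_derivative_D\<^sub>x[OF x])
    moreover have "D\<^sub>x (\<lambda>x. Im (F x)) x = 0"
      by (rule has_vector_derivative_D\<^sub>x[OF x]) (simp add: F_def)
    ultimately show "D\<^sub>x F x = of_real (D\<^sub>x f x)" using R by (simp add: complex_eq_iff)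
  qed
  show "D\<^sub>x (\<lambda>x. complex_of_real (f x)) x = of_real (D\<^sub>x f x)" if "x \<ge> 0" for x
    using der(1)[OF that] unfolding F_def .
  have "weak2_on {0..} f (D\<^sub>x f) (\<lambda>x. q x * f x - Re (tau q F x))"
    unfolding weak2_on_def
  proof (intro allI impI)
    fix a b :: real assume ab: "a < b \<and> {a..b} \<subseteq> {0..}"
    show "weak2 a b f (D\<^sub>x f) (\<lambda>x. q x * f x - Re (tau q F x))"
      by (rule weak2_cong[OF weak2_linear_image[OF weak2_onD[OF w] bounded_linear_Re]])
        (use ab der(2) in \<open>auto simp: F_def\<close>)
  qed
  moreover have "sq_int 0 (\<lambda>x. Re (F x))" "sq_int 0 (\<lambda>x. Re (tau q F x))"
    using sq_int_linear_image[OF _ bounded_linear_Re] F by (auto simp: L2_iff_sq_int)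
  ultimately show "end_sol q 0 f (D\<^sub>x f) (\<lambda>x. Re (tau q (\<lambda>x. of_real (f x)) x))"
    by (simp add: end_sol_def F_def[abs_def])
qed

lemma bracket_of_real:
  assumes q: "L1_loc q" and f: "(\<lambda>x. complex_of_real (f x)) \<in> max_dom q" and x: "x \<ge> 0"
  shows "bracket y (\<lambda>x. of_real (f x)) x = y x * of_real (D\<^sub>x f x) - of_real (f x) * D\<^sub>x y x"
  using max_dom_real(2)[OF q f x] by (simp add: bracket_def)

text \<open>Two vectors annihilated by the same nonzero linear form of the plane are
  proportional.\<close>

lemma tendsto_proportional:
  fixes A B c s :: real
  assumes "A * s = B * c" "A' * s = B' * c" "s \<noteq> 0 \<or> c \<noteq> 0"
  shows "A * B' - B * A' = 0"
proof (cases "s = 0")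
  case True
  then have "B = 0" "B' = 0" using assms by auto
  then show ?thesis by simp
next
  case False
  have "s * (A * B' - B * A') = (A * s) * B' - B * (A' * s)" by (simp add: algebra_simps)
  also have "\<dots> = 0" using assms(1,2) by simp
  finally show ?thesis using False by simp
qed

lemma BC_bracket_limit:
  assumes q: "L1_loc q" and adm: "admissible q (BC f g \<beta>)"
  shows "((\<lambda>x. f x * D\<^sub>x g x - g x * D\<^sub>x f x) \<longlongrightarrow> 1) at_top"
proof -
  have f: "(\<lambda>x. complex_of_real (f x)) \<in> max_dom q" and g: "(\<lambda>x. complex_of_real (g x)) \<in> max_dom q"
    and l: "(bracket (\<lambda>x. of_real (f x)) (\<lambda>x. of_real (g x)) \<longlongrightarrow> 1) at_top" using adm by auto
  have "((\<lambda>x. Re (bracket (\<lambda>x. of_real (f x)) (\<lambda>x. of_real (g x)) x)) \<longlongrightarrow> Re 1) at_top" by (rule tendsto_Re[OF l])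
  then have "((\<lambda>x. Re (bracket (\<lambda>x. of_real (f x)) (\<lambda>x. of_real (g x)) x)) \<longlongrightarrow> 1) at_top" by simp
  then show ?thesis
  proof (rule Lim_transform_eventually)
    show "eventually (\<lambda>x. Re (bracket (\<lambda>x. of_real (f x)) (\<lambda>x. of_real (g x)) x) = f x * D\<^sub>x g x - g x * D\<^sub>x f x) at_top"
      using eventually_ge_at_top[of 0]
      by eventually_elim (simp add: bracket_of_real[OF q g] max_dom_real(2)[OF q f])
  qed
qed

text \<open>The Pluecker relation between the 2 x 2 minors of a 2 x 4 matrix. It expresses the
  Wronskian of \<open>y\<close> and \<open>z\<close> at infinity through their boundary values with
  respect to \<open>f\<close> and \<open>g\<close>, whose own Wronskian tends to 1.\<close>

lemma bracket_pluecker: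
  fixes y y' z z' f f' g g' :: real
  shows "(y * z' - z * y') * (f * g' - g * f') =
     (y * f' - f * y') * (z * g' - g * z') - (y * g' - g * y') * (z * f' - f * z')"
  by (simp add: algebra_simps)

lemma BC_wronskian_limit:
  assumes q: "L1_loc q" and adm: "admissible q (BC f g \<beta>)"
    and lims: "((\<lambda>x. y x * D\<^sub>x f x - f x * y' x) \<longlongrightarrow> A) at_top" "((\<lambda>x. y x * D\<^sub>x g x - g x * y' x) \<longlongrightarrow> B) at_top"
      "((\<lambda>x. z x * D\<^sub>x f x - f x * z' x) \<longlongrightarrow> A') at_top" "((\<lambda>x. z x * D\<^sub>x g x - g x * z' x) \<longlongrightarrow> B') at_top"
  shows "((\<lambda>x. y x * z' x - z x * y' x) \<longlongrightarrow> A * B' - B * A') at_top"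
proof -
  have fg: "((\<lambda>x. f x * D\<^sub>x g x - g x * D\<^sub>x f x) \<longlongrightarrow> 1) at_top" by (rule BC_bracket_limit[OF q adm])
  have "((\<lambda>x. ((y x * D\<^sub>x f x - f x * y' x) * (z x * D\<^sub>x g x - g x * z' x) - (y x * D\<^sub>x g x - g x * y' x) * (z x * D\<^sub>x f x - f x * z' x))
       / (f x * D\<^sub>x g x - g x * D\<^sub>x f x)) \<longlongrightarrow> (A * B' - B * A') / 1) at_top"
    by (rule tendsto_divide[OF tendsto_diff[OF tendsto_mult[OF lims(1) lims(4)] tendsto_mult[OF lims(2) lims(3)]] fg]) simp
  then have "((\<lambda>x. ((y x * D\<^sub>x f x - f x * y' x) * (z x * D\<^sub>x g x - g x * z' x) - (y x * D\<^sub>x g x - g x * y' x) * (z x * D\<^sub>x f x - f x * z' x))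
       / (f x * D\<^sub>x g x - g x * D\<^sub>x f x)) \<longlongrightarrow> A * B' - B * A') at_top" by simp
  moreover have "eventually (\<lambda>x. f x * D\<^sub>x g x - g x * D\<^sub>x f x \<noteq> 0) at_top"
    using tendsto_imp_eventually_ne[OF fg, of 0] by simp
  ultimately show ?thesis
  proof (rule Lim_transform_eventually[OF _ eventually_mono])
    fix x assume "f x * D\<^sub>x g x - g x * D\<^sub>x f x \<noteq> 0"
    then show "((y x * D\<^sub>x f x - f x * y' x) * (z x * D\<^sub>x g x - g x * z' x) - (y x * D\<^sub>x g x - g x * y' x) * (z x * D\<^sub>x f x - f x * z' x))
       / (f x * D\<^sub>x g x - g x * D\<^sub>x f x) = y x * z' x - z x * y' x"
      unfolding bracket_pluecker[symmetric] by simp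
  qed
qed

text \<open>Symmetry of the operator at infinity. For a non-negative potential the derivatives are
  square integrable, so the Wronskian is integrable and its limit must be 0; under a boundary
  condition the two pairs of boundary values are proportional.\<close>

theorem end_sol_wronskian_zero:
  assumes q: "L1_loc q" and adm: "admissible q E" and T: "T \<ge> 0"
    and y: "end_sol q T y y' k" "bc_real E y y'" and z: "end_sol q T z z' m" "bc_real E z z'"
  shows "((\<lambda>x. y x * z' x - z x * y' x) \<longlongrightarrow> 0) at_top"
proof (cases E)
  case No_BC
  then have q0: "AE x in lebesgue_on {0..}. 0 \<le> q x" using adm by simp
  define L where "L = (y T * z' T - z T * y' T) + integral {T..} (\<lambda>s. z s * k s - y s * m s)"
  have lim: "((\<lambda>x. y x * z' x - z x * y' x) \<longlongrightarrow> L) at_top"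
    unfolding L_def by (rule end_sol_wronskian_limit[OF y(1) z(1)])
  have 1: "(\<lambda>s. y s * z' s) absolutely_integrable_on {T..}"
    using end_solD(2)[OF y(1)] end_sol_nonneg(1)[OF q0 T z(1)] by (rule sq_int_mult)
  have 2: "(\<lambda>s. z s * y' s) absolutely_integrable_on {T..}"
    using end_solD(2)[OF z(1)] end_sol_nonneg(1)[OF q0 T y(1)] by (rule sq_int_mult)
  have "(\<lambda>s. y s * z' s - z s * y' s) absolutely_integrable_on {T..}" using 1 2 by (rule set_integral_diff(1))
  with lim have "L = 0" by (rule tendsto_absolutely_integrable_zero)
  then show ?thesis using lim by simp
next
  case (BC f g \<beta>)
  obtain A B where AB: "((\<lambda>x. y x * D\<^sub>x f x - f x * y' x) \<longlongrightarrow> A) at_top" "((\<lambda>x. y x * D\<^sub>x g x - g x * y' x) \<longlongrightarrow> B) at_top"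
    "A * sin \<beta> = B * cos \<beta>" using y(2) BC by auto
  obtain A' B' where AB': "((\<lambda>x. z x * D\<^sub>x f x - f x * z' x) \<longlongrightarrow> A') at_top" "((\<lambda>x. z x * D\<^sub>x g x - g x * z' x) \<longlongrightarrow> B') at_top"
    "A' * sin \<beta> = B' * cos \<beta>" using z(2) BC by auto
  have "A * B' - B * A' = 0"
    by (rule tendsto_proportional[OF AB(3) AB'(3)]) (metis sin_cos_squared_add zero_power2 add_0 zero_neq_one)
  then show ?thesis using BC_wronskian_limit[OF q adm[unfolded BC] AB(1,2) AB'(1,2)] by simp
qed

lemma end_sol_BC_limits:
  assumes q: "L1_loc q" and adm: "admissible q (BC f g \<beta>)" and T: "T \<ge> 0" and y: "end_sol q T y y' k"
  obtains A B where "((\<lambda>x. y x * D\<^sub>x f x - f x * y' x) \<longlongrightarrow> A) at_top" "((\<lambda>x. y x * D\<^sub>x g x - g x * y' x) \<longlongrightarrow> B) at_top"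
proof -
  have f: "(\<lambda>x. complex_of_real (f x)) \<in> max_dom q" and g: "(\<lambda>x. complex_of_real (g x)) \<in> max_dom q" using adm by auto
  show thesis
    by (rule that[OF end_sol_wronskian_limit[OF y end_sol_mono[OF max_dom_real(1)[OF q f] T]]
      end_sol_wronskian_limit[OF y end_sol_mono[OF max_dom_real(1)[OF q g] T]]])
qed

text \<open>Two linearly independent functions cannot both have vanishing boundary values, so \<open>[y,u](\<infinity>) = 0\<close> transfers
  the boundary condition from \<open>u\<close> to \<open>y\<close>.\<close>

theorem bc_real_transfer:
  assumes q: "L1_loc q" and adm: "admissible q E" and T: "T \<ge> 0"
    and u: "end_sol q T u u' k" "bc_real E u u'" and y: "end_sol q T y y' m"
    and lim: "((\<lambda>x. y x * u' x - u x * y' x) \<longlongrightarrow> 0) at_top"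
    and th: "\<And>f g \<beta>. E = BC f g \<beta> \<Longrightarrow> \<exists>\<theta> \<theta>' n. end_sol q T \<theta> \<theta>' n \<and> ((\<lambda>x. u x * \<theta>' x - \<theta> x * u' x) \<longlongrightarrow> 1) at_top"
  shows "bc_real E y y'"
proof (cases E)
  case (BC f g \<beta>)
  note adm' = adm[unfolded BC]
  obtain \<theta> \<theta>' n where t: "end_sol q T \<theta> \<theta>' n" "((\<lambda>x. u x * \<theta>' x - \<theta> x * u' x) \<longlongrightarrow> 1) at_top"
    using th[OF BC] by blast
  obtain A B where AB: "((\<lambda>x. u x * D\<^sub>x f x - f x * u' x) \<longlongrightarrow> A) at_top" "((\<lambda>x. u x * D\<^sub>x g x - g x * u' x) \<longlongrightarrow> B) at_top"
    "A * sin \<beta> = B * cos \<beta>" using u(2) BC by auto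
  obtain A1 B1 where 1: "((\<lambda>x. y x * D\<^sub>x f x - f x * y' x) \<longlongrightarrow> A1) at_top" "((\<lambda>x. y x * D\<^sub>x g x - g x * y' x) \<longlongrightarrow> B1) at_top"
    by (rule end_sol_BC_limits[OF q adm' T y])
  obtain A2 B2 where 2: "((\<lambda>x. \<theta> x * D\<^sub>x f x - f x * \<theta>' x) \<longlongrightarrow> A2) at_top" "((\<lambda>x. \<theta> x * D\<^sub>x g x - g x * \<theta>' x) \<longlongrightarrow> B2) at_top"
    by (rule end_sol_BC_limits[OF q adm' T t(1)])
  have e1: "A1 * B = B1 * A"
    using tendsto_unique[OF _ BC_wronskian_limit[OF q adm' 1 AB(1,2)] lim] by simp
  have e2: "A * B2 - B * A2 = 1"
    using tendsto_unique[OF _ BC_wronskian_limit[OF q adm' AB(1,2) 2] t(2)] by simp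
  have "A1 * sin \<beta> = B1 * cos \<beta>"
  proof (cases "A = 0")
    case True
    then have "B \<noteq> 0" using e2 by auto
    then have "A1 = 0" "cos \<beta> = 0" using e1 AB(3) True by auto
    then show ?thesis by simp
  next
    case False
    have "A * (A1 * sin \<beta>) = A1 * (A * sin \<beta>)" by simp
    also have "\<dots> = (A1 * B) * cos \<beta>" using AB(3) by simp
    also have "\<dots> = A * (B1 * cos \<beta>)" using e1 by simp
    finally show ?thesis using False by simp
  qed
  then show ?thesis using 1 BC by auto
qed simp

section \<open>Real solutions\<close>

definition sol :: "(real \<Rightarrow> real) \<Rightarrow> real \<Rightarrow> real set \<Rightarrow> (real \<Rightarrow> real) \<Rightarrow> (real \<Rightarrow> real) \<Rightarrow> bool" where
  "sol q l I y y' \<longleftrightarrow> weak2_on I y y' (\<lambda>x. (q x - l) * y x)"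

lemma solD: "sol q l I y y' \<Longrightarrow> a < b \<Longrightarrow> {a..b} \<subseteq> I \<Longrightarrow> weak2 a b y y' (\<lambda>x. (q x - l) * y x)"
  unfolding sol_def by (rule weak2_onD)

lemma sol_subset: "sol q l I y y' \<Longrightarrow> J \<subseteq> I \<Longrightarrow> sol q l J y y'"
  unfolding sol_def by (rule weak2_on_subset)

lemma sol_continuous:
  assumes "sol q l {a..b} y y'" "a < b" shows "continuous_on {a..b} y" "continuous_on {a..b} y'"
  using weak2_continuous[OF solD[OF assms(1,2)]] by auto

lemma sol_deriv:
  assumes "sol q l {a..b} y y'" "x \<in> {a..b}" "a < b"
  shows "(y has_real_derivative y' x) (at x within {a..b})"
  using weak2D(1)[OF solD[OF assms(1,3)]] assms(2) by (simp add: has_real_derivative_iff_has_vector_derivative)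

lemma sol_continuous_atLeast:
  assumes "sol q l {T..} y y'" shows "continuous_on {T..} y" "continuous_on {T..} y'"
  by (rule continuous_on_atLeast, rule sol_continuous[OF sol_subset[OF assms]]; simp)+

lemma sol_linear:
  assumes "sol q l I y y'" "sol q l I z z'"
  shows "sol q l I (\<lambda>x. A * y x + B * z x) (\<lambda>x. A * y' x + B * z' x)"
  unfolding sol_def weak2_on_def
proof (intro allI impI)
  fix a b assume ab: "a < b \<and> {a..b} \<subseteq> I"
  have "weak2 a b (\<lambda>x. A *\<^sub>R y x + B *\<^sub>R z x) (\<lambda>x. A *\<^sub>R y' x + B *\<^sub>R z' x) (\<lambda>x. A *\<^sub>R ((q x - l) * y x) + B *\<^sub>R ((q x - l) * z x))"
    using ab assms by (intro weak2_add weak2_scaleR solD) auto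
  then show "weak2 a b (\<lambda>x. A * y x + B * z x) (\<lambda>x. A * y' x + B * z' x) (\<lambda>x. (q x - l) * (A * y x + B * z x))"
    by (rule weak2_cong) (auto simp: algebra_simps)
qed

lemma sol_cong:
  assumes "sol q l I y y'" "\<And>x. x \<in> I \<Longrightarrow> z x = y x" "\<And>x. x \<in> I \<Longrightarrow> z' x = y' x"
  shows "sol q l I z z'"
  unfolding sol_def weak2_on_def
proof (intro allI impI)
  fix a b assume ab: "a < b \<and> {a..b} \<subseteq> I"
  show "weak2 a b z z' (\<lambda>x. (q x - l) * z x)"
    by (rule weak2_cong[OF solD[OF assms(1)]]) (use ab assms in auto)
qed

lemma sol_scale: "sol q l I y y' \<Longrightarrow> sol q l I (\<lambda>x. A * y x) (\<lambda>x. A * y' x)"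
  using sol_linear[of q l I y y' y y' A 0] by simp

lemma sol_wronskian:
  assumes y: "sol q l {a..b} y y'" and z: "sol q m {a..b} z z'" and ab: "a < b" and uv: "a \<le> c" "c \<le> d" "d \<le> b"
  shows "((\<lambda>s. (l - m) * (y s * z s)) has_integral ((y d * z' d - z d * y' d) - (y c * z' c - z c * y' c))) {c..d}"
proof -
  have "(\<lambda>s. (l - m) * (y s * z s)) = (\<lambda>s. y s * ((q s - m) * z s) - z s * ((q s - l) * y s))"
    by (simp add: fun_eq_iff algebra_simps)
  then show ?thesis using weak2_wronskian[OF solD[OF y ab] solD[OF z ab] uv] by simp
qed

lemma sol_wronskian_const:
  assumes y: "sol q l {0..} y y'" and z: "sol q l {0..} z z'" and x: "x \<ge> 0" "t \<ge> 0"
  shows "y x * z' x - z x * y' x = y t * z' t - z t * y' t"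
proof -
  define b where "b = max x t + 1"
  have b: "0 < b" "x \<le> b" "t \<le> b" using x by (auto simp: b_def)
  have s: "sol q l {0..b} y y'" "sol q l {0..b} z z'" using y z by (auto intro: sol_subset)
  have "y d * z' d - z d * y' d = y 0 * z' 0 - z 0 * y' 0" if "0 \<le> d" "d \<le> b" for d
    using has_integral_unique[OF sol_wronskian[OF s b(1), of 0 d]] that by (simp add: )
  then show ?thesis using x b by metis
qed

lemma integral_has_real_derivative_within:
  assumes "continuous_on {a..b} f" "\<And>x. x \<in> {a..b} \<Longrightarrow> (f has_integral F x - F a) {a..x}" "x \<in> {a..b}"
  shows "(F has_real_derivative f x) (at x within {a..b})"
proof -
  have "((\<lambda>x. F a + integral {a..x} f) has_vector_derivative 0 + f x) (at x within {a..b})"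
    by (intro has_vector_derivative_add has_vector_derivative_const integral_has_vector_derivative assms)
  then have "((\<lambda>x. F a + integral {a..x} f) has_vector_derivative f x) (at x within {a..b})" by simp
  then have "(F has_vector_derivative f x) (at x within {a..b})"
    by (rule has_vector_derivative_transform[OF assms(3), rotated]) (use integral_unique[OF assms(2)] in auto)
  then show ?thesis by (simp add: has_real_derivative_iff_has_vector_derivative)
qed

text \<open>Although second derivatives exist only almost everywhere, the Wronskian is continuously
  differentiable: the potential cancels and the remaining derivative is continuous.\<close>

lemma wronskian_deriv:
  assumes y: "sol q l {a..b} y y'" and z: "sol q m {a..b} z z'" and ab: "a < b" and x: "x \<in> {a..b}"
  shows "((\<lambda>x. y x * z' x - z x * y' x) has_real_derivative (l - m) * (y x * z x)) (at x within {a..b})"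
proof (rule integral_has_real_derivative_within[OF _ _ x])
  show "continuous_on {a..b} (\<lambda>x. (l - m) * (y x * z x))"
    by (intro continuous_intros sol_continuous(1)[OF y ab] sol_continuous(1)[OF z ab])
qed (use sol_wronskian[OF y z ab] in auto)

lemma nondecreasing_within:
  fixes f :: "real \<Rightarrow> real"
  assumes "\<And>x. x \<in> {a..b} \<Longrightarrow> (f has_real_derivative f' x) (at x within {a..b})" "\<And>x. x \<in> {a..b} \<Longrightarrow> f' x \<ge> 0"
    and "a \<le> c" "c \<le> d" "d \<le> b"
  shows "f c \<le> f d"
proof -
  have "(f' has_integral (f d - f c)) {c..d}"
  proof (rule fundamental_theorem_of_calculus[OF assms(4)])
    fix x assume "x \<in> {c..d}"
    then show "(f has_vector_derivative f' x) (at x within {c..d})"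
      using assms has_vector_derivative_within_subset[of f "f' x" x "{a..b}" "{c..d}"]
      by (auto simp: has_real_derivative_iff_has_vector_derivative)
  qed
  then have "0 \<le> f d - f c" by (rule has_integral_nonneg) (use assms in auto)
  then show ?thesis by simp
qed

text \<open>Picone's identity: with \<open>w = y/h\<close> and the Wronskian \<open>p = h y' - y h'\<close> one has \<open>h\<^sup>2 w' = p\<close> and \<open>p' = e h\<^sup>2 w\<close>,
  so \<open>(p w)' = e y\<^sup>2 + p\<^sup>2/h\<^sup>2\<close>.\<close>

lemma quotient_deriv:
  assumes h: "sol q l {a..b} h h'" and y: "sol q m {a..b} y y'" and ab: "a < b"
    and pos: "\<And>x. x \<in> {a..b} \<Longrightarrow> h x > 0" and x: "x \<in> {a..b}"
  shows "((\<lambda>x. y x / h x) has_real_derivative (h x * y' x - y x * h' x) / (h x)\<^sup>2) (at x within {a..b})"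
  using pos[OF x]
  by (auto intro!: derivative_eq_intros sol_deriv[OF h x ab] sol_deriv[OF y x ab] simp: power2_eq_square field_simps)

lemma picone_deriv:
  assumes h: "sol q l {a..b} h h'" and y: "sol q (l - e) {a..b} y y'" and ab: "a < b"
    and pos: "\<And>x. x \<in> {a..b} \<Longrightarrow> h x > 0" and x: "x \<in> {a..b}"
  shows "((\<lambda>x. (h x * y' x - y x * h' x) * (y x / h x)) has_real_derivative
            e * (y x)\<^sup>2 + ((h x * y' x - y x * h' x) / h x)\<^sup>2) (at x within {a..b})"
    "((\<lambda>x. (y x / h x)\<^sup>2) has_real_derivative 2 * ((h x * y' x - y x * h' x) * (y x / h x)) / (h x)\<^sup>2) (at x within {a..b})"
    "((\<lambda>x. (h x * y' x - y x * h' x)\<^sup>2) has_real_derivative 2 * e * (h x)\<^sup>2 * ((h x * y' x - y x * h' x) * (y x / h x))) (at x within {a..b})"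
proof -
  have p: "((\<lambda>x. h x * y' x - y x * h' x) has_real_derivative e * (h x * y x)) (at x within {a..b})"
    using wronskian_deriv[OF h y ab x] by simp
  note w = quotient_deriv[OF h y ab pos x]
  have hx: "h x > 0" using pos x by blast
  show "((\<lambda>x. (h x * y' x - y x * h' x) * (y x / h x)) has_real_derivative
            e * (y x)\<^sup>2 + ((h x * y' x - y x * h' x) / h x)\<^sup>2) (at x within {a..b})"
  proof (rule DERIV_cong[OF DERIV_mult[OF p w]])
    have 1: "e * (h x * y x) * (y x / h x) = e * (y x)\<^sup>2" using hx by (simp add: power2_eq_square)
    have 2: "(h x * y' x - y x * h' x) / (h x)\<^sup>2 * (h x * y' x - y x * h' x) = ((h x * y' x - y x * h' x) / h x)\<^sup>2"
      by (simp add: power2_eq_square)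
    show "e * (h x * y x) * (y x / h x) + (h x * y' x - y x * h' x) / (h x)\<^sup>2 * (h x * y' x - y x * h' x) =
      e * (y x)\<^sup>2 + ((h x * y' x - y x * h' x) / h x)\<^sup>2" unfolding 1 2 ..
  qed
  show "((\<lambda>x. (y x / h x)\<^sup>2) has_real_derivative 2 * ((h x * y' x - y x * h' x) * (y x / h x)) / (h x)\<^sup>2) (at x within {a..b})"
    unfolding power2_eq_square[of "_ / _"]
  proof (rule DERIV_cong[OF DERIV_mult[OF w w]])
    have "P / H * W + P / H * W = 2 * (P * W) / H" for P H W :: real
      by (simp add: add_divide_distrib)
    then show "(h x * y' x - y x * h' x) / (h x)\<^sup>2 * (y x / h x) + (h x * y' x - y x * h' x) / (h x)\<^sup>2 * (y x / h x)
      = 2 * ((h x * y' x - y x * h' x) * (y x / h x)) / (h x)\<^sup>2" .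
  qed
  show "((\<lambda>x. (h x * y' x - y x * h' x)\<^sup>2) has_real_derivative 2 * e * (h x)\<^sup>2 * ((h x * y' x - y x * h' x) * (y x / h x))) (at x within {a..b})"
    unfolding power2_eq_square[of "_ - _"]
    by (rule DERIV_cong[OF DERIV_mult[OF p p]]) (use hx in \<open>simp add: field_simps power2_eq_square\<close>)
qed

lemma picone_mono:
  assumes h: "sol q l {a..b} h h'" and y: "sol q (l - e) {a..b} y y'" and ab: "a < b" and e: "e \<ge> 0"
    and pos: "\<And>x. x \<in> {a..b} \<Longrightarrow> h x > 0" and cd: "a \<le> c" "c \<le> d" "d \<le> b"
  shows "(h c * y' c - y c * h' c) * (y c / h c) \<le> (h d * y' d - y d * h' d) * (y d / h d)"
  by (rule nondecreasing_within[OF picone_deriv(1)[OF h y ab pos] _ cd]) (use e in auto)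

text \<open>By Picone's identity \<open>p w\<close> stays nonnegative once it is so, and both
  \<open>w^2\<close> and \<open>p^2\<close> have derivatives of the sign of
  \<open>p w\<close>.\<close>

lemma picone_sq_mono:
  assumes h: "sol q l {a..b} h h'" and y: "sol q (l - e) {a..b} y y'" and ab: "a < b" and e: "e \<ge> 0"
    and pos: "\<And>x. x \<in> {a..b} \<Longrightarrow> h x > 0" and H: "(h a * y' a - y a * h' a) * (y a / h a) \<ge> 0"
    and cd: "a \<le> c" "c \<le> d" "d \<le> b"
  shows "(y c / h c)\<^sup>2 \<le> (y d / h d)\<^sup>2" "(h c * y' c - y c * h' c)\<^sup>2 \<le> (h d * y' d - y d * h' d)\<^sup>2"
proof -
  have H': "(h x * y' x - y x * h' x) * (y x / h x) \<ge> 0" if "x \<in> {a..b}" for x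
    using picone_mono[OF h y ab e pos, of a x] H that by auto
  show "(y c / h c)\<^sup>2 \<le> (y d / h d)\<^sup>2"
  proof (rule nondecreasing_within[OF picone_deriv(2)[OF h y ab pos] _ cd])
    fix x assume "x \<in> {a..b}"
    then have "2 * ((h x * y' x - y x * h' x) * (y x / h x)) \<ge> 0" using H' by (metis mult_nonneg_nonneg zero_le_numeral)
    then show "2 * ((h x * y' x - y x * h' x) * (y x / h x)) / (h x)\<^sup>2 \<ge> 0" by (rule divide_nonneg_nonneg) simp
  qed
  show "(h c * y' c - y c * h' c)\<^sup>2 \<le> (h d * y' d - y d * h' d)\<^sup>2"
  proof (rule nondecreasing_within[OF picone_deriv(3)[OF h y ab pos] _ cd])
    fix x assume "x \<in> {a..b}"
    then have "0 \<le> (h x * y' x - y x * h' x) * (y x / h x)" by (rule H')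
    moreover have "0 \<le> 2 * e * (h x)\<^sup>2" using e by simp
    ultimately show "2 * e * (h x)\<^sup>2 * ((h x * y' x - y x * h' x) * (y x / h x)) \<ge> 0" by (rule mult_nonneg_nonneg[rotated])
  qed
qed

lemma continuous_sign_pos:
  fixes f :: "real \<Rightarrow> real"
  assumes "continuous_on {a..b} f" "\<And>x. x \<in> {a..b} \<Longrightarrow> f x \<noteq> 0" "c \<in> {a..b}" "f c > 0" "x \<in> {a..b}"
  shows "f x > 0"
proof (rule ccontr)
  assume "\<not> f x > 0"
  then have 0: "0 \<in> {f x..f c}" using assms(4) by simp
  have "connected (f ` {a..b})" using assms(1) by (rule connected_continuous_image) simp
  then have "{f x..f c} \<subseteq> f ` {a..b}" by (rule connected_contains_Icc) (use assms(3,5) in blast)+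
  then have "0 \<in> f ` {a..b}" using 0 by blast
  then show False using assms(2) by fastforce
qed

lemma sol_left_positive:
  assumes h: "sol q l {0..X} h h'" and y: "sol q (l - e) {0..X} y y'" and X: "X > 0" and e: "e \<ge> 0"
    and hpos: "\<And>x. 0 < x \<Longrightarrow> x \<le> X \<Longrightarrow> h x > 0" and h0: "h 0 = 0" and y0: "y 0 = 0" "y' 0 > 0" and x: "0 < x" "x \<le> X"
  shows "y x > 0"
proof -
  have "(y has_real_derivative y' 0) (at 0 within {0..X})" using sol_deriv[OF y _ X] X by auto
  then obtain d where d: "d > 0" "\<And>s. 0 < s \<Longrightarrow> s \<in> {0..X} \<Longrightarrow> s < d \<Longrightarrow> y 0 < y s"
    using has_real_derivative_pos_inc_right[of y "y' 0" 0 "{0..X}"] y0 by auto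
  define s where "s = min (d/2) x"
  have s: "0 < s" "s < d" "s \<le> x" "s \<le> X" using d x by (auto simp: s_def)
  have ypos: "y r \<ge> 0" if "r \<in> {0..s}" for r
    using d(2)[of r] y0 that s by (cases "r = 0") auto
  have hpos': "h r \<ge> 0" if "r \<in> {0..s}" for r using hpos[of r] h0 that s by (cases "r = 0") auto
  have "((\<lambda>r. e * (h r * y r)) has_integral (h s * y' s - y s * h' s)) {0..s}"
    using sol_wronskian[OF h y X, of 0 s] s h0 y0 by simp
  then have p: "h s * y' s - y s * h' s \<ge> 0"
    by (rule has_integral_nonneg) (use e ypos hpos' in auto)
  have ys: "y s > 0" using d(2)[of s] s y0 by auto
  have hs: "h s > 0" using hpos s by auto
  have sX: "sol q l {s..X} h h'" "sol q (l - e) {s..X} y y'" using h y s by (auto intro: sol_subset)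
  show ?thesis
  proof (cases "s = X")
    case True then show ?thesis using ys s x by auto
  next
    case False
    then have sX': "s < X" using s by auto
    have nz: "y r \<noteq> 0" if r: "r \<in> {s..X}" for r
    proof
      assume "y r = 0"
      have "(y s / h s)\<^sup>2 \<le> (y r / h r)\<^sup>2"
      proof (rule picone_sq_mono(1)[OF sX sX' e])
        show "0 \<le> (h s * y' s - y s * h' s) * (y s / h s)"
          using p ys hs by (intro mult_nonneg_nonneg divide_nonneg_nonneg) auto
      qed (use hpos s r in auto)
      then show False using \<open>y r = 0\<close> ys hs by (simp add: power2_eq_square) (simp add: mult_le_0_iff divide_simps)
    qed
    show ?thesis
      by (rule continuous_sign_pos[OF sol_continuous(1)[OF sX(2) sX'] nz, of s]) (use s ys x sX' in auto)
  qed
qed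

text \<open>If \<open>p w\<close> were positive somewhere, \<open>p^2\<close> would be nondecreasing
  from there on and could not tend to 0. Hence \<open>w^2\<close> is nonincreasing, and a zero of
  \<open>y\<close> persists to the right.\<close>

lemma sol_right_tail:
  assumes h: "sol q l {T..} h h'" and y: "sol q (l - e) {T..} y y'" and e: "e \<ge> 0"
    and pos: "\<And>x. x \<ge> T \<Longrightarrow> h x > 0" and lim: "((\<lambda>x. h x * y' x - y x * h' x) \<longlongrightarrow> 0) at_top"
  shows "x \<ge> T \<Longrightarrow> (h x * y' x - y x * h' x) * (y x / h x) \<le> 0"
    "c \<ge> T \<Longrightarrow> y c = 0 \<Longrightarrow> x \<ge> c \<Longrightarrow> y x = 0"
proof -
  have H: "(h x * y' x - y x * h' x) * (y x / h x) \<le> 0" if x: "x \<ge> T" for x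
  proof (rule ccontr)
    assume "\<not> (h x * y' x - y x * h' x) * (y x / h x) \<le> 0"
    then have Hx: "(h x * y' x - y x * h' x) * (y x / h x) > 0" by simp
    have "(h x * y' x - y x * h' x)\<^sup>2 \<le> (h b * y' b - y b * h' b)\<^sup>2" if b: "b > x" for b
      by (rule picone_sq_mono(2)[OF sol_subset[OF h] sol_subset[OF y] b e])
        (use x pos Hx b in auto)
    then have "eventually (\<lambda>b. (h x * y' x - y x * h' x)\<^sup>2 \<le> (h b * y' b - y b * h' b)\<^sup>2) at_top"
      using eventually_gt_at_top[of x] by (rule eventually_mono[rotated])
    moreover have "((\<lambda>b. (h b * y' b - y b * h' b)\<^sup>2) \<longlongrightarrow> 0\<^sup>2) at_top" by (rule tendsto_power[OF lim])
    ultimately have "(h x * y' x - y x * h' x)\<^sup>2 \<le> 0\<^sup>2"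
      by (intro tendsto_lowerbound[where F = at_top and f = "\<lambda>b. (h b * y' b - y b * h' b)\<^sup>2"]) auto
    then show False using Hx by simp
  qed
  show "(h x * y' x - y x * h' x) * (y x / h x) \<le> 0" if "x \<ge> T" using H that .
  show "y x = 0" if c: "c \<ge> T" "y c = 0" and x: "x \<ge> c"
  proof (cases "x = c")
    case False
    then have cx: "c < x" using x by simp
    have "- ((y c / h c)\<^sup>2) \<le> - ((y x / h x)\<^sup>2)"
    proof (rule nondecreasing_within[of c x "\<lambda>x. - ((y x / h x)\<^sup>2)" "\<lambda>x. - (2 * ((h x * y' x - y x * h' x) * (y x / h x)) / (h x)\<^sup>2)"])
      fix s assume s: "s \<in> {c..x}"
      show "((\<lambda>x. - ((y x / h x)\<^sup>2)) has_real_derivative - (2 * ((h s * y' s - y s * h' s) * (y s / h s)) / (h s)\<^sup>2)) (at s within {c..x})"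
        by (rule DERIV_minus, rule picone_deriv(2)[OF sol_subset[OF h] sol_subset[OF y] cx]) (use c pos s in auto)
      show "0 \<le> - (2 * ((h s * y' s - y s * h' s) * (y s / h s)) / (h s)\<^sup>2)"
      proof -
        have "2 * ((h s * y' s - y s * h' s) * (y s / h s)) \<le> 0" using H[of s] s c by simp
        then have "2 * ((h s * y' s - y s * h' s) * (y s / h s)) / (h s)\<^sup>2 \<le> 0" by (rule divide_nonpos_nonneg) simp
        then show ?thesis by simp
      qed
    qed (use cx in auto)
    then have "(y x / h x)\<^sup>2 \<le> 0" using c by simp
    then show ?thesis using pos[of x] c x by simp
  qed (use c in simp)
qed

section \<open>Existence and uniqueness of real solutions\<close>

lemma q_minus_absolutely_integrable:
  assumes "L1_loc q" "b > 0" shows "(\<lambda>x. q x - l) absolutely_integrable_on {0..b}"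
  using L1_locD[OF assms] by (rule set_integral_diff(1)) simp

lemma sol_exists_0:
  assumes "L1_loc q"
  obtains y y' where "sol q l {0..} y y'" "y 0 = A" "y' 0 = B"
proof -
  obtain y y' where y: "y 0 = A" "y' 0 = B" "\<And>b. b > 0 \<Longrightarrow> weak2 0 b y y' (\<lambda>x. (q x - l) * y x)"
    using ivp_exists[of "\<lambda>x. q x - l" A B] q_minus_absolutely_integrable[OF assms] by blast
  have "sol q l {0..} y y'" unfolding sol_def weak2_on_def
  proof (intro allI impI)
    fix a b :: real assume ab: "a < b \<and> {a..b} \<subseteq> {0..}"
    then have a: "0 \<le> a" "0 < b" by auto
    show "weak2 a b y y' (\<lambda>x. (q x - l) * y x)" by (rule weak2_subset[OF y(3)[OF a(2)] a(1)]) simp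
  qed
  then show thesis using that y by blast
qed

lemma sol_exists:
  assumes q: "L1_loc q" and t: "t \<ge> 0"
  obtains y y' where "sol q l {0..} y y'" "y t = A" "y' t = B"
proof -
  obtain a a' where a: "sol q l {0..} a a'" "a 0 = 1" "a' 0 = 0" using sol_exists_0[OF q] by blast
  obtain b b' where b: "sol q l {0..} b b'" "b 0 = 0" "b' 0 = 1" using sol_exists_0[OF q] by blast
  have W: "a t * b' t - b t * a' t = 1" using sol_wronskian_const[OF a(1) b(1) t, of 0] a b by simp
  define \<alpha> \<gamma> where "\<alpha> = A * b' t - B * b t" and "\<gamma> = B * a t - A * a' t"
  show thesis
  proof (rule that[OF sol_linear[OF a(1) b(1), of \<alpha> \<gamma>]])
    have "\<alpha> * a t + \<gamma> * b t = A * (a t * b' t - b t * a' t)" by (simp add: \<alpha>_def \<gamma>_def algebra_simps)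
    then show "\<alpha> * a t + \<gamma> * b t = A" using W by simp
    have "\<alpha> * a' t + \<gamma> * b' t = B * (a t * b' t - b t * a' t)" by (simp add: \<alpha>_def \<gamma>_def algebra_simps)
    then show "\<alpha> * a' t + \<gamma> * b' t = B" using W by simp
  qed
qed

text \<open>Uniqueness: the Wronskians with a fundamental system are constant.\<close>

lemma sol_unique_zero:
  assumes q: "L1_loc q" and ab: "a < b" "0 \<le> a" and y: "sol q l {a..b} y y'" and t: "t \<in> {a..b}" "y t = 0" "y' t = 0" and x: "x \<in> {a..b}"
  shows "y x = 0" "y' x = 0"
proof -
  have W: "y x * z' x - z x * y' x = 0" if z: "sol q l {0..} z z'" for z z'
  proof -
    have z': "sol q l {a..b} z z'" using z ab by (auto intro: sol_subset)
    have "y d * z' d - z d * y' d = y a * z' a - z a * y' a" if "a \<le> d" "d \<le> b" for d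
      using has_integral_unique[OF sol_wronskian[OF y z' ab(1), of a d]] that by simp
    then show ?thesis using t x by (metis atLeastAtMost_iff diff_self mult_zero_left mult_zero_right)
  qed
  have x0: "x \<ge> 0" using x ab by auto
  obtain z z' where z: "sol q l {0..} z z'" "z x = 0" "z' x = 1" by (rule sol_exists[OF q x0])
  obtain w w' where w: "sol q l {0..} w w'" "w x = 1" "w' x = 0" by (rule sol_exists[OF q x0])
  show "y x = 0" using W[OF z(1)] z by simp
  show "y' x = 0" using W[OF w(1)] w by simp
qed

section \<open>Eigenfunctions\<close>

lemma sq_int_ae_cong:
  fixes y z :: "real \<Rightarrow> 'a::euclidean_space"
  assumes y: "sq_int T y" and N: "negligible {x\<in>{T..}. z x \<noteq> y x}"
  shows "sq_int T z"
proof -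
  have s: "{T..} \<in> sets lebesgue" by simp
  have "(\<lambda>x. if x \<in> {T..} then y x else 0) \<in> borel_measurable lebesgue"
    using sq_intD(1)[OF y] borel_measurable_if[OF s] by blast
  moreover have "AE x in lebesgue. (if x \<in> {T..} then y x else 0) = (if x \<in> {T..} then z x else 0)"
    by (rule AE_I'[of "{x\<in>{T..}. z x \<noteq> y x}"]) (use N in \<open>auto simp: negligible_iff_null_sets\<close>)
  ultimately have "(\<lambda>x. if x \<in> {T..} then z x else 0) \<in> borel_measurable lebesgue" by (rule borel_measurable_AE)
  then have "z \<in> borel_measurable (lebesgue_on {T..})" using borel_measurable_if[OF s] by blast
  moreover have "(\<lambda>x. (norm (z x))\<^sup>2) integrable_on {T..}"
    by (rule integrable_spike[OF sq_intD(2)[OF y] N]) auto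
  ultimately show ?thesis by (simp add: sq_int_def)
qed

lemma satisfies_bc_of_real:
  assumes q: "L1_loc q" and adm: "admissible q E"
    and y: "\<And>x. x \<ge> X \<Longrightarrow> y x = complex_of_real (v x)" "\<And>x. x \<ge> X \<Longrightarrow> D\<^sub>x y x = of_real (v' x)"
    and bc: "bc_real E v v'"
  shows "satisfies_bc E y"
proof (cases E)
  case (BC f g \<beta>)
  have f: "(\<lambda>x. complex_of_real (f x)) \<in> max_dom q" and g: "(\<lambda>x. complex_of_real (g x)) \<in> max_dom q"
    using adm BC by auto
  obtain A B where AB: "((\<lambda>x. v x * D\<^sub>x f x - f x * v' x) \<longlongrightarrow> A) at_top" "((\<lambda>x. v x * D\<^sub>x g x - g x * v' x) \<longlongrightarrow> B) at_top"
    "A * sin \<beta> = B * cos \<beta>" using bc BC by auto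
  have lim: "(bracket y (\<lambda>x. of_real (h x)) \<longlongrightarrow> of_real C) at_top"
    if h: "(\<lambda>x. complex_of_real (h x)) \<in> max_dom q" and C: "((\<lambda>x. v x * D\<^sub>x h x - h x * v' x) \<longlongrightarrow> C) at_top" for h C
  proof (rule Lim_transform_eventually[OF tendsto_of_real[OF C]])
    show "eventually (\<lambda>x. complex_of_real (v x * D\<^sub>x h x - h x * v' x) = bracket y (\<lambda>x. of_real (h x)) x) at_top"
      using eventually_ge_at_top[of "max X 0"]
    proof eventually_elim
      case (elim x)
      then have "x \<ge> X" "x \<ge> 0" by auto
      then show ?case using bracket_of_real[OF q h, of x y] y by simp
    qed
  qed
  have "complex_of_real A * of_real (sin \<beta>) - of_real B * of_real (cos \<beta>) = 0"
    using AB(3) by (metis diff_self of_real_mult)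
  then show ?thesis using lim[OF f AB(1)] lim[OF g AB(2)] BC by auto
qed simp

lemma bc_real_Re:
  assumes q: "L1_loc q" and adm: "admissible q E" and bc: "satisfies_bc E y"
  shows "bc_real E (\<lambda>x. Re (c * y x)) (\<lambda>x. Re (c * D\<^sub>x y x))"
proof (cases E)
  case (BC f g \<beta>)
  have f: "(\<lambda>x. complex_of_real (f x)) \<in> max_dom q" and g: "(\<lambda>x. complex_of_real (g x)) \<in> max_dom q"
    using adm BC by auto
  obtain A B where AB: "(bracket y (\<lambda>x. of_real (f x)) \<longlongrightarrow> A) at_top" "(bracket y (\<lambda>x. of_real (g x)) \<longlongrightarrow> B) at_top"
    "A * of_real (sin \<beta>) - B * of_real (cos \<beta>) = 0" using bc BC by auto
  have lim: "((\<lambda>x. Re (c * y x) * D\<^sub>x h x - h x * Re (c * D\<^sub>x y x)) \<longlongrightarrow> Re (c * C)) at_top"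
    if h: "(\<lambda>x. complex_of_real (h x)) \<in> max_dom q" and C: "(bracket y (\<lambda>x. of_real (h x)) \<longlongrightarrow> C) at_top" for h C
  proof (rule Lim_transform_eventually[OF tendsto_Re[OF tendsto_mult[OF tendsto_const C]]])
    show "eventually (\<lambda>x. Re (c * bracket y (\<lambda>x. of_real (h x)) x) = Re (c * y x) * D\<^sub>x h x - h x * Re (c * D\<^sub>x y x)) at_top"
      using eventually_ge_at_top[of 0]
      by eventually_elim (simp add: bracket_of_real[OF q h] algebra_simps)
  qed
  have "Re (c * (A * of_real (sin \<beta>) - B * of_real (cos \<beta>))) = 0" using AB(3) by simp
  then have "Re (c * A) * sin \<beta> = Re (c * B) * cos \<beta>" by (simp add: algebra_simps)
  then show ?thesis using lim[OF f AB(1)] lim[OF g AB(2)] BC by auto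
qed simp

text \<open>Leads from real data back to the complex domains. \<open>I\<close> is the half-line, or
  the half-line without \<open>t\<close>; what it omits is null and does not affect square
  integrability.\<close>

lemma weak2_complex:
  assumes s: "weak2_on I v v' (\<lambda>x. q x * v x - k x)" and I: "I \<subseteq> {0..}" and nI: "negligible ({0..} - I)"
    and cov: "\<And>x. x \<in> I \<Longrightarrow> \<exists>a b. (a < x \<or> x = 0 \<and> a = 0) \<and> x < b \<and> {a..b} \<subseteq> I"
    and L: "sq_int 0 v" "sq_int 0 k"
  defines "y \<equiv> (\<lambda>x. complex_of_real (v x))"
  shows "y \<in> L2" "AC1_loc I y" "\<And>x. x \<in> I \<Longrightarrow> D\<^sub>x y x = of_real (v' x)" "tau q y \<in> L2"
    "AE x in lebesgue_on {0..}. tau q y x = of_real (k x)"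
proof -
  have w: "weak2_on I y (\<lambda>x. of_real (v' x)) (\<lambda>x. of_real (q x * v x - k x))"
    unfolding weak2_on_def y_def
  proof (intro allI impI)
    fix a b assume ab: "a < b \<and> {a..b} \<subseteq> I"
    show "weak2 a b (\<lambda>x. complex_of_real (v x)) (\<lambda>x. of_real (v' x)) (\<lambda>x. of_real (q x * v x - k x))"
      by (rule weak2_linear_image[OF weak2_onD[OF s] bounded_linear_of_real]) (use ab in auto)
  qed
  note AC = weak2_on_imp_AC1_loc[OF w I cov]
  show "AC1_loc I y" by (rule AC(1)) auto
  show "D\<^sub>x y x = of_real (v' x)" if "x \<in> I" for x by (rule AC(2)[OF _ that]) auto
  have "sq_int 0 y" unfolding y_def using sq_int_linear_image[OF L(1) bounded_linear_of_real] .
  then show "y \<in> L2" by (simp add: L2_iff_sq_int)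
  have N: "negligible {x\<in>I. D\<^sub>x (D\<^sub>x y) x \<noteq> of_real (q x * v x - k x)}" by (rule AC(3)) auto
  have neg: "negligible {x\<in>{0..}. tau q y x \<noteq> of_real (k x)}"
    by (rule negligible_subset[OF negligible_Un[OF N nI]]) (auto simp: tau_def y_def algebra_simps)
  then show "AE x in lebesgue_on {0..}. tau q y x = of_real (k x)" by (subst AE_lebesgue_on_iff) auto
  have "sq_int 0 (\<lambda>x. complex_of_real (k x))" using sq_int_linear_image[OF L(2) bounded_linear_of_real] .
  then have "sq_int 0 (tau q y)" by (rule sq_int_ae_cong) (rule neg)
  then show "tau q y \<in> L2" by (simp add: L2_iff_sq_int)
qed

lemma sol_complex:
  assumes s: "sol q m I v v'" and I: "I \<subseteq> {0..}" and nI: "negligible ({0..} - I)"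
    and cov: "\<And>x. x \<in> I \<Longrightarrow> \<exists>a b. (a < x \<or> x = 0 \<and> a = 0) \<and> x < b \<and> {a..b} \<subseteq> I"
    and L: "sq_int 0 v"
  defines "y \<equiv> (\<lambda>x. complex_of_real (v x))"
  shows "y \<in> L2" "AC1_loc I y" "\<And>x. x \<in> I \<Longrightarrow> D\<^sub>x y x = of_real (v' x)" "tau q y \<in> L2"
    "AE x in lebesgue_on {0..}. tau q y x = of_real m * y x"
proof -
  have eq: "(\<lambda>x. (q x - m) * v x) = (\<lambda>x. q x * v x - m * v x)" by (simp add: fun_eq_iff algebra_simps)
  have "sq_int 0 (\<lambda>x. m * v x)" using sq_int_scaleR[OF L, of m] by simp
  note C = weak2_complex[OF s[unfolded sol_def eq] I nI cov L this]
  show "y \<in> L2" "AC1_loc I y" "tau q y \<in> L2" unfolding y_def by (rule C; assumption)+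
  show "D\<^sub>x y x = of_real (v' x)" if "x \<in> I" for x unfolding y_def by (rule C(3)[OF _ that])
  have "AE x in lebesgue_on {0..}. tau q (\<lambda>x. of_real (v x)) x = of_real (m * v x)" by (rule C(5))
  then show "AE x in lebesgue_on {0..}. tau q y x = of_real m * y x" by (simp add: y_def)
qed

lemma atLeast_cover: "x \<in> {0::real..} \<Longrightarrow> \<exists>a b. (a < x \<or> x = 0 \<and> a = 0) \<and> x < b \<and> {a..b} \<subseteq> {0..}"
  by (cases "x = 0") (intro exI[of _ 0] exI[of _ "x+1"], auto)+

lemma atLeast_Diff_cover:
  assumes "t > 0" "x \<in> {0::real..} - {t}"
  shows "\<exists>a b. (a < x \<or> x = 0 \<and> a = 0) \<and> x < b \<and> {a..b} \<subseteq> {0..} - {t}"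
proof (cases "x < t")
  case True
  show ?thesis
    by (intro exI[of _ 0] exI[of _ "(x+t)/2"]) (use True assms in auto)
next
  case False
  show ?thesis
    by (intro exI[of _ "(x+t)/2"] exI[of _ "x+1"]) (use False assms in auto)
qed

lemma eigenvalue_unperturbedI:
  assumes q: "L1_loc q" and adm: "admissible q E" and s: "sol q m {0..} v v'" and v0: "v 0 = 0"
    and L: "sq_int 0 v" and bc: "bc_real E v v'" and nt: "x0 \<ge> 0" "v x0 \<noteq> 0"
  shows "eigenvalue q E 0 0 m"
proof -
  note C = sol_complex[OF s order_refl _ atLeast_cover L, simplified]
  define y where "y x = complex_of_real (v x)" for x
  have "satisfies_bc E y"
    by (rule satisfies_bc_of_real[OF q adm _ _ bc, of 0]) (use C(3) in \<open>auto simp: y_def[abs_def]\<close>)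
  then have "y \<in> dom_S_delta q E 0 0"
    using C v0 by (simp add: dom_S_delta_def dom_S_def max_dom_def y_def[abs_def])
  moreover have "y x0 \<noteq> 0" using nt by (simp add: y_def)
  moreover have "AE x in lebesgue_on {0..}. tau q y x = of_real m * y x" using C(5) by (simp add: y_def[abs_def])
  ultimately show ?thesis unfolding eigenvalue_def using nt(1) by blast
qed

lemma eigenvalue_deltaI:
  assumes q: "L1_loc q" and adm: "admissible q E" and t: "t > 0" and r: "r \<noteq> 0"
    and sl: "sol q m {0..t} vl vl'" and sr: "sol q m {t..} vr vr'"
    and v: "vl 0 = 0" "vl t = vr t" "vl t \<noteq> 0" "vl' t - vr' t = r * vl t"
    and L: "sq_int t vr" and bc: "bc_real E vr vr'"
  shows "eigenvalue q E t r m"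
proof -
  define w where "w x = (if x \<le> t then vl x else vr x)" for x
  define w' where "w' x = (if x \<le> t then vl' x else vr' x)" for x
  define y where "y x = complex_of_real (w x)" for x
  have wr: "w x = vr x" if "x \<ge> t" for x using that v(2) by (auto simp: w_def)
  have s: "sol q m ({0..} - {t}) w w'" unfolding sol_def weak2_on_def
  proof (intro allI impI)
    fix a b assume ab: "a < b \<and> {a..b} \<subseteq> {0..} - {t}"
    show "weak2 a b w w' (\<lambda>x. (q x - m) * w x)"
    proof (cases "b < t")
      case True
      have "a \<in> {a..b}" using ab by simp
      then have "a \<ge> 0" using subsetD[OF conjunct2[OF ab], of a] by simp
      then have "{a..b} \<subseteq> {0..t}" using True by auto
      then have "weak2 a b vl vl' (\<lambda>x. (q x - m) * vl x)" using sl ab by (intro solD) auto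
      then show ?thesis by (rule weak2_cong) (use True in \<open>auto simp: w_def w'_def\<close>)
    next
      case False
      have "t \<notin> {a..b}" using ab by blast
      then have "a > t" using False by auto
      then have "{a..b} \<subseteq> {t..}" by auto
      then have "weak2 a b vr vr' (\<lambda>x. (q x - m) * vr x)" using sr ab by (intro solD) auto
      then show ?thesis by (rule weak2_cong) (use \<open>a > t\<close> in \<open>auto simp: w_def w'_def\<close>)
    qed
  qed
  have cl: "continuous_on {0..t} vl" by (rule sol_continuous(1)[OF sl t])
  have cr: "continuous_on {t..} vr" by (rule sol_continuous_atLeast(1)[OF sr])
  have cw: "continuous_on {0..} w"
  proof -
    have "continuous_on ({0..t} \<union> {t..}) w"
    proof (rule continuous_on_closed_Un)
      show "continuous_on {0..t} w" using cl by (rule continuous_on_eq) (auto simp: w_def)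
      show "continuous_on {t..} w" using cr by (rule continuous_on_eq) (auto simp: wr)
    qed auto
    moreover have "{0..t} \<union> {t..} = {0..}" using t by auto
    ultimately show ?thesis by simp
  qed
  have "sq_int t w" by (rule sq_int_dominated[OF L, where C=1])
      (auto simp: wr intro!: continuous_on_atLeast_measurable continuous_on_subset[OF cw] less_imp_le[OF t])
  then have Lw: "sq_int 0 w" by (rule sq_int_extend) (use t in \<open>auto intro: continuous_on_subset[OF cw]\<close>)
  have nI: "negligible ({0..} - ({0..} - {t}))" by (rule negligible_subset[of "{t}"]) auto
  note C = sol_complex[OF s Diff_subset nI atLeast_Diff_cover[OF t] Lw]
  have C': "y \<in> L2" "AC1_loc ({0..} - {t}) y" "tau q y \<in> L2" "AE x in lebesgue_on {0..}. tau q y x = of_real m * y x"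
    using C(1,2,4,5) by (simp_all add: y_def[abs_def])
  have Dy: "D\<^sub>x y x = of_real (w' x)" if "x \<ge> 0" "x \<noteq> t" for x
    using C(3)[of x] that by (simp add: y_def[abs_def])
  have cl': "continuous_on {0..t} vl'" by (rule sol_continuous(2)[OF sl t])
  have cr': "continuous_on {t..} vr'" by (rule sol_continuous_atLeast(2)[OF sr])
  have dl: "(D\<^sub>x y \<longlongrightarrow> of_real (vl' t)) (at_left t)"
  proof (rule Lim_transform_eventually)
    have "(vl' \<longlongrightarrow> vl' t) (at t within {0..t})" using cl' t by (auto simp: continuous_on_def)
    moreover have "at t within {0..t} = at_left t" using t by (simp add: at_within_Icc_at_left)
    ultimately have "(vl' \<longlongrightarrow> vl' t) (at_left t)" by simp
    then show "((\<lambda>x. complex_of_real (vl' x)) \<longlongrightarrow> of_real (vl' t)) (at_left t)" by (rule tendsto_of_real)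
    show "eventually (\<lambda>x. complex_of_real (vl' x) = D\<^sub>x y x) (at_left t)"
      using eventually_at_left_real[OF t] by eventually_elim (use Dy in \<open>auto simp: w'_def\<close>)
  qed
  have dr: "(D\<^sub>x y \<longlongrightarrow> of_real (vr' t)) (at_right t)"
  proof (rule Lim_transform_eventually)
    have "(vr' \<longlongrightarrow> vr' t) (at t within {t..})" using cr' by (auto simp: continuous_on_def)
    then have "(vr' \<longlongrightarrow> vr' t) (at_right t)" by (rule tendsto_within_subset) auto
    then show "((\<lambda>x. complex_of_real (vr' x)) \<longlongrightarrow> of_real (vr' t)) (at_right t)" by (rule tendsto_of_real)
    show "eventually (\<lambda>x. complex_of_real (vr' x) = D\<^sub>x y x) (at_right t)"
      using eventually_at_right_less[of t] by eventually_elim (use Dy t in \<open>auto simp: w'_def\<close>)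
  qed
  have jump: "complex_of_real (vl' t) - of_real (vr' t) = of_real r * y t"
    using v(4) by (simp add: y_def w_def flip: of_real_diff of_real_mult)
  have "satisfies_bc E y"
    by (rule satisfies_bc_of_real[OF q adm _ _ bc, of "t+1"]) (use Dy t in \<open>auto simp: y_def wr w'_def\<close>)
  moreover have "continuous_on {0..} y" unfolding y_def by (intro continuous_intros cw)
  moreover have "y 0 = 0" using v(1) t by (simp add: y_def w_def)
  ultimately have "y \<in> dom_S_delta q E t r"
    using C' dl dr jump t r unfolding dom_S_delta_def by auto
  moreover have "y t \<noteq> 0" using v(3) by (simp add: y_def w_def)
  ultimately show ?thesis unfolding eigenvalue_def using t C'(4) by (meson less_imp_le)
qed

lemma sol_Re:
  assumes w: "weak2_on I y y' (\<lambda>x. of_real (q x) * y x - k x)" and N: "negligible {x\<in>I. k x \<noteq> of_real m * y x}"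
  shows "sol q m I (\<lambda>x. Re (c * y x)) (\<lambda>x. Re (c * y' x))"
  unfolding sol_def weak2_on_def
proof (intro allI impI)
  fix a b assume ab: "a < b \<and> {a..b} \<subseteq> I"
  have bl: "bounded_linear (\<lambda>z. Re (c * z))"
    using bounded_linear_compose[OF bounded_linear_Re bounded_linear_mult_right] .
  have "weak2 a b (\<lambda>x. Re (c * y x)) (\<lambda>x. Re (c * y' x)) (\<lambda>x. Re (c * (of_real (q x) * y x - k x)))"
    by (rule weak2_linear_image[OF weak2_onD[OF w] bl]) (use ab in auto)
  then show "weak2 a b (\<lambda>x. Re (c * y x)) (\<lambda>x. Re (c * y' x)) (\<lambda>x. (q x - m) * Re (c * y x))"
    by (rule weak2_spike[OF _ N]) (use ab in \<open>auto simp: algebra_simps\<close>)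
qed

lemma eigenvalue_unperturbedE:
  assumes q: "L1_loc q" and adm: "admissible q E" and e: "eigenvalue q E t r m" and tr: "t = 0 \<or> r = 0"
  obtains v v' x0 where "sol q m {0..} v v'" "v 0 = 0" "sq_int 0 v" "bc_real E v v'" "x0 \<ge> 0" "v x0 \<noteq> 0"
proof -
  obtain y x0 where y: "y \<in> dom_S q E" "x0 \<ge> 0" "y x0 \<noteq> 0" "AE x in lebesgue_on {0..}. tau q y x = of_real m * y x"
    using e tr unfolding eigenvalue_def dom_S_delta_def by auto
  have y': "y \<in> L2" "AC1_loc {0..} y" "tau q y \<in> L2" "y 0 = 0" "satisfies_bc E y"
    using y(1) by (auto simp: dom_S_def max_dom_def)
  \<comment> \<open>This factor rotates the value at \<open>x0\<close> onto the positive real axis,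
    so the real part of \<open>c y\<close> is a nontrivial real eigenfunction.\<close>
  define c where "c = cnj (y x0)"
  have w: "weak2_on {0..} y (D\<^sub>x y) (\<lambda>x. of_real (q x) * y x - tau q y x)"
    using AC1_loc_tau[OF q y'(2)] y'(3) by (simp add: L2_iff_sq_int)
  have N: "negligible {x\<in>{0..}. tau q y x \<noteq> of_real m * y x}" using y(4) by (subst (asm) AE_lebesgue_on_iff) auto
  show thesis
  proof (rule that[OF sol_Re[OF w N, of c] _ _ bc_real_Re[OF q adm y'(5)] y(2)])
    have "sq_int 0 (\<lambda>x. c * y x)" using y'(1) sq_int_linear_image[OF _ bounded_linear_mult_right] by (simp add: L2_iff_sq_int)
    then show "sq_int 0 (\<lambda>x. Re (c * y x))" by (rule sq_int_linear_image[OF _ bounded_linear_Re])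
    show "Re (c * y x0) \<noteq> 0" using y(3) by (simp add: c_def complex_eq_iff sum_power2_eq_zero_iff flip: power2_eq_square)
  qed (use y' in auto)
qed

text \<open>The domain of the perturbed operator describes \<open>y\<close> only away from
  \<open>t\<close>. Integrability of \<open>y2\<close> up to the endpoints extends \<open>y'\<close>
  continuously, and continuity of \<open>y\<close> turns the extended values into one-sided
  derivatives.\<close>

lemma weak2_closure:
  fixes y :: "real \<Rightarrow> 'a::euclidean_space"
  assumes ab: "a < b" and c: "continuous_on {a..b} y" and w: "weak2_on {a<..<b} y y' y2" and i: "y2 absolutely_integrable_on {a..b}"
  obtains Y' where "weak2 a b y Y' y2" "\<And>x. x \<in> {a<..<b} \<Longrightarrow> Y' x = y' x"
proof -
  define m where "m = (a + b) / 2"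
  have m: "a < m" "m < b" using ab by (auto simp: m_def)
  have ii: "y2 integrable_on {a..b}" using i by (simp add: absolutely_integrable_on_def)
  define Y' where "Y' x = y' m + (integral {a..x} y2 - integral {a..m} y2)" for x
  have Yi: "(y2 has_integral (Y' v - Y' u)) {u..v}" if uv: "a \<le> u" "u \<le> v" "v \<le> b" for u v
  proof -
    have "integral {a..u} y2 + integral {u..v} y2 = integral {a..v} y2"
      by (rule Henstock_Kurzweil_Integration.integral_combine) (use uv in \<open>auto intro: integrable_on_subinterval[OF ii]\<close>)
    moreover have "y2 integrable_on {u..v}" by (rule integrable_on_subinterval[OF ii]) (use uv in auto)
    ultimately show ?thesis unfolding Y'_def by (simp add: has_integral_iff algebra_simps)
  qed
  have Ym: "Y' m = y' m" by (simp add: Y'_def)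
  have Yeq: "Y' x = y' x" if x: "x \<in> {a<..<b}" for x
  proof (cases x m rule: linorder_cases)
    case less
    have "weak2 x m y y' y2" by (rule weak2_onD[OF w]) (use less x m in auto)
    then have "(y2 has_integral (y' m - y' x)) {x..m}" using less by (intro weak2D(3)) auto
    moreover have "(y2 has_integral (Y' m - Y' x)) {x..m}" by (rule Yi) (use x m less in auto)
    ultimately have "Y' m - Y' x = y' m - y' x" by (metis has_integral_unique)
    then show ?thesis by (simp add: Ym)
  next
    case greater
    have "weak2 m x y y' y2" by (rule weak2_onD[OF w]) (use greater x m in auto)
    then have "(y2 has_integral (y' x - y' m)) {m..x}" using greater by (intro weak2D(3)) auto
    moreover have "(y2 has_integral (Y' x - Y' m)) {m..x}" by (rule Yi) (use x m greater in auto)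
    ultimately have "Y' x - Y' m = y' x - y' m" by (metis has_integral_unique)
    then show ?thesis by (simp add: Ym)
  qed (simp add: Ym)
  have Yc: "continuous_on {a..b} Y'" unfolding Y'_def
    by (intro continuous_intros indefinite_integral_continuous_1[OF ii])
  \<comment> \<open>A primitive of the extended derivative, normalised at an interior point. It
    agrees with \<open>y\<close> inside, hence by continuity on the closed interval, where its
    differentiability is inherited by \<open>y\<close>.\<close>
  define G where "G x = y m + (integral {a..x} Y' - integral {a..m} Y')" for x
  have Gm: "G m = y m" by (simp add: G_def)
  have Gd: "(G has_vector_derivative Y' x) (at x within {a..b})" if "x \<in> {a..b}" for x
  proof -
    have "((\<lambda>x. y m + (integral {a..x} Y' - integral {a..m} Y')) has_vector_derivative 0 + (Y' x - 0)) (at x within {a..b})"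
      by (intro has_vector_derivative_add has_vector_derivative_diff has_vector_derivative_const integral_has_vector_derivative[OF Yc that])
    then show ?thesis by (simp add: G_def[abs_def])
  qed
  have Gc: "continuous_on {a..b} G"
    unfolding continuous_on_eq_continuous_within using Gd has_vector_derivative_continuous by blast
  have GY: "(Y' has_integral G v - G u) {u..v}" if "a \<le> u" "u \<le> v" "v \<le> b" for u v
    by (rule fundamental_theorem_of_calculus[OF that(2)])
      (use that in \<open>auto intro: has_vector_derivative_within_subset[OF Gd]\<close>)
  have yY: "(Y' has_integral y v - y u) {u..v}" if uv: "a < u" "u < v" "v < b" for u v
  proof (rule fundamental_theorem_of_calculus)
    have w': "weak2 u v y y' y2" by (rule weak2_onD[OF w]) (use uv in auto)
    fix x assume "x \<in> {u..v}"
    then show "(y has_vector_derivative Y' x) (at x within {u..v})" using weak2D(1)[OF w'] Yeq[of x] uv by auto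
  qed (use uv in auto)
  have Geq: "G x = y x" if x: "x \<in> {a<..<b}" for x
  proof (cases x m rule: linorder_cases)
    case less
    have "(Y' has_integral y m - y x) {x..m}" by (rule yY) (use x m less in auto)
    moreover have "(Y' has_integral G m - G x) {x..m}" by (rule GY) (use x m less in auto)
    ultimately have "G m - G x = y m - y x" by (metis has_integral_unique)
    then show ?thesis by (simp add: Gm)
  next
    case greater
    have "(Y' has_integral y x - y m) {m..x}" by (rule yY) (use x m greater in auto)
    moreover have "(Y' has_integral G x - G m) {m..x}" by (rule GY) (use x m greater in auto)
    ultimately have "G x - G m = y x - y m" by (metis has_integral_unique)
    then show ?thesis by (simp add: Gm)
  qed (simp add: Gm)
  have "G x - y x = 0" if x: "x \<in> {a..b}" for x
  proof (rule continuous_constant_on_closure[where S = "{a<..<b}" and f = "\<lambda>x. G x - y x" and a = 0])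
    show "continuous_on (closure {a<..<b}) (\<lambda>x. G x - y x)" using ab by (simp add: closure_greaterThanLessThan continuous_on_diff Gc c)
  qed (use Geq ab x in \<open>auto simp: closure_greaterThanLessThan\<close>)
  then have Gy: "y x = G x" if "x \<in> {a..b}" for x using that by simp
  have "weak2 a b G Y' y2" unfolding weak2_def using Gd i Yi by blast
  then have "weak2 a b y Y' y2" by (rule weak2_cong) (use Gy in auto)
  then show thesis using Yeq that by blast
qed

lemma eigenvalue_deltaE:
  assumes q: "L1_loc q" and adm: "admissible q E" and e: "eigenvalue q E t r m" and t: "t > 0" and r: "r > 0"
  obtains v vl' vr' x0 where "sol q m {0..t} v vl'" "sol q m {t..} v vr'" "v 0 = 0" "vl' t - vr' t = r * v t"
    "sq_int t v" "bc_real E v vr'" "x0 \<ge> 0" "v x0 \<noteq> 0"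
proof -
  obtain y x0 where y: "y \<in> dom_S_delta q E t r" "x0 \<ge> 0" "y x0 \<noteq> 0" "AE x in lebesgue_on {0..}. tau q y x = of_real m * y x"
    using e unfolding eigenvalue_def by auto
  have y': "y \<in> L2" "continuous_on {0..} y" "AC1_loc ({0..} - {t}) y" "tau q y \<in> L2" "y 0 = 0" "satisfies_bc E y"
    using y(1) t r by (auto simp: dom_S_delta_def)
  obtain dl dr where d: "(D\<^sub>x y \<longlongrightarrow> dl) (at_left t)" "(D\<^sub>x y \<longlongrightarrow> dr) (at_right t)" "dl - dr = of_real r * y t"
    using y(1) t r by (auto simp: dom_S_delta_def)
  define c where "c = cnj (y x0)"
  define v where "v x = Re (c * y x)" for x
  define v' where "v' x = Re (c * D\<^sub>x y x)" for x
  have w: "weak2_on ({0..} - {t}) y (D\<^sub>x y) (\<lambda>x. of_real (q x) * y x - tau q y x)"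
    using AC1_loc_tau[OF q y'(3)] y'(4) by (simp add: L2_iff_sq_int)
  have N: "negligible {x\<in>{0..} - {t}. tau q y x \<noteq> of_real m * y x}"
    using y(4) by (subst (asm) AE_lebesgue_on_iff) (auto elim: negligible_subset)
  have s: "sol q m ({0..} - {t}) v v'" unfolding v_def v'_def by (rule sol_Re[OF w N])
  have cv: "continuous_on {0..} v" unfolding v_def by (intro continuous_intros y'(2))
  have i2: "(\<lambda>x. (q x - m) * v x) absolutely_integrable_on {a..b}" if "0 \<le> a" for a b
  proof -
    have "continuous_on {a..b} v" by (rule continuous_on_subset[OF cv]) (use that in auto)
    moreover have "(\<lambda>x. q x - m) absolutely_integrable_on {a..b}"
      using L1_loc_subinterval[OF q that] by (rule set_integral_diff(1)) simp
    ultimately have "(\<lambda>x. v x * (q x - m)) absolutely_integrable_on {a..b}" by (rule absolutely_integrable_continuous_mult)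
    then show ?thesis by (simp add: mult.commute)
  qed
  have d': "(v' \<longlongrightarrow> Re (c * dl)) (at_left t)" "(v' \<longlongrightarrow> Re (c * dr)) (at_right t)"
    unfolding v'_def by (intro tendsto_Re tendsto_mult tendsto_const d)+
  have jump: "Re (c * dl) - Re (c * dr) = r * v t"
  proof -
    have "Re (c * dl) - Re (c * dr) = Re (c * (dl - dr))" by (simp add: algebra_simps)
    also have "\<dots> = Re (of_real r * (c * y t))" unfolding d(3) by (simp add: algebra_simps)
    finally show ?thesis by (simp add: v_def)
  qed
  \<comment> \<open>Only the value at \<open>t\<close> is replaced, by the limit from the right: at
    a kink \<open>D\<^sub>x\<close> has no meaning.\<close>
  define vr' where "vr' x = (if x = t then Re (c * dr) else v' x)" for x
  obtain Y' where Y': "weak2 0 t v Y' (\<lambda>x. (q x - m) * v x)" "\<And>x. x \<in> {0<..<t} \<Longrightarrow> Y' x = v' x"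
  proof (rule weak2_closure[OF t])
    show "continuous_on {0..t} v" by (rule continuous_on_subset[OF cv]) auto
    show "weak2_on {0<..<t} v v' (\<lambda>x. (q x - m) * v x)" using s unfolding sol_def by (rule weak2_on_subset) auto
    show "(\<lambda>x. (q x - m) * v x) absolutely_integrable_on {0..t}" by (rule i2) simp
  qed blast
  have Yt: "Y' t = Re (c * dl)"
  proof (rule tendsto_unique)
    show "at_left t \<noteq> bot" by simp
    have "(Y' \<longlongrightarrow> Y' t) (at t within {0..t})" using weak2_continuous(2)[OF Y'(1)] t by (auto simp: continuous_on_def)
    moreover have "at t within {0..t} = at_left t" using t by (simp add: at_within_Icc_at_left)
    ultimately show "(Y' \<longlongrightarrow> Y' t) (at_left t)" by simp
    show "(Y' \<longlongrightarrow> Re (c * dl)) (at_left t)"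
    proof (rule Lim_transform_eventually[OF d'(1)])
      show "eventually (\<lambda>x. v' x = Y' x) (at_left t)"
        using eventually_at_left_real[OF t] by eventually_elim (use Y' in auto)
    qed
  qed
  have sl: "sol q m {0..t} v Y'" unfolding sol_def weak2_on_def
  proof (intro allI impI)
    fix a b assume ab: "a < b \<and> {a..b} \<subseteq> {0..t}"
    show "weak2 a b v Y' (\<lambda>x. (q x - m) * v x)" by (rule weak2_subset[OF Y'(1)]) (use ab in auto)
  qed
  have sr: "sol q m {t..} v vr'" unfolding sol_def weak2_on_def
  proof (intro allI impI)
    fix a b assume ab: "a < b \<and> {a..b} \<subseteq> {t..}"
    then have at: "t \<le> a" by auto
    obtain Z' where Z': "weak2 t (b+1) v Z' (\<lambda>x. (q x - m) * v x)" "\<And>x. x \<in> {t<..<b+1} \<Longrightarrow> Z' x = v' x"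
    proof (rule weak2_closure[of t "b+1" v v'])
      show "continuous_on {t..b+1} v" by (rule continuous_on_subset[OF cv]) (use t in auto)
      show "weak2_on {t<..<b+1} v v' (\<lambda>x. (q x - m) * v x)" using s unfolding sol_def by (rule weak2_on_subset) (use t in auto)
      show "(\<lambda>x. (q x - m) * v x) absolutely_integrable_on {t..b+1}" by (rule i2) (use t in simp)
    qed (use ab at in auto)
    have tb: "t < b + 1" using ab at by auto
    have Zt: "Z' t = Re (c * dr)"
    proof (rule tendsto_unique)
      show "at_right t \<noteq> bot" by simp
      have "(Z' \<longlongrightarrow> Z' t) (at t within {t..b+1})" using weak2_continuous(2)[OF Z'(1)] tb by (auto simp: continuous_on_def)
      moreover have "at t within {t..b+1} = at_right t" using tb by (simp add: at_within_Icc_at_right)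
      ultimately show "(Z' \<longlongrightarrow> Z' t) (at_right t)" by simp
      show "(Z' \<longlongrightarrow> Re (c * dr)) (at_right t)"
      proof (rule Lim_transform_eventually[OF d'(2)])
        show "eventually (\<lambda>x. v' x = Z' x) (at_right t)"
          using eventually_at_right_real[OF tb] by eventually_elim (use Z' in auto)
      qed
    qed
    have "weak2 a b v Z' (\<lambda>x. (q x - m) * v x)" by (rule weak2_subset[OF Z'(1)]) (use ab at in auto)
    then show "weak2 a b v vr' (\<lambda>x. (q x - m) * v x)"
      by (rule weak2_cong) (use Zt Z'(2) at in \<open>auto simp: vr'_def\<close>)
  qed
  have Lv: "sq_int 0 v"
  proof -
    have "sq_int 0 (\<lambda>x. c * y x)" using y'(1) sq_int_linear_image[OF _ bounded_linear_mult_right] by (simp add: L2_iff_sq_int)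
    then show ?thesis unfolding v_def by (rule sq_int_linear_image[OF _ bounded_linear_Re])
  qed
  have "bc_real E v v'" unfolding v_def v'_def by (rule bc_real_Re[OF q adm y'(6)])
  then have bc: "bc_real E v vr'"
  proof (cases E)
    case (BC f g \<beta>)
    have ev: "eventually (\<lambda>x. v x * D\<^sub>x h x - h x * v' x = v x * D\<^sub>x h x - h x * vr' x) at_top" for h
      using eventually_gt_at_top[of t] by eventually_elim (simp add: vr'_def)
    have "((\<lambda>x. v x * D\<^sub>x h x - h x * vr' x) \<longlongrightarrow> C) at_top" if "((\<lambda>x. v x * D\<^sub>x h x - h x * v' x) \<longlongrightarrow> C) at_top" for h C
      using Lim_transform_eventually[OF that ev] .
    then show ?thesis using \<open>bc_real E v v'\<close> BC by auto
  qed simp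
  show thesis
  proof (rule that[OF sl sr _ _ sq_int_mono[OF Lv] bc y(2)])
    show "v x0 \<noteq> 0" using y(3) by (simp add: v_def c_def complex_eq_iff sum_power2_eq_zero_iff flip: power2_eq_square)
    show "Y' t - vr' t = r * v t" using jump Yt by (simp add: vr'_def)
    show "v 0 = 0" using y'(5) by (simp add: v_def)
  qed (use t in simp)
qed

section \<open>Perturbation of a positive ground state\<close>

lemma sol_imp_end_sol:
  assumes "sol q l {T..} y y'" "sq_int T y"
  shows "end_sol q T y y' (\<lambda>x. l * y x)"
  unfolding end_sol_def
proof (intro conjI assms(2))
  have eq: "(\<lambda>x. (q x - l) * y x) = (\<lambda>x. q x * y x - l * y x)" by (simp add: fun_eq_iff algebra_simps)
  show "weak2_on {T..} y y' (\<lambda>x. q x * y x - l * y x)" using assms(1) unfolding sol_def eq .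
  show "sq_int T (\<lambda>x. l * y x)" using sq_int_scaleR[OF assms(2), of l] by simp
qed

lemma sol_sq_intI:
  assumes "sol q l {T..} y y'" "sq_int T z" "\<And>x. x \<ge> T \<Longrightarrow> norm (y x) \<le> C * norm (z x)"
  shows "sq_int T y"
  by (rule sq_int_dominated[OF assms(2) continuous_on_atLeast_measurable[OF sol_continuous_atLeast(1)[OF assms(1)]]])
    (use assms(3) in auto)

lemma integral_tail_tendsto_zero:
  fixes f :: "real \<Rightarrow> real"
  assumes f: "f absolutely_integrable_on {T..}"
  shows "((\<lambda>x. integral {x..} f) \<longlongrightarrow> 0) at_top" "x \<ge> T \<Longrightarrow> integral {T..x} f + integral {x..} f = integral {T..} f"
proof -
  have split: "integral {T..x} f + integral {x..} f = integral {T..} f" if x: "x \<ge> T" for x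
  proof -
    have U: "{T..} = {T..x} \<union> {x..}" using x by auto
    have i: "f integrable_on {T..x}" "f integrable_on {x..}"
      using absolutely_integrable_atLeast_subinterval(1)[OF f order_refl, of x] absolutely_integrable_atLeast_subinterval(2)[OF f x]
      by (auto simp: absolutely_integrable_on_def)
    have "integral ({T..x} \<union> {x..}) f = integral {T..x} f + integral {x..} f"
      by (rule Henstock_Kurzweil_Integration.integral_Un[OF i]) (rule negligible_subset[of "{x}"], auto)
    then show ?thesis using U by simp
  qed
  show "integral {T..x} f + integral {x..} f = integral {T..} f" if "x \<ge> T" using split[OF that] .
  have "((\<lambda>x. integral {T..} f - integral {T..x} f) \<longlongrightarrow> integral {T..} f - integral {T..} f) at_top"
    by (rule tendsto_diff[OF tendsto_const integral_tendsto_at_top[OF f]])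
  then have "((\<lambda>x. integral {T..} f - integral {T..x} f) \<longlongrightarrow> 0) at_top" by simp
  then show "((\<lambda>x. integral {x..} f) \<longlongrightarrow> 0) at_top"
  proof (rule Lim_transform_eventually)
    show "eventually (\<lambda>x. integral {T..} f - integral {T..x} f = integral {x..} f) at_top"
      using eventually_ge_at_top[of T] by eventually_elim (use split in \<open>simp add: algebra_simps\<close>)
  qed
qed

text \<open>Positivity is an assumption here so that the perturbation argument is shared by both
  kinds of endpoint; they differ in the proof of \<open>upos\<close>. The square integrable
  companion solution demanded by \<open>second\<close> is what transfers the boundary condition from
  \<open>u\<close> to other solutions.\<close>

locale ground_state =
  fixes q :: "real \<Rightarrow> real" and E :: endpoint and u u' :: "real \<Rightarrow> real" and l :: real
  assumes L1: "L1_loc q" and adm: "admissible q E"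
    and u: "sol q l {0..} u u'" and u0: "u 0 = 0" and upos: "\<And>x. x > 0 \<Longrightarrow> u x > 0"
    and uL: "sq_int 0 u" and ubc: "bc_real E u u'"
    and second: "\<And>f g \<beta>. E = BC f g \<beta> \<Longrightarrow>
       \<exists>\<theta> \<theta>'. sol q l {0..} \<theta> \<theta>' \<and> sq_int 0 \<theta> \<and> u 0 * \<theta>' 0 - \<theta> 0 * u' 0 = 1"
begin

definition N :: real where "N = integral {0..} (\<lambda>x. (u x)\<^sup>2)"

lemma u2_absolutely_integrable: "(\<lambda>x. (u x)\<^sup>2) absolutely_integrable_on {0..}"
  using sq_int_absolutely_integrable[OF uL] by simp

lemma u2_integrable: "0 \<le> a \<Longrightarrow> (\<lambda>x. (u x)\<^sup>2) integrable_on {a..b}" "0 \<le> a \<Longrightarrow> (\<lambda>x. (u x)\<^sup>2) integrable_on {a..}"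
  using absolutely_integrable_atLeast_subinterval[OF u2_absolutely_integrable] by (auto simp: absolutely_integrable_on_def)

lemma integral_u2_le: "0 \<le> a \<Longrightarrow> integral {a..b} (\<lambda>x. (u x)\<^sup>2) \<le> N" "0 \<le> a \<Longrightarrow> integral {a..} (\<lambda>x. (u x)\<^sup>2) \<le> N"
  unfolding N_def by (rule integral_subset_le; use u2_integrable in auto)+

lemma u_nonneg: "x \<ge> 0 \<Longrightarrow> u x \<ge> 0"
  using upos u0 by (cases "x = 0") (auto intro: less_imp_le)

lemma end_u: "T \<ge> 0 \<Longrightarrow> end_sol q T u u' (\<lambda>x. l * u x)"
  by (rule end_sol_mono[OF sol_imp_end_sol[OF u uL]])

lemma bc_transfer:
  assumes T: "T \<ge> 0" and y: "end_sol q T y y' k" and lim: "((\<lambda>x. u x * y' x - y x * u' x) \<longlongrightarrow> 0) at_top"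
  shows "bc_real E y y'"
proof (rule bc_real_transfer[OF L1 adm T end_u[OF T] ubc y])
  show "((\<lambda>x. y x * u' x - u x * y' x) \<longlongrightarrow> 0) at_top" using tendsto_minus[OF lim] by simp
  fix f g \<beta> assume "E = BC f g \<beta>"
  then obtain \<theta> \<theta>' where t: "sol q l {0..} \<theta> \<theta>'" "sq_int 0 \<theta>" "u 0 * \<theta>' 0 - \<theta> 0 * u' 0 = 1" using second by blast
  have "eventually (\<lambda>x. 1 = u x * \<theta>' x - \<theta> x * u' x) at_top"
    using eventually_ge_at_top[of 0] by eventually_elim (use sol_wronskian_const[OF u t(1), of _ 0] t(3) in simp)
  with tendsto_const have "((\<lambda>x. u x * \<theta>' x - \<theta> x * u' x) \<longlongrightarrow> 1) at_top" by (rule Lim_transform_eventually)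
  then show "\<exists>\<theta> \<theta>' n. end_sol q T \<theta> \<theta>' n \<and> ((\<lambda>x. u x * \<theta>' x - \<theta> x * u' x) \<longlongrightarrow> 1) at_top"
    using end_sol_mono[OF sol_imp_end_sol[OF t(1,2)] T] by blast
qed

text \<open>The solution on the right: with \<open>y\<^sub>1, y\<^sub>2\<close> a fundamental system at level \<open>l - e\<close> and \<open>p\<^sub>i = u y\<^sub>i' - y\<^sub>i u'\<close>, the quotient
  \<open>p\<^sub>1/p\<^sub>2\<close> has derivative \<open>e u\<^sup>2/p\<^sub>2\<^sup>2\<close>, so it increases to a limit \<open>c\<close>, and \<open>y\<^sub>1 - c y\<^sub>2\<close> is the solution sought.\<close>

lemma right_solution:
  assumes t: "t > 0" and e: "e > 0"
  shows "\<exists>y y'. sol q (l - e) {t..} y y' \<and> y t = u t \<and> (\<forall>x\<ge>t. 0 \<le> y x \<and> y x \<le> u x) \<and> sq_int t y \<and> bc_real E y y' \<and>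
    ((\<lambda>x. u x * y' x - y x * u' x) \<longlongrightarrow> 0) at_top \<and>
    (\<forall>x M. t \<le> x \<and> (\<forall>s\<in>{t..x}. 1 / (u s)\<^sup>2 \<le> M) \<longrightarrow> 1 - y x / u x \<le> e * N * M * (x - t))"
proof -
  have ut: "u t > 0" using upos t by simp
  have t0: "t \<ge> 0" using t by simp
  obtain y1 y1' where y1: "sol q (l - e) {0..} y1 y1'" "y1 t = u t" "y1' t = u' t" by (rule sol_exists[OF L1 t0])
  obtain y2 y2' where y2: "sol q (l - e) {0..} y2 y2'" "y2 t = 0" "y2' t = 1 / u t" by (rule sol_exists[OF L1 t0])
  have W: "y1 x * y2' x - y2 x * y1' x = 1" if "x \<ge> 0" for x
    using sol_wronskian_const[OF y1(1) y2(1) that t0] y1 y2 ut by simp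
  define p1 p2 where "p1 x = u x * y1' x - y1 x * u' x" and "p2 x = u x * y2' x - y2 x * u' x" for x
  have sub: "sol q l {a..b} u u'" "sol q (l - e) {a..b} y1 y1'" "sol q (l - e) {a..b} y2 y2'" if "t \<le> a" for a b
    using u y1(1) y2(1) that t0 by (auto elim!: sol_subset)
  have p2t: "p2 t = 1" "p1 t = 0" using y2 y1 ut by (auto simp: p1_def p2_def)
  \<comment> \<open>Since \<open>y2\<close> vanishes at \<open>t\<close>, so does
    \<open>p2 w\<close>, and Picone's identity makes the square of \<open>p2\<close> nondecreasing.
    Thus \<open>p2\<close> stays at least 1 and the quotient \<open>R\<close> is defined on all of
    \<open>{t..}\<close>.\<close>
  have p2sq: "(p2 a)\<^sup>2 \<le> (p2 b)\<^sup>2" if ab: "t \<le> a" "a \<le> b" for a b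
  proof (cases "t = b")
    case False
    then have "t < b" using ab by simp
    then show ?thesis unfolding p2_def
      by (rule picone_sq_mono(2)[OF sub(1)[OF order_refl] sub(3)[OF order_refl]]) (use e upos t y2(2) ab in auto)
  qed (use ab in auto)
  have p2ge: "p2 x \<ge> 1" if x: "x \<ge> t" for x
  proof (cases "x = t")
    case False
    then have tx: "t < x" using x by simp
    have "p2 x > 0"
    proof (rule continuous_sign_pos[of t x p2 t])
      show "continuous_on {t..x} p2" unfolding p2_def
        by (intro continuous_intros sol_continuous[OF sub(1)[OF order_refl] tx] sol_continuous[OF sub(3)[OF order_refl] tx])
      fix s assume "s \<in> {t..x}"
      then show "p2 s \<noteq> 0" using p2sq[of t s] p2t by auto
    qed (use tx p2t in auto)
    moreover have "(p2 x)\<^sup>2 \<ge> 1" using p2sq[of t x] p2t x by simp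
    ultimately show ?thesis by (metis abs_of_pos abs_square_less_1 not_le)
  qed (use p2t in simp)
  define R where "R x = p1 x / p2 x" for x
  have Rd: "(R has_real_derivative e * (u x)\<^sup>2 / (p2 x)\<^sup>2) (at x within {a..b})" if ab: "t \<le> a" "a < b" "x \<in> {a..b}" for a b x
  proof -
    have d1: "(p1 has_real_derivative e * (u x * y1 x)) (at x within {a..b})"
      using wronskian_deriv[OF sub(1,2)[OF ab(1)] ab(2,3)] by (simp add: p1_def[abs_def])
    have d2: "(p2 has_real_derivative e * (u x * y2 x)) (at x within {a..b})"
      using wronskian_deriv[OF sub(1,3)[OF ab(1)] ab(2,3)] by (simp add: p2_def[abs_def])
    have p20: "p2 x \<noteq> 0" using p2ge[of x] ab by auto
    have x0: "x \<ge> 0" using ab t0 by auto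
    have "y1 x * p2 x - y2 x * p1 x = u x * (y1 x * y2' x - y2 x * y1' x)" by (simp add: p1_def p2_def algebra_simps)
    then have key: "y1 x * p2 x - y2 x * p1 x = u x" using W[OF x0] by simp
    have "e * (u x * y1 x) * p2 x - p1 x * (e * (u x * y2 x)) = e * u x * (y1 x * p2 x - y2 x * p1 x)" by (simp add: algebra_simps)
    also have "\<dots> = e * (u x)\<^sup>2" using key by (simp add: power2_eq_square)
    finally have num: "e * (u x * y1 x) * p2 x - p1 x * (e * (u x * y2 x)) = e * (u x)\<^sup>2" .
    show ?thesis unfolding R_def
      by (rule DERIV_cong[OF DERIV_divide[OF d1 d2 p20]]) (simp add: num power2_eq_square)
  qed
  have Rint: "R b - R a \<ge> 0" "R b - R a \<le> e / (p2 a)\<^sup>2 * integral {a..} (\<lambda>x. (u x)\<^sup>2)" if ab: "t \<le> a" "a \<le> b" for a b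
  proof -
    have a0: "0 \<le> a" using ab t0 by simp
    have i: "((\<lambda>x. e * (u x)\<^sup>2 / (p2 x)\<^sup>2) has_integral (R b - R a)) {a..b}"
    proof (cases "a = b")
      case False
      then have "a < b" using ab by simp
      then show ?thesis
        by (intro fundamental_theorem_of_calculus) (use Rd[OF ab(1)] ab in \<open>auto simp: has_real_derivative_iff_has_vector_derivative\<close>)
    qed (simp add: has_integral_refl)
    show "R b - R a \<ge> 0" using i by (rule has_integral_nonneg) (use e in auto)
    have j: "((\<lambda>x. e / (p2 a)\<^sup>2 * (u x)\<^sup>2) has_integral (e / (p2 a)\<^sup>2 * integral {a..b} (\<lambda>x. (u x)\<^sup>2))) {a..b}"
      by (intro has_integral_mult_right integrable_integral u2_integrable(1) a0)
    have "R b - R a \<le> e / (p2 a)\<^sup>2 * integral {a..b} (\<lambda>x. (u x)\<^sup>2)"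
    proof (rule has_integral_le[OF i j])
      fix x assume x: "x \<in> {a..b}"
      have "(p2 a)\<^sup>2 \<le> (p2 x)\<^sup>2" "(p2 a)\<^sup>2 > 0" using p2sq[of a x] x ab p2ge[of a] by auto
      then have "e * (u x)\<^sup>2 / (p2 x)\<^sup>2 \<le> e * (u x)\<^sup>2 / (p2 a)\<^sup>2"
        using e by (intro divide_left_mono mult_pos_pos mult_nonneg_nonneg) (auto intro: less_le_trans)
      then show "e * (u x)\<^sup>2 / (p2 x)\<^sup>2 \<le> e / (p2 a)\<^sup>2 * (u x)\<^sup>2" by simp
    qed
    also have "\<dots> \<le> e / (p2 a)\<^sup>2 * integral {a..} (\<lambda>x. (u x)\<^sup>2)"
      by (intro mult_left_mono integral_subset_le u2_integrable a0) (use e in auto)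
    finally show "R b - R a \<le> e / (p2 a)\<^sup>2 * integral {a..} (\<lambda>x. (u x)\<^sup>2)" .
  qed
  \<comment> \<open>The limit of the nondecreasing \<open>R\<close>, the only coefficient for which
    the Wronskian of \<open>u\<close> and \<open>y1 - c y2\<close>, namely \<open>p1 - c p2\<close>,
    can vanish at infinity while \<open>p2\<close> stays above 1.\<close>
  define c where "c = (SUP x\<in>{t..}. R x)"
  have bdd: "bdd_above (R ` {t..})"
    by (rule bdd_aboveI2[of _ _ "R t + e / (p2 t)\<^sup>2 * integral {t..} (\<lambda>x. (u x)\<^sup>2)"]) (use Rint(2)[of t] in \<open>auto simp: algebra_simps\<close>)
  have c1: "R x \<le> c" if "x \<ge> t" for x unfolding c_def using bdd that by (intro cSUP_upper) auto
  have c2: "c \<le> R x + e / (p2 x)\<^sup>2 * integral {x..} (\<lambda>x. (u x)\<^sup>2)" if x: "x \<ge> t" for x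
    unfolding c_def
  proof (rule cSUP_least)
    fix b assume b: "b \<in> {t..}"
    show "R b \<le> R x + e / (p2 x)\<^sup>2 * integral {x..} (\<lambda>x. (u x)\<^sup>2)"
    proof (cases "b \<ge> x")
      case True then show ?thesis using Rint(2)[OF x] by (simp add: algebra_simps)
    next
      case False
      have "0 \<le> e / (p2 x)\<^sup>2 * integral {x..} (\<lambda>x. (u x)\<^sup>2)"
        using e x t0 by (intro mult_nonneg_nonneg integral_nonneg u2_integrable) auto
      then show ?thesis using Rint(1)[of b x] b False by auto
    qed
  qed auto
  define y y' where "y x = 1 * y1 x + (- c) * y2 x" and "y' x = 1 * y1' x + (- c) * y2' x" for x
  have y0: "sol q (l - e) {0..} y y'" unfolding y_def y'_def by (rule sol_linear[OF y1(1) y2(1)])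
  have ys: "sol q (l - e) {t..} y y'" using y0 by (rule sol_subset) (use t0 in auto)
  have us: "sol q l {t..} u u'" using u by (rule sol_subset) (use t0 in auto)
  have yt: "y t = u t" using y1 y2 by (simp add: y_def)
  define p where "p x = u x * y' x - y x * u' x" for x
  have pp: "p x = - (p2 x * (c - R x))" if "x \<ge> t" for x
    using p2ge[OF that] by (simp add: p_def y_def y'_def R_def p1_def p2_def field_simps)
  have pneg: "p x \<le> 0" if "x \<ge> t" for x
    unfolding pp[OF that] using p2ge[OF that] c1[OF that] by (simp add: mult_nonneg_nonneg)
  \<comment> \<open>The remaining increase of \<open>R\<close> carries the factor
    \<open>1/p2^2\<close>, which outweighs the factor \<open>p2\<close> in \<open>p\<close>. What is
    left is \<open>e\<close> times a tail of the integral of \<open>u^2\<close>.\<close>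
  have plow: "p x \<ge> - (e * integral {x..} (\<lambda>x. (u x)\<^sup>2))" if x: "x \<ge> t" for x
  proof -
    have g: "p2 x \<ge> 1" by (rule p2ge[OF x])
    have I0: "integral {x..} (\<lambda>x. (u x)\<^sup>2) \<ge> 0" using x t0 by (intro integral_nonneg u2_integrable) auto
    have "p2 x * (c - R x) \<le> p2 x * (e / (p2 x)\<^sup>2 * integral {x..} (\<lambda>x. (u x)\<^sup>2))"
      using c2[OF x] g by (intro mult_left_mono) auto
    also have "\<dots> = (e * integral {x..} (\<lambda>x. (u x)\<^sup>2)) / p2 x" using g by (simp add: power2_eq_square)
    also have "\<dots> \<le> e * integral {x..} (\<lambda>x. (u x)\<^sup>2)"
    proof -
      have "0 \<le> e * integral {x..} (\<lambda>x. (u x)\<^sup>2)" using e I0 by simp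
      then show ?thesis using g divide_left_mono[of 1 "p2 x"] by fastforce
    qed
    finally show ?thesis unfolding pp[OF x] by simp
  qed
  have plim: "(p \<longlongrightarrow> 0) at_top"
  proof (rule tendsto_sandwich)
    have "((\<lambda>x. - (e * integral {x..} (\<lambda>x. (u x)\<^sup>2))) \<longlongrightarrow> - (e * 0)) at_top"
      by (intro tendsto_minus tendsto_mult tendsto_const integral_tail_tendsto_zero(1)[OF u2_absolutely_integrable])
    then show "((\<lambda>x. - (e * integral {x..} (\<lambda>x. (u x)\<^sup>2))) \<longlongrightarrow> 0) at_top" by simp
    show "((\<lambda>x. 0) \<longlongrightarrow> (0::real)) at_top" by simp
    show "eventually (\<lambda>x. - (e * integral {x..} (\<lambda>x. (u x)\<^sup>2)) \<le> p x) at_top"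
      using eventually_ge_at_top[of t] by eventually_elim (rule plow)
    show "eventually (\<lambda>x. p x \<le> 0) at_top"
      using eventually_ge_at_top[of t] by eventually_elim (rule pneg)
  qed
  have wd: "((\<lambda>x. y x / u x) has_real_derivative p x / (u x)\<^sup>2) (at x within {a..b})" if "t \<le> a" "a < b" "x \<in> {a..b}" for a b x
    unfolding p_def by (rule quotient_deriv[OF sol_subset[OF us] sol_subset[OF ys]]) (use that upos t in auto)
  have wmono: "y b / u b \<le> y a / u a" if ab: "t \<le> a" "a \<le> b" for a b
  proof (cases "a = b")
    case False
    then have "a < b" using ab by simp
    then have "- (y a / u a) \<le> - (y b / u b)"
      by (intro nondecreasing_within[of a b "\<lambda>x. - (y x / u x)" "\<lambda>x. - (p x / (u x)\<^sup>2)"] DERIV_minus wd)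
        (use ab pneg in \<open>auto simp: divide_nonpos_nonneg\<close>)
    then show ?thesis by simp
  qed simp
  have yle: "y x \<le> u x" if x: "x \<ge> t" for x
    using wmono[OF order_refl x] yt ut upos[of x] x t by (simp add: divide_le_eq)
  \<comment> \<open>As \<open>y/u\<close> decreases, a negative value would persist. Then the
    inequality \<open>p w \<le> 0\<close> gives \<open>p \<ge> 0\<close>, so \<open>p\<close>
    vanishes from \<open>x\<close> on, although its derivative \<open>e u y\<close> does
    not.\<close>
  have ynn: "y x \<ge> 0" if x: "x \<ge> t" for x
  proof (rule ccontr)
    assume "\<not> y x \<ge> 0"
    then have yx: "y x < 0" by simp
    have yneg: "y s < 0" if s: "s \<ge> x" for s
    proof -
      have "y s / u s \<le> y x / u x" by (rule wmono[OF x s])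
      also have "\<dots> < 0" using yx upos[of x] x t by (simp add: divide_neg_pos)
      finally show ?thesis using upos[of s] s x t by (simp add: divide_less_0_iff)
    qed
    have pz: "p s = 0" if s: "s \<ge> x" for s
    proof -
      have "p s * (y s / u s) \<le> 0" unfolding p_def
        by (rule sol_right_tail(1)[OF us ys]) (use e upos t plim s x in \<open>auto simp: p_def[abs_def]\<close>)
      moreover have "y s / u s < 0" using yneg[OF s] upos[of s] s x t by (simp add: divide_neg_pos)
      ultimately have "p s \<ge> 0" by (meson mult_neg_neg not_le)
      then show ?thesis using pneg[of s] s x by simp
    qed
    have "((\<lambda>s. (l - (l - e)) * (u s * y s)) has_integral (p (x+1) - p x)) {x..x+1}"
      unfolding p_def by (rule sol_wronskian[OF sol_subset[OF us] sol_subset[OF ys]]) (use x in auto)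
    then have "((\<lambda>s. e * (u s * y s)) has_integral 0) {x..x+1}" using pz by simp
    then have "((\<lambda>s. - (e * (u s * y s))) has_integral - 0) {x..x+1}" by (rule has_integral_neg)
    then have i: "((\<lambda>s. - (e * (u s * y s))) has_integral 0) (cbox x (x+1))" by simp
    have "- (e * (u x * y x)) = 0"
    proof (rule has_integral_0_cbox_imp_0[OF _ _ i])
      show "continuous_on (cbox x (x+1)) (\<lambda>s. - (e * (u s * y s)))"
        using x by (intro continuous_intros continuous_on_subset[OF sol_continuous_atLeast(1)[OF us]] continuous_on_subset[OF sol_continuous_atLeast(1)[OF ys]]) auto
      fix s assume "s \<in> box x (x+1)"
      then show "0 \<le> - (e * (u s * y s))" using yneg[of s] upos[of s] e x t by (simp add: mult_le_0_iff)
    qed auto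
    then show False using e yx upos[of x] x t by simp
  qed
  have yL: "sq_int t y" by (rule sol_sq_intI[OF ys sq_int_mono[OF uL t0], where C = 1]) (use yle ynn in force)
  have "bc_real E y y'"
    by (rule bc_transfer[OF t0 sol_imp_end_sol[OF ys yL]]) (use plim in \<open>simp add: p_def[abs_def]\<close>)
  \<comment> \<open>From \<open>w' = p/u^2\<close> and \<open>- p \<le> e N\<close>. The estimate
    gives pointwise convergence of \<open>y\<close> to \<open>u\<close> as \<open>e\<close> tends to
    0.\<close>
  moreover have "1 - y x / u x \<le> e * N * M * (x - t)" if x: "t \<le> x" and M: "\<forall>s\<in>{t..x}. 1 / (u s)\<^sup>2 \<le> M" for x M
  proof (cases "x = t")
    case False
    then have tx: "t < x" using x by simp
    have "y t / u t + e * N * M * t \<le> y x / u x + e * N * M * x"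
    proof (rule nondecreasing_within[of t x "\<lambda>x. y x / u x + e * N * M * x" "\<lambda>x. p x / (u x)\<^sup>2 + e * N * M"])
      fix s assume s: "s \<in> {t..x}"
      show "((\<lambda>x. y x / u x + e * N * M * x) has_real_derivative p s / (u s)\<^sup>2 + e * N * M) (at s within {t..x})"
        by (rule DERIV_add[OF wd[OF order_refl tx s]]) (auto intro!: derivative_eq_intros)
      have "- p s \<le> e * N"
      proof -
        have "e * integral {s..} (\<lambda>x. (u x)\<^sup>2) \<le> e * N"
          using integral_u2_le(2)[of s] s t e by (intro mult_left_mono) auto
        then show ?thesis using plow[of s] s by auto
      qed
      then have "- p s * (1 / (u s)\<^sup>2) \<le> (e * N) * M"
        using M s pneg[of s] by (intro mult_mono) (auto intro: order_trans[of _ "- p s"])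
      then show "0 \<le> p s / (u s)\<^sup>2 + e * N * M" by simp
    qed (use tx in auto)
    then show ?thesis using yt ut by (simp add: algebra_simps)
  qed (use yt ut in simp)
  ultimately show ?thesis using ys yt yle ynn yL plim unfolding p_def[abs_def] by blast
qed

text \<open>The Dirichlet solution is positive on \<open>(0, t]\<close> by comparison with
  \<open>u\<close>, hence can be normalised at \<open>t\<close>. Its Wronskian with \<open>u\<close>
  vanishes at 0 and has derivative \<open>e u z\<close>, so it lies between 0 and
  \<open>e N\<close>; this makes \<open>z/u\<close> increase to 1 with controlled slope.\<close>

lemma left_solution:
  assumes t: "t > 0" and e: "e > 0"
  shows "\<exists>z z'. sol q (l - e) {0..t} z z' \<and> z 0 = 0 \<and> z t = u t \<and> (\<forall>x\<in>{0..t}. 0 \<le> z x \<and> z x \<le> u x) \<and>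
    (\<forall>x M. 0 < x \<and> x \<le> t \<and> (\<forall>s\<in>{x..t}. 1 / (u s)\<^sup>2 \<le> M) \<longrightarrow> 1 - z x / u x \<le> e * N * M * (t - x))"
proof -
  have ut: "u t > 0" using upos t by simp
  obtain f f' where f: "sol q (l - e) {0..} f f'" "f 0 = 0" "f' 0 = 1" by (rule sol_exists_0[OF L1])
  have us: "sol q l {0..t} u u'" using u by (rule sol_subset) auto
  have fs: "sol q (l - e) {0..t} f f'" using f(1) by (rule sol_subset) auto
  have fpos: "f x > 0" if "0 < x" "x \<le> t" for x
    by (rule sol_left_positive[OF us fs t _ upos u0 f(2)]) (use f e that in auto)
  define C where "C = u t / f t"
  have C: "C > 0" using ut fpos[of t] t by (simp add: C_def)
  define z z' where "z x = C * f x" and "z' x = C * f' x" for x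
  have zs: "sol q (l - e) {0..t} z z'" unfolding z_def z'_def by (rule sol_scale[OF fs])
  have z0: "z 0 = 0" using f by (simp add: z_def)
  have zt: "z t = u t" using fpos[of t] t by (simp add: z_def C_def)
  have znn: "z x \<ge> 0" if "x \<in> {0..t}" for x
    using fpos[of x] f(2) C that by (cases "x = 0") (auto simp: z_def intro!: mult_nonneg_nonneg less_imp_le)
  define p where "p x = u x * z' x - z x * u' x" for x
  have pint: "((\<lambda>s. e * (u s * z s)) has_integral p x) {0..x}" if "x \<in> {0..t}" for x
    using sol_wronskian[OF us zs t, of 0 x] that u0 z0 by (simp add: p_def)
  have pnn: "p x \<ge> 0" if x: "x \<in> {0..t}" for x
    using pint[OF x] by (rule has_integral_nonneg) (use e znn u_nonneg x in auto)
  have wd: "((\<lambda>x. z x / u x) has_real_derivative p x / (u x)\<^sup>2) (at x within {a..t})" if "0 < a" "a < t" "x \<in> {a..t}" for a x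
    unfolding p_def by (rule quotient_deriv[OF sol_subset[OF us] sol_subset[OF zs]]) (use that upos in auto)
  have zle: "z x \<le> u x" if x: "x \<in> {0..t}" for x
  proof -
    consider "x = 0" | "x = t" | "0 < x" "x < t" using x by fastforce
    then show ?thesis
    proof cases
      case 3
      have "z x / u x \<le> z t / u t"
        by (rule nondecreasing_within[OF wd[OF 3]]) (use pnn 3 in auto)
      then show ?thesis using zt ut upos[OF 3(1)] by (simp add: divide_le_eq)
    qed (use zt z0 u0 in auto)
  qed
  have pN: "p x \<le> e * N" if x: "x \<in> {0..t}" for x
  proof -
    have "((\<lambda>s. e * (u s)\<^sup>2) has_integral e * integral {0..x} (\<lambda>x. (u x)\<^sup>2)) {0..x}"
      by (intro has_integral_mult_right integrable_integral u2_integrable) simp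
    then have "p x \<le> e * integral {0..x} (\<lambda>x. (u x)\<^sup>2)"
    proof (rule has_integral_le[OF pint[OF x]])
      fix s assume s: "s \<in> {0..x}"
      have "u s * z s \<le> u s * u s" by (rule mult_left_mono) (use zle[of s] u_nonneg[of s] s x in auto)
      then show "e * (u s * z s) \<le> e * (u s)\<^sup>2" using e by (simp add: power2_eq_square)
    qed
    also have "\<dots> \<le> e * N" using e by (intro mult_left_mono integral_u2_le) auto
    finally show ?thesis .
  qed
  have "1 - z x / u x \<le> e * N * M * (t - x)" if x: "0 < x" "x \<le> t" and M: "\<forall>s\<in>{x..t}. 1 / (u s)\<^sup>2 \<le> M" for x M
  proof (cases "x = t")
    case False
    then have tx: "x < t" using x by simp
    have "e * N * M * x - z x / u x \<le> e * N * M * t - z t / u t"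
    proof (rule nondecreasing_within[of x t "\<lambda>x. e * N * M * x - z x / u x" "\<lambda>x. e * N * M - p x / (u x)\<^sup>2"])
      fix s assume s: "s \<in> {x..t}"
      show "((\<lambda>x. e * N * M * x - z x / u x) has_real_derivative e * N * M - p s / (u s)\<^sup>2) (at s within {x..t})"
        by (rule DERIV_diff[OF _ wd[OF x(1) tx s]]) (auto intro!: derivative_eq_intros)
      have "p s * (1 / (u s)\<^sup>2) \<le> (e * N) * M"
        using M s pN[of s] pnn[of s] x by (intro mult_mono) (auto intro: order_trans[of _ "p s"])
      then show "0 \<le> e * N * M - p s / (u s)\<^sup>2" by simp
    qed (use tx in auto)
    then show ?thesis using zt ut by (simp add: algebra_simps)
  qed (use zt ut in simp)
  then show ?thesis using zs z0 zt znn zle by blast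
qed

end

section \<open>Green's formula with jumps and the eigenvalue curve\<close>

lemma sol_product_integrable:
  assumes "sol q l {a..b} y y'" "sol q m {a..b} z z'" "a < b"
  shows "(\<lambda>s. y s * z s) integrable_on {a..b}"
  by (intro integrable_continuous_real continuous_intros sol_continuous(1)[OF assms(1,3)] sol_continuous(1)[OF assms(2,3)])

lemma integral_product_pos:
  fixes y z :: "real \<Rightarrow> real"
  assumes y: "continuous_on {a..b} y" and z: "continuous_on {a..b} z" and ab: "a < b"
    and nn: "\<And>x. x \<in> {a..b} \<Longrightarrow> y x \<ge> 0" "\<And>x. x \<in> {a..b} \<Longrightarrow> z x \<ge> 0" and pos: "y b > 0" "z b > 0"
  shows "integral {a..b} (\<lambda>x. y x * z x) > 0"
proof -
  have c: "continuous_on {a..b} (\<lambda>x. y x * z x)" by (intro continuous_intros y z)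
  have "integral {a..b} (\<lambda>x. y x * z x) \<noteq> 0"
  proof
    assume "integral {a..b} (\<lambda>x. y x * z x) = 0"
    then have "\<forall>x\<in>{a..b}. y x * z x = 0" using integral_eq_0_iff[OF c ab] nn by simp
    then have "y b * z b = 0" using ab by simp
    then show False using pos by simp
  qed
  moreover have "integral {a..b} (\<lambda>x. y x * z x) \<ge> 0"
    by (rule integral_nonneg[OF integrable_continuous_real[OF c]]) (use nn in auto)
  ultimately show ?thesis by simp
qed

lemma mult_le_square: "0 \<le> a \<Longrightarrow> b \<le> a \<Longrightarrow> a * b \<le> (a::real)\<^sup>2"
  unfolding power2_eq_square by (rule mult_left_mono)

text \<open>Green's formula on both sides of \<open>t\<close>: the contributions of 0 and of
  infinity vanish and the jumps of the derivatives remain. It is used for the ground state against a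
  glued function, for an arbitrary lower eigenfunction against a glued function, and for two glued
  functions.\<close>

lemma jump_formula:
  assumes q: "L1_loc q" and adm: "admissible q E" and t: "t > 0"
    and a: "sol q m {0..t} a a'" "a 0 = 0" and b: "sol q n {0..t} b b'" "b 0 = 0"
    and c: "sol q m {t..} c c'" "c t = a t" "sq_int t c" "bc_real E c c'"
    and d: "sol q n {t..} d d'" "d t = b t" "sq_int t d" "bc_real E d d'"
  shows "(m - n) * (integral {0..t} (\<lambda>s. a s * b s) + integral {t..} (\<lambda>s. c s * d s)) =
     a t * (b' t - d' t) - b t * (a' t - c' t)"
proof -
  have ec: "end_sol q t c c' (\<lambda>x. m * c x)" and ed: "end_sol q t d d' (\<lambda>x. n * d x)"
    using sol_imp_end_sol c d by auto
  have "((\<lambda>s. (m - n) * (a s * b s)) has_integral (a t * b' t - b t * a' t)) {0..t}"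
    using sol_wronskian[OF a(1) b(1) t, of 0 t] a(2) b(2) t by simp
  moreover have "((\<lambda>s. (m - n) * (a s * b s)) has_integral (m - n) * integral {0..t} (\<lambda>s. a s * b s)) {0..t}"
    by (intro has_integral_mult_right integrable_integral sol_product_integrable[OF a(1) b(1) t])
  ultimately have left: "(m - n) * integral {0..t} (\<lambda>s. a s * b s) = a t * b' t - b t * a' t"
    by (rule has_integral_unique[symmetric])
  have "(c t * d' t - d t * c' t) + integral {t..} (\<lambda>s. d s * (m * c s) - c s * (n * d s)) = 0"
    using tendsto_unique[OF _ end_sol_wronskian_limit[OF ec ed] end_sol_wronskian_zero[OF q adm _ ec c(4) ed d(4)]] t by simp
  moreover have "integral {t..} (\<lambda>s. d s * (m * c s) - c s * (n * d s)) = (m - n) * integral {t..} (\<lambda>s. c s * d s)"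
  proof -
    have "(\<lambda>s. d s * (m * c s) - c s * (n * d s)) = (\<lambda>s. (m - n) * (c s * d s))" by (simp add: fun_eq_iff algebra_simps)
    then show ?thesis by simp
  qed
  ultimately have right: "(m - n) * integral {t..} (\<lambda>s. c s * d s) = - (c t * d' t - d t * c' t)" by simp
  have "(m - n) * (integral {0..t} (\<lambda>s. a s * b s) + integral {t..} (\<lambda>s. c s * d s)) =
     (a t * b' t - b t * a' t) - (a t * d' t - b t * c' t)"
    using left right c(2) d(2) by (simp add: distrib_left)
  then show ?thesis by (simp add: algebra_simps)
qed

context ground_state
begin

text \<open>Up to \<open>t\<close> this is comparison with \<open>u\<close> from the left. Beyond
  \<open>t\<close> a zero would persist to infinity, so by uniqueness the solution on
  \<open>{t..}\<close> would vanish at \<open>t\<close> as well, contrary to the left part.\<close>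

lemma below_eigenfunction_positive:
  assumes t: "t > 0" and r: "r > 0" and m: "m < l" and ev: "eigenvalue q E t r m"
  obtains v vl' vr' where "sol q m {0..t} v vl'" "sol q m {t..} v vr'" "v 0 = 0" "vl' t - vr' t = r * v t"
    "sq_int t v" "bc_real E v vr'" "\<And>x. x > 0 \<Longrightarrow> v x > 0"
proof -
  obtain w wl' wr' x0 where w: "sol q m {0..t} w wl'" "sol q m {t..} w wr'" "w 0 = 0" "wl' t - wr' t = r * w t"
    "sq_int t w" "bc_real E w wr'" "x0 \<ge> 0" "w x0 \<noteq> 0" by (rule eigenvalue_deltaE[OF L1 adm ev t r])
  \<comment> \<open>Zero Cauchy data at 0 would give zero Cauchy data on the left of
    \<open>t\<close>, and by the jump condition on its right too.\<close>
  have wl0: "wl' 0 \<noteq> 0"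
  proof
    assume z: "wl' 0 = 0"
    have l0: "w x = 0" "wl' x = 0" if "x \<in> {0..t}" for x
      using sol_unique_zero[OF L1 t order_refl w(1) _ w(3) z that] t by auto
    then have "w t = 0" "wr' t = 0" using w(4) t by auto
    then have "w x = 0" if "x > t" for x
      using sol_unique_zero(1)[OF L1 that _ sol_subset[OF w(2)], of t x] that t by auto
    then show False using l0 w(7,8) by (metis atLeastAtMost_iff not_le)
  qed
  define s where "s = (if wl' 0 > 0 then 1 else (-1::real))"
  define v vl' vr' where "v x = s * w x" and "vl' x = s * wl' x" and "vr' x = s * wr' x" for x
  have v: "sol q m {0..t} v vl'" "sol q m {t..} v vr'" "v 0 = 0" "vl' t - vr' t = r * v t" "vl' 0 > 0"
  proof -
    show "sol q m {0..t} v vl'" unfolding v_def vl'_def by (rule sol_scale[OF w(1)])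
    show "sol q m {t..} v vr'" unfolding v_def vr'_def by (rule sol_scale[OF w(2)])
    show "v 0 = 0" "vl' 0 > 0" using w(3) wl0 by (auto simp: v_def vl'_def s_def)
    have "s * (wl' t - wr' t) = s * (r * w t)" using w(4) by simp
    then show "vl' t - vr' t = r * v t" by (simp add: v_def vl'_def vr'_def algebra_simps)
  qed
  have vL: "sq_int t v" unfolding v_def using sq_int_scaleR[OF w(5), of s] by simp
  have vbc: "bc_real E v vr'"
  proof (cases E)
    case (BC f g \<beta>)
    then obtain A B where AB: "((\<lambda>x. w x * D\<^sub>x f x - f x * wr' x) \<longlongrightarrow> A) at_top" "((\<lambda>x. w x * D\<^sub>x g x - g x * wr' x) \<longlongrightarrow> B) at_top"
      "A * sin \<beta> = B * cos \<beta>" using w(6) by auto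
    have "((\<lambda>x. v x * D\<^sub>x h x - h x * vr' x) \<longlongrightarrow> s * C) at_top" if "((\<lambda>x. w x * D\<^sub>x h x - h x * wr' x) \<longlongrightarrow> C) at_top" for h C
      using tendsto_mult[OF tendsto_const that, of s] by (simp add: v_def vr'_def algebra_simps)
    note lims = this[OF AB(1)] this[OF AB(2)]
    have "s * A * sin \<beta> = s * B * cos \<beta>" by (simp add: mult.assoc AB(3))
    then show ?thesis unfolding BC bc_real.simps using lims by blast
  qed simp
  define e where "e = l - m"
  have e: "e > 0" "m = l - e" using m by (auto simp: e_def)
  have us: "sol q l {0..t} u u'" "sol q l {t..} u u'" using u t by (auto elim: sol_subset)
  have left: "v x > 0" if "0 < x" "x \<le> t" for x
    by (rule sol_left_positive[OF us(1) v(1)[unfolded e(2)] t _ upos u0 v(3,5)]) (use e that in auto)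
  have lim: "((\<lambda>x. u x * vr' x - v x * u' x) \<longlongrightarrow> 0) at_top"
    by (rule end_sol_wronskian_zero[OF L1 adm _ end_u ubc sol_imp_end_sol[OF v(2) vL] vbc]) (use t in auto)
  have nz: "v x \<noteq> 0" if x: "x \<ge> t" for x
  proof
    assume vx: "v x = 0"
    have z: "v s = 0" if "s \<ge> x" for s
      by (rule sol_right_tail(2)[OF us(2) v(2)[unfolded e(2)] _ _ lim x vx that]) (use e upos t in auto)
    have "(v has_real_derivative vr' x) (at x within {x..x+1})"
      using sol_deriv[OF sol_subset[OF v(2)], of x "x+1" x] x by auto
    moreover have "(v has_real_derivative 0) (at x within {x..x+1})"
      by (rule has_field_derivative_transform_within[OF DERIV_const[of 0] zero_less_one]) (use z in auto)
    ultimately have "vr' x = 0"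
      by (intro has_field_derivative_unique[of v _ x "{x..x+1}"]) (auto simp: trivial_limit_within islimpt_Icc)
    then have "v t = 0"
      using sol_unique_zero(1)[OF L1 _ _ sol_subset[OF v(2)], of t "x+1" x t] vx x t by auto
    then show False using left[of t] t by simp
  qed
  have "v x > 0" if x: "x > 0" for x
  proof (cases "x \<le> t")
    case False
    then have tx: "t < x" by simp
    show ?thesis
      by (rule continuous_sign_pos[OF sol_continuous(1)[OF sol_subset[OF v(2)] tx] nz, of t]) (use tx left t in auto)
  qed (use left x in auto)
  then show thesis using that v vL vbc by blast
qed

lemma u_bounded_below_inverse:
  assumes "0 < a" obtains M where "\<And>s. s \<in> {a..b} \<Longrightarrow> 1 / (u s)\<^sup>2 \<le> M"
proof -
  have c: "continuous_on {a..b} (\<lambda>s. 1 / (u s)\<^sup>2)"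
  proof (intro continuous_intros continuous_on_subset[OF sol_continuous_atLeast(1)[OF u]] ballI)
    fix s assume "s \<in> {a..b}"
    then show "(u s)\<^sup>2 \<noteq> 0" using upos[of s] assms by auto
  qed (use assms in auto)
  obtain M where M: "\<And>s. s \<in> {a..b} \<Longrightarrow> norm (1 / (u s)\<^sup>2) \<le> M"
    using compact_imp_bounded[OF compact_continuous_image[OF c compact_Icc]] unfolding bounded_iff by blast
  show thesis by (rule that[of M]) (use M in fastforce)
qed

lemma N_pos: "N > 0"
proof -
  have "continuous_on {0..1} u" by (rule continuous_on_subset[OF sol_continuous_atLeast(1)[OF u]]) auto
  then have "integral {0..1} (\<lambda>x. u x * u x) > 0" by (intro integral_product_pos) (use u_nonneg upos in auto)
  then show ?thesis using integral_u2_le(1)[of 0 1] by (simp add: power2_eq_square)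
qed

lemma squeeze_to_u:
  assumes S: "S \<longlonglongrightarrow> 0" and le: "\<And>n. z n \<le> u x" and C: "\<And>n. u x - z n \<le> S n * C"
  shows "(\<lambda>n. u x * z n) \<longlonglongrightarrow> (u x)\<^sup>2"
proof -
  have "(\<lambda>n. u x - z n) \<longlonglongrightarrow> 0"
  proof (rule tendsto_sandwich[of "\<lambda>n. 0" _ _ "\<lambda>n. S n * C"])
    show "(\<lambda>n. S n * C) \<longlonglongrightarrow> 0" using tendsto_mult_left_zero[OF S] .
  qed (use le C in auto)
  then have "(\<lambda>n. u x * (u x - (u x - z n))) \<longlonglongrightarrow> u x * (u x - 0)"
    by (intro tendsto_mult tendsto_diff tendsto_const)
  then show ?thesis by (simp add: power2_eq_square)
qed

text \<open>The curve \<open>r \<mapsto> \<lambda>(t, r)\<close> is parametrised by the eigenvalue \<open>l - e\<close> instead of \<open>r\<close>.\<close>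

theorem delta_branch:
  assumes t: "t > 0"
  obtains \<rho> where "\<And>e. e > 0 \<Longrightarrow> \<rho> e > 0"
    "\<And>e. e > 0 \<Longrightarrow> eigenvalue q E t (\<rho> e) (l - e)"
    "\<And>e m. e > 0 \<Longrightarrow> eigenvalue q E t (\<rho> e) m \<Longrightarrow> m \<le> l - e \<Longrightarrow> m = l - e"
    "continuous_on {0<..} \<rho>" "\<And>e. e > 0 \<Longrightarrow> \<rho> e \<le> N / (u t)\<^sup>2 * e"
    "((\<lambda>e. \<rho> e / e) \<longlongrightarrow> N / (u t)\<^sup>2) (at_right 0)"
proof -
  have ut: "u t > 0" using upos t by simp
  have t0: "t \<ge> 0" using t by simp
  define PR where "PR e y y' \<longleftrightarrow> sol q (l - e) {t..} y y' \<and> y t = u t \<and> (\<forall>x\<ge>t. 0 \<le> y x \<and> y x \<le> u x) \<and> sq_int t y \<and> bc_real E y y' \<and>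
    ((\<lambda>x. u x * y' x - y x * u' x) \<longlongrightarrow> 0) at_top \<and>
    (\<forall>x M. t \<le> x \<and> (\<forall>s\<in>{t..x}. 1 / (u s)\<^sup>2 \<le> M) \<longrightarrow> 1 - y x / u x \<le> e * N * M * (x - t))" for e y y'
  have "\<exists>y y'. PR e y y'" if "e > 0" for e unfolding PR_def using right_solution[OF t that] .
  then obtain y y' where PR: "\<And>e. e > 0 \<Longrightarrow> PR e (y e) (y' e)" by metis
  have y: "\<And>e. e > 0 \<Longrightarrow> sol q (l - e) {t..} (y e) (y' e)" "\<And>e. e > 0 \<Longrightarrow> y e t = u t"
    "\<And>e x. e > 0 \<Longrightarrow> x \<ge> t \<Longrightarrow> 0 \<le> y e x" "\<And>e x. e > 0 \<Longrightarrow> x \<ge> t \<Longrightarrow> y e x \<le> u x"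
    "\<And>e. e > 0 \<Longrightarrow> sq_int t (y e)" "\<And>e. e > 0 \<Longrightarrow> bc_real E (y e) (y' e)"
    "\<And>e x M. e > 0 \<Longrightarrow> t \<le> x \<Longrightarrow> (\<And>s. s \<in> {t..x} \<Longrightarrow> 1 / (u s)\<^sup>2 \<le> M) \<Longrightarrow> 1 - y e x / u x \<le> e * N * M * (x - t)"
    using PR unfolding PR_def by blast+
  define PL where "PL e z z' \<longleftrightarrow> sol q (l - e) {0..t} z z' \<and> z 0 = 0 \<and> z t = u t \<and> (\<forall>x\<in>{0..t}. 0 \<le> z x \<and> z x \<le> u x) \<and>
    (\<forall>x M. 0 < x \<and> x \<le> t \<and> (\<forall>s\<in>{x..t}. 1 / (u s)\<^sup>2 \<le> M) \<longrightarrow> 1 - z x / u x \<le> e * N * M * (t - x))" for e z z'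
  have "\<exists>z z'. PL e z z'" if "e > 0" for e unfolding PL_def using left_solution[OF t that] .
  then obtain z z' where PL: "\<And>e. e > 0 \<Longrightarrow> PL e (z e) (z' e)" by metis
  have z: "\<And>e. e > 0 \<Longrightarrow> sol q (l - e) {0..t} (z e) (z' e)" "\<And>e. e > 0 \<Longrightarrow> z e 0 = 0" "\<And>e. e > 0 \<Longrightarrow> z e t = u t"
    "\<And>e x. e > 0 \<Longrightarrow> x \<in> {0..t} \<Longrightarrow> 0 \<le> z e x" "\<And>e x. e > 0 \<Longrightarrow> x \<in> {0..t} \<Longrightarrow> z e x \<le> u x"
    "\<And>e x M. e > 0 \<Longrightarrow> 0 < x \<Longrightarrow> x \<le> t \<Longrightarrow> (\<And>s. s \<in> {x..t} \<Longrightarrow> 1 / (u s)\<^sup>2 \<le> M) \<Longrightarrow> 1 - z e x / u x \<le> e * N * M * (t - x)"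
    using PL unfolding PL_def by blast+
  have us: "sol q l {0..t} u u'" "sol q l {t..} u u'" using u t by (auto elim: sol_subset)
  have yt: "y e t = z e t" if "e > 0" for e using y(2) z(3) that by simp
  have uLt: "sq_int t u" by (rule sq_int_mono[OF uL t0])
  define \<rho> where "\<rho> e = (z' e t - y' e t) / u t" for e
  have jump: "z' e t - y' e t = \<rho> e * u t" for e using ut by (simp add: \<rho>_def)
  define I where "I e = integral {0..t} (\<lambda>s. u s * z e s) + integral {t..} (\<lambda>s. u s * y e s)" for e
  have cz: "continuous_on {0..t} (z e)" if "e > 0" for e by (rule sol_continuous(1)[OF z(1)[OF that] t])
  have cu: "continuous_on {0..t} u" by (rule sol_continuous(1)[OF us(1) t])
  have uy: "(\<lambda>s. w s * y e s) integrable_on {t..}" if "e > 0" "sq_int t w" for e w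
    using sq_int_mult[OF that(2) y(5)[OF that(1)]] by (simp add: absolutely_integrable_on_def)
  have uy0: "integral {t..} (\<lambda>s. w s * y e s) \<ge> 0" if "e > 0" "sq_int t w" "\<And>s. s \<ge> t \<Longrightarrow> w s \<ge> 0" for e w
    by (rule integral_nonneg[OF uy[OF that(1,2)]]) (use y(3)[OF that(1)] that(3) in auto)
  have form: "\<rho> e * (u t)\<^sup>2 = e * I e" if e: "e > 0" for e
  proof -
    have "(l - (l - e)) * I e = u t * (z' e t - y' e t) - z e t * (u' t - u' t)"
      unfolding I_def
      by (rule jump_formula[OF L1 adm t us(1) u0 z(1)[OF e] z(2)[OF e] us(2) refl uLt ubc y(1)[OF e] yt[OF e] y(5)[OF e] y(6)[OF e]])
    then show ?thesis by (simp add: jump power2_eq_square)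
  qed
  have Ipos: "I e > 0" if e: "e > 0" for e
  proof -
    have "integral {0..t} (\<lambda>s. u s * z e s) > 0"
      by (rule integral_product_pos[OF cu cz[OF e] t]) (use u_nonneg z(4)[OF e] ut z(3)[OF e] in auto)
    then show ?thesis using uy0[OF e uLt] u_nonneg t unfolding I_def by fastforce
  qed
  have Nsplit: "integral {0..t} (\<lambda>s. (u s)\<^sup>2) + integral {t..} (\<lambda>s. (u s)\<^sup>2) = N"
    unfolding N_def by (rule integral_tail_tendsto_zero(2)[OF u2_absolutely_integrable t0])
  have IN: "I e \<le> N" if e: "e > 0" for e
  proof -
    have "integral {0..t} (\<lambda>s. u s * z e s) \<le> integral {0..t} (\<lambda>s. (u s)\<^sup>2)"
      by (rule integral_le[OF sol_product_integrable[OF us(1) z(1)[OF e] t] u2_integrable(1)[OF order_refl]])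
        (rule mult_le_square, use z(5)[OF e] u_nonneg in auto)
    moreover have "integral {t..} (\<lambda>s. u s * y e s) \<le> integral {t..} (\<lambda>s. (u s)\<^sup>2)"
      by (rule integral_le[OF uy[OF e uLt] u2_integrable(2)[OF t0]])
        (rule mult_le_square, use y(4)[OF e] u_nonneg t in auto)
    ultimately show ?thesis using Nsplit unfolding I_def by linarith
  qed
  have \<rho>eq: "\<rho> e = e * I e / (u t)\<^sup>2" if "e > 0" for e using form[OF that] ut by (simp add: field_simps)
  have \<rho>pos: "\<rho> e > 0" if "e > 0" for e using \<rho>eq[OF that] Ipos[OF that] that ut by simp
  have \<rho>le: "\<rho> e \<le> N / (u t)\<^sup>2 * e" if "e > 0" for e
  proof -
    have "e * I e / (u t)\<^sup>2 \<le> e * N / (u t)\<^sup>2" using IN[OF that] that by (intro divide_right_mono mult_left_mono) auto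
    then show ?thesis using \<rho>eq[OF that] by (simp add: mult.commute)
  qed
  have ev: "eigenvalue q E t (\<rho> e) (l - e)" if e: "e > 0" for e
    by (rule eigenvalue_deltaI[OF L1 adm t _ z(1)[OF e] y(1)[OF e] z(2)[OF e] _ _ _ y(5)[OF e] y(6)[OF e]])
      (use \<rho>pos[OF e] yt[OF e] z(3)[OF e] ut jump in auto)
  \<comment> \<open>Both functions have the same relative jump at \<open>t\<close>, so the jumps
    cancel in Green's formula; the integral of their product is positive, and only
    \<open>m = l - e\<close> is left.\<close>
  have uniq: "m = l - e" if e: "e > 0" and m: "eigenvalue q E t (\<rho> e) m" "m \<le> l - e" for e m
  proof -
    obtain v vl' vr' where v: "sol q m {0..t} v vl'" "sol q m {t..} v vr'" "v 0 = 0" "vl' t - vr' t = \<rho> e * v t"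
      "sq_int t v" "bc_real E v vr'" "\<And>x. x > 0 \<Longrightarrow> v x > 0"
      using below_eigenfunction_positive[OF t \<rho>pos[OF e] _ m(1)] m(2) e by auto
    have v0: "v x \<ge> 0" if "x \<ge> 0" for x using v(3,7) that by (cases "x = 0") (auto intro: less_imp_le)
    have "(m - (l - e)) * (integral {0..t} (\<lambda>s. v s * z e s) + integral {t..} (\<lambda>s. v s * y e s)) =
       v t * (z' e t - y' e t) - z e t * (vl' t - vr' t)"
      by (rule jump_formula[OF L1 adm t v(1,3) z(1)[OF e] z(2)[OF e] v(2) refl v(5,6) y(1)[OF e] yt[OF e] y(5)[OF e] y(6)[OF e]])
    also have "\<dots> = 0" by (simp add: jump v(4) z(3)[OF e])
    finally have "(m - (l - e)) * (integral {0..t} (\<lambda>s. v s * z e s) + integral {t..} (\<lambda>s. v s * y e s)) = 0" .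
    moreover have "integral {0..t} (\<lambda>s. v s * z e s) > 0"
      by (rule integral_product_pos[OF sol_continuous(1)[OF v(1) t] cz[OF e] t]) (use v0 z(4)[OF e] ut z(3)[OF e] v(7)[OF t] in auto)
    moreover have "integral {t..} (\<lambda>s. v s * y e s) \<ge> 0" by (rule uy0[OF e v(5)]) (use v0 t in auto)
    ultimately show ?thesis by simp
  qed
  \<comment> \<open>Green's formula between two glued functions gives
    \<open>(\<rho> e - \<rho> d) u(t)^2 = (e - d) J\<close>, and \<open>J\<close> lies between 0 and
    \<open>N\<close> because both functions lie between 0 and \<open>u\<close>.\<close>
  have lip: "\<bar>\<rho> e - \<rho> d\<bar> \<le> N / (u t)\<^sup>2 * \<bar>e - d\<bar>" if e: "e > 0" and d: "d > 0" for e d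
  proof -
    define J where "J = integral {0..t} (\<lambda>s. z d s * z e s) + integral {t..} (\<lambda>s. y d s * y e s)"
    have "((l - d) - (l - e)) * J = z d t * (z' e t - y' e t) - z e t * (z' d t - y' d t)"
      unfolding J_def
      by (rule jump_formula[OF L1 adm t z(1)[OF d] z(2)[OF d] z(1)[OF e] z(2)[OF e] y(1)[OF d] yt[OF d] y(5)[OF d] y(6)[OF d]
            y(1)[OF e] yt[OF e] y(5)[OF e] y(6)[OF e]])
    then have eq: "(e - d) * J = (\<rho> e - \<rho> d) * (u t)\<^sup>2"
      by (simp add: jump z(3)[OF d] z(3)[OF e] power2_eq_square algebra_simps)
    have "integral {0..t} (\<lambda>s. z d s * z e s) \<ge> 0"
      by (rule integral_nonneg[OF sol_product_integrable[OF z(1)[OF d] z(1)[OF e] t]]) (use z(4)[OF d] z(4)[OF e] in auto)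
    then have J0: "J \<ge> 0" using uy0[OF e y(5)[OF d]] y(3)[OF d] unfolding J_def by fastforce
    have "integral {0..t} (\<lambda>s. z d s * z e s) \<le> integral {0..t} (\<lambda>s. u s * z e s)"
      by (rule integral_le[OF sol_product_integrable[OF z(1)[OF d] z(1)[OF e] t] sol_product_integrable[OF us(1) z(1)[OF e] t]])
        (rule mult_right_mono, use z(5)[OF d] z(4)[OF e] in auto)
    moreover have "integral {t..} (\<lambda>s. y d s * y e s) \<le> integral {t..} (\<lambda>s. u s * y e s)"
      by (rule integral_le[OF uy[OF e y(5)[OF d]] uy[OF e uLt]]) (rule mult_right_mono, use y(4)[OF d] y(3)[OF e] in auto)
    ultimately have JN: "J \<le> N" using IN[OF e] unfolding J_def I_def by linarith
    have "\<bar>\<rho> e - \<rho> d\<bar> * (u t)\<^sup>2 = \<bar>(e - d) * J\<bar>" using eq by (simp add: abs_mult)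
    also have "\<dots> \<le> \<bar>e - d\<bar> * N" using J0 JN by (simp add: abs_mult mult_left_mono)
    finally show ?thesis using ut by (simp add: field_simps)
  qed
  have K: "N / (u t)\<^sup>2 > 0" using N_pos ut by simp
  have cont: "continuous_on {0<..} \<rho>"
  proof (rule lipschitz_on_continuous_on)
    show "(N / (u t)\<^sup>2)-lipschitz_on {0<..} \<rho>"
      by (rule lipschitz_onI) (use lip K in \<open>auto simp: dist_real_def\<close>)
  qed
  \<comment> \<open>Dominated convergence along sequences with majorant \<open>u^2\<close>; the
    pointwise limits come from the slope estimates of the left and right solutions.\<close>
  have Ilim: "(I \<longlongrightarrow> N) (at_right 0)"
  proof (rule tendsto_at_right_sequentially[of 0 1])
    fix S :: "nat \<Rightarrow> real" assume S: "\<And>n. 0 < S n" "S \<longlonglongrightarrow> 0"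
    have l1: "(\<lambda>n. integral {0..t} (\<lambda>s. u s * z (S n) s)) \<longlonglongrightarrow> integral {0..t} (\<lambda>s. (u s)\<^sup>2)"
    proof (rule dominated_convergence(2)[OF sol_product_integrable[OF us(1) z(1)[OF S(1)] t] u2_integrable(1)[OF order_refl]])
      fix n x assume x: "x \<in> {0..t}"
      show "norm (u x * z (S n) x) \<le> (u x)\<^sup>2"
        using z(4)[OF S(1) x, of n] mult_le_square[OF _ z(5)[OF S(1) x, of n]] u_nonneg[of x] x by simp
    next
      fix x assume x: "x \<in> {0..t}"
      show "(\<lambda>n. u x * z (S n) x) \<longlonglongrightarrow> (u x)\<^sup>2"
      proof (cases "x = 0")
        case False
        then have x0: "0 < x" "x \<le> t" using x by auto
        obtain M where M: "\<And>s. s \<in> {x..t} \<Longrightarrow> 1 / (u s)\<^sup>2 \<le> M" using u_bounded_below_inverse[OF x0(1)] by blast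
        show ?thesis
        proof (rule squeeze_to_u[OF S(2), where C = "N * M * (t - x) * u x"])
          show "z (S n) x \<le> u x" for n using z(5)[OF S(1) x] .
          have "u x * (1 - z (S n) x / u x) \<le> u x * (S n * N * M * (t - x))" for n
            using z(6)[OF S(1) x0 M] upos[OF x0(1)] by (intro mult_left_mono) auto
          then show "u x - z (S n) x \<le> S n * (N * M * (t - x) * u x)" for n
            using upos[OF x0(1)] by (simp add: right_diff_distrib mult_ac)
        qed
      qed (use u0 in simp)
    qed
    have l2: "(\<lambda>n. integral {t..} (\<lambda>s. u s * y (S n) s)) \<longlonglongrightarrow> integral {t..} (\<lambda>s. (u s)\<^sup>2)"
    proof (rule dominated_convergence(2)[OF uy[OF S(1) uLt] u2_integrable(2)[OF t0]])
      fix n x assume x: "x \<in> {t..}"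
      show "norm (u x * y (S n) x) \<le> (u x)\<^sup>2"
        using y(3)[OF S(1), of x n] mult_le_square[OF _ y(4)[OF S(1), of x n]] u_nonneg[of x] x t by simp
    next
      fix x assume "x \<in> {t..}"
      then have x: "t \<le> x" "x > 0" using t by auto
      obtain M where M: "\<And>s. s \<in> {t..x} \<Longrightarrow> 1 / (u s)\<^sup>2 \<le> M" using u_bounded_below_inverse[OF t] by blast
      show "(\<lambda>n. u x * y (S n) x) \<longlonglongrightarrow> (u x)\<^sup>2"
      proof (rule squeeze_to_u[OF S(2), where C = "N * M * (x - t) * u x"])
        show "y (S n) x \<le> u x" for n using y(4)[OF S(1) x(1)] .
        have "u x * (1 - y (S n) x / u x) \<le> u x * (S n * N * M * (x - t))" for n
          using y(7)[OF S(1) x(1) M] upos[OF x(2)] by (intro mult_left_mono) auto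
        then show "u x - y (S n) x \<le> S n * (N * M * (x - t) * u x)" for n
          using upos[OF x(2)] by (simp add: right_diff_distrib mult_ac)
      qed
    qed
    show "(\<lambda>n. I (S n)) \<longlonglongrightarrow> N"
      unfolding I_def Nsplit[symmetric] by (rule tendsto_add[OF l1 l2])
  qed simp
  have lim: "((\<lambda>e. \<rho> e / e) \<longlongrightarrow> N / (u t)\<^sup>2) (at_right 0)"
  proof (rule Lim_transform_eventually)
    show "((\<lambda>e. I e / (u t)\<^sup>2) \<longlongrightarrow> N / (u t)\<^sup>2) (at_right 0)"
      by (rule tendsto_divide[OF Ilim tendsto_const]) (use ut in simp)
    show "eventually (\<lambda>e. I e / (u t)\<^sup>2 = \<rho> e / e) (at_right 0)"
      using eventually_at_right_less[of 0] by eventually_elim (simp add: \<rho>eq)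
  qed
  show thesis using that[OF \<rho>pos ev uniq cont \<rho>le lim] .
qed

text \<open>By continuity and the linear bound on \<open>\<rho>\<close>, every small strength is
  \<open>\<rho> e\<close> for some small \<open>e\<close>; there the first eigenvalue is
  \<open>l - e\<close>, and the difference quotient is \<open>- e / \<rho> e\<close>.\<close>

theorem right_derivative:
  assumes t: "t > 0" and fe: "\<And>r. r \<ge> 0 \<Longrightarrow> first_eigenvalue q E t r (L r)" and L0: "L 0 = l"
  shows "(L has_vector_derivative - ((u t)\<^sup>2 / N)) (at_right 0)"
proof -
  have ut: "u t > 0" using upos t by simp
  obtain \<rho> where r1: "\<And>e. e > 0 \<Longrightarrow> \<rho> e > 0" and r2: "\<And>e. e > 0 \<Longrightarrow> eigenvalue q E t (\<rho> e) (l - e)"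
    and r3: "\<And>e m. e > 0 \<Longrightarrow> eigenvalue q E t (\<rho> e) m \<Longrightarrow> m \<le> l - e \<Longrightarrow> m = l - e"
    and r4: "continuous_on {0<..} \<rho>" and r5: "\<And>e. e > 0 \<Longrightarrow> \<rho> e \<le> N / (u t)\<^sup>2 * e"
    and r6: "((\<lambda>e. \<rho> e / e) \<longlongrightarrow> N / (u t)\<^sup>2) (at_right 0)" by (rule delta_branch[OF t]) blast
  define K where "K = N / (u t)\<^sup>2"
  have K: "K > 0" using N_pos ut by (simp add: K_def)
  have Lr: "L (\<rho> e) = l - e" if e: "e > 0" for e
    using fe[of "\<rho> e"] r1[OF e] r2[OF e] r3[OF e] unfolding first_eigenvalue_def by auto
  have lim: "((\<lambda>e. - (1 / (\<rho> e / e))) \<longlongrightarrow> - (1 / K)) (at_right 0)"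
    by (rule tendsto_minus[OF tendsto_divide[OF tendsto_const r6[folded K_def]]]) (use K in simp)
  have "((\<lambda>r. (L r - L 0) / (r - 0)) \<longlongrightarrow> - (1 / K)) (at_right 0)"
  proof (rule tendstoI)
    fix \<eta> :: real assume \<eta>: "\<eta> > 0"
    obtain e0 where e0: "e0 > 0" "\<And>e. 0 < e \<Longrightarrow> e < e0 \<Longrightarrow> dist (- (1 / (\<rho> e / e))) (- (1 / K)) < \<eta>"
      using tendstoD[OF lim \<eta>] unfolding eventually_at_right_field by auto
    define e1 where "e1 = e0 / 2"
    have e1: "e1 > 0" "e1 < e0" using e0 by (auto simp: e1_def)
    show "eventually (\<lambda>r. dist ((L r - L 0) / (r - 0)) (- (1 / K)) < \<eta>) (at_right 0)"
      unfolding eventually_at_right_field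
    proof (intro exI conjI allI impI)
      show "\<rho> e1 > 0" by (rule r1[OF e1(1)])
      fix r assume r: "0 < r" "r < \<rho> e1"
      \<comment> \<open>Chosen so that the linear bound gives \<open>\<rho> d \<le> r\<close>: the
        left end for the intermediate value theorem.\<close>
      define d where "d = min e1 (r / (2 * K))"
      have d: "0 < d" "d \<le> e1" using e1 r K by (auto simp: d_def)
      have "\<rho> d \<le> K * d" using r5[OF d(1)] by (simp add: K_def)
      also have "\<dots> \<le> K * (r / (2 * K))" using K by (intro mult_left_mono) (auto simp: d_def)
      also have "\<dots> \<le> r" using K r by simp
      finally have "\<rho> d \<le> r" .
      moreover have "continuous_on {d..e1} \<rho>" by (rule continuous_on_subset[OF r4]) (use d in auto)
      ultimately obtain e where e: "d \<le> e" "e \<le> e1" "\<rho> e = r" using IVT'[of \<rho> d r e1] r d by auto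
      then have ep: "e > 0" "e < e0" using d e1 by auto
      have "(L r - L 0) / (r - 0) = - (1 / (\<rho> e / e))" using Lr[OF ep(1)] e(3) L0 by simp
      then show "dist ((L r - L 0) / (r - 0)) (- (1 / K)) < \<eta>" using e0(2)[OF ep] by simp
    qed
  qed
  then have "(L has_field_derivative - (1 / K)) (at_right 0)" by (simp add: has_field_derivative_iff)
  moreover have "1 / K = (u t)\<^sup>2 / N" by (simp add: K_def)
  ultimately show ?thesis by (simp add: has_real_derivative_iff_has_vector_derivative)
qed

end

context ground_state
begin

theorem potential_formula:
  assumes fe: "\<And>t r. t \<ge> 0 \<Longrightarrow> r \<ge> 0 \<Longrightarrow> first_eigenvalue q E t r (lam t r)" and l: "\<And>t. t \<ge> 0 \<Longrightarrow> lam t 0 = l"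
  shows "\<And>x. x > 0 \<Longrightarrow> lam x differentiable (at_right 0)" "\<And>x. x > 0 \<Longrightarrow> right_pderiv_r lam x < 0"
    "AC1_loc {0<..} (phi0 lam)"
    "AE x in lebesgue_on {0<..}. q x = D\<^sub>x (D\<^sub>x (phi0 lam)) x / phi0 lam x + l"
proof -
  have d: "(lam x has_vector_derivative - ((u x)\<^sup>2 / N)) (at_right 0)" if x: "x > 0" for x
    by (rule right_derivative[OF x]) (use fe l x in auto)
  show "lam x differentiable (at_right 0)" if "x > 0" for x
    using d[OF that] by (auto simp: differentiable_def has_vector_derivative_def)
  have r: "right_pderiv_r lam x = - ((u x)\<^sup>2 / N)" if x: "x > 0" for x
    unfolding right_pderiv_r_def by (rule vector_derivative_within[OF _ d[OF x]]) simp
  show "right_pderiv_r lam x < 0" if x: "x > 0" for x using r[OF x] upos[OF x] N_pos by simp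
  have ph: "phi0 lam x = inverse (sqrt N) * u x" if x: "x > 0" for x
    using r[OF x] upos[OF x] by (simp add: phi0_def real_sqrt_divide) (simp add: divide_inverse mult.commute)
  have s: "sol q l {0<..} (phi0 lam) (\<lambda>x. inverse (sqrt N) * u' x)"
    by (rule sol_cong[OF sol_scale[OF sol_subset[OF u], of "{0<..}" "inverse (sqrt N)"]]) (use ph in auto)
  have cov: "\<exists>a b. (a < x \<or> x = 0 \<and> a = 0) \<and> x < b \<and> {a..b} \<subseteq> {0<..}" if "x \<in> {0<..}" for x :: real
    by (intro exI[of _ "x/2"] exI[of _ "x+1"]) (use that in auto)
  have I: "{0<..} \<subseteq> {0::real..}" by auto
  note AC = weak2_on_imp_AC1_loc[OF s[unfolded sol_def] I cov]
  show "AC1_loc {0<..} (phi0 lam)" by (rule AC(1))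
  show "AE x in lebesgue_on {0<..}. q x = D\<^sub>x (D\<^sub>x (phi0 lam)) x / phi0 lam x + l"
  proof (subst AE_lebesgue_on_iff)
    show "negligible {x\<in>{0<..}. \<not> q x = D\<^sub>x (D\<^sub>x (phi0 lam)) x / phi0 lam x + l}"
    proof (rule negligible_subset[OF AC(3)])
      show "{x\<in>{0<..}. \<not> q x = D\<^sub>x (D\<^sub>x (phi0 lam)) x / phi0 lam x + l} \<subseteq>
        {x\<in>{0<..}. D\<^sub>x (D\<^sub>x (phi0 lam)) x \<noteq> (q x - l) * phi0 lam x}"
      proof safe
        fix x :: real assume x: "x > 0" "q x \<noteq> D\<^sub>x (D\<^sub>x (phi0 lam)) x / phi0 lam x + l"
          and eq: "D\<^sub>x (D\<^sub>x (phi0 lam)) x = (q x - l) * phi0 lam x"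
        have "phi0 lam x > 0" using ph[OF x(1)] upos[OF x(1)] N_pos by simp
        then show False using x(2) eq by simp
      qed
    qed
  qed simp
qed

end

section \<open>Positivity of the ground state for a non-negative potential\<close>

text \<open>Continuous dependence on the spectral parameter by variation of constants:
  \<open>f\<close> is expanded in \<open>u\<close> and a companion \<open>\<theta>\<close> of
  Wronskian 1, with Wronskians of \<open>f\<close> as coefficients, and these change at rate
  \<open>m - l\<close>.\<close>

lemma sol_near:
  assumes q: "L1_loc q" and u: "sol q l {0..} u u'" "u 0 = 0" "u' 0 \<noteq> 0" and X: "X > 0" and eps: "\<eta> > 0"
  shows "\<exists>\<delta>>0. \<forall>m. \<bar>m - l\<bar> < \<delta> \<longrightarrow> (\<exists>f f'. sol q m {0..} f f' \<and> f 0 = 0 \<and> f' 0 = u' 0 \<and> (\<forall>x\<in>{0..X}. \<bar>f x - u x\<bar> < \<eta>))"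
proof -
  obtain \<theta> \<theta>' where th: "sol q l {0..} \<theta> \<theta>'" "\<theta> 0 = - 1 / u' 0" "\<theta>' 0 = 0" by (rule sol_exists_0[OF q])
  have W: "u x * \<theta>' x - \<theta> x * u' x = 1" if "x \<ge> 0" for x
    using sol_wronskian_const[OF u(1) th(1) that order_refl] u th by simp
  have uX: "sol q l {0..X} u u'" "sol q l {0..X} \<theta> \<theta>'" using u(1) th(1) by (auto elim: sol_subset)
  have bnd: "\<exists>B. B > 0 \<and> (\<forall>x\<in>{0..X}. \<bar>g x\<bar> \<le> B)" if c: "continuous_on {0..X} g" for g :: "real \<Rightarrow> real"
  proof -
    obtain B where B: "\<And>x. x \<in> {0..X} \<Longrightarrow> norm (g x) \<le> B"
      using compact_imp_bounded[OF compact_continuous_image[OF c compact_Icc]] unfolding bounded_iff by blast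
    have "\<bar>g x\<bar> \<le> \<bar>B\<bar> + 1" if "x \<in> {0..X}" for x using B[OF that] by simp
    then show ?thesis by (intro exI[of _ "\<bar>B\<bar> + 1"]) auto
  qed
  obtain A where A: "A > 0" "\<And>x. x \<in> {0..X} \<Longrightarrow> \<bar>u x\<bar> \<le> A" using bnd[OF sol_continuous(1)[OF uX(1) X]] by blast
  obtain B where B: "B > 0" "\<And>x. x \<in> {0..X} \<Longrightarrow> \<bar>\<theta> x\<bar> \<le> B" using bnd[OF sol_continuous(1)[OF uX(2) X]] by blast
  \<comment> \<open>The two terms of \<open>f - u = (\<alpha> - 1) u + \<beta> \<theta>\<close> are
    each at most the distance of the parameters times \<open>\<Phi> X A B\<close>, with
    \<open>\<Phi>\<close> the maximum of \<open>\<bar>f\<bar>\<close>.\<close>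
  define K where "K = 2 * X * A * B"
  have K: "K > 0" using X A B by (simp add: K_def)
  define \<delta> where "\<delta> = min (1 / (2 * K)) (\<eta> / (2 * A * K))"
  have \<delta>: "\<delta> > 0" "\<delta> \<le> 1 / (2 * K)" "\<delta> \<le> \<eta> / (2 * A * K)" using K A eps by (auto simp: \<delta>_def)
  show ?thesis
  proof (intro exI[of _ \<delta>] conjI allI impI \<delta>(1))
    fix m assume m: "\<bar>m - l\<bar> < \<delta>"
    obtain f f' where f: "sol q m {0..} f f'" "f 0 = 0" "f' 0 = u' 0" by (rule sol_exists_0[OF q])
    have fX: "sol q m {0..X} f f'" using f(1) by (auto elim: sol_subset)
    have fc: "continuous_on {0..X} (\<lambda>x. \<bar>f x\<bar>)" by (intro continuous_intros sol_continuous(1)[OF fX X])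
    obtain x1 where x1: "x1 \<in> {0..X}" "\<And>x. x \<in> {0..X} \<Longrightarrow> \<bar>f x\<bar> \<le> \<bar>f x1\<bar>"
      using continuous_attains_sup[OF _ _ fc] X by (auto simp: compact_Icc)
    define \<Phi> where "\<Phi> = \<bar>f x1\<bar>"
    have F: "\<bar>f x - u x\<bar> \<le> \<bar>m - l\<bar> * K * \<Phi>" if x: "x \<in> {0..X}" for x
    proof -
      have int: "\<bar>c\<bar> \<le> \<bar>m - l\<bar> * (\<Phi> * D) * X"
        if i: "((\<lambda>s. k * g s) has_integral c) {0..x}" and k: "\<bar>k\<bar> = \<bar>m - l\<bar>" and g: "\<And>s. s \<in> {0..X} \<Longrightarrow> \<bar>g s\<bar> \<le> \<Phi> * D" and D: "D > 0"
        for c k g D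
      proof -
        have "norm c \<le> (\<bar>m - l\<bar> * (\<Phi> * D)) * measure lborel (cbox 0 x)"
        proof (rule has_integral_bound[of _ "\<lambda>s. k * g s"])
          show "((\<lambda>s. k * g s) has_integral c) (cbox 0 x)" using i by simp
          show "0 \<le> \<bar>m - l\<bar> * (\<Phi> * D)" using D by (simp add: \<Phi>_def)
          fix s assume "s \<in> cbox 0 x"
          then have "s \<in> {0..X}" using x by auto
          then show "norm (k * g s) \<le> \<bar>m - l\<bar> * (\<Phi> * D)" using g k by (simp add: abs_mult mult_left_mono)
        qed
        also have "\<dots> \<le> (\<bar>m - l\<bar> * (\<Phi> * D)) * X" using x D by (intro mult_left_mono) (auto simp: \<Phi>_def)
        finally show ?thesis by simp
      qed
      define \<alpha> \<beta> where "\<alpha> = f x * \<theta>' x - \<theta> x * f' x" and "\<beta> = u x * f' x - f x * u' x"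
      have ia: "((\<lambda>s. (m - l) * (f s * \<theta> s)) has_integral (\<alpha> - 1)) {0..x}"
        using sol_wronskian[OF fX uX(2) X, of 0 x] x f th u by (simp add: \<alpha>_def)
      have ib: "((\<lambda>s. (l - m) * (u s * f s)) has_integral \<beta>) {0..x}"
        using sol_wronskian[OF uX(1) fX X, of 0 x] x f u by (simp add: \<beta>_def)
      have a1: "\<bar>\<alpha> - 1\<bar> \<le> \<bar>m - l\<bar> * (\<Phi> * B) * X"
        by (rule int[OF ia]) (use x1(2) B in \<open>auto simp: abs_mult \<Phi>_def intro!: mult_mono\<close>)
      have b1: "\<bar>\<beta>\<bar> \<le> \<bar>m - l\<bar> * (\<Phi> * A) * X"
        by (rule int[OF ib]) (use x1(2) A in \<open>auto simp: abs_mult \<Phi>_def mult.commute[of "\<bar>f _\<bar>"] abs_minus_commute intro!: mult_mono\<close>)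
      have "f x * 1 = f x * (u x * \<theta>' x - \<theta> x * u' x)" using W x by simp
      then have "f x - u x = (\<alpha> - 1) * u x + \<beta> * \<theta> x" by (simp add: \<alpha>_def \<beta>_def algebra_simps)
      then have "\<bar>f x - u x\<bar> \<le> \<bar>\<alpha> - 1\<bar> * \<bar>u x\<bar> + \<bar>\<beta>\<bar> * \<bar>\<theta> x\<bar>" by (metis abs_mult abs_triangle_ineq)
      also have "\<dots> \<le> (\<bar>m - l\<bar> * (\<Phi> * B) * X) * A + (\<bar>m - l\<bar> * (\<Phi> * A) * X) * B"
        using a1 b1 A(2)[OF x] B(2)[OF x] by (intro add_mono mult_mono) auto
      also have "\<dots> = \<bar>m - l\<bar> * K * \<Phi>" by (simp add: K_def algebra_simps)
      finally show ?thesis .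
    qed
    have mK: "\<bar>m - l\<bar> * K \<le> 1/2"
    proof -
      have "\<bar>m - l\<bar> * K \<le> 1 / (2 * K) * K" using m \<delta>(2) K by (intro mult_right_mono) auto
      then show ?thesis using K by simp
    qed
    \<comment> \<open>The bound on \<open>f - u\<close> still contains the maximum of
      \<open>f\<close> itself; for parameters this close it enters with factor at most 1/2 and is
      absorbed.\<close>
    have "\<Phi> \<le> \<bar>u x1\<bar> + \<bar>f x1 - u x1\<bar>" unfolding \<Phi>_def by linarith
    also have "\<dots> \<le> A + \<bar>m - l\<bar> * K * \<Phi>" using A(2)[OF x1(1)] F[OF x1(1)] by linarith
    also have "\<dots> \<le> A + 1/2 * \<Phi>" using mK by (intro add_left_mono mult_right_mono) (auto simp: \<Phi>_def)
    finally have \<Phi>: "\<Phi> \<le> 2 * A" by simp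
    have "\<bar>f x - u x\<bar> < \<eta>" if x: "x \<in> {0..X}" for x
    proof -
      have "\<bar>f x - u x\<bar> \<le> \<bar>m - l\<bar> * K * (2 * A)" using F[OF x] \<Phi> K
        by (meson abs_ge_zero less_imp_le mult_left_mono mult_nonneg_nonneg order_trans)
      also have "\<dots> < \<delta> * K * (2 * A)" using m K A by (intro mult_strict_right_mono) auto
      also have "\<dots> \<le> (\<eta> / (2 * A * K)) * K * (2 * A)" using \<delta>(3) K A by (intro mult_right_mono) auto
      also have "\<dots> = \<eta>" using K A by simp
      finally show ?thesis .
    qed
    then show "\<exists>f f'. sol q m {0..} f f' \<and> f 0 = 0 \<and> f' 0 = u' 0 \<and> (\<forall>x\<in>{0..X}. \<bar>f x - u x\<bar> < \<eta>)"
      using f by blast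
  qed
qed

lemma sol_zero_simple:
  assumes q: "L1_loc q" and u: "sol q l {0..} u u'" and nt: "x0 \<ge> 0" "u x0 \<noteq> 0" and c: "c \<ge> 0" "u c = 0"
  shows "u' c \<noteq> 0"
proof
  assume "u' c = 0"
  have X: "0 < max x0 c + 1" using c by simp
  have s: "sol q l {0..max x0 c + 1} u u'" using u by (rule sol_subset) auto
  have "u x0 = 0"
    by (rule sol_unique_zero(1)[OF q X order_refl s _ c(2) \<open>u' c = 0\<close>]) (use nt c in auto)
  then show False using nt by simp
qed

lemma sol_negative_nearby:
  assumes u: "sol q l {0..} u u'" and c: "c > 0" "u c = 0" "u' c \<noteq> 0"
  shows "\<exists>d>0. u d < 0"
proof -
  have "(u has_real_derivative u' c) (at c within {0..c+1})"
    using sol_deriv[OF sol_subset[OF u], of 0 "c+1" c] c by auto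
  then have d: "(u has_real_derivative u' c) (at c)"
    using at_within_interior[of c "{0..c+1}"] c by simp
  show ?thesis
  proof (cases "u' c > 0")
    case True
    obtain e where e: "e > 0" "\<And>h. 0 < h \<Longrightarrow> h < e \<Longrightarrow> u (c - h) < u c" using DERIV_pos_inc_left[OF d True] by blast
    define h where "h = min e c / 2"
    have "0 < h" "h < e" "h < c" using e c by (auto simp: h_def)
    then show ?thesis using e(2)[of h] c by (intro exI[of _ "c - h"]) auto
  next
    case False
    then have "u' c < 0" using c by simp
    obtain e where e: "e > 0" "\<And>h. 0 < h \<Longrightarrow> h < e \<Longrightarrow> u c > u (c + h)" using DERIV_neg_dec_right[OF d \<open>u' c < 0\<close>] by blast
    show ?thesis using e(1) e(2)[of "e/2"] c by (intro exI[of _ "c + e/2"]) auto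
  qed
qed

section \<open>From the bottom of the spectrum to a lower bound for the quadratic form\<close>

lemma weak2_on_spike:
  assumes "weak2_on I y y' y2" "negligible {x\<in>I. z2 x \<noteq> y2 x}" shows "weak2_on I y y' z2"
  unfolding weak2_on_def
proof (intro allI impI)
  fix a b assume ab: "a < b \<and> {a..b} \<subseteq> I"
  show "weak2 a b y y' z2"
    by (rule weak2_spike[OF weak2_onD[OF assms(1)] assms(2)]) (use ab in auto)
qed

lemma sq_int_product_integrable:
  fixes y z :: "real \<Rightarrow> real"
  assumes "sq_int T y" "sq_int T z" shows "(\<lambda>x. y x * z x) integrable_on {T..}"
  using sq_int_mult[OF assms] by (simp add: absolutely_integrable_on_def)

lemma L2_norm_of_real:
  assumes "sq_int 0 v" shows "L2_norm (\<lambda>x. complex_of_real (v x)) = sqrt (integral {0..} (\<lambda>x. (v x)\<^sup>2))"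
proof -
  have "sq_int 0 (\<lambda>x. complex_of_real (v x))" using sq_int_linear_image[OF assms bounded_linear_of_real] .
  then have "(\<lambda>x. complex_of_real (v x)) \<in> L2" by (simp add: L2_iff_sq_int)
  then have "integrable (lebesgue_on {0..}) (\<lambda>x. (norm (complex_of_real (v x)))\<^sup>2)" by (simp add: L2_def)
  then have "integral\<^sup>L (lebesgue_on {0..}) (\<lambda>x. (norm (complex_of_real (v x)))\<^sup>2) = integral {0..} (\<lambda>x. (norm (complex_of_real (v x)))\<^sup>2)"
    by (rule lebesgue_integral_eq_integral) simp
  then show ?thesis by (simp add: L2_norm_def)
qed

text \<open>Real functions in the domain of the operator without boundary condition at infinity,
  paired with a representative \<open>k\<close> of \<open>tau q y\<close>, which behaves linearly
  without reference to pointwise second derivatives.\<close>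

definition dom0 :: "(real \<Rightarrow> real) \<Rightarrow> (real \<Rightarrow> real) \<Rightarrow> (real \<Rightarrow> real) \<Rightarrow> (real \<Rightarrow> real) \<Rightarrow> bool" where
  "dom0 q y y' k \<longleftrightarrow> end_sol q 0 y y' k \<and> y 0 = 0"

lemma dom0D:
  assumes "dom0 q y y' k"
  shows "end_sol q 0 y y' k" "y 0 = 0" "sq_int 0 y" "sq_int 0 k" "weak2_on {0..} y y' (\<lambda>x. q x * y x - k x)"
  using assms unfolding dom0_def end_sol_def by auto

lemma sq_int_add_mult:
  fixes y z :: "real \<Rightarrow> real"
  assumes "sq_int T y" "sq_int T z" shows "sq_int T (\<lambda>x. y x + s * z x)"
  using sq_int_add[OF assms(1) sq_int_scaleR[OF assms(2), of s]] by simp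

lemma dom0_add_mult:
  assumes y: "dom0 q y y' k" and z: "dom0 q z z' m"
  shows "dom0 q (\<lambda>x. y x + s * z x) (\<lambda>x. y' x + s * z' x) (\<lambda>x. k x + s * m x)"
  unfolding dom0_def end_sol_def
proof (intro conjI)
  show "weak2_on {0..} (\<lambda>x. y x + s * z x) (\<lambda>x. y' x + s * z' x) (\<lambda>x. q x * (y x + s * z x) - (k x + s * m x))"
    unfolding weak2_on_def
  proof (intro allI impI)
    fix a b :: real assume ab: "a < b \<and> {a..b} \<subseteq> {0..}"
    have "weak2 a b (\<lambda>x. y x + s *\<^sub>R z x) (\<lambda>x. y' x + s *\<^sub>R z' x) (\<lambda>x. (q x * y x - k x) + s *\<^sub>R (q x * z x - m x))"
      by (intro weak2_add weak2_scaleR weak2_onD[OF dom0D(5)[OF y]] weak2_onD[OF dom0D(5)[OF z]]) (use ab in auto)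
    then show "weak2 a b (\<lambda>x. y x + s * z x) (\<lambda>x. y' x + s * z' x) (\<lambda>x. q x * (y x + s * z x) - (k x + s * m x))"
      by (rule weak2_cong) (auto simp: algebra_simps)
  qed
qed (use dom0D(2-4)[OF y] dom0D(2-4)[OF z] sq_int_add_mult in auto)

lemma dom0_symmetric:
  assumes q: "L1_loc q" and q0: "admissible q No_BC" and y: "dom0 q y y' k" and z: "dom0 q z z' m"
  shows "integral {0..} (\<lambda>x. z x * k x) = integral {0..} (\<lambda>x. y x * m x)"
proof -
  have "(y 0 * z' 0 - z 0 * y' 0) + integral {0..} (\<lambda>s. z s * k s - y s * m s) = 0"
    by (rule tendsto_unique[OF _ end_sol_wronskian_limit[OF dom0D(1)[OF y] dom0D(1)[OF z]]
          end_sol_wronskian_zero[OF q q0 order_refl dom0D(1)[OF y] _ dom0D(1)[OF z]]]) auto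
  moreover have "integral {0..} (\<lambda>s. z s * k s - y s * m s) = integral {0..} (\<lambda>x. z x * k x) - integral {0..} (\<lambda>x. y x * m x)"
    by (rule Henstock_Kurzweil_Integration.integral_diff) (intro sq_int_product_integrable dom0D(3)[OF y] dom0D(3)[OF z] dom0D(4)[OF y] dom0D(4)[OF z])+
  ultimately show ?thesis using dom0D(2)[OF y] dom0D(2)[OF z] by simp
qed

text \<open>At a real point of the resolvent set, taking real parts commutes with the shifted
  operator, so solvability and the norm bound descend to real functions.\<close>

lemma resolvent_real:
  assumes q: "L1_loc q" and res: "complex_of_real m \<in> resolvent_set q No_BC"
  shows "sq_int 0 h \<Longrightarrow> \<exists>z z'. dom0 q z z' (\<lambda>x. m * z x + h x)"
    "\<exists>C>0. \<forall>y y' k. dom0 q y y' k \<longrightarrow> integral {0..} (\<lambda>x. (y x)\<^sup>2) \<le> C\<^sup>2 * integral {0..} (\<lambda>x. (k x - m * y x)\<^sup>2)"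
proof -
  assume h: "sq_int 0 h"
  have "sq_int 0 (\<lambda>x. complex_of_real (h x))" using sq_int_linear_image[OF h bounded_linear_of_real] .
  then have hL: "(\<lambda>x. complex_of_real (h x)) \<in> L2" by (simp add: L2_iff_sq_int)
  obtain y where y: "y \<in> dom_S q No_BC" "AE x in lebesgue_on {0..}. tau q y x - of_real m * y x = of_real (h x)"
    using res hL unfolding resolvent_set_def by auto
  have y': "y \<in> L2" "AC1_loc {0..} y" "tau q y \<in> L2" "y 0 = 0"
    using y(1) by (auto simp: dom_S_def max_dom_def)
  define z z' where "z x = Re (y x)" and "z' x = Re (D\<^sub>x y x)" for x
  have w: "weak2_on {0..} y (D\<^sub>x y) (\<lambda>x. of_real (q x) * y x - tau q y x)"
    using AC1_loc_tau[OF q y'(2)] y'(3) by (simp add: L2_iff_sq_int)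
  have zw: "weak2_on {0..} z z' (\<lambda>x. Re (of_real (q x) * y x - tau q y x))"
    unfolding weak2_on_def z_def z'_def
  proof (intro allI impI)
    fix a b :: real assume ab: "a < b \<and> {a..b} \<subseteq> {0..}"
    show "weak2 a b (\<lambda>x. Re (y x)) (\<lambda>x. Re (D\<^sub>x y x)) (\<lambda>x. Re (of_real (q x) * y x - tau q y x))"
      by (rule weak2_linear_image[OF weak2_onD[OF w] bounded_linear_Re]) (use ab in auto)
  qed
  have N: "negligible {x\<in>{0..}. \<not> tau q y x - of_real m * y x = of_real (h x)}"
    using y(2) by (subst (asm) AE_lebesgue_on_iff) auto
  have "weak2_on {0..} z z' (\<lambda>x. q x * z x - (m * z x + h x))"
  proof (rule weak2_on_spike[OF zw negligible_subset[OF N]]; safe)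
    fix x assume ne: "q x * z x - (m * z x + h x) \<noteq> Re (of_real (q x) * y x - tau q y x)"
      and eq: "tau q y x - of_real m * y x = of_real (h x)"
    have "Re (tau q y x) = m * z x + h x" using arg_cong[OF eq, of Re] by (simp add: z_def)
    then show False using ne by (simp add: z_def)
  qed
  moreover have zL: "sq_int 0 z" unfolding z_def using sq_int_linear_image[OF _ bounded_linear_Re] y'(1) by (simp add: L2_iff_sq_int)
  moreover have "sq_int 0 (\<lambda>x. m * z x + h x)" using sq_int_add_mult[OF h zL, of m] by (simp add: add.commute)
  moreover have "z 0 = 0" using y'(4) by (simp add: z_def)
  ultimately have "dom0 q z z' (\<lambda>x. m * z x + h x)" by (simp add: dom0_def end_sol_def)
  then show "\<exists>z z'. dom0 q z z' (\<lambda>x. m * z x + h x)" by blast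
next
  obtain C0 where C0: "\<And>y. y \<in> dom_S q No_BC \<Longrightarrow> L2_norm y \<le> C0 * L2_norm (\<lambda>x. tau q y x - of_real m * y x)"
    using res unfolding resolvent_set_def by auto
  define C where "C = \<bar>C0\<bar> + 1"
  have "integral {0..} (\<lambda>x. (y x)\<^sup>2) \<le> C\<^sup>2 * integral {0..} (\<lambda>x. (k x - m * y x)\<^sup>2)" if d: "dom0 q y y' k" for y y' k
  proof -
    define Y where "Y x = complex_of_real (y x)" for x
    note W = weak2_complex[OF dom0D(5)[OF d] order_refl _ atLeast_cover dom0D(3,4)[OF d], simplified]
    have "Y \<in> dom_S q No_BC" using W dom0D(2)[OF d] by (simp add: dom_S_def max_dom_def Y_def[abs_def])
    then have le: "L2_norm Y \<le> C0 * L2_norm (\<lambda>x. tau q Y x - of_real m * Y x)" by (rule C0)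
    have s: "sq_int 0 (\<lambda>x. k x - m * y x)" using sq_int_add_mult[OF dom0D(4,3)[OF d], of "- m"] by simp
    have "L2_norm (\<lambda>x. tau q Y x - of_real m * Y x) = L2_norm (\<lambda>x. complex_of_real (k x - m * y x))"
    proof -
      have ae: "AE x in lebesgue_on {0..}. tau q Y x = of_real (k x)" using W(5) by (simp add: Y_def[abs_def])
      have sq: "sq_int 0 (\<lambda>x. tau q Y x - of_real m * Y x)"
      proof (rule sq_int_ae_cong)
        show "sq_int 0 (\<lambda>x. complex_of_real (k x - m * y x))" using sq_int_linear_image[OF s bounded_linear_of_real] .
        have "negligible {x\<in>{0..}. \<not> tau q Y x = of_real (k x)}" using ae by (subst (asm) AE_lebesgue_on_iff) auto
        then show "negligible {x\<in>{0..}. tau q Y x - of_real m * Y x \<noteq> complex_of_real (k x - m * y x)}"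
          by (rule negligible_subset) (auto simp: Y_def)
      qed
      show ?thesis unfolding L2_norm_def
      proof (rule arg_cong[where f=sqrt], rule integral_cong_AE)
        show "(\<lambda>x. (norm (tau q Y x - of_real m * Y x))\<^sup>2) \<in> borel_measurable (lebesgue_on {0..})"
          using sq_intD(1)[OF sq] by measurable
        have "(\<lambda>x. complex_of_real (k x - m * y x)) \<in> borel_measurable (lebesgue_on {0..})"
          using sq_intD(1)[OF sq_int_linear_image[OF s bounded_linear_of_real]] .
        then show "(\<lambda>x. (norm (complex_of_real (k x - m * y x)))\<^sup>2) \<in> borel_measurable (lebesgue_on {0..})" by measurable
        show "AE x in lebesgue_on {0..}. (norm (tau q Y x - of_real m * Y x))\<^sup>2 = (norm (complex_of_real (k x - m * y x)))\<^sup>2"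
          using ae by eventually_elim (simp add: Y_def)
      qed
    qed
    then have "sqrt (integral {0..} (\<lambda>x. (y x)\<^sup>2)) \<le> C0 * sqrt (integral {0..} (\<lambda>x. (k x - m * y x)\<^sup>2))"
      using le L2_norm_of_real[OF dom0D(3)[OF d]] L2_norm_of_real[OF s] by (simp add: Y_def[abs_def])
    also have "\<dots> \<le> C * sqrt (integral {0..} (\<lambda>x. (k x - m * y x)\<^sup>2))"
      using sq_intD(2)[OF s] by (intro mult_right_mono) (auto simp: C_def intro!: integral_nonneg)
    finally have "(sqrt (integral {0..} (\<lambda>x. (y x)\<^sup>2)))\<^sup>2 \<le> (C * sqrt (integral {0..} (\<lambda>x. (k x - m * y x)\<^sup>2)))\<^sup>2"
      using sq_intD(2)[OF dom0D(3)[OF d]] by (intro power_mono) (auto intro!: integral_nonneg)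
    then show ?thesis
      using sq_intD(2)[OF dom0D(3)[OF d]] sq_intD(2)[OF s] by (simp add: power_mult_distrib integral_nonneg)
  qed
  then show "\<exists>C>0. \<forall>y y' k. dom0 q y y' k \<longrightarrow> integral {0..} (\<lambda>x. (y x)\<^sup>2) \<le> C\<^sup>2 * integral {0..} (\<lambda>x. (k x - m * y x)\<^sup>2)"
    by (intro exI[of _ C]) (auto simp: C_def)
qed

text \<open>If the bottom \<open>m\<close> of the numerical range were below the spectrum, then with \<open>(S - m) z = y\<close> the Cauchy-Schwarz
  inequality for the non-negative form \<open>\<langle>(S - m) \<cdot>, \<cdot>\<rangle>\<close> gives \<open>\<parallel>y\<parallel>\<^sup>4 \<le> \<langle>(S - m) y, y\<rangle> \<langle>y, z\<rangle> \<le> C \<langle>(S - m) y, y\<rangle> \<parallel>y\<parallel>\<^sup>2\<close>,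
  so the form would be bounded below by \<open>m + 1/C\<close>.\<close>

theorem form_lower_bound:
  assumes q: "L1_loc q" and q0: "admissible q No_BC" and spec: "\<And>z. z \<in> spectrum_S q No_BC \<Longrightarrow> l \<le> Re z"
    and d: "dom0 q y y' k"
  shows "l * integral {0..} (\<lambda>x. (y x)\<^sup>2) \<le> integral {0..} (\<lambda>x. y x * k x)"
proof (rule ccontr)
  define S where "S y = integral {0..} (\<lambda>x. (y x)\<^sup>2)" for y :: "real \<Rightarrow> real"
  define b where "b y k = integral {0..} (\<lambda>x. y x * k x)" for y k :: "real \<Rightarrow> real"
  have S0: "S y \<ge> 0" if "dom0 q y y' k" for y y' k
    unfolding S_def using sq_intD(2)[OF dom0D(3)[OF that]] by (intro integral_nonneg) auto
  have b0: "b y k \<ge> 0" if "dom0 q y y' k" for y y' k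
    using end_sol_nonneg(3)[OF q0[simplified] order_refl dom0D(1)[OF that]] dom0D(2)[OF that] by (simp add: b_def)
  assume "\<not> ?thesis"
  then have lt: "b y k < l * S y" by (simp add: b_def S_def)
  then have Sy: "S y > 0" using S0[OF d] b0[OF d] by (cases "S y = 0") auto
  \<comment> \<open>The Rayleigh quotients; they are bounded below by 0 because the form of a
    non-negative potential is nonnegative.\<close>
  define X where "X = {b y k / S y | y y' k. dom0 q y y' k \<and> S y > 0}"
  have yX: "b y k / S y \<in> X" using d Sy unfolding X_def by blast
  have bdd: "bdd_below X" by (rule bdd_belowI[of _ 0]) (auto simp: X_def intro!: divide_nonneg_pos b0)
  define m where "m = Inf X"
  have "m \<le> b y k / S y" unfolding m_def using yX bdd by (rule cInf_lower)
  also have "\<dots> < l" using lt Sy by (simp add: divide_less_eq)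
  finally have ml: "m < l" .
  have res: "complex_of_real m \<in> resolvent_set q No_BC"
    using spec[of "complex_of_real m"] ml unfolding spectrum_S_def by fastforce
  have Bnn: "b w k - m * S w \<ge> 0" if w: "dom0 q w w' k" for w w' k
  proof (cases "S w = 0")
    case False
    then have Sw: "S w > 0" using S0[OF w] by simp
    have "m \<le> b w k / S w" unfolding m_def by (rule cInf_lower[OF _ bdd]) (use w Sw X_def in blast)
    then show ?thesis using Sw by (simp add: le_divide_eq)
  qed (use b0[OF w] in simp)
  obtain C where C: "C > 0" "\<And>y y' k. dom0 q y y' k \<Longrightarrow> S y \<le> C\<^sup>2 * integral {0..} (\<lambda>x. (k x - m * y x)\<^sup>2)"
    using resolvent_real(2)[OF q res] unfolding S_def by blast
  have "m + 1 / C \<le> r" if "r \<in> X" for r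
  proof -
    obtain y y' k where y: "dom0 q y y' k" "S y > 0" "r = b y k / S y" using \<open>r \<in> X\<close> by (auto simp: X_def)
    obtain z z' where z: "dom0 q z z' (\<lambda>x. m * z x + y x)" using resolvent_real(1)[OF q res dom0D(3)[OF y(1)]] by blast
    define G where "G = integral {0..} (\<lambda>x. z x * y x)"
    have yi: "((\<lambda>x. (y x)\<^sup>2) has_integral S y) {0..}"
      using integrable_integral[OF sq_intD(2)[OF dom0D(3)[OF y(1)]]] by (simp add: S_def)
    have zi: "((\<lambda>x. (z x)\<^sup>2) has_integral S z) {0..}"
      using integrable_integral[OF sq_intD(2)[OF dom0D(3)[OF z]]] by (simp add: S_def)
    have zy: "((\<lambda>x. z x * y x) has_integral G) {0..}"
      unfolding G_def by (rule integrable_integral[OF sq_int_product_integrable[OF dom0D(3)[OF z] dom0D(3)[OF y(1)]]])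
    have yk: "((\<lambda>x. y x * k x) has_integral b y k) {0..}"
      unfolding b_def by (rule integrable_integral[OF sq_int_product_integrable[OF dom0D(3,4)[OF y(1)]]])
    have "integral {0..} (\<lambda>x. z x * k x) = integral {0..} (\<lambda>x. y x * (m * z x + y x))"
      by (rule dom0_symmetric[OF q q0 y(1) z])
    also have "\<dots> = m * G + S y"
    proof (rule integral_unique)
      have "((\<lambda>x. m * (z x * y x) + (y x)\<^sup>2) has_integral (m * G + S y)) {0..}"
        by (intro has_integral_add has_integral_mult_right zy yi)
      then show "((\<lambda>x. y x * (m * z x + y x)) has_integral (m * G + S y)) {0..}"
        by (rule has_integral_eq[rotated]) (simp add: power2_eq_square algebra_simps)
    qed
    finally have zk: "((\<lambda>x. z x * k x) has_integral (m * G + S y)) {0..}"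
      using integrable_integral[OF sq_int_product_integrable[OF dom0D(3)[OF z] dom0D(4)[OF y(1)]]] by simp
    \<comment> \<open>The shifted form at \<open>y + s z\<close>. As the shifted operator maps
      \<open>z\<close> to \<open>y\<close>, the mixed term is the squared norm of \<open>y\<close>
      and the last coefficient is the scalar product of \<open>y\<close> and
      \<open>z\<close>.\<close>
    have "0 \<le> (b y k - m * S y) + 2 * s * S y + s\<^sup>2 * G" for s
    proof -
      note w = dom0_add_mult[OF y(1) z, of s]
      have "b (\<lambda>x. y x + s * z x) (\<lambda>x. k x + s * (m * z x + y x)) = b y k + s * (m * G + S y) + s * (m * G + S y) + s\<^sup>2 * (m * S z + G)"
        unfolding b_def
      proof (rule integral_unique)
        have "((\<lambda>x. y x * k x + s * (z x * k x) + s * (m * (z x * y x) + (y x)\<^sup>2) + s\<^sup>2 * (m * (z x)\<^sup>2 + z x * y x)) has_integral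
          (b y k + s * (m * G + S y) + s * (m * G + S y) + s\<^sup>2 * (m * S z + G))) {0..}"
          by (intro has_integral_add has_integral_mult_right zy yi zi yk zk)
        then show "((\<lambda>x. (y x + s * z x) * (k x + s * (m * z x + y x))) has_integral
          (integral {0..} (\<lambda>x. y x * k x) + s * (m * G + S y) + s * (m * G + S y) + s\<^sup>2 * (m * S z + G))) {0..}"
          unfolding b_def by (rule has_integral_eq[rotated]) (simp add: power2_eq_square algebra_simps)
      qed
      moreover have "S (\<lambda>x. y x + s * z x) = S y + 2 * s * G + s\<^sup>2 * S z"
        unfolding S_def[of "\<lambda>x. y x + s * z x"]
      proof (rule integral_unique)
        have "((\<lambda>x. (y x)\<^sup>2 + (2 * s) * (z x * y x) + s\<^sup>2 * (z x)\<^sup>2) has_integral (S y + 2 * s * G + s\<^sup>2 * S z)) {0..}"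
          by (intro has_integral_add has_integral_mult_right zy yi zi)
        then show "((\<lambda>x. (y x + s * z x)\<^sup>2) has_integral (S y + 2 * s * G + s\<^sup>2 * S z)) {0..}"
          by (rule has_integral_eq[rotated]) (simp add: power2_eq_square algebra_simps)
      qed
      ultimately show ?thesis using Bnn[OF w] by (simp add: algebra_simps)
    qed
    then have disc: "(S y)\<^sup>2 \<le> (b y k - m * S y) * G" by (rule discriminant_nonpos)
    have "G\<^sup>2 \<le> S z * S y" unfolding G_def S_def
      by (rule integral_Cauchy_Schwarz) (use zi yi zy in auto)
    also have "\<dots> \<le> (C\<^sup>2 * S y) * S y"
      using C(2)[OF z] S0[OF y(1)] by (intro mult_right_mono) (simp_all add: S_def)
    also have "\<dots> = (C * S y)\<^sup>2" by (simp add: power2_eq_square)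
    finally have "\<bar>G\<bar> \<le> \<bar>C * S y\<bar>" by (simp add: abs_le_square_iff)
    then have G: "G \<le> C * S y" using C(1) y(2) by simp
    have "S y * S y \<le> (b y k - m * S y) * (C * S y)"
      using disc mult_left_mono[OF G Bnn[OF y(1)]] by (simp add: power2_eq_square)
    then have "S y \<le> (b y k - m * S y) * C" using y(2) by simp
    then have "S y / C \<le> b y k - m * S y" using C(1) by (simp add: divide_le_eq)
    then have "(m + 1 / C) * S y \<le> b y k" by (simp add: distrib_right)
    then show ?thesis using y(2,3) by (simp add: pos_le_divide_eq)
  qed
  then have "m + 1 / C \<le> m" unfolding m_def using yX by (intro cInf_greatest) auto
  then show False using C(1) by simp
qed

section \<open>Cutting off a solution at its zero\<close>

lemma weak2_mult:
  fixes y z :: "real \<Rightarrow> real"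
  assumes y: "weak2 a b y y' y2" and z: "weak2 a b z z' z2"
  shows "weak2 a b (\<lambda>x. y x * z x) (\<lambda>x. y x * z' x + y' x * z x) (\<lambda>x. y x * z2 x + 2 * (y' x * z' x) + z x * y2 x)"
  unfolding weak2_def
proof (intro conjI ballI allI impI)
  fix x assume "x \<in> {a..b}"
  then show "((\<lambda>x. y x * z x) has_vector_derivative y x * z' x + y' x * z x) (at x within {a..b})"
    using has_vector_derivative_mult[OF weak2D(1)[OF y] weak2D(1)[OF z]] by simp
next
  have "(\<lambda>x. 2 * (y' x * z' x)) absolutely_integrable_on {a..b}"
    by (intro absolutely_integrable_continuous_real continuous_intros weak2_continuous[OF y] weak2_continuous[OF z])
  then show "(\<lambda>x. y x * z2 x + 2 * (y' x * z' x) + z x * y2 x) absolutely_integrable_on {a..b}"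
    by (rule set_integral_add(1)[OF set_integral_add(1)
          [OF absolutely_integrable_continuous_mult[OF weak2_continuous(1)[OF y] weak2D(2)[OF z]]]
        absolutely_integrable_continuous_mult[OF weak2_continuous(1)[OF z] weak2D(2)[OF y]]])
next
  fix u v assume uv: "a \<le> u \<and> u \<le> v \<and> v \<le> b"
  have "((\<lambda>x. (y x * z2 x + y' x * z' x) + (z x * y2 x + z' x * y' x)) has_integral (y v * z' v - y u * z' u) + (z v * y' v - z u * y' u)) {u..v}"
    by (intro has_integral_add weak2_by_parts(1)[OF y z] weak2_by_parts(1)[OF z y]) (use uv in auto)
  then show "((\<lambda>x. y x * z2 x + 2 * (y' x * z' x) + z x * y2 x) has_integral y v * z' v + y' v * z v - (y u * z' u + y' u * z u)) {u..v}"
    by (rule has_integral_eq_rhs[OF has_integral_eq[rotated]]) (auto simp: algebra_simps)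
qed

lemma weak2_smooth:
  fixes y :: "real \<Rightarrow> real"
  assumes "\<And>x. x \<in> {a..b} \<Longrightarrow> (y has_real_derivative y' x) (at x)" "\<And>x. x \<in> {a..b} \<Longrightarrow> (y' has_real_derivative y2 x) (at x)"
    and c: "continuous_on {a..b} y2"
  shows "weak2 a b y y' y2"
  unfolding weak2_def
proof (intro conjI ballI allI impI)
  fix u v assume uv: "a \<le> u \<and> u \<le> v \<and> v \<le> b"
  show "(y2 has_integral y' v - y' u) {u..v}"
    by (rule fundamental_theorem_of_calculus)
      (use uv assms(2) in \<open>auto simp flip: has_real_derivative_iff_has_vector_derivative intro: has_field_derivative_at_within\<close>)
qed (use assms in \<open>auto simp flip: has_real_derivative_iff_has_vector_derivative intro: has_field_derivative_at_within absolutely_integrable_continuous_real\<close>)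

lemma sq_int_zero: "sq_int T (\<lambda>x. 0::real)"
  by (simp add: sq_int_def integrable_0)

lemma sq_int_piece:
  fixes y :: "real \<Rightarrow> real"
  assumes "sq_int T' y" "T \<le> T'" "continuous_on {T..T'} g" "\<And>x. T \<le> x \<Longrightarrow> x < T' \<Longrightarrow> y x = g x"
  shows "sq_int T y"
proof -
  define h where "h x = (if x \<le> T' then g x else y x)" for x
  have "sq_int T' h"
    by (rule sq_int_ae_cong[OF assms(1)], rule negligible_subset[of "{T'}"]) (auto simp: h_def)
  moreover have "continuous_on {T..T'} h" using assms(3) by (rule continuous_on_eq) (auto simp: h_def)
  ultimately have "sq_int T h" by (rule sq_int_extend[OF _ assms(2)])
  moreover have "{x \<in> {T..}. y x \<noteq> h x} \<subseteq> {T'}"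
  proof
    fix x assume x: "x \<in> {x \<in> {T..}. y x \<noteq> h x}"
    then show "x \<in> {T'}" using assms(4)[of x] by (cases "x < T'") (auto simp: h_def split: if_splits)
  qed
  ultimately show ?thesis by (metis sq_int_ae_cong negligible_subset negligible_sing)
qed

lemma positive_near_zero:
  assumes "sol q m {0..} f f'" "f 0 = 0" "f' 0 > 0" "X > 0"
  obtains e where "0 < e" "e < X" "\<And>x. 0 < x \<Longrightarrow> x \<le> e \<Longrightarrow> f x > 0"
proof -
  have "(f has_real_derivative f' 0) (at 0 within {0..X})"
    using sol_deriv[OF sol_subset[OF assms(1)], of 0 X 0] assms(4) by auto
  then obtain d where d: "d > 0" "\<And>s. 0 < s \<Longrightarrow> s \<in> {0..X} \<Longrightarrow> s < d \<Longrightarrow> f 0 < f s"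
    using has_real_derivative_pos_inc_right[of f "f' 0" 0 "{0..X}"] assms by auto
  show thesis
    by (rule that[of "min d X / 2"]) (use d assms in auto)
qed

lemma zero_between:
  assumes f: "sol q m {0..} f f'" "f 0 = 0" "f' 0 > 0" and d: "d > 0" "f d \<le> 0"
  obtains c where "0 < c" "c \<le> d" "f c = 0"
proof -
  obtain e where e: "0 < e" "e < d" "\<And>x. 0 < x \<Longrightarrow> x \<le> e \<Longrightarrow> f x > 0" using positive_near_zero[OF f d(1)] by blast
  have "continuous_on {e..d} f" by (rule continuous_on_subset[OF sol_continuous_atLeast(1)[OF f(1)]]) (use e in auto)
  then obtain c where "e \<le> c" "c \<le> d" "f c = 0" using IVT2'[of f d 0 e] d e(3)[of e] e(1,2) by auto
  then show thesis using that[of c] e(1) by auto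
qed

text \<open>A Dirichlet solution below \<open>l\<close> that vanishes at \<open>c\<close> and is cut off on \<open>[c, c + d]\<close> has
  \<open>\<langle>(S - m) y, y\<rangle> = \<integral> f\<^sup>2 \<eta>'\<^sup>2 = O(d)\<close>, since \<open>f = O(x - c)\<close> and \<open>\<eta>' = O(1/d)\<close>.\<close>

lemma no_zero_below_spectrum:
  assumes q: "L1_loc q" and low: "\<And>y y' k. dom0 q y y' k \<Longrightarrow> l * integral {0..} (\<lambda>x. (y x)\<^sup>2) \<le> integral {0..} (\<lambda>x. y x * k x)"
    and m: "m < l" and f: "sol q m {0..} f f'" "f 0 = 0" "f' 0 > 0" and c: "c > 0" "f c = 0"
  shows False
proof -
  obtain e where e: "0 < e" "e < c" "\<And>x. 0 < x \<Longrightarrow> x \<le> e \<Longrightarrow> f x > 0" using positive_near_zero[OF f c(1)] by blast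
  have fc: "continuous_on {a..b} f" "continuous_on {a..b} f'" if "0 \<le> a" for a b
    by (rule continuous_on_subset[OF sol_continuous_atLeast(1)[OF f(1)]], use that in force)
      (rule continuous_on_subset[OF sol_continuous_atLeast(2)[OF f(1)]], use that in force)
  \<comment> \<open>Mass on an initial interval that the cut-off does not reach: a lower bound for
    the norm independent of \<open>d\<close>.\<close>
  define S0 where "S0 = integral {0..e} (\<lambda>x. f x * f x)"
  have S0: "S0 > 0" unfolding S0_def
  proof (rule integral_product_pos[OF fc(1) fc(1)])
    show "f x \<ge> 0" if "x \<in> {0..e}" for x using e(3)[of x] f(2) that by (cases "x = 0") auto
    then show "f x \<ge> 0" if "x \<in> {0..e}" for x using that .
  qed (use e in auto)
  obtain M where M: "\<And>x. x \<in> {c..c+1} \<Longrightarrow> norm (f' x) \<le> M"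
    using compact_imp_bounded[OF compact_continuous_image[OF fc(2) compact_Icc], of c "c+1"] c unfolding bounded_iff by (metis imageI less_imp_le)
  have fM: "\<bar>f x\<bar> \<le> M * (x - c)" if x: "x \<in> {c..c+1}" for x
  proof -
    have "norm (f x - f c) \<le> M * norm (x - c)"
    proof (rule field_differentiable_bound[of "{c..c+1}" f f'])
      fix z assume z: "z \<in> {c..c+1}"
      show "(f has_real_derivative f' z) (at z within {c..c+1})"
        by (rule sol_deriv[OF sol_subset[OF f(1)] z]) (use c in auto)
    qed (use M x in auto)
    then show ?thesis using c x by simp
  qed
  \<comment> \<open>The bound 1 keeps the cut-off where \<open>M\<close> bounds \<open>f'\<close>;
    the \<open>+ 1\<close> in the denominator covers \<open>M = 0\<close>, and the final halving
    makes the inequality strict.\<close>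
  define d where "d = min 1 ((l - m) * S0 / (16 * M\<^sup>2 + 1) / 2)"
  have "16 * M\<^sup>2 + 1 > 0" using zero_le_power2[of M] by linarith
  then have d: "d > 0" "d \<le> 1" using m S0 by (auto simp: d_def)
  have dsmall: "16 * M\<^sup>2 * d < (l - m) * S0"
  proof -
    have p: "(l - m) * S0 > 0" using m S0 by simp
    have "16 * M\<^sup>2 * d \<le> (16 * M\<^sup>2 + 1) * d" using d by (intro mult_right_mono) auto
    also have "\<dots> \<le> (16 * M\<^sup>2 + 1) * ((l - m) * S0 / (16 * M\<^sup>2 + 1) / 2)"
      using \<open>16 * M\<^sup>2 + 1 > 0\<close> by (intro mult_left_mono) (auto simp: d_def)
    also have "\<dots> = (l - m) * S0 / 2"
    proof -
      have "r * (p / r / 2) = p / 2" if "r > 0" for r p :: real using that by simp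
      then show ?thesis using \<open>16 * M\<^sup>2 + 1 > 0\<close> by blast
    qed
    also have "\<dots> < (l - m) * S0" using p by linarith
    finally show ?thesis .
  qed
  define s where "s x = (x - c) / d" for x
  \<comment> \<open>A polynomial profile with value 1 and slope 0 at \<open>c\<close>, value 0 and
    slope 0 at \<open>c + d\<close>, so that the truncated function keeps an absolutely continuous
    derivative. \<open>\<eta>1\<close> and \<open>\<eta>2\<close> are its derivatives.\<close>
  define \<eta> \<eta>1 \<eta>2 where "\<eta> x = (1 - (s x)\<^sup>2)\<^sup>2" and "\<eta>1 x = - 4 * s x * (1 - (s x)\<^sup>2) / d" and "\<eta>2 x = - 4 * (1 - 3 * (s x)\<^sup>2) / d\<^sup>2" for x
  have sd: "(s has_real_derivative 1 / d) (at x)" for x unfolding s_def using d by (auto intro!: derivative_eq_intros)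
  have ed: "(\<eta> has_real_derivative \<eta>1 x) (at x)" for x
    unfolding \<eta>_def \<eta>1_def using d by (auto intro!: derivative_eq_intros sd simp: field_simps)
  have ed1: "(\<eta>1 has_real_derivative \<eta>2 x) (at x)" for x
    unfolding \<eta>1_def \<eta>2_def using d by (auto intro!: derivative_eq_intros sd simp: field_simps power2_eq_square)
  have sc: "continuous_on A s" for A unfolding s_def using d by (intro continuous_intros) auto
  have ec: "continuous_on A \<eta>" "continuous_on A \<eta>1" "continuous_on A \<eta>2" for A
    unfolding \<eta>_def \<eta>1_def \<eta>2_def using d by (intro continuous_intros sc; simp)+
  have ew: "weak2 a b \<eta> \<eta>1 \<eta>2" for a b by (rule weak2_smooth[OF ed ed1 ec(3)])
  have sv: "s c = 0" "s (c + d) = 1" using d by (auto simp: s_def)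
  have ev: "\<eta> c = 1" "\<eta>1 c = 0" "\<eta> (c + d) = 0" "\<eta>1 (c + d) = 0" by (simp_all add: \<eta>_def \<eta>1_def sv)
  define Y where "Y x = (if x \<le> c then f x else if x \<le> c + d then f x * \<eta> x else 0)" for x
  define Y' where "Y' x = (if x \<le> c then f' x else if x \<le> c + d then f x * \<eta>1 x + f' x * \<eta> x else 0)" for x
  define K where "K x = (if x \<le> c then m * f x else if x \<le> c + d then m * (f x * \<eta> x) - 2 * (f' x * \<eta>1 x) - f x * \<eta>2 x else 0)" for x
  have w1: "weak2 0 c Y Y' (\<lambda>x. q x * Y x - K x)"
    by (rule weak2_cong[OF solD[OF f(1)]]) (use c in \<open>auto simp: Y_def Y'_def K_def algebra_simps\<close>)
  have w2: "weak2 c (c + d) Y Y' (\<lambda>x. q x * Y x - K x)"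
  proof -
    have "weak2 c (c + d) (\<lambda>x. f x * \<eta> x) (\<lambda>x. f x * \<eta>1 x + f' x * \<eta> x) (\<lambda>x. f x * \<eta>2 x + 2 * (f' x * \<eta>1 x) + \<eta> x * ((q x - m) * f x))"
      by (rule weak2_mult[OF solD[OF f(1)] ew]) (use c d in auto)
    then have "weak2 c (c + d) Y Y' (\<lambda>x. f x * \<eta>2 x + 2 * (f' x * \<eta>1 x) + \<eta> x * ((q x - m) * f x))"
      by (rule weak2_cong) (use c ev in \<open>auto simp: Y_def Y'_def\<close>)
    then show ?thesis
      by (rule weak2_spike[where N = "{c}"]) (auto simp: Y_def K_def algebra_simps)
  qed
  have w3: "weak2 (c + d) b Y Y' (\<lambda>x. q x * Y x - K x)" for b
  proof -
    have "weak2 (c + d) b (\<lambda>x. 0) (\<lambda>x. 0) (\<lambda>x. 0::real)" by (rule weak2_smooth) auto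
    then have "weak2 (c + d) b Y Y' (\<lambda>x. 0)"
      by (rule weak2_cong) (use ev d in \<open>auto simp: Y_def Y'_def\<close>)
    then show ?thesis by (rule weak2_spike[where N = "{c + d}"]) (use d in \<open>auto simp: Y_def K_def\<close>)
  qed
  have w: "weak2_on {0..} Y Y' (\<lambda>x. q x * Y x - K x)"
    unfolding weak2_on_def
  proof (intro allI impI)
    fix a b :: real assume ab: "a < b \<and> {a..b} \<subseteq> {0..}"
    have "weak2 0 (max b (c + d)) Y Y' (\<lambda>x. q x * Y x - K x)"
      using c d by (intro weak2_combine[OF weak2_combine[OF w1 w2] w3]) auto
    then show "weak2 a b Y Y' (\<lambda>x. q x * Y x - K x)" by (rule weak2_subset) (use ab in auto)
  qed
  have Yc: "continuous_on {0..b} Y" if "b > 0" for b by (rule weak2_continuous(1)[OF weak2_onD[OF w]]) (use that in auto)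
  have YL: "sq_int 0 Y"
  proof (rule sq_int_extend)
    show "sq_int (c + d + 1) Y" by (rule sq_int_ae_cong[OF sq_int_zero], rule negligible_subset[OF negligible_empty]) (use d in \<open>auto simp: Y_def\<close>)
  qed (use c d Yc in auto)
  have KL: "sq_int 0 K"
  proof (rule sq_int_piece[where T' = c])
    show "sq_int c K"
    proof (rule sq_int_piece[where T' = "c + d"])
      show "sq_int (c + d) K"
        by (rule sq_int_ae_cong[OF sq_int_zero], rule negligible_subset[of "{c + d}"]) (use d in \<open>auto simp: K_def\<close>)
      show "continuous_on {c..c+d} (\<lambda>x. if x = c then K c else m * (f x * \<eta> x) - 2 * (f' x * \<eta>1 x) - f x * \<eta>2 x)"
      proof (rule continuous_on_eq[where f = "\<lambda>x. m * (f x * \<eta> x) - 2 * (f' x * \<eta>1 x) - f x * \<eta>2 x"])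
        show "continuous_on {c..c+d} (\<lambda>x. m * (f x * \<eta> x) - 2 * (f' x * \<eta>1 x) - f x * \<eta>2 x)"
          using c by (intro continuous_intros fc ec) auto
      qed (use c ev in \<open>auto simp: K_def\<close>)
    qed (use d in \<open>auto simp: K_def\<close>)
    show "continuous_on {0..c} (\<lambda>x. m * f x)" by (intro continuous_intros fc) auto
  qed (use c in \<open>auto simp: K_def\<close>)
  have D: "dom0 q Y Y' K" using w YL KL f(2) c by (simp add: dom0_def end_sol_def Y_def)
  define I where "I = integral {c..c+d} (\<lambda>x. (f x * \<eta>1 x)\<^sup>2)"
  have cI: "continuous_on {c..c+d} (\<lambda>x. (f x * \<eta>1 x)\<^sup>2)" using c by (intro continuous_intros fc ec) auto
  have Ii: "((\<lambda>x. (f x * \<eta>1 x)\<^sup>2) has_integral I) {c..c+d}"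
    unfolding I_def by (rule integrable_integral[OF integrable_continuous_real[OF cI]])
  \<comment> \<open>The integrand is the derivative of \<open>\<eta> f^2 \<eta>1\<close>, which
    vanishes at both ends. Subtracting it shows that the form of the truncated function is the
    integral of \<open>f^2 \<eta>1^2\<close>.\<close>
  have "((\<lambda>x. \<eta>1 x * ((f x)\<^sup>2 * \<eta>1 x) + \<eta> x * (2 * f x * f' x * \<eta>1 x + (f x)\<^sup>2 * \<eta>2 x)) has_integral
     (\<eta> (c+d) * ((f (c+d))\<^sup>2 * \<eta>1 (c+d)) - \<eta> c * ((f c)\<^sup>2 * \<eta>1 c))) {c..c+d}"
  proof (rule fundamental_theorem_of_calculus)
    fix x assume x: "x \<in> {c..c+d}"
    have fd: "(f has_real_derivative f' x) (at x within {c..c+d})"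
      by (rule sol_deriv[OF sol_subset[OF f(1)] x]) (use c d in auto)
    have "((\<lambda>x. \<eta> x * ((f x)\<^sup>2 * \<eta>1 x)) has_real_derivative \<eta>1 x * ((f x)\<^sup>2 * \<eta>1 x) + \<eta> x * (2 * f x * f' x * \<eta>1 x + (f x)\<^sup>2 * \<eta>2 x)) (at x within {c..c+d})"
      by (rule derivative_eq_intros fd DERIV_subset[OF ed subset_UNIV] DERIV_subset[OF ed1 subset_UNIV] refl)+ (simp add: algebra_simps)
    then show "((\<lambda>x. \<eta> x * ((f x)\<^sup>2 * \<eta>1 x)) has_vector_derivative \<eta>1 x * ((f x)\<^sup>2 * \<eta>1 x) + \<eta> x * (2 * f x * f' x * \<eta>1 x + (f x)\<^sup>2 * \<eta>2 x)) (at x within {c..c+d})"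
      by (simp add: has_real_derivative_iff_has_vector_derivative)
  qed (use d in auto)
  then have FTC: "((\<lambda>x. \<eta>1 x * ((f x)\<^sup>2 * \<eta>1 x) + \<eta> x * (2 * f x * f' x * \<eta>1 x + (f x)\<^sup>2 * \<eta>2 x)) has_integral 0) {c..c+d}"
    by (simp add: ev)
  have "((\<lambda>x. Y x * (K x - m * Y x)) has_integral I) {c..c+d}"
    using has_integral_diff[OF Ii FTC]
    by (rule has_integral_eq_rhs[OF has_integral_eq[rotated]])
      (use c ev in \<open>auto simp: Y_def K_def algebra_simps power2_eq_square\<close>)
  then have YK: "((\<lambda>x. Y x * (K x - m * Y x)) has_integral I) {0..}"
    by (rule has_integral_on_superset) (use c in \<open>auto simp: Y_def K_def\<close>)
  have Yi: "((\<lambda>x. (Y x)\<^sup>2) has_integral integral {0..} (\<lambda>x. (Y x)\<^sup>2)) {0..}"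
    using sq_intD(2)[OF YL] by (simp add: integrable_integral)
  have "((\<lambda>x. Y x * K x) has_integral (I + m * integral {0..} (\<lambda>x. (Y x)\<^sup>2))) {0..}"
    using has_integral_add[OF YK has_integral_mult_right[OF Yi, of m]]
    by (rule has_integral_eq[rotated]) (simp add: algebra_simps power2_eq_square)
  then have "integral {0..} (\<lambda>x. Y x * K x) = I + m * integral {0..} (\<lambda>x. (Y x)\<^sup>2)" by (rule integral_unique)
  then have ineq: "(l - m) * integral {0..} (\<lambda>x. (Y x)\<^sup>2) \<le> I" using low[OF D] by (simp add: algebra_simps)
  have "I \<le> 16 * M\<^sup>2 * d"
  proof -
    have "I \<le> integral {c..c+d} (\<lambda>x. 16 * M\<^sup>2)"
      unfolding I_def
    proof (rule integral_le[OF integrable_continuous_real[OF cI]])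
      fix x assume x: "x \<in> {c..c+d}"
      have s01: "0 \<le> s x" "s x \<le> 1" using x d by (auto simp: s_def)
      then have s2: "0 \<le> (s x)\<^sup>2" "(s x)\<^sup>2 \<le> 1" by (auto simp: power_le_one)
      \<comment> \<open>The factor \<open>d\<close> from the zero of \<open>f\<close> cancels the
        \<open>1/d\<close> in \<open>\<eta>1\<close>, so the integrand is bounded independently of
        \<open>d\<close> and the integral is of order \<open>d\<close>.\<close>
      have "\<bar>f x\<bar> \<le> M * (d * s x)" using fM[of x] x d by (simp add: s_def)
      then have "\<bar>f x * \<eta>1 x\<bar> \<le> (M * (d * s x)) * \<bar>\<eta>1 x\<bar>" by (simp add: abs_mult mult_right_mono)
      also have "\<bar>\<eta>1 x\<bar> = 4 * s x * (1 - (s x)\<^sup>2) / d" using s01 s2 d by (simp add: \<eta>1_def abs_mult)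
      also have "(M * (d * s x)) * (4 * s x * (1 - (s x)\<^sup>2) / d) = 4 * M * ((s x)\<^sup>2 * (1 - (s x)\<^sup>2))"
        using d by (simp add: power2_eq_square)
      also have "\<dots> \<le> 4 * M * 1"
      proof (rule mult_left_mono)
        show "(s x)\<^sup>2 * (1 - (s x)\<^sup>2) \<le> 1" using s2 mult_mono[of "(s x)\<^sup>2" 1 "1 - (s x)\<^sup>2" 1] by simp
        have "norm (f' c) \<le> M" using M by simp
        then have "0 \<le> M" using norm_ge_zero order_trans by blast
        then show "0 \<le> 4 * M" by simp
      qed
      finally have "\<bar>f x * \<eta>1 x\<bar> \<le> 4 * M" by simp
      then have "(f x * \<eta>1 x)\<^sup>2 \<le> (4 * M)\<^sup>2" by (rule abs_le_square_iff[THEN iffD1, OF order_trans]) simp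
      then show "(f x * \<eta>1 x)\<^sup>2 \<le> 16 * M\<^sup>2" by (simp add: power_mult_distrib)
    qed auto
    also have "\<dots> = 16 * M\<^sup>2 * d" using d by simp
    finally show ?thesis .
  qed
  moreover have "S0 \<le> integral {0..} (\<lambda>x. (Y x)\<^sup>2)"
  proof -
    have "S0 = integral {0..e} (\<lambda>x. (Y x)\<^sup>2)"
      unfolding S0_def by (rule integral_cong) (use e in \<open>auto simp: Y_def power2_eq_square\<close>)
    also have "\<dots> \<le> integral {0..} (\<lambda>x. (Y x)\<^sup>2)"
    proof (rule integral_subset_le)
      show "(\<lambda>x. (Y x)\<^sup>2) integrable_on {0..e}"
        by (intro integrable_continuous_real continuous_intros Yc e)
    qed (use sq_intD(2)[OF YL] in auto)
    finally show ?thesis .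
  qed
  then have "(l - m) * S0 \<le> (l - m) * integral {0..} (\<lambda>x. (Y x)\<^sup>2)" using m by (intro mult_left_mono) auto
  ultimately show False using ineq dsmall by linarith
qed

text \<open>At the level \<open>l\<close> itself the cut-off gives no contradiction, the factor
  \<open>l - m\<close> being 0. But zeros are simple, so \<open>u\<close> takes a negative value;
  this survives a small decrease of the level and still forces a zero.\<close>

theorem nonneg_ground_state_positive:
  assumes q: "L1_loc q" and q0: "admissible q No_BC" and spec: "\<And>z. z \<in> spectrum_S q No_BC \<Longrightarrow> l \<le> Re z"
    and u: "sol q l {0..} u u'" "u 0 = 0" "u' 0 > 0" and x: "x > 0"
  shows "u x > 0"
proof (rule ccontr)
  assume "\<not> u x > 0"
  then obtain c where c: "0 < c" "c \<le> x" "u c = 0" using zero_between[OF u x] by (metis not_le)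
  obtain e where e: "0 < e" "e < 1" "\<And>x. 0 < x \<Longrightarrow> x \<le> e \<Longrightarrow> u x > 0" using positive_near_zero[OF u zero_less_one] by blast
  have "u e \<noteq> 0" using e(3)[of e] e(1) by simp
  then have "u' c \<noteq> 0" using sol_zero_simple[OF q u(1), of e c] e(1) c by simp
  then obtain d where d: "d > 0" "u d < 0" using sol_negative_nearby[OF u(1) c(1,3)] by blast
  obtain \<delta> where \<delta>: "\<delta> > 0" "\<And>m. \<bar>m - l\<bar> < \<delta> \<Longrightarrow> \<exists>f f'. sol q m {0..} f f' \<and> f 0 = 0 \<and> f' 0 = u' 0 \<and> (\<forall>x\<in>{0..d}. \<bar>f x - u x\<bar> < - u d)"
    using sol_near[OF q u(1,2) _ d(1), of "- u d"] u(3) d(2) by auto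
  obtain f f' where f: "sol q (l - \<delta>/2) {0..} f f'" "f 0 = 0" "f' 0 = u' 0" "\<And>x. x \<in> {0..d} \<Longrightarrow> \<bar>f x - u x\<bar> < - u d"
    using \<delta>(2)[of "l - \<delta>/2"] \<delta>(1) by auto
  have "f d \<le> 0" using f(4)[of d] d by auto
  then obtain c' where c': "0 < c'" "f c' = 0" using zero_between[OF f(1,2) _ d(1)] f(3) u(3) by auto
  show False
    by (rule no_zero_below_spectrum[OF q form_lower_bound[OF q q0 spec] _ f(1,2) _ c']) (use \<delta>(1) f(3) u(3) in auto)
qed

section \<open>Positivity of the ground state in the limit-circle case\<close>

text \<open>Weyl's alternative: variation of constants around the square integrable solutions at \<open>z0\<close>, with
  \<open>\<integral>\<^sub>X (\<bar>a\<bar> + \<bar>b\<bar>)\<^sup>2\<close> small enough to absorb the integral term.\<close>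

theorem limit_circle_sq_int:
  assumes q: "L1_loc q" and lc: "limit_circle q" and y: "sol q l {0..} y y'"
  shows "sq_int 0 y"
proof -
  obtain z0 where z0: "\<And>Y. solution q z0 Y \<Longrightarrow> Y \<in> L2" using lc unfolding limit_circle_def by blast
  define Q where "Q x = complex_of_real (q x) - z0" for x
  have Qi: "Q absolutely_integrable_on {0..b}" if "b > 0" for b
  proof -
    have "(\<lambda>x. complex_of_real (q x)) absolutely_integrable_on {0..b}"
      using absolutely_integrable_linear[OF L1_locD[OF q that] bounded_linear_of_real] by (simp add: o_def)
    then show ?thesis unfolding Q_def by (rule set_integral_diff(1)) (rule absolutely_integrable_continuous_real, simp)
  qed
  have inL: "sq_int 0 a" if w: "\<forall>b>0. weak2 0 b a a' (\<lambda>x. Q x * a x)" for a a' :: "real \<Rightarrow> complex"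
  proof -
    have W: "weak2_on {0..} a a' (\<lambda>x. Q x * a x)"
      unfolding weak2_on_def
    proof (intro allI impI)
      fix c d :: real assume cd: "c < d \<and> {c..d} \<subseteq> {0..}"
      then have c: "0 \<le> c" by auto
      have "weak2 0 d a a' (\<lambda>x. Q x * a x)" using w c cd by simp
      then show "weak2 c d a a' (\<lambda>x. Q x * a x)" by (rule weak2_subset) (use c cd in auto)
    qed
    have "negligible {x\<in>{0..}. D\<^sub>x (D\<^sub>x a) x \<noteq> Q x * a x}" by (rule weak2_on_imp_AC1_loc(3)[OF W order_refl atLeast_cover])
    then have N: "negligible {x\<in>{0..}. tau q a x \<noteq> z0 * a x}"
      by (rule negligible_subset) (auto simp: tau_def Q_def algebra_simps)
    have "AC1_loc {0..} a" by (rule weak2_on_imp_AC1_loc(1)[OF W order_refl atLeast_cover])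
    then have "solution q z0 a" unfolding solution_def using N by (simp add: AE_lebesgue_on_iff)
    then show ?thesis using z0 L2_iff_sq_int by blast
  qed
  obtain a a' where a: "a 0 = 1" "a' 0 = 0" "\<forall>b>0. weak2 0 b a a' (\<lambda>x. Q x * a x)" using ivp_exists[OF Qi] by blast
  obtain b b' where b: "b 0 = 0" "b' 0 = 1" "\<forall>c>0. weak2 0 c b b' (\<lambda>x. Q x * b x)" using ivp_exists[OF Qi] by blast
  have W: "a x * b' x - b x * a' x = 1" if x: "x \<ge> 0" for x
  proof (cases "x = 0")
    case False
    have "((\<lambda>s. a s * (Q s * b s) - b s * (Q s * a s)) has_integral ((a x * b' x - b x * a' x) - (a 0 * b' 0 - b 0 * a' 0))) {0..x}"
      by (rule weak2_wronskian[of 0 x]) (use a b x False in auto)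
    then have "((\<lambda>s. 0) has_integral ((a x * b' x - b x * a' x) - 1)) {0..x}" using a b by (simp add: algebra_simps)
    then show ?thesis using has_integral_unique[OF has_integral_0] by fastforce
  qed (use a b in auto)
  define g where "g x = norm (a x) + norm (b x)" for x
  have ns: "sq_int 0 (\<lambda>x. norm (w x))" if "sq_int 0 w" for w :: "real \<Rightarrow> complex"
    using sq_intD[OF that] by (auto simp: sq_int_def intro: borel_measurable_norm)
  have gL: "sq_int 0 g" unfolding g_def by (intro sq_int_add ns inL[OF a(3)] inL[OF b(3)])
  have g2: "(\<lambda>x. (g x)\<^sup>2) absolutely_integrable_on {0..}" using sq_int_absolutely_integrable[OF gL] by simp
  have g0: "g x \<ge> 0" for x by (simp add: g_def)
  have gc: "continuous_on {0..c} g" if "c > 0" for c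
    unfolding g_def using weak2_continuous(1) a(3) b(3) that by (intro continuous_intros) blast+
  define \<kappa> where "\<kappa> = norm (complex_of_real l - z0)"
  have \<kappa>: "\<kappa> \<ge> 0" by (simp add: \<kappa>_def)
  \<comment> \<open>The threshold ensures \<open>\<kappa> G \<le> 1/2\<close>, and its
    \<open>+ 1\<close> covers \<open>\<kappa> = 0\<close>.\<close>
  have "eventually (\<lambda>x. integral {x..} (\<lambda>x. (g x)\<^sup>2) < 1 / (2 * \<kappa> + 1) \<and> x > 0) at_top"
    by (intro eventually_conj order_tendstoD(2)[OF integral_tail_tendsto_zero(1)[OF g2]] eventually_gt_at_top) (use \<kappa> in auto)
  then obtain X where X: "integral {X..} (\<lambda>x. (g x)\<^sup>2) < 1 / (2 * \<kappa> + 1)" "X > 0"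
    unfolding eventually_at_top_linorder by blast
  define G where "G = integral {X..} (\<lambda>x. (g x)\<^sup>2)"
  have gX: "(\<lambda>x. (g x)\<^sup>2) integrable_on {X..}" "(\<lambda>x. (g x)\<^sup>2) integrable_on {X..n}" for n
    using absolutely_integrable_atLeast_subinterval[OF g2, of X] X(2) by (auto simp: absolutely_integrable_on_def)
  have G0: "G \<ge> 0" unfolding G_def by (rule Henstock_Kurzweil_Integration.integral_nonneg[OF gX(1)]) simp
  have \<kappa>G: "\<kappa> * G \<le> 1 / 2"
  proof -
    have "\<kappa> * G \<le> \<kappa> * (1 / (2 * \<kappa> + 1))" using X(1) \<kappa> by (intro mult_left_mono) (auto simp: G_def)
    also have "\<dots> \<le> 1 / 2" using \<kappa> by (simp add: field_simps)
    finally show ?thesis .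
  qed
  have yw: "weak2 0 n (\<lambda>x. complex_of_real (y x)) (\<lambda>x. of_real (y' x)) (\<lambda>x. of_real ((q x - l) * y x))" if "n > 0" for n
    by (rule weak2_linear_image[OF solD[OF y] bounded_linear_of_real]) (use that in auto)
  have yc: "continuous_on {0..n} y" for n by (rule continuous_on_subset[OF sol_continuous_atLeast(1)[OF y]]) auto
  define Wr where "Wr z z' x = of_real (y x) * z' x - z x * of_real (y' x)" for z z' :: "real \<Rightarrow> complex" and x
  define C where "C = norm (Wr a a' X) + norm (Wr b b' X)"
  have bound: "integral {X..n} (\<lambda>x. (y x)\<^sup>2) \<le> 4 * G * C\<^sup>2" if n: "n > X" for n
  proof -
    have n0: "n > 0" using n X(2) by simp
    have cX: "continuous_on {X..x} y" "continuous_on {X..x} g" if "x > X" for x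
      by (rule continuous_on_subset[OF yc[of x]], use X(2) in auto) (rule continuous_on_subset[OF gc[of x]], use X(2) that in auto)
    have i: "(\<lambda>s. \<bar>y s\<bar> * g s) integrable_on {X..x}" for x
    proof (cases "x > X")
      case True
      then show ?thesis by (intro integrable_continuous_real continuous_intros cX)
    next
      case False
      then show ?thesis by (cases "x = X") (auto intro: has_integral_integrable[OF has_integral_refl(2)])
    qed
    define J where "J = integral {X..n} (\<lambda>s. \<bar>y s\<bar> * g s)"
    have J0: "J \<ge> 0" unfolding J_def by (rule Henstock_Kurzweil_Integration.integral_nonneg[OF i]) (simp add: g0)
    have Wb: "norm (Wr z z' x) \<le> C + \<kappa> * J"
      if z: "\<forall>c>0. weak2 0 c z z' (\<lambda>x. Q x * z x)" "\<And>s. norm (z s) \<le> g s" "norm (Wr z z' X) \<le> C" and x: "x \<in> {X..n}" for z z' x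
    proof -
      have "((\<lambda>s. of_real (y s) * (Q s * z s) - z s * of_real ((q s - l) * y s)) has_integral (Wr z z' x - Wr z z' X)) {X..x}"
        unfolding Wr_def by (rule weak2_wronskian[OF yw[OF n0] z(1)[rule_format, OF n0]]) (use X(2) x in auto)
      then have h: "((\<lambda>s. (of_real l - z0) * (of_real (y s) * z s)) has_integral (Wr z z' x - Wr z z' X)) {X..x}"
        by (rule has_integral_eq[rotated]) (simp add: Q_def algebra_simps)
      have "norm (integral {X..x} (\<lambda>s. (of_real l - z0) * (of_real (y s) * z s))) \<le> integral {X..x} (\<lambda>s. \<kappa> * (\<bar>y s\<bar> * g s))"
      proof (rule integral_norm_bound_integral)
        fix s show "norm ((of_real l - z0) * (of_real (y s) * z s)) \<le> \<kappa> * (\<bar>y s\<bar> * g s)"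
          unfolding norm_mult \<kappa>_def using z(2)[of s] by (intro mult_left_mono) (auto intro: mult_left_mono)
      qed (use h integrable_on_mult_right[OF i] in auto)
      also have "\<dots> = \<kappa> * integral {X..x} (\<lambda>s. \<bar>y s\<bar> * g s)" by simp
      also have "\<dots> \<le> \<kappa> * J" unfolding J_def
        by (intro mult_left_mono[OF _ \<kappa>] integral_subset_le i) (use x g0 in auto)
      finally have "norm (Wr z z' x - Wr z z' X) \<le> \<kappa> * J" using integral_unique[OF h] by simp
      then show ?thesis using z(3) norm_triangle_sub[of "Wr z z' x" "Wr z z' X"] by linarith
    qed
    \<comment> \<open>Since \<open>a\<close> and \<open>b\<close> have Wronskian 1, \<open>y\<close>
      is their combination with its own Wronskians as coefficients; these vary only through the
      difference of the two levels.\<close>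
    have pw: "(y x)\<^sup>2 \<le> (2 * C\<^sup>2 + 2 * (\<kappa> * J)\<^sup>2) * (g x)\<^sup>2" if x: "x \<in> {X..n}" for x
    proof -
      have "complex_of_real (y x) = of_real (y x) * (a x * b' x - b x * a' x)" using W[of x] x X(2) by simp
      also have "\<dots> = a x * Wr b b' x - b x * Wr a a' x" by (simp add: Wr_def algebra_simps)
      finally have "norm (complex_of_real (y x)) \<le> norm (a x) * norm (Wr b b' x) + norm (b x) * norm (Wr a a' x)"
        by (metis norm_triangle_ineq4 norm_mult)
      also have "\<dots> \<le> norm (a x) * (C + \<kappa> * J) + norm (b x) * (C + \<kappa> * J)"
        by (intro add_mono mult_left_mono Wb[OF a(3)] Wb[OF b(3)] x) (auto simp: g_def C_def)
      finally have "\<bar>y x\<bar> \<le> (C + \<kappa> * J) * g x" by (simp add: g_def algebra_simps)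
      then have "(y x)\<^sup>2 \<le> ((C + \<kappa> * J) * g x)\<^sup>2" by (rule abs_le_square_iff[THEN iffD1, OF order_trans]) simp
      also have "\<dots> = (C + \<kappa> * J)\<^sup>2 * (g x)\<^sup>2" by (simp add: power_mult_distrib)
      also have "\<dots> \<le> (2 * C\<^sup>2 + 2 * (\<kappa> * J)\<^sup>2) * (g x)\<^sup>2"
      proof (rule mult_right_mono)
        show "(C + \<kappa> * J)\<^sup>2 \<le> 2 * C\<^sup>2 + 2 * (\<kappa> * J)\<^sup>2"
          using zero_le_power2[of "C - \<kappa> * J"] by (simp add: power2_eq_square algebra_simps)
      qed simp
      finally show ?thesis .
    qed
    define I where "I = integral {X..n} (\<lambda>x. (y x)\<^sup>2)"
    have yi: "(\<lambda>x. (y x)\<^sup>2) integrable_on {X..n}" using n by (intro integrable_continuous_real continuous_intros cX)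
    have I0: "I \<ge> 0" unfolding I_def by (rule Henstock_Kurzweil_Integration.integral_nonneg[OF yi]) simp
    have gle: "integral {X..n} (\<lambda>x. (g x)\<^sup>2) \<le> G" unfolding G_def by (rule integral_subset_le[OF _ gX(2,1)]) auto
    have "J\<^sup>2 \<le> integral {X..n} (\<lambda>x. \<bar>y x\<bar>\<^sup>2) * integral {X..n} (\<lambda>x. (g x)\<^sup>2)"
      unfolding J_def by (rule integral_Cauchy_Schwarz) (use yi gX i in auto)
    also have "\<dots> \<le> I * G" using gle I0 by (auto simp: I_def intro: mult_left_mono)
    finally have J2: "J\<^sup>2 \<le> I * G" .
    \<comment> \<open>By Cauchy-Schwarz the integral \<open>I\<close> reappears on the right, with
      factor \<open>2 (\<kappa> G)^2 \<le> 1/2\<close>. Absorbing it leaves a bound that does not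
      depend on \<open>n\<close>.\<close>
    have "I \<le> integral {X..n} (\<lambda>x. (2 * C\<^sup>2 + 2 * (\<kappa> * J)\<^sup>2) * (g x)\<^sup>2)"
      unfolding I_def by (rule integral_le[OF yi]) (use pw integrable_on_mult_right[OF gX(2)] in auto)
    also have "\<dots> = (2 * C\<^sup>2 + 2 * (\<kappa> * J)\<^sup>2) * integral {X..n} (\<lambda>x. (g x)\<^sup>2)" by simp
    also have "\<dots> \<le> (2 * C\<^sup>2 + 2 * (\<kappa> * J)\<^sup>2) * G" using gle by (intro mult_left_mono) auto
    also have "\<dots> \<le> (2 * C\<^sup>2 + 2 * (\<kappa>\<^sup>2 * (I * G))) * G"
      using J2 G0 by (intro mult_right_mono add_left_mono mult_left_mono) (auto simp: power_mult_distrib intro: mult_left_mono)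
    also have "\<dots> = 2 * G * C\<^sup>2 + 2 * ((\<kappa> * G)\<^sup>2 * I)" by (simp add: power2_eq_square algebra_simps)
    also have "(\<kappa> * G)\<^sup>2 * I \<le> (1 / 2)\<^sup>2 * I"
      using \<kappa>G \<kappa> G0 I0 by (intro mult_right_mono power_mono) auto
    finally have "I \<le> 4 * G * C\<^sup>2" by (simp add: power2_eq_square)
    then show ?thesis by (simp add: I_def)
  qed
  have "(\<lambda>x. (y x)\<^sup>2) integrable_on {X..}"
  proof (rule nonneg_bounded_integral_integrable)
    fix n assume n: "n \<ge> X"
    have "continuous_on {X..n} y" by (rule continuous_on_subset[OF yc[of n]]) (use X(2) in auto)
    then show "(\<lambda>x. (y x)\<^sup>2) integrable_on {X..n}" by (intro integrable_continuous_real continuous_intros)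
    show "integral {X..n} (\<lambda>x. (y x)\<^sup>2) \<le> 4 * G * C\<^sup>2"
      using bound[of n] n G0 by (cases "n = X") auto
  qed simp
  moreover have "y \<in> borel_measurable (lebesgue_on {X..})"
    by (rule continuous_on_atLeast_measurable[OF continuous_on_subset[OF sol_continuous_atLeast(1)[OF y]]]) (use X(2) in auto)
  ultimately have "sq_int X y" by (simp add: sq_int_def)
  then show ?thesis by (rule sq_int_extend) (use X(2) yc in auto)
qed

section \<open>Solutions satisfying the boundary condition at infinity, and their dependence on the
  level\<close>

definition bc_solution :: "(real \<Rightarrow> real) \<Rightarrow> endpoint \<Rightarrow> real \<Rightarrow> (real \<Rightarrow> real) \<Rightarrow> (real \<Rightarrow> real) \<Rightarrow> bool" where
  "bc_solution q E m y y' \<longleftrightarrow> sol q m {0..} y y' \<and> sq_int 0 y \<and> bc_real E y y' \<and> (y 0 \<noteq> 0 \<or> y' 0 \<noteq> 0)"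

lemma bc_solutionD:
  assumes "bc_solution q E m y y'"
  shows "sol q m {0..} y y'" "sq_int 0 y" "bc_real E y y'" "y 0 \<noteq> 0 \<or> y' 0 \<noteq> 0"
  using assms by (auto simp: bc_solution_def)

lemma bc_solution_nontrivial:
  assumes "bc_solution q E m y y'" shows "\<exists>x\<ge>0. y x \<noteq> 0"
proof (cases "y 0 = 0")
  case True
  then have "y' 0 * y' 0 > 0" using bc_solutionD(4)[OF assms] not_real_square_gt_zero by blast
  then obtain e where "0 < e" "y' 0 * y e > 0"
    using positive_near_zero[OF sol_scale[OF bc_solutionD(1)[OF assms], of "y' 0"] _ _ zero_less_one] True
    by (metis mult_zero_right order_refl)
  then show ?thesis by (intro exI[of _ e]) auto
qed auto

text \<open>All solutions are square integrable, so the boundary condition is one linear equation on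
  a two-dimensional space.\<close>

lemma bc_solution_exists:
  assumes q: "L1_loc q" and adm: "admissible q (BC f g \<beta>)"
  obtains y y' where "bc_solution q (BC f g \<beta>) m y y'"
proof -
  have L: "sq_int 0 y" if "sol q m {0..} y y'" for y y' using limit_circle_sq_int[OF q _ that] adm by simp
  obtain y y' where y: "sol q m {0..} y y'" "y 0 = 1" "y' 0 = 0" by (rule sol_exists_0[OF q])
  obtain z z' where z: "sol q m {0..} z z'" "z 0 = 0" "z' 0 = 1" by (rule sol_exists_0[OF q])
  obtain A B where A: "((\<lambda>x. y x * D\<^sub>x f x - f x * y' x) \<longlongrightarrow> A) at_top" "((\<lambda>x. y x * D\<^sub>x g x - g x * y' x) \<longlongrightarrow> B) at_top"
    by (rule end_sol_BC_limits[OF q adm order_refl sol_imp_end_sol[OF y(1) L[OF y(1)]]])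
  obtain A' B' where A': "((\<lambda>x. z x * D\<^sub>x f x - f x * z' x) \<longlongrightarrow> A') at_top" "((\<lambda>x. z x * D\<^sub>x g x - g x * z' x) \<longlongrightarrow> B') at_top"
    by (rule end_sol_BC_limits[OF q adm order_refl sol_imp_end_sol[OF z(1) L[OF z(1)]]])
  define p p' where "p = A * sin \<beta> - B * cos \<beta>" and "p' = A' * sin \<beta> - B' * cos \<beta>"
  obtain c d where cd: "c * p + d * p' = 0" "c \<noteq> 0 \<or> d \<noteq> 0"
  proof (cases "p = 0")
    case True then show thesis by (intro that[of 1 0]) auto
  next
    case False then show thesis by (intro that[of "p'" "- p"]) auto
  qed
  have lim: "((\<lambda>x. (c * y x + d * z x) * h' x - h x * (c * y' x + d * z' x)) \<longlongrightarrow> c * P + d * P') at_top"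
    if "((\<lambda>x. y x * h' x - h x * y' x) \<longlongrightarrow> P) at_top" "((\<lambda>x. z x * h' x - h x * z' x) \<longlongrightarrow> P') at_top" for h h' P P'
    by (rule Lim_transform_eventually[OF tendsto_add[OF tendsto_mult[OF tendsto_const that(1)] tendsto_mult[OF tendsto_const that(2)]]])
      (auto simp: algebra_simps)
  have "bc_real (BC f g \<beta>) (\<lambda>x. c * y x + d * z x) (\<lambda>x. c * y' x + d * z' x)"
    unfolding bc_real.simps
  proof (intro exI conjI)
    show "(c * A + d * A') * sin \<beta> = (c * B + d * B') * cos \<beta>" using cd(1) by (simp add: p_def p'_def algebra_simps)
  qed (rule lim[OF A(1) A'(1)], rule lim[OF A(2) A'(2)])
  then have "bc_solution q (BC f g \<beta>) m (\<lambda>x. c * y x + d * z x) (\<lambda>x. c * y' x + d * z' x)"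
    using sol_linear[OF y(1) z(1)] L[OF sol_linear[OF y(1) z(1)]] y z cd(2) by (auto simp: bc_solution_def)
  then show thesis by (rule that)
qed

lemma bc_solution_second:
  fixes A B :: real
  assumes q: "L1_loc q" and adm: "admissible q (BC f g \<beta>)" and AB: "A \<noteq> 0 \<or> B \<noteq> 0"
  obtains b b' where "sol q m {0..} b b'" "sq_int 0 b" "A * b' 0 - b 0 * B = 1"
proof -
  obtain C D where CD: "A * D - C * B = 1"
  proof (cases "A = 0")
    case True then show thesis using AB by (intro that[of 0 "- 1 / B"]) auto
  next
    case False then show thesis by (intro that[of "1 / A" 0]) auto
  qed
  obtain b b' where b: "sol q m {0..} b b'" "b 0 = C" "b' 0 = D" by (rule sol_exists_0[OF q])
  show thesis using that[OF b(1) limit_circle_sq_int[OF q _ b(1)]] adm b CD by simp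
qed

text \<open>Variation of constants from infinity. The Wronskian of \<open>y\<close> with
  \<open>a\<close> vanishes there because both satisfy the boundary condition, so \<open>y\<close>
  differs from a multiple of \<open>a\<close> only by tail integrals of order \<open>m - s\<close>,
  uniformly on the half-line in terms of \<open>\<bar>a\<bar> + \<bar>b\<bar>\<close>.\<close>

lemma bc_solutions_close:
  assumes q: "L1_loc q" and adm: "admissible q E"
    and a: "sol q s {0..} a a'" "sq_int 0 a" "bc_real E a a'" and b: "sol q s {0..} b b'" "sq_int 0 b"
    and W: "a 0 * b' 0 - b 0 * a' 0 = 1"
    and y: "sol q m {0..} y y'" "sq_int 0 y" "bc_real E y y'"
    and K: "integral {0..} (\<lambda>x. (a x)\<^sup>2) \<le> K" "integral {0..} (\<lambda>x. (b x)\<^sup>2) \<le> K" "12 * ((m - s) * K)\<^sup>2 \<le> 1"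
  obtains \<alpha> where "\<And>x. x \<ge> 0 \<Longrightarrow> \<bar>y x - \<alpha> * a x\<bar> \<le> \<bar>m - s\<bar> * (3 * \<bar>\<alpha>\<bar> * K) * (\<bar>a x\<bar> + \<bar>b x\<bar>)"
proof -
  have ea: "end_sol q T a a' (\<lambda>x. s * a x)" and eb: "end_sol q T b b' (\<lambda>x. s * b x)" and ey: "end_sol q T y y' (\<lambda>x. m * y x)"
    if "T \<ge> 0" for T
    using end_sol_mono[OF sol_imp_end_sol[OF a(1,2)] that] end_sol_mono[OF sol_imp_end_sol[OF b(1,2)] that]
      end_sol_mono[OF sol_imp_end_sol[OF y(1,2)] that] by auto
  define P where "P = integral {0..} (\<lambda>x. (y x)\<^sup>2)"
  have i2: "(\<lambda>x. (z x)\<^sup>2) integrable_on {0..}" "(\<lambda>x. (z x)\<^sup>2) integrable_on {x..}" if "sq_int 0 z" "x \<ge> 0" for z :: "real \<Rightarrow> real" and x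
    using sq_intD(2)[OF that(1)] sq_intD(2)[OF sq_int_mono[OF that]] by auto
  have P0: "P \<ge> 0" unfolding P_def by (rule Henstock_Kurzweil_Integration.integral_nonneg[OF i2(1)[OF y(2) order_refl]]) simp
  have "0 \<le> integral {0..} (\<lambda>x. (a x)\<^sup>2)" by (rule Henstock_Kurzweil_Integration.integral_nonneg[OF i2(1)[OF a(2) order_refl]]) simp
  then have K0: "K \<ge> 0" using K(1) by linarith
  have CS: "\<bar>integral {x..} (\<lambda>t. z t * y t)\<bar> \<le> sqrt (P * K)"
    if z: "sq_int 0 z" "integral {0..} (\<lambda>x. (z x)\<^sup>2) \<le> K" and x: "x \<ge> 0" for z x
  proof -
    have "(\<lambda>t. z t * y t) integrable_on {x..}"
      using sq_int_mult[OF sq_int_mono[OF z(1) x] sq_int_mono[OF y(2) x]] by (simp add: absolutely_integrable_on_def)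
    then have "(integral {x..} (\<lambda>t. z t * y t))\<^sup>2 \<le> integral {x..} (\<lambda>t. (z t)\<^sup>2) * integral {x..} (\<lambda>t. (y t)\<^sup>2)"
      by (rule integral_Cauchy_Schwarz[OF i2(2)[OF z(1) x] i2(2)[OF y(2) x]])
    also have "\<dots> \<le> K * P"
    proof (rule mult_mono[OF _ _ K0])
      have "integral {x..} (\<lambda>t. (z t)\<^sup>2) \<le> integral {0..} (\<lambda>x. (z x)\<^sup>2)"
        by (rule integral_subset_le[OF _ i2(2)[OF z(1) x] i2(1)[OF z(1) x]]) (use x in auto)
      then show "integral {x..} (\<lambda>t. (z t)\<^sup>2) \<le> K" using z(2) by linarith
      show "integral {x..} (\<lambda>t. (y t)\<^sup>2) \<le> P" unfolding P_def
        by (rule integral_subset_le[OF _ i2(2)[OF y(2) x] i2(1)[OF y(2) x]]) (use x in auto)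
      show "0 \<le> integral {x..} (\<lambda>t. (y t)\<^sup>2)" by (rule Henstock_Kurzweil_Integration.integral_nonneg[OF i2(2)[OF y(2) x]]) simp
    qed
    finally show ?thesis by (intro real_le_rsqrt[of "\<bar>_\<bar>"]) (simp add: mult.commute)
  qed
  have lim: "((\<lambda>t. y t * z' t - z t * y' t) \<longlongrightarrow> (y x * z' x - z x * y' x) + (m - s) * integral {x..} (\<lambda>t. z t * y t)) at_top"
    if z: "end_sol q x z z' (\<lambda>x. s * z x)" and x: "x \<ge> 0" for z z' x
  proof -
    have "(\<lambda>t. z t * (m * y t) - y t * (s * z t)) = (\<lambda>t. (m - s) * (z t * y t))" by (simp add: fun_eq_iff algebra_simps)
    then show ?thesis using end_sol_wronskian_limit[OF ey[OF x] z] by simp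
  qed
  \<comment> \<open>The limit at infinity of the Wronskian of \<open>y\<close> with
    \<open>b\<close>.\<close>
  define \<alpha> where "\<alpha> = (y 0 * b' 0 - b 0 * y' 0) + (m - s) * integral {0..} (\<lambda>t. b t * y t)"
  have Wb: "y x * b' x - b x * y' x = \<alpha> - (m - s) * integral {x..} (\<lambda>t. b t * y t)" if x: "x \<ge> 0" for x
    using tendsto_unique[OF trivial_limit_at_top_linorder lim[OF eb[OF order_refl] order_refl] lim[OF eb[OF x] x]]
    by (simp add: \<alpha>_def)
  have Wa: "y x * a' x - a x * y' x = - ((m - s) * integral {x..} (\<lambda>t. a t * y t))" if x: "x \<ge> 0" for x
    using tendsto_unique[OF trivial_limit_at_top_linorder end_sol_wronskian_zero[OF q adm order_refl ey[OF order_refl] y(3) ea[OF order_refl] a(3)] lim[OF ea[OF x] x]]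
    by simp
  define R where "R = \<bar>m - s\<bar> * sqrt (P * K)"
  have R0: "R \<ge> 0" unfolding R_def using P0 K0 by simp
  have close: "\<bar>y x - \<alpha> * a x\<bar> \<le> R * (\<bar>a x\<bar> + \<bar>b x\<bar>)" if x: "x \<ge> 0" for x
  proof -
    have "a x * b' x - b x * a' x = 1" using sol_wronskian_const[OF a(1) b(1) x order_refl] W by simp
    then have "y x = y x * (a x * b' x - b x * a' x)" by simp
    also have "\<dots> = a x * (y x * b' x - b x * y' x) - b x * (y x * a' x - a x * y' x)" by (simp add: algebra_simps)
    finally have "y x - \<alpha> * a x = (m - s) * (b x * integral {x..} (\<lambda>t. a t * y t) - a x * integral {x..} (\<lambda>t. b t * y t))"
      unfolding Wa[OF x] Wb[OF x] by (simp add: algebra_simps)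
    then have "\<bar>y x - \<alpha> * a x\<bar> = \<bar>m - s\<bar> * \<bar>b x * integral {x..} (\<lambda>t. a t * y t) - a x * integral {x..} (\<lambda>t. b t * y t)\<bar>"
      by (simp add: abs_mult)
    also have "\<dots> \<le> \<bar>m - s\<bar> * (\<bar>b x\<bar> * \<bar>integral {x..} (\<lambda>t. a t * y t)\<bar> + \<bar>a x\<bar> * \<bar>integral {x..} (\<lambda>t. b t * y t)\<bar>)"
      by (intro mult_left_mono order_trans[OF abs_triangle_ineq4]) (auto simp: abs_mult)
    also have "\<dots> \<le> \<bar>m - s\<bar> * (\<bar>b x\<bar> * sqrt (P * K) + \<bar>a x\<bar> * sqrt (P * K))"
      by (intro mult_left_mono add_mono CS[OF a(2) K(1) x] CS[OF b(2) K(2) x]) auto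
    finally show ?thesis by (simp add: R_def algebra_simps)
  qed
  have "P \<le> 3 * \<alpha>\<^sup>2 * K + 3 * R\<^sup>2 * (K + K)"
  proof -
    have "P \<le> integral {0..} (\<lambda>x. 3 * \<alpha>\<^sup>2 * (a x)\<^sup>2 + 3 * R\<^sup>2 * ((a x)\<^sup>2 + (b x)\<^sup>2))"
      unfolding P_def
    proof (rule integral_le)
      show "(\<lambda>x. 3 * \<alpha>\<^sup>2 * (a x)\<^sup>2 + 3 * R\<^sup>2 * ((a x)\<^sup>2 + (b x)\<^sup>2)) integrable_on {0..}"
        by (intro integrable_add integrable_on_mult_right i2 a b order_refl)
      fix x :: real assume "x \<in> {0..}"
      then have x: "x \<ge> 0" by simp
      have "\<bar>y x\<bar> \<le> \<bar>\<alpha> * a x\<bar> + R * (\<bar>a x\<bar> + \<bar>b x\<bar>)" using close[OF x] by linarith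
      then have "(y x)\<^sup>2 \<le> (\<bar>\<alpha> * a x\<bar> + R * (\<bar>a x\<bar> + \<bar>b x\<bar>))\<^sup>2" by (rule abs_le_square_iff[THEN iffD1, OF order_trans]) simp
      also have "\<dots> \<le> 3 * (\<bar>\<alpha> * a x\<bar>\<^sup>2 + (R * \<bar>a x\<bar>)\<^sup>2 + (R * \<bar>b x\<bar>)\<^sup>2)"
      proof -
        have "(u + (v + w))\<^sup>2 \<le> 3 * (u\<^sup>2 + v\<^sup>2 + w\<^sup>2)" for u v w :: real
          using zero_le_power2[of "u - v"] zero_le_power2[of "v - w"] zero_le_power2[of "u - w"] by (simp add: power2_eq_square algebra_simps)
        from this[of "\<bar>\<alpha> * a x\<bar>" "R * \<bar>a x\<bar>" "R * \<bar>b x\<bar>"] show ?thesis by (simp add: distrib_left)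
      qed
      also have "\<dots> = 3 * \<alpha>\<^sup>2 * (a x)\<^sup>2 + 3 * R\<^sup>2 * ((a x)\<^sup>2 + (b x)\<^sup>2)" by (simp add: power_mult_distrib algebra_simps)
      finally show "(y x)\<^sup>2 \<le> 3 * \<alpha>\<^sup>2 * (a x)\<^sup>2 + 3 * R\<^sup>2 * ((a x)\<^sup>2 + (b x)\<^sup>2)" .
    qed (rule i2(1)[OF y(2) order_refl])
    also have "\<dots> = 3 * \<alpha>\<^sup>2 * integral {0..} (\<lambda>x. (a x)\<^sup>2) + 3 * R\<^sup>2 * (integral {0..} (\<lambda>x. (a x)\<^sup>2) + integral {0..} (\<lambda>x. (b x)\<^sup>2))"
      by (rule integral_unique) (intro has_integral_add has_integral_mult_right integrable_integral i2 a b order_refl)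
    also have "\<dots> \<le> 3 * \<alpha>\<^sup>2 * K + 3 * R\<^sup>2 * (K + K)"
      by (intro add_mono mult_left_mono K(1,2)) auto
    finally show ?thesis .
  qed
  also have "3 * R\<^sup>2 * (K + K) = 6 * ((m - s) * K)\<^sup>2 * P"
  proof -
    have "R\<^sup>2 = (m - s)\<^sup>2 * (P * K)" using P0 K0 by (simp add: R_def power_mult_distrib)
    then show ?thesis by (simp add: power_mult_distrib power2_eq_square)
  qed
  \<comment> \<open>The closeness assumption is tuned to bound this term by \<open>P/2\<close>, so
    that it can be absorbed and \<open>P\<close> is controlled by \<alpha> alone.\<close>
  also have "6 * ((m - s) * K)\<^sup>2 * P \<le> 1 / 2 * P" using K(3) P0 by (intro mult_right_mono) auto
  finally have "P \<le> 6 * \<alpha>\<^sup>2 * K" by simp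
  then have "P * K \<le> 6 * \<alpha>\<^sup>2 * K * K" using K0 by (intro mult_right_mono) auto
  also have "6 * \<alpha>\<^sup>2 * K * K = 6 * (\<alpha> * K)\<^sup>2" by (simp add: power2_eq_square)
  \<comment> \<open>Enlarging 6 to 9 produces a perfect square under the root.\<close>
  also have "6 * (\<alpha> * K)\<^sup>2 \<le> 9 * (\<alpha> * K)\<^sup>2" by (intro mult_right_mono) auto
  also have "\<dots> = (3 * \<bar>\<alpha>\<bar> * K)\<^sup>2" by (simp add: power_mult_distrib)
  finally have "sqrt (P * K) \<le> 3 * \<bar>\<alpha>\<bar> * K" using K0 by (intro real_le_lsqrt) auto
  then have "R \<le> \<bar>m - s\<bar> * (3 * \<bar>\<alpha>\<bar> * K)" unfolding R_def by (intro mult_left_mono) auto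
  then show thesis using close by (intro that[of \<alpha>]) (meson abs_ge_zero add_nonneg_nonneg mult_right_mono order_trans)
qed

text \<open>The error is relative to \<alpha>, since boundary condition solutions carry no common
  normalisation. A vanishing \<alpha> would make \<open>y\<close> trivial.\<close>

lemma bc_solution_near:
  assumes q: "L1_loc q" and adm: "admissible q E" and a: "bc_solution q E s a a'"
    and b: "sol q s {0..} b b'" "sq_int 0 b" "a 0 * b' 0 - b 0 * a' 0 = 1" and \<eta>: "\<eta> > 0"
  obtains \<delta> where "\<delta> > 0" "\<And>m y y'. \<bar>m - s\<bar> < \<delta> \<Longrightarrow> bc_solution q E m y y' \<Longrightarrow>
    \<exists>\<alpha>. \<alpha> \<noteq> 0 \<and> (\<forall>x\<ge>0. \<bar>y x - \<alpha> * a x\<bar> \<le> \<bar>\<alpha>\<bar> * (\<eta> * (\<bar>a x\<bar> + \<bar>b x\<bar>)))"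
proof -
  define K where "K = max 1 (max (integral {0..} (\<lambda>x. (a x)\<^sup>2)) (integral {0..} (\<lambda>x. (b x)\<^sup>2)))"
  have K: "K \<ge> 1" "integral {0..} (\<lambda>x. (a x)\<^sup>2) \<le> K" "integral {0..} (\<lambda>x. (b x)\<^sup>2) \<le> K" by (auto simp: K_def)
  define \<delta> where "\<delta> = min (1 / (4 * K)) (\<eta> / (3 * K))"
  have "\<exists>\<alpha>. \<alpha> \<noteq> 0 \<and> (\<forall>x\<ge>0. \<bar>y x - \<alpha> * a x\<bar> \<le> \<bar>\<alpha>\<bar> * (\<eta> * (\<bar>a x\<bar> + \<bar>b x\<bar>)))"
    if m: "\<bar>m - s\<bar> < \<delta>" and y: "bc_solution q E m y y'" for m y y'
  proof -
    have m1: "\<bar>m - s\<bar> * K \<le> 1 / 4" and m2: "\<bar>m - s\<bar> * (3 * K) \<le> \<eta>"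
      using m K(1) by (auto simp: \<delta>_def field_simps)
    have "((m - s) * K)\<^sup>2 \<le> (1 / 4)\<^sup>2"
      using m1 K(1) by (intro abs_le_square_iff[THEN iffD1]) (simp add: abs_mult)
    then have "12 * ((m - s) * K)\<^sup>2 \<le> 1" by (simp add: power2_eq_square)
    then obtain \<alpha> where \<alpha>: "\<And>x. x \<ge> 0 \<Longrightarrow> \<bar>y x - \<alpha> * a x\<bar> \<le> \<bar>m - s\<bar> * (3 * \<bar>\<alpha>\<bar> * K) * (\<bar>a x\<bar> + \<bar>b x\<bar>)"
      using bc_solutions_close[OF q adm bc_solutionD(1-3)[OF a] b bc_solutionD(1-3)[OF y] K(2,3)] by blast
    have "\<bar>y x - \<alpha> * a x\<bar> \<le> \<bar>\<alpha>\<bar> * (\<eta> * (\<bar>a x\<bar> + \<bar>b x\<bar>))" if x: "x \<ge> 0" for x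
    proof -
      have "\<bar>m - s\<bar> * (3 * \<bar>\<alpha>\<bar> * K) * (\<bar>a x\<bar> + \<bar>b x\<bar>) = \<bar>\<alpha>\<bar> * ((\<bar>m - s\<bar> * (3 * K)) * (\<bar>a x\<bar> + \<bar>b x\<bar>))" by (simp add: algebra_simps)
      also have "\<dots> \<le> \<bar>\<alpha>\<bar> * (\<eta> * (\<bar>a x\<bar> + \<bar>b x\<bar>))" by (intro mult_left_mono mult_right_mono m2) auto
      finally show ?thesis using \<alpha>[OF x] by linarith
    qed
    moreover have "\<alpha> \<noteq> 0" using \<alpha> bc_solution_nontrivial[OF y] by fastforce
    ultimately show ?thesis by blast
  qed
  moreover have "\<delta> > 0" using K(1) \<eta> by (simp add: \<delta>_def)
  ultimately show thesis using that by blast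
qed

text \<open>The inequality \<open>y y' \<le> (h' / h) y\<^sup>2\<close> at \<open>T\<close> replaces the form on \<open>[T, \<infinity>)\<close>, so a zero of \<open>y\<close> at \<open>x0\<close> gives
  \<open>\<integral> y'\<^sup>2 + (q - m) y\<^sup>2 \<le> (h' / h) y(T)\<^sup>2\<close> on \<open>[x0, T]\<close>.\<close>

lemma zero_imp_lower_bound:
  assumes q: "L1_loc q" and h: "sol q l {T..} h h'" and pos: "\<And>x. x \<ge> T \<Longrightarrow> h x > 0"
    and y: "sol q m {0..} y y'" and ml: "m \<le> l"
    and lim: "((\<lambda>x. h x * y' x - y x * h' x) \<longlongrightarrow> 0) at_top"
    and x0: "0 \<le> x0" "x0 < T" "y x0 = 0" "y' x0 \<noteq> 0"
  shows "- ((\<bar>h' T / h T\<bar> + integral {0..T} (\<lambda>x. \<bar>q x\<bar>))\<^sup>2) \<le> m"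
proof -
  \<comment> \<open>\<open>Q\<close> integrates over the whole of \<open>{0..T}\<close>, so the
    resulting bound does not depend on the position of the zero.\<close>
  define M Q where "M = h' T / h T" and "Q = integral {0..T} (\<lambda>x. \<bar>q x\<bar>)"
  define K where "K = \<bar>M\<bar> + Q"
  have w: "weak2 x0 T y y' (\<lambda>x. (q x - m) * y x)" by (rule solD[OF y]) (use x0 in auto)
  have c: "continuous_on {x0..T} y" "continuous_on {x0..T} y'" by (rule weak2_continuous[OF w])+
  define A B D where "A = integral {x0..T} (\<lambda>x. (y' x)\<^sup>2)" and "B = integral {x0..T} (\<lambda>x. (y x)\<^sup>2)"
    and "D = integral {x0..T} (\<lambda>x. \<bar>y x * y' x\<bar>)"
  have iA: "(\<lambda>x. (y' x)\<^sup>2) integrable_on {x0..T}" and iB: "(\<lambda>x. (y x)\<^sup>2) integrable_on {x0..T}"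
    and iD: "(\<lambda>x. \<bar>y x * y' x\<bar>) integrable_on {x0..T}" and iE: "(\<lambda>x. y x * y' x) integrable_on {x0..T}"
    by (intro integrable_continuous_real continuous_intros c)+
  have qa: "q absolutely_integrable_on {x0..T}" by (rule L1_loc_subinterval[OF q x0(1)])
  have "(\<lambda>x. (y x)\<^sup>2 * q x) absolutely_integrable_on {x0..T}"
    by (intro absolutely_integrable_continuous_mult continuous_intros c qa)
  then have iq: "(\<lambda>x. (y x)\<^sup>2 * q x) integrable_on {x0..T}" and iqa: "(\<lambda>x. \<bar>(y x)\<^sup>2 * q x\<bar>) integrable_on {x0..T}"
    by (auto simp: absolutely_integrable_on_def)
  have q0: "(\<lambda>x. \<bar>q x\<bar>) integrable_on {0..T}" "(\<lambda>x. \<bar>q x\<bar>) integrable_on {x0..T}"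
    using L1_loc_subinterval[OF q order_refl, of T] qa by (auto simp: absolutely_integrable_on_def)
  have Q0: "Q \<ge> 0" unfolding Q_def by (rule Henstock_Kurzweil_Integration.integral_nonneg[OF q0(1)]) simp
  have D0: "D \<ge> 0" unfolding D_def by (rule Henstock_Kurzweil_Integration.integral_nonneg[OF iD]) simp
  have energy: "y T * y' T = integral {x0..T} (\<lambda>x. (y x)\<^sup>2 * q x) - m * B + A"
  proof -
    have "(\<lambda>x. y x * ((q x - m) * y x) + y' x * y' x) = (\<lambda>x. (y x)\<^sup>2 * q x - m * (y x)\<^sup>2 + (y' x)\<^sup>2)"
      by (simp add: fun_eq_iff power2_eq_square algebra_simps)
    moreover have "((\<lambda>x. y x * ((q x - m) * y x) + y' x * y' x) has_integral (y T * y' T - y x0 * y' x0)) {x0..T}"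
      by (rule weak2_by_parts(1)[OF w w]) (use x0 in auto)
    ultimately have "((\<lambda>x. (y x)\<^sup>2 * q x - m * (y x)\<^sup>2 + (y' x)\<^sup>2) has_integral (y T * y' T - y x0 * y' x0)) {x0..T}" by simp
    moreover have "((\<lambda>x. (y x)\<^sup>2 * q x - m * (y x)\<^sup>2 + (y' x)\<^sup>2) has_integral (integral {x0..T} (\<lambda>x. (y x)\<^sup>2 * q x) - m * B + A)) {x0..T}"
      unfolding A_def B_def by (intro has_integral_add has_integral_diff has_integral_mult_right integrable_integral iq iA iB)
    ultimately have "y T * y' T - y x0 * y' x0 = integral {x0..T} (\<lambda>x. (y x)\<^sup>2 * q x) - m * B + A" by (rule has_integral_unique)
    then show ?thesis using x0(3) by simp
  qed
  \<comment> \<open>Because \<open>y\<close> vanishes at \<open>x0\<close>, its square is twice the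
    integral of \<open>y y'\<close>.\<close>
  have sup: "(y x)\<^sup>2 \<le> 2 * D" if x: "x \<in> {x0..T}" for x
  proof -
    have "((\<lambda>x. 2 * (y x * y' x)) has_integral ((y x)\<^sup>2 - (y x0)\<^sup>2)) {x0..x}"
    proof (rule fundamental_theorem_of_calculus)
      fix t assume t: "t \<in> {x0..x}"
      have "(y has_real_derivative y' t) (at t within {x0..x})"
        using weak2D(1)[OF w, of t] t x by (auto simp: has_real_derivative_iff_has_vector_derivative intro: has_vector_derivative_within_subset)
      then show "((\<lambda>x. (y x)\<^sup>2) has_vector_derivative 2 * (y t * y' t)) (at t within {x0..x})"
        unfolding has_real_derivative_iff_has_vector_derivative[symmetric]
        by (auto intro!: derivative_eq_intros)
    qed (use x in auto)
    from integral_unique[OF this] have "(y x)\<^sup>2 = 2 * integral {x0..x} (\<lambda>x. y x * y' x)" using x0(3) by simp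
    also have "\<dots> \<le> 2 * integral {x0..x} (\<lambda>x. \<bar>y x * y' x\<bar>)"
      by (intro mult_left_mono integral_le integrable_on_subinterval[OF iE] integrable_on_subinterval[OF iD]) (use x in auto)
    also have "\<dots> \<le> 2 * D" unfolding D_def
      by (intro mult_left_mono integral_subset_le integrable_on_subinterval[OF iD] iD) (use x in auto)
    finally show ?thesis .
  qed
  have "- (Q * (2 * D)) \<le> integral {x0..T} (\<lambda>x. (y x)\<^sup>2 * q x)"
  proof -
    have "- integral {x0..T} (\<lambda>x. (y x)\<^sup>2 * q x) \<le> integral {x0..T} (\<lambda>x. \<bar>q x\<bar> * (2 * D))"
      unfolding integral_neg[symmetric]
    proof (rule integral_le)
      fix x assume x: "x \<in> {x0..T}"
      have "- ((y x)\<^sup>2 * q x) \<le> \<bar>q x\<bar> * (y x)\<^sup>2" using mult_left_mono[of "- q x" "\<bar>q x\<bar>" "(y x)\<^sup>2"] by (simp add: mult.commute)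
      also have "\<dots> \<le> \<bar>q x\<bar> * (2 * D)" by (intro mult_left_mono sup x) simp
      finally show "- ((y x)\<^sup>2 * q x) \<le> \<bar>q x\<bar> * (2 * D)" .
    qed (use iq q0(2) in \<open>auto intro: integrable_neg integrable_on_mult_left\<close>)
    also have "\<dots> = integral {x0..T} (\<lambda>x. \<bar>q x\<bar>) * (2 * D)" by simp
    also have "\<dots> \<le> Q * (2 * D)" unfolding Q_def
      by (intro mult_right_mono integral_subset_le q0) (use D0 x0 in auto)
    finally show ?thesis by linarith
  qed
  moreover have "y T * y' T \<le> \<bar>M\<bar> * (2 * D)"
  proof -
    have hT: "h T > 0" using pos by simp
    have "sol q (l - (l - m)) {T..} y y'" using sol_subset[OF y, of "{T..}"] x0 by simp
    from sol_right_tail(1)[OF h this _ pos lim order_refl] ml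
    have "(h T * y' T - y T * h' T) * (y T / h T) \<le> 0" by simp
    also have "(h T * y' T - y T * h' T) * (y T / h T) = y T * y' T - M * (y T)\<^sup>2" using hT by (simp add: M_def field_simps power2_eq_square)
    finally have "y T * y' T \<le> M * (y T)\<^sup>2" by simp
    also have "\<dots> \<le> \<bar>M\<bar> * (y T)\<^sup>2" by (intro mult_right_mono) auto
    also have "\<dots> \<le> \<bar>M\<bar> * (2 * D)" using x0 by (intro mult_left_mono sup) auto
    finally show ?thesis .
  qed
  ultimately have "A - m * B \<le> K * (2 * D)" using energy by (simp add: K_def algebra_simps)
  \<comment> \<open>Young's inequality weighted so that the integral \<open>A\<close> of
    \<open>y'^2\<close> cancels, leaving \<open>0 \<le> (m + K^2) B\<close>.\<close>
  also have "K * (2 * D) \<le> A + K\<^sup>2 * B"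
  proof -
    have "K * (2 * D) = integral {x0..T} (\<lambda>x. (2 * K) * \<bar>y x * y' x\<bar>)" by (simp add: D_def)
    also have "\<dots> \<le> integral {x0..T} (\<lambda>x. (y' x)\<^sup>2 + K\<^sup>2 * (y x)\<^sup>2)"
    proof (rule integral_le)
      fix x
      have "0 \<le> (\<bar>y' x\<bar> - K * \<bar>y x\<bar>)\<^sup>2" by simp
      then show "(2 * K) * \<bar>y x * y' x\<bar> \<le> (y' x)\<^sup>2 + K\<^sup>2 * (y x)\<^sup>2" by (simp add: power2_diff power_mult_distrib abs_mult algebra_simps)
    qed (intro integrable_add integrable_on_mult_right iD iA iB)+
    also have "\<dots> = A + K\<^sup>2 * B" unfolding A_def B_def
      by (rule integral_unique) (intro has_integral_add has_integral_mult_right integrable_integral iA iB)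
    finally show ?thesis .
  qed
  finally have "0 \<le> (m + K\<^sup>2) * B" by (simp add: algebra_simps)
  moreover have "B > 0"
  proof -
    have "\<exists>x\<in>{x0..T}. y x \<noteq> 0"
    proof (rule ccontr)
      assume "\<not> (\<exists>x\<in>{x0..T}. y x \<noteq> 0)"
      then have z: "\<And>x. x \<in> {x0..T} \<Longrightarrow> 0 = y x" by auto
      have x0T: "x0 \<in> {x0..T}" using x0 by auto
      have "(y has_vector_derivative 0) (at x0 within {x0..T})"
        by (rule has_vector_derivative_transform[OF x0T _ has_vector_derivative_const[of 0]]) (use z in auto)
      then have "y' x0 = 0"
        using vector_derivative_unique_within_closed_interval[OF x0(2), of x0 y] weak2D(1)[OF w x0T] x0T by auto
      then show False using x0(4) by simp
    qed
    then obtain d where d: "d \<in> {x0..T}" "y d \<noteq> 0" by blast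
    then have "x0 < d" using x0(3) by (cases "d = x0") auto
    have cd: "continuous_on {x0..d} (\<lambda>x. \<bar>y x\<bar>)" using d by (intro continuous_intros continuous_on_subset[OF c(1)]) auto
    have "0 < integral {x0..d} (\<lambda>x. \<bar>y x\<bar> * \<bar>y x\<bar>)" by (rule integral_product_pos[OF cd cd \<open>x0 < d\<close>]) (use d in auto)
    also have "\<dots> = integral {x0..d} (\<lambda>x. (y x)\<^sup>2)" by (simp add: power2_eq_square)
    also have "\<dots> \<le> B" unfolding B_def
      by (intro integral_subset_le integrable_on_subinterval[OF iB] iB) (use d in auto)
    finally show ?thesis .
  qed
  ultimately have "0 \<le> m + K\<^sup>2" by (simp add: zero_le_mult_iff)
  then show ?thesis by (simp add: K_def M_def Q_def)
qed

text \<open>If \<open>u\<close> vanished at \<open>c\<close>, follow the zeros in \<open>(0, c]\<close> of the solutions satisfying the boundary condition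
  at \<open>\<infinity>\<close> as the spectral parameter decreases: they move to the left, and they disappear before the parameter
  reaches \<open>-\<infinity>\<close>. So one of them arrives at 0, at an eigenvalue below \<open>l\<close>.\<close>

theorem bc_ground_state_positive:
  assumes q: "L1_loc q" and adm: "admissible q (BC f g \<beta>)"
    and low: "\<And>m. eigenvalue q (BC f g \<beta>) 0 0 m \<Longrightarrow> l \<le> m"
    and u: "sol q l {0..} u u'" "u 0 = 0" "u' 0 > 0" and uL: "sq_int 0 u" "bc_real (BC f g \<beta>) u u'" and x: "x > 0"
  shows "u x > 0"
proof (rule ccontr)
  let ?E = "BC f g \<beta>"
  assume "\<not> u x > 0"
  then obtain c where c: "0 < c" "c \<le> x" "u c = 0" using zero_between[OF u x] by (metis not_le)
  define Z where "Z = {m. m \<le> l \<and> (\<exists>y y' z. bc_solution q ?E m y y' \<and> 0 < z \<and> z \<le> c \<and> y z = 0)}"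
  have simple: "y' z \<noteq> 0" if y: "bc_solution q ?E m y y'" and z: "z \<ge> 0" "y z = 0" for m y y' z
  proof -
    obtain x0 where "x0 \<ge> 0" "y x0 \<noteq> 0" using bc_solution_nontrivial[OF y] by blast
    then show ?thesis by (rule sol_zero_simple[OF q bc_solutionD(1)[OF y] _ _ z])
  qed
  have ey: "end_sol q T y y' (\<lambda>x. m * y x)" if "bc_solution q ?E m y y'" "T \<ge> 0" for m y y' T
    by (rule end_sol_mono[OF sol_imp_end_sol[OF bc_solutionD(1,2)[OF that(1)]] that(2)])
  have W0: "((\<lambda>x. y x * z' x - z x * y' x) \<longlongrightarrow> 0) at_top" if y: "bc_solution q ?E m y y'" and z: "bc_solution q ?E n z z'" for m n y y' z z'
    by (rule end_sol_wronskian_zero[OF q adm order_refl ey[OF y order_refl] bc_solutionD(3)[OF y] ey[OF z order_refl] bc_solutionD(3)[OF z]])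
  have lZ: "l \<in> Z"
  proof -
    have "bc_solution q ?E l u u'" using u uL by (simp add: bc_solution_def)
    then show ?thesis using c by (auto simp: Z_def)
  qed
  \<comment> \<open>Zeros move to the left as the level decreases: at a slightly smaller level the
    solution has at \<open>z\<close> the sign of \<open>a' z\<close>, by Green's formula on
    \<open>[z, \<infinity>)\<close>, and keeps the opposite sign at a point left of
    \<open>z\<close>.\<close>
  have down: "\<exists>m'\<in>Z. m' < m" if m: "m \<in> Z" for m
  proof -
    obtain a a' z where a: "bc_solution q ?E m a a'" and z: "0 < z" "z \<le> c" "a z = 0" using m by (auto simp: Z_def)
    obtain b b' where b: "sol q m {0..} b b'" "sq_int 0 b" "a 0 * b' 0 - b 0 * a' 0 = 1"
      by (rule bc_solution_second[OF q adm bc_solutionD(4)[OF a]])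
    have a'z: "a' z \<noteq> 0" by (rule simple[OF a]) (use z in auto)
    have da: "(a has_real_derivative a' z) (at z within {0..z})"
      by (rule sol_deriv[OF sol_subset[OF bc_solutionD(1)[OF a]]]) (use z in auto)
    have "((\<lambda>x. a' z * a x) has_real_derivative a' z * a' z) (at z within {0..z})"
      by (rule DERIV_cmult[OF da])
    moreover have "a' z * a' z > 0" using a'z not_real_square_gt_zero by blast
    ultimately obtain d where d: "d > 0" "\<And>h. h > 0 \<Longrightarrow> z - h \<in> {0..z} \<Longrightarrow> h < d \<Longrightarrow> a' z * a (z - h) < a' z * a z"
      using has_real_derivative_pos_inc_left by blast
    \<comment> \<open>A point just left of the simple zero, where \<open>a\<close> and
      \<open>a' z\<close> have opposite signs.\<close>
    define x1 where "x1 = z - min d z / 2"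
    have x1: "0 < x1" "x1 < z" using d(1) z by (auto simp: x1_def min_def)
    have ax1: "a' z * a x1 < 0" using d(2)[of "min d z / 2"] d(1) z by (auto simp: x1_def min_def)
    define A B where "A = integral {z..} (\<lambda>x. (a x)\<^sup>2)" and "B = integral {z..} (\<lambda>x. (b x)\<^sup>2)"
    have ai: "(\<lambda>x. (a x)\<^sup>2) integrable_on {z..}" and bi: "(\<lambda>x. (b x)\<^sup>2) integrable_on {z..}"
      using sq_intD(2)[OF sq_int_mono[OF bc_solutionD(2)[OF a]], of z] sq_intD(2)[OF sq_int_mono[OF b(2)], of z] z by auto
    have B0: "B \<ge> 0" unfolding B_def by (rule Henstock_Kurzweil_Integration.integral_nonneg[OF bi]) simp
    have A0: "A > 0"
    proof -
      have "\<exists>d>z. a d \<noteq> 0"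
      proof -
        have "((\<lambda>x. a' z * a x) has_real_derivative a' z * a' z) (at z within {z..z+1})"
          by (rule DERIV_cmult[OF sol_deriv[OF sol_subset[OF bc_solutionD(1)[OF a]]]]) (use z in auto)
        then obtain e where e: "e > 0" "\<And>h. h > 0 \<Longrightarrow> z + h \<in> {z..z+1} \<Longrightarrow> h < e \<Longrightarrow> a' z * a z < a' z * a (z + h)"
          using has_real_derivative_pos_inc_right \<open>a' z * a' z > 0\<close> by blast
        have "a' z * a z < a' z * a (z + min e 1 / 2)" by (rule e(2)) (use e(1) in auto)
        then show ?thesis using e(1) z by (intro exI[of _ "z + min e 1 / 2"]) auto
      qed
      then obtain d where d: "d > z" "a d \<noteq> 0" by blast
      have ca: "continuous_on {z..d} a" by (rule continuous_on_subset[OF sol_continuous_atLeast(1)[OF bc_solutionD(1)[OF a]]]) (use z in auto)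
      then have cd: "continuous_on {z..d} (\<lambda>x. \<bar>a x\<bar>)" by (intro continuous_intros)
      have "0 < integral {z..d} (\<lambda>x. \<bar>a x\<bar> * \<bar>a x\<bar>)" by (rule integral_product_pos[OF cd cd d(1)]) (use d in auto)
      also have "\<dots> = integral {z..d} (\<lambda>x. (a x)\<^sup>2)" by (simp add: power2_eq_square)
      also have "\<dots> \<le> A" unfolding A_def
        by (rule integral_subset_le[OF _ _ ai]) (auto intro!: integrable_continuous_real continuous_intros ca)
      finally show ?thesis .
    qed
    \<comment> \<open>The first bound makes the integral of \<open>a w\<close> over
      \<open>[z, \<infinity>)\<close> positive, the second makes \<open>w\<close> inherit the sign
      of \<open>a\<close> at \<open>x1\<close>.\<close>
    define \<eta> where "\<eta> = min (A / (2 * A + B + 1)) (\<bar>a x1\<bar> / (\<bar>a x1\<bar> + \<bar>b x1\<bar> + 1))"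
    have ax1': "\<bar>a x1\<bar> > 0" using ax1 by auto
    have p1: "2 * A + B + 1 > 0" and p2: "\<bar>a x1\<bar> + \<bar>b x1\<bar> + 1 > 0" using A0 B0 by auto
    have \<eta>: "\<eta> > 0" using A0 ax1' p1 p2 by (simp add: \<eta>_def)
    have \<eta>1: "\<eta> * (2 * A + B) < A"
    proof -
      have "\<eta> * (2 * A + B + 1) \<le> A / (2 * A + B + 1) * (2 * A + B + 1)" using p1 by (intro mult_right_mono) (auto simp: \<eta>_def)
      also have "\<dots> = A" using p1 by simp
      finally show ?thesis using \<eta> by (simp add: distrib_left)
    qed
    have \<eta>2: "\<eta> * (\<bar>a x1\<bar> + \<bar>b x1\<bar>) < \<bar>a x1\<bar>"
    proof -
      have "\<eta> * (\<bar>a x1\<bar> + \<bar>b x1\<bar> + 1) \<le> \<bar>a x1\<bar> / (\<bar>a x1\<bar> + \<bar>b x1\<bar> + 1) * (\<bar>a x1\<bar> + \<bar>b x1\<bar> + 1)"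
        using p2 by (intro mult_right_mono) (auto simp: \<eta>_def)
      also have "\<dots> = \<bar>a x1\<bar>" using p2 by simp
      finally show ?thesis using \<eta> by (simp add: distrib_left)
    qed
    obtain \<delta> where \<delta>: "\<delta> > 0" "\<And>m' y y'. \<bar>m' - m\<bar> < \<delta> \<Longrightarrow> bc_solution q ?E m' y y' \<Longrightarrow>
        \<exists>\<alpha>. \<alpha> \<noteq> 0 \<and> (\<forall>x\<ge>0. \<bar>y x - \<alpha> * a x\<bar> \<le> \<bar>\<alpha>\<bar> * (\<eta> * (\<bar>a x\<bar> + \<bar>b x\<bar>)))"
      using bc_solution_near[OF q adm a b \<eta>] by blast
    define m' where "m' = m - \<delta> / 2"
    have m': "\<bar>m' - m\<bar> < \<delta>" "m' < m" using \<delta>(1) by (auto simp: m'_def)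
    obtain y y' where y: "bc_solution q ?E m' y y'" by (rule bc_solution_exists[OF q adm])
    obtain \<alpha> where \<alpha>: "\<alpha> \<noteq> 0" "\<And>x. x \<ge> 0 \<Longrightarrow> \<bar>y x - \<alpha> * a x\<bar> \<le> \<bar>\<alpha>\<bar> * (\<eta> * (\<bar>a x\<bar> + \<bar>b x\<bar>))"
      using \<delta>(2)[OF m'(1) y] by blast
    define w where "w x = y x / \<alpha>" for x
    have yw: "y x = \<alpha> * w x" for x using \<alpha>(1) by (simp add: w_def)
    have near: "\<bar>w x - a x\<bar> \<le> \<eta> * (\<bar>a x\<bar> + \<bar>b x\<bar>)" if "x \<ge> 0" for x
    proof -
      have "\<bar>\<alpha>\<bar> * \<bar>w x - a x\<bar> \<le> \<bar>\<alpha>\<bar> * (\<eta> * (\<bar>a x\<bar> + \<bar>b x\<bar>))"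
        using \<alpha>(2)[OF that] unfolding yw by (simp add: abs_mult[symmetric] algebra_simps)
      then show ?thesis using \<alpha>(1) by simp
    qed
    have ii: "(\<lambda>x. a x * y x) integrable_on {z..}"
      using sq_int_mult[OF sq_int_mono[OF bc_solutionD(2)[OF a]] sq_int_mono[OF bc_solutionD(2)[OF y]], of z] z
      by (simp add: absolutely_integrable_on_def)
    \<comment> \<open>Green's formula on \<open>[z, \<infinity>)\<close>: infinity contributes
      nothing, and at \<open>z\<close> only the term with \<open>a' z\<close> survives.\<close>
    have "w z * a' z = (m - m') * integral {z..} (\<lambda>x. a x * w x)"
    proof -
      have "(\<lambda>t. y t * (m * a t) - a t * (m' * y t)) = (\<lambda>t. (m - m') * (a t * y t))" by (simp add: fun_eq_iff algebra_simps)
      then have "((\<lambda>x. a x * y' x - y x * a' x) \<longlongrightarrow> (a z * y' z - y z * a' z) + (m - m') * integral {z..} (\<lambda>x. a x * y x)) at_top"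
        using end_sol_wronskian_limit[OF ey[OF a] ey[OF y], of z] z by simp
      from tendsto_unique[OF trivial_limit_at_top_linorder this W0[OF a y]]
      have "y z * a' z = (m - m') * integral {z..} (\<lambda>x. a x * y x)" using z by simp
      moreover have "integral {z..} (\<lambda>x. a x * y x) = \<alpha> * integral {z..} (\<lambda>x. a x * w x)"
        unfolding yw by (simp add: mult.left_commute[of _ \<alpha>])
      ultimately have "\<alpha> * (w z * a' z) = \<alpha> * ((m - m') * integral {z..} (\<lambda>x. a x * w x))" unfolding yw by (simp add: algebra_simps)
      then show ?thesis using \<alpha>(1) by simp
    qed
    moreover have "integral {z..} (\<lambda>x. a x * w x) > 0"
    proof -
      have "0 < (1 - 2 * \<eta>) * A - \<eta> * B" using \<eta>1 by (simp add: algebra_simps)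
      also have "\<dots> = integral {z..} (\<lambda>x. (1 - 2 * \<eta>) * (a x)\<^sup>2 - \<eta> * (b x)\<^sup>2)"
        unfolding A_def B_def
        by (rule integral_unique[symmetric]) (intro has_integral_diff has_integral_mult_right integrable_integral ai bi)
      also have "\<dots> \<le> integral {z..} (\<lambda>x. a x * w x)"
      proof (rule integral_le)
        show "(\<lambda>x. (1 - 2 * \<eta>) * (a x)\<^sup>2 - \<eta> * (b x)\<^sup>2) integrable_on {z..}"
          by (intro integrable_diff integrable_on_mult_right ai bi)
        have "(\<lambda>x. inverse \<alpha> * (a x * y x)) integrable_on {z..}" by (rule integrable_on_mult_right[OF ii])
        then show "(\<lambda>x. a x * w x) integrable_on {z..}" by (simp add: w_def field_simps)
        fix x assume "x \<in> {z..}"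
        then have x: "x \<ge> 0" using z by simp
        have "- (a x * (w x - a x)) \<le> \<bar>a x\<bar> * \<bar>w x - a x\<bar>" by (metis abs_ge_minus_self abs_mult)
        also have "\<dots> \<le> \<bar>a x\<bar> * (\<eta> * (\<bar>a x\<bar> + \<bar>b x\<bar>))" by (intro mult_left_mono near x) simp
        also have "\<dots> = \<eta> * ((a x)\<^sup>2 + \<bar>a x\<bar> * \<bar>b x\<bar>)" by (simp add: power2_eq_square algebra_simps)
        also have "\<dots> \<le> \<eta> * ((a x)\<^sup>2 + ((a x)\<^sup>2 + (b x)\<^sup>2))"
        proof (intro mult_left_mono add_left_mono)
          have "0 \<le> (\<bar>a x\<bar> - \<bar>b x\<bar>)\<^sup>2 + (\<bar>a x\<bar>\<^sup>2 + \<bar>b x\<bar>\<^sup>2)" by simp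
          then show "\<bar>a x\<bar> * \<bar>b x\<bar> \<le> (a x)\<^sup>2 + (b x)\<^sup>2" by (simp add: power2_diff)
        qed (use \<eta> in auto)
        finally show "(1 - 2 * \<eta>) * (a x)\<^sup>2 - \<eta> * (b x)\<^sup>2 \<le> a x * w x" by (simp add: power2_eq_square algebra_simps)
      qed
      finally show ?thesis .
    qed
    ultimately have wz: "a' z * w z > 0" using m'(2) by (simp add: mult.commute)
    have wx1: "a' z * w x1 < 0"
    proof -
      have "\<bar>w x1 - a x1\<bar> < \<bar>a x1\<bar>" using near[of x1] \<eta>2 x1 by simp
      then have "\<bar>a' z\<bar> * \<bar>w x1 - a x1\<bar> < \<bar>a' z\<bar> * \<bar>a x1\<bar>" using a'z by simp
      then have "\<bar>a' z * w x1 - a' z * a x1\<bar> < \<bar>a' z * a x1\<bar>" by (simp only: abs_mult[symmetric] right_diff_distrib)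
      then show ?thesis using ax1 by linarith
    qed
    have "continuous_on {x1..z} y" by (rule continuous_on_subset[OF sol_continuous_atLeast(1)[OF bc_solutionD(1)[OF y]]]) (use x1 in auto)
    then have "continuous_on {x1..z} (\<lambda>x. a' z * w x)" unfolding w_def using \<alpha>(1) by (intro continuous_intros) auto
    then obtain \<xi> where \<xi>: "x1 \<le> \<xi>" "\<xi> \<le> z" "a' z * w \<xi> = 0"
      using IVT'[of "\<lambda>x. a' z * w x" x1 0 z] wx1 wz x1 by auto
    then have "y \<xi> = 0" using a'z by (simp add: yw)
    moreover have "m' \<le> l" "0 < \<xi>" "\<xi> \<le> c" using m m'(2) \<xi>(1,2) x1 z by (auto simp: Z_def)
    ultimately have "m' \<in> Z" unfolding Z_def using y by blast
    then show ?thesis using m'(2) by blast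
  qed
  \<comment> \<open>Non-oscillation supplies a level \<open>l0\<close> whose boundary condition
    solution has no zeros far out; it serves as the comparison function for all levels below
    \<open>l0\<close>.\<close>
  have "bdd_below Z"
  proof -
    obtain l0 where l0: "\<And>y. solution q (of_real l0) (\<lambda>x. complex_of_real (y x)) \<Longrightarrow> \<exists>x\<ge>0. y x \<noteq> 0 \<Longrightarrow> \<exists>a\<ge>0. \<forall>x>a. y x \<noteq> 0"
      using adm by (auto simp: non_oscillatory_def)
    obtain p p' where p: "bc_solution q ?E l0 p p'" by (rule bc_solution_exists[OF q adm])
    note C = sol_complex[OF bc_solutionD(1)[OF p] order_refl _ atLeast_cover bc_solutionD(2)[OF p], simplified]
    have "solution q (of_real l0) (\<lambda>x. complex_of_real (p x))" using C by (simp add: solution_def)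
    then obtain T0 where T0: "T0 \<ge> 0" "\<And>x. x > T0 \<Longrightarrow> p x \<noteq> 0" using l0[of p] bc_solution_nontrivial[OF p] by blast
    define T where "T = max T0 c + 1"
    have T: "T > T0" "T > c" "T > 0" using c by (auto simp: T_def)
    \<comment> \<open>The factor \<open>p T\<close> makes the value at \<open>T\<close> a square,
      hence positive.\<close>
    define h h' where "h x = p T * p x" and "h' x = p T * p' x" for x
    have hs: "sol q l0 {T..} h h'" unfolding h_def h'_def
      by (rule sol_scale[OF sol_subset[OF bc_solutionD(1)[OF p]]]) (use T in auto)
    have hpos: "h x > 0" if x: "x \<ge> T" for x
    proof (rule continuous_sign_pos[of T x h T])
      show "continuous_on {T..x} h" by (rule continuous_on_subset[OF sol_continuous_atLeast(1)[OF hs]]) auto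
      show "h t \<noteq> 0" if "t \<in> {T..x}" for t using T0(2)[of T] T0(2)[of t] that T by (auto simp: h_def)
      have "p T \<noteq> 0" using T0(2) T by blast
      then show "h T > 0" unfolding h_def using not_real_square_gt_zero by blast
    qed (use x in auto)
    have "min l0 (- ((\<bar>h' T / h T\<bar> + integral {0..T} (\<lambda>x. \<bar>q x\<bar>))\<^sup>2)) \<le> m" if m: "m \<in> Z" for m
    proof (cases "m \<le> l0")
      case True
      obtain y y' z where y: "bc_solution q ?E m y y'" and z: "0 < z" "z \<le> c" "y z = 0" using m by (auto simp: Z_def)
      have "((\<lambda>x. p T * (p x * y' x - y x * p' x)) \<longlongrightarrow> p T * 0) at_top" by (rule tendsto_mult[OF tendsto_const W0[OF p y]])
      then have lim: "((\<lambda>x. h x * y' x - y x * h' x) \<longlongrightarrow> 0) at_top" by (simp add: h_def h'_def algebra_simps)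
      have "- ((\<bar>h' T / h T\<bar> + integral {0..T} (\<lambda>x. \<bar>q x\<bar>))\<^sup>2) \<le> m"
        by (rule zero_imp_lower_bound[OF q hs hpos bc_solutionD(1)[OF y] True lim]) (use z T simple[OF y, of z] in auto)
      then show ?thesis by simp
    qed auto
    then show ?thesis by (rule bdd_belowI)
  qed
  define s where "s = Inf Z"
  have sl: "s \<le> l" unfolding s_def by (rule cInf_lower[OF lZ \<open>bdd_below Z\<close>])
  \<comment> \<open>The infimum is not attained because zeros can always be followed further
    down.\<close>
  have sZ: "s \<notin> Z"
  proof
    assume "s \<in> Z"
    then obtain m where m: "m \<in> Z" "m < s" using down by blast
    then show False using cInf_lower[OF m(1) \<open>bdd_below Z\<close>] by (simp add: s_def)
  qed
  obtain a a' where a: "bc_solution q ?E s a a'" by (rule bc_solution_exists[OF q adm])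
  obtain b b' where b: "sol q s {0..} b b'" "sq_int 0 b" "a 0 * b' 0 - b 0 * a' 0 = 1"
    by (rule bc_solution_second[OF q adm bc_solutionD(4)[OF a]])
  \<comment> \<open>A zero in \<open>(0, c]\<close> would put \<open>s\<close> into
    \<open>Z\<close>. A zero at 0 makes \<open>s\<close> an eigenvalue, so \<open>l \<le> s\<close>;
    then \<open>s = l\<close>, which again lies in \<open>Z\<close>.\<close>
  have nz: "a x \<noteq> 0" if x: "x \<in> {0..c}" for x
  proof (cases "x = 0")
    case True
    show ?thesis
    proof
      assume "a x = 0"
      then have a0: "a 0 = 0" using True by simp
      obtain x0 where x0: "x0 \<ge> 0" "a x0 \<noteq> 0" using bc_solution_nontrivial[OF a] by blast
      have "l \<le> s" by (rule low[OF eigenvalue_unperturbedI[OF q adm bc_solutionD(1)[OF a] a0 bc_solutionD(2,3)[OF a] x0]])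
      then show False using sl lZ sZ by simp
    qed
  next
    case False
    then show ?thesis using sZ sl a x by (force simp: Z_def)
  qed
  have ca: "continuous_on {0..c} a" and cb: "continuous_on {0..c} b"
    by (rule continuous_on_subset[OF sol_continuous_atLeast(1)[OF bc_solutionD(1)[OF a]]], force)
      (rule continuous_on_subset[OF sol_continuous_atLeast(1)[OF b(1)]], force)
  have ne: "{0..c} \<noteq> {}" using c by simp
  have c1: "continuous_on {0..c} (\<lambda>x. \<bar>a x\<bar>)" and c2: "continuous_on {0..c} (\<lambda>x. \<bar>a x\<bar> + \<bar>b x\<bar>)" by (intro continuous_intros ca cb)+
  obtain xi where xi: "xi \<in> {0..c}" "\<And>x. x \<in> {0..c} \<Longrightarrow> \<bar>a xi\<bar> \<le> \<bar>a x\<bar>" using continuous_attains_inf[OF compact_Icc ne c1] by blast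
  obtain xs where xs: "xs \<in> {0..c}" "\<And>x. x \<in> {0..c} \<Longrightarrow> \<bar>a x\<bar> + \<bar>b x\<bar> \<le> \<bar>a xs\<bar> + \<bar>b xs\<bar>" using continuous_attains_sup[OF compact_Icc ne c2] by blast
  define \<epsilon> S where "\<epsilon> = \<bar>a xi\<bar>" and "S = \<bar>a xs\<bar> + \<bar>b xs\<bar>"
  have \<epsilon>: "\<epsilon> > 0" using nz[OF xi(1)] by (simp add: \<epsilon>_def)
  have S: "S \<ge> 0" by (simp add: S_def)
  have \<eta>: "\<epsilon> / (S + 1) > 0" using \<epsilon> S by simp
  obtain \<delta> where \<delta>: "\<delta> > 0" "\<And>m y y'. \<bar>m - s\<bar> < \<delta> \<Longrightarrow> bc_solution q ?E m y y' \<Longrightarrow>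
      \<exists>\<alpha>. \<alpha> \<noteq> 0 \<and> (\<forall>x\<ge>0. \<bar>y x - \<alpha> * a x\<bar> \<le> \<bar>\<alpha>\<bar> * (\<epsilon> / (S + 1) * (\<bar>a x\<bar> + \<bar>b x\<bar>)))"
    using bc_solution_near[OF q adm a b \<eta>] by blast
  \<comment> \<open>Levels of \<open>Z\<close> come arbitrarily close to \<open>s\<close>, and their
    solutions have zeros in \<open>(0, c]\<close>; yet near \<open>s\<close> they are close to
    multiples of \<open>a\<close>, which stays away from 0 on \<open>{0..c}\<close>.\<close>
  have "Z \<noteq> {}" using lZ by auto
  then obtain m where m: "m \<in> Z" "m < s + \<delta>" using cInf_lessD[of Z "s + \<delta>"] \<delta>(1) by (auto simp: s_def)
  have "s \<le> m" unfolding s_def by (rule cInf_lower[OF m(1) \<open>bdd_below Z\<close>])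
  then have ms: "\<bar>m - s\<bar> < \<delta>" using m(2) by simp
  obtain y y' z where y: "bc_solution q ?E m y y'" and z: "0 < z" "z \<le> c" "y z = 0" using m(1) by (auto simp: Z_def)
  obtain \<alpha> where \<alpha>: "\<alpha> \<noteq> 0" "\<And>x. x \<ge> 0 \<Longrightarrow> \<bar>y x - \<alpha> * a x\<bar> \<le> \<bar>\<alpha>\<bar> * (\<epsilon> / (S + 1) * (\<bar>a x\<bar> + \<bar>b x\<bar>))"
    using \<delta>(2)[OF ms y] by blast
  have "\<bar>\<alpha>\<bar> * \<bar>a z\<bar> \<le> \<bar>\<alpha>\<bar> * (\<epsilon> / (S + 1) * (\<bar>a z\<bar> + \<bar>b z\<bar>))" using \<alpha>(2)[of z] z by (simp add: abs_mult)
  then have "\<bar>a z\<bar> \<le> \<epsilon> / (S + 1) * (\<bar>a z\<bar> + \<bar>b z\<bar>)" by (rule mult_left_le_imp_le) (use \<alpha>(1) in auto)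
  also have "\<dots> \<le> \<epsilon> / (S + 1) * S" using xs(2)[of z] z \<eta> by (intro mult_left_mono) (auto simp: S_def)
  also have "\<dots> < \<epsilon>" using \<epsilon> S by (simp add: field_simps)
  finally show False using xi(2)[of z] z by (simp add: \<epsilon>_def)
qed

section \<open>Reconstruction of the potential\<close>

lemma bc_real_scale:
  assumes "bc_real E y y'" shows "bc_real E (\<lambda>x. c * y x) (\<lambda>x. c * y' x)"
proof (cases E)
  case (BC f g \<beta>)
  obtain A B where AB: "((\<lambda>x. y x * D\<^sub>x f x - f x * y' x) \<longlongrightarrow> A) at_top"
      "((\<lambda>x. y x * D\<^sub>x g x - g x * y' x) \<longlongrightarrow> B) at_top" "A * sin \<beta> = B * cos \<beta>"
    using assms unfolding BC by auto
  have lim: "((\<lambda>x. c * y x * h' x - h x * (c * y' x)) \<longlongrightarrow> c * P) at_top" if "((\<lambda>x. y x * h' x - h x * y' x) \<longlongrightarrow> P) at_top" for h h' P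
    by (rule Lim_transform_eventually[OF tendsto_mult[OF tendsto_const that]]) (auto simp: algebra_simps)
  show ?thesis unfolding BC bc_real.simps
    by (intro exI[of _ "c * A"] exI[of _ "c * B"] conjI lim AB(1,2)) (simp add: AB(3))
qed simp

text \<open>Dividing by \<open>v' 0\<close>, nonzero because zeros are simple, fixes the sign under
  which the two positivity theorems apply.\<close>

theorem first_eigenvalue_ground_state:
  assumes q: "L1_loc q" and adm: "admissible q E" and lam: "first_eigenvalue_function q E lam"
  obtains u u' where "ground_state q E u u' (lam 0 0)"
proof -
  define l where "l = lam 0 0"
  have fe: "eigenvalue q E 0 0 l" and low: "\<And>m. eigenvalue q E 0 0 m \<Longrightarrow> l \<le> m"
    using lam by (auto simp: first_eigenvalue_function_def first_eigenvalue_def l_def)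
  obtain v v' x0 where v: "sol q l {0..} v v'" "v 0 = 0" "sq_int 0 v" "bc_real E v v'" and x0: "x0 \<ge> 0" "v x0 \<noteq> 0"
    by (rule eigenvalue_unperturbedE[OF q adm fe]) auto
  have v'0: "v' 0 \<noteq> 0" by (rule sol_zero_simple[OF q v(1) x0 order_refl v(2)])
  define u u' where "u x = inverse (v' 0) * v x" and "u' x = inverse (v' 0) * v' x" for x
  have u: "sol q l {0..} u u'" unfolding u_def u'_def by (rule sol_scale[OF v(1)])
  have u0: "u 0 = 0" "u' 0 = 1" using v(2) v'0 by (auto simp: u_def u'_def)
  have uL: "sq_int 0 u" unfolding u_def using sq_int_scaleR[OF v(3), of "inverse (v' 0)"] by simp
  have ubc: "bc_real E u u'" unfolding u_def u'_def by (rule bc_real_scale[OF v(4)])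
  have upos: "u x > 0" if x: "x > 0" for x
  proof (cases E)
    case No_BC
    have spec: "\<And>z. z \<in> spectrum_S q No_BC \<Longrightarrow> l \<le> Re z"
      using lam No_BC by (auto simp: first_eigenvalue_function_def l_def)
    show ?thesis by (rule nonneg_ground_state_positive[OF q adm[unfolded No_BC] spec u _ _ x]) (simp_all add: u0)
  next
    case (BC f g \<beta>)
    show ?thesis
      by (rule bc_ground_state_positive[OF q adm[unfolded BC] low[unfolded BC] u _ _ uL ubc[unfolded BC] x]) (simp_all add: u0)
  qed
  have "ground_state q E u u' l"
  proof
    fix f g \<beta> assume E: "E = BC f g \<beta>"
    obtain b b' where "sol q l {0..} b b'" "sq_int 0 b" "u 0 * b' 0 - b 0 * u' 0 = 1"
      by (rule bc_solution_second[OF q adm[unfolded E], where A = "u 0" and B = "u' 0" and m = l]) (simp add: u0)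
    then show "\<exists>\<theta> \<theta>'. sol q l {0..} \<theta> \<theta>' \<and> sq_int 0 \<theta> \<and> u 0 * \<theta>' 0 - \<theta> 0 * u' 0 = 1" by blast
  qed (fact q adm u uL ubc u0 upos)+
  then show thesis unfolding l_def by (rule that)
qed

lemma first_eigenvalue_function_unperturbed:
  assumes lam: "first_eigenvalue_function q E lam" and t: "t \<ge> 0"
  shows "lam t 0 = lam 0 0"
proof -
  have "first_eigenvalue q E t 0 (lam t 0)" "first_eigenvalue q E 0 0 (lam 0 0)"
    using lam t by (auto simp: first_eigenvalue_function_def)
  moreover have "eigenvalue q E t 0 = eigenvalue q E 0 0" by (simp add: eigenvalue_def dom_S_delta_def fun_eq_iff)
  ultimately show ?thesis by (metis first_eigenvalue_def order_antisym)
qed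

theorem theorem4p1:
  fixes q :: "real \<Rightarrow> real" and E :: endpoint and lam :: "real \<Rightarrow> real \<Rightarrow> real"
  assumes "L1_loc q" and "admissible q E" and "first_eigenvalue_function q E lam"
  shows "(\<forall>q' E'. L1_loc q' \<and> admissible q' E' \<and> first_eigenvalue_function q' E' lam \<longrightarrow>
            (AE x in lebesgue_on {0..}. q' x = q x)) \<and>
         (\<forall>x>0. lam x differentiable (at_right 0) \<and> right_pderiv_r lam x < 0) \<and>
         AC1_loc {0<..} (phi0 lam) \<and>
         (\<forall>t\<ge>0. AE x in lebesgue_on {0<..}. 
            q x = D\<^sub>x (D\<^sub>x (phi0 lam)) x / phi0 lam x + lam t 0)"
proof -
  \<comment> \<open>Proved for an arbitrary potential and endpoint, so that it also applies to a
    competitor with the same \<open>lam\<close>.\<close>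
  have main: "(\<forall>x>0. lam x differentiable (at_right 0) \<and> right_pderiv_r lam x < 0) \<and> AC1_loc {0<..} (phi0 lam) \<and>
      (AE x in lebesgue_on {0<..}. q x = D\<^sub>x (D\<^sub>x (phi0 lam)) x / phi0 lam x + lam 0 0)"
    if q: "L1_loc q" and adm: "admissible q E" and lam: "first_eigenvalue_function q E lam" for q E
  proof -
    obtain u u' where "ground_state q E u u' (lam 0 0)" by (rule first_eigenvalue_ground_state[OF q adm lam])
    then interpret ground_state q E u u' "lam 0 0" .
    have fe: "\<And>t r. t \<ge> 0 \<Longrightarrow> r \<ge> 0 \<Longrightarrow> first_eigenvalue q E t r (lam t r)"
      using lam by (simp add: first_eigenvalue_function_def)
    note F = potential_formula[OF fe first_eigenvalue_function_unperturbed[OF lam]]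
    show ?thesis using F by blast
  qed
  \<comment> \<open>The expression \<open>F\<close> is built from \<open>lam\<close> alone, and both
    potentials equal it almost everywhere on \<open>(0, \<infinity>)\<close>.\<close>
  have unique: "AE x in lebesgue_on {0..}. q' x = q x"
    if q': "L1_loc q'" "admissible q' E'" "first_eigenvalue_function q' E' lam" for q' E'
  proof -
    define F where "F x = D\<^sub>x (D\<^sub>x (phi0 lam)) x / phi0 lam x + lam 0 0" for x
    have "negligible {x\<in>{0<..}. p x \<noteq> F x}" if "L1_loc p" "admissible p G" "first_eigenvalue_function p G lam" for p G
      using main[OF that] by (simp add: AE_lebesgue_on_iff F_def)
    from negligible_Un[OF negligible_Un[OF this[OF q'] this[OF assms]] negligible_sing[of 0]]
    have "negligible {x\<in>{0..}. q' x \<noteq> q x}"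
    proof (rule negligible_subset, intro subsetI)
      fix x assume "x \<in> {x\<in>{0..}. q' x \<noteq> q x}"
      then show "x \<in> {x\<in>{0<..}. q' x \<noteq> F x} \<union> {x\<in>{0<..}. q x \<noteq> F x} \<union> {0}" by (cases "x = 0") auto
    qed
    then show ?thesis by (simp add: AE_lebesgue_on_iff)
  qed
  have "AE x in lebesgue_on {0<..}. q x = D\<^sub>x (D\<^sub>x (phi0 lam)) x / phi0 lam x + lam t 0" if t: "t \<ge> 0" for t
    unfolding first_eigenvalue_function_unperturbed[OF assms(3) t] using main[OF assms] by blast
  then show ?thesis using main[OF assms] unique by blast
qed

end
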